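(* Let $(\mathbb{K},|.|)$ be $\mathbb{R}$ or an ultrametric field. Let $E$ and $F$ be topological $\mathbb{K}$-vector spaces and $f\colon U\to F$ a map on an open subset $U\subseteq E$. Let $\ell\in\mathbb{N}_0$ and $\sigma\in\,]0,1]$. If $E$ is metrizable, then $f$ is $C^{\ell,\sigma}_{BGN}$ if and only if $f\circ\gamma\colon\mathbb{K}^{\ell+1}\to F$ is $C^{\ell,\sigma}_{BGN}$ for each $C^\infty_{BGN}$-map $\gamma\colon\mathbb{K}^{\ell+1}\to U$.
   Context: Vector spaces are Hausdorff. An ultrametric field is a field with an absolute value satisfying the ultrametric inequality and defining a non-discrete topology; $\mathbb{R}$ has the usual absolute value. $C^k_{BGN}$: for $V\subseteq E$ with dense interior, $V^{[1]}=\{(x,y,t)\in V\times E\times\mathbb{K}: x+ty\in V\}$, $V^{]1[}$ its subset with $t\ne0$, $g^{]1[}(x,y,t)=(g(x+ty)-g(x))/t$. $g$ is $C^0_{BGN}$ if continuous; $C^1_{BGN}$ if continuous and $g^{]1[}$ extends continuously to $g^{[1]}\colon V^{[1]}\to F$; $C^k_{BGN}$ if $C^1_{BGN}$ and $g^{[1]}$ is $C^{k-1}_{BGN}$, with $g^{[k]}:=(g^{[1]})^{[k-1]}$, $g^{[0]}:=g$; $C^\infty_{BGN}$ if $C^k_{BGN}$ for all $k$. Gauge on $E$: $q\colon E\to[0,\infty[$ with $q(tx)=|t|q(x)$ and $\{q<r\}$ a $0$-neighbourhood for each $r>0$. A map $g\colon V\to F$ ($V\subseteq E$) is $C^{0,\sigma}$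 if for each $x_0\in V$ and gauge $q$ on $F$ there are a gauge $p$ on $E$ and a neighbourhood $W$ of $x_0$ in $V$ with $q(g(y)-g(x))\le p(y-x)^\sigma$ for all $x,y\in W$. $g$ is $C^{k,\sigma}_{BGN}$ if it is $C^k_{BGN}$ and $g^{[j]}$ is $C^{0,\sigma}$ for all $j\le k$. *)

theory Defs
  imports "HOL-Analysis.Analysis"
begin

definition abs_value :: "('k::field \<Rightarrow> real) \<Rightarrow> bool" where
  "abs_value absK \<longleftrightarrow> (\<forall>x. 0 \<le> absK x) \<and> (\<forall>x. absK x = 0 \<longleftrightarrow> x = 0)
     \<and> (\<forall>x y. absK (x * y) = absK x * absK y) \<and> (\<forall>x y. absK (x + y) \<le> absK x + absK y)"

definition ktop :: "('k::field \<Rightarrow> real) \<Rightarrow> 'k topology" where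
  "ktop absK = topology (\<lambda>S. \<forall>x\<in>S. \<exists>e>0. \<forall>y. absK (y - x) < e \<longrightarrow> y \<in> S)"

definition is_real_field :: "('k::field \<Rightarrow> real) \<Rightarrow> bool" where
  "is_real_field absK \<longleftrightarrow> (\<exists>\<phi>::'k \<Rightarrow> real. bij \<phi> \<and> \<phi> 1 = 1
     \<and> (\<forall>x y. \<phi> (x + y) = \<phi> x + \<phi> y \<and> \<phi> (x * y) = \<phi> x * \<phi> y)
     \<and> (\<forall>x. absK x = \<bar>\<phi> x\<bar>))"

definition ultrametric_field :: "('k::field \<Rightarrow> real) \<Rightarrow> bool" where
  "ultrametric_field absK \<longleftrightarrow> abs_value absK
     \<and> (\<forall>x y. absK (x + y) \<le> max (absK x) (absK y))
     \<and> \<not> (\<forall>x. openin (ktop absK) {x})"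

section \<open>Topological vector spaces (carrier = topspace)\<close>

record ('a, 'k) lin_top =
  lt_top :: "'a topology"
  lt_add :: "'a \<Rightarrow> 'a \<Rightarrow> 'a"
  lt_smul :: "'k \<Rightarrow> 'a \<Rightarrow> 'a"
  lt_zero :: "'a"

definition lt_sub :: "('a, 'k::field) lin_top \<Rightarrow> 'a \<Rightarrow> 'a \<Rightarrow> 'a" where
  "lt_sub S y x = lt_add S y (lt_smul S (-1) x)"

definition is_tvs :: "('k::field \<Rightarrow> real) \<Rightarrow> ('a, 'k) lin_top \<Rightarrow> bool" where
  "is_tvs absK S \<longleftrightarrow>
    (let C = topspace (lt_top S); add = lt_add S; sm = lt_smul S; z = lt_zero S in
      z \<in> C \<and> (\<forall>x\<in>C. \<forall>y\<in>C. add x y \<in> C) \<and> (\<forall>c. \<forall>x\<in>C. sm c x \<in> C)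
    \<and> (\<forall>x\<in>C. \<forall>y\<in>C. \<forall>w\<in>C. add (add x y) w = add x (add y w))
    \<and> (\<forall>x\<in>C. \<forall>y\<in>C. add x y = add y x)
    \<and> (\<forall>x\<in>C. add z x = x)
    \<and> (\<forall>x\<in>C. \<exists>y\<in>C. add x y = z)
    \<and> (\<forall>c. \<forall>x\<in>C. \<forall>y\<in>C. sm c (add x y) = add (sm c x) (sm c y))
    \<and> (\<forall>a b. \<forall>x\<in>C. sm (a + b) x = add (sm a x) (sm b x))
    \<and> (\<forall>a b. \<forall>x\<in>C. sm a (sm b x) = sm (a * b) x)
    \<and> (\<forall>x\<in>C. sm 1 x = x)
    \<and> continuous_map (prod_topology (lt_top S) (lt_top S)) (lt_top S) (\<lambda>(x, y). add x y)
    \<and> continuous_map (prod_topology (ktop absK) (lt_top S)) (lt_top S) (\<lambda>(c, x). sm c x)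
    \<and> Hausdorff_space (lt_top S))"

definition Kpow :: "('k::field \<Rightarrow> real) \<Rightarrow> ('n \<Rightarrow> 'k, 'k) lin_top" where
  "Kpow absK = \<lparr> lt_top = product_topology (\<lambda>_. ktop absK) UNIV,
                 lt_add = (\<lambda>x y i. x i + y i), lt_smul = (\<lambda>c x i. c * x i),
                 lt_zero = (\<lambda>_. 0) \<rparr>"

section \<open>Iterated spaces E, E x E x K, (E x E x K) x (E x E x K) x K, ...\<close>

datatype ('a, 'k) pt = Base 'a | Triple "('a, 'k) pt" "('a, 'k) pt" 'k

fun pt_add :: "('a \<Rightarrow> 'a \<Rightarrow> 'a) \<Rightarrow> ('a, 'k::field) pt \<Rightarrow> ('a, 'k) pt \<Rightarrow> ('a, 'k) pt" where
  "pt_add ad (Base a) (Base b) = Base (ad a b)"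
| "pt_add ad (Triple x y s) (Triple x' y' s') = Triple (pt_add ad x x') (pt_add ad y y') (s + s')"
| "pt_add ad _ _ = undefined"

fun pt_smul :: "('k \<Rightarrow> 'a \<Rightarrow> 'a) \<Rightarrow> 'k::field \<Rightarrow> ('a, 'k) pt \<Rightarrow> ('a, 'k) pt" where
  "pt_smul sm c (Base a) = Base (sm c a)"
| "pt_smul sm c (Triple x y s) = Triple (pt_smul sm c x) (pt_smul sm c y) (c * s)"

text \<open>Transport of a topology along a map (used with injective maps only).\<close>
definition img_top :: "('a \<Rightarrow> 'b) \<Rightarrow> 'a topology \<Rightarrow> 'b topology" where
  "img_top h T = topology (\<lambda>S. S \<subseteq> h ` topspace T \<and> openin T {x \<in> topspace T. h x \<in> S})"

fun iter_sp :: "('k::field \<Rightarrow> real) \<Rightarrow> ('a, 'k) lin_top \<Rightarrow> nat \<Rightarrow> (('a, 'k) pt, 'k) lin_top" where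
  "iter_sp absK S 0 =
     \<lparr> lt_top = img_top Base (lt_top S), lt_add = pt_add (lt_add S),
       lt_smul = pt_smul (lt_smul S), lt_zero = Base (lt_zero S) \<rparr>"
| "iter_sp absK S (Suc j) =
     \<lparr> lt_top = img_top (\<lambda>(x, y, t). Triple x y t)
         (prod_topology (lt_top (iter_sp absK S j))
            (prod_topology (lt_top (iter_sp absK S j)) (ktop absK))),
       lt_add = pt_add (lt_add S), lt_smul = pt_smul (lt_smul S),
       lt_zero = Triple (lt_zero (iter_sp absK S j)) (lt_zero (iter_sp absK S j)) 0 \<rparr>"

fun bgn_dom :: "('k::field \<Rightarrow> real) \<Rightarrow> ('a, 'k) lin_top \<Rightarrow> 'a set \<Rightarrow> nat \<Rightarrow> ('a, 'k) pt set" where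
  "bgn_dom absK S V 0 = Base ` V"
| "bgn_dom absK S V (Suc j) =
     {Triple x y t | x y t. x \<in> bgn_dom absK S V j
        \<and> y \<in> topspace (lt_top (iter_sp absK S j))
        \<and> pt_add (lt_add S) x (pt_smul (lt_smul S) t y) \<in> bgn_dom absK S V j}"

definition bgn_ext_ok :: "('k::field \<Rightarrow> real) \<Rightarrow> ('a, 'k) lin_top \<Rightarrow> ('f, 'k) lin_top \<Rightarrow> 'a set
     \<Rightarrow> nat \<Rightarrow> (('a, 'k) pt \<Rightarrow> 'f) \<Rightarrow> (('a, 'k) pt \<Rightarrow> 'f) \<Rightarrow> bool" where
  "bgn_ext_ok absK S F V j h G \<longleftrightarrow>
     continuous_map (subtopology (lt_top (iter_sp absK S (Suc j))) (bgn_dom absK S V (Suc j)))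
       (lt_top F) G
   \<and> (\<forall>x y t. Triple x y t \<in> bgn_dom absK S V (Suc j) \<and> t \<noteq> 0 \<longrightarrow>
        G (Triple x y t) =
          lt_smul F (inverse t)
            (lt_sub F (h (pt_add (lt_add S) x (pt_smul (lt_smul S) t y))) (h x)))"

primrec bgn_der :: "('k::field \<Rightarrow> real) \<Rightarrow> ('a, 'k) lin_top \<Rightarrow> ('f, 'k) lin_top \<Rightarrow> 'a set
     \<Rightarrow> ('a \<Rightarrow> 'f) \<Rightarrow> nat \<Rightarrow> ('a, 'k) pt \<Rightarrow> 'f" where
  "bgn_der absK S F V g 0 = (\<lambda>p. case p of Base a \<Rightarrow> g a | Triple _ _ _ \<Rightarrow> undefined)"
| "bgn_der absK S F V g (Suc j) =
     (SOME G. bgn_ext_ok absK S F V j (bgn_der absK S F V g j) G)"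

definition bgn_C :: "('k::field \<Rightarrow> real) \<Rightarrow> ('a, 'k) lin_top \<Rightarrow> ('f, 'k) lin_top \<Rightarrow> 'a set
     \<Rightarrow> ('a \<Rightarrow> 'f) \<Rightarrow> nat \<Rightarrow> bool" where
  "bgn_C absK S F V g k \<longleftrightarrow> V \<subseteq> topspace (lt_top S)
     \<and> continuous_map (subtopology (lt_top S) V) (lt_top F) g
     \<and> (\<forall>j<k. bgn_ext_ok absK S F V j (bgn_der absK S F V g j) (bgn_der absK S F V g (Suc j)))"

definition bgn_Cinf :: "('k::field \<Rightarrow> real) \<Rightarrow> ('a, 'k) lin_top \<Rightarrow> ('f, 'k) lin_top \<Rightarrow> 'a set
     \<Rightarrow> ('a \<Rightarrow> 'f) \<Rightarrow> bool" where
  "bgn_Cinf absK S F V g \<longleftrightarrow> (\<forall>k. bgn_C absK S F V g k)"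

definition is_gauge :: "('k::field \<Rightarrow> real) \<Rightarrow> ('a, 'k) lin_top \<Rightarrow> ('a \<Rightarrow> real) \<Rightarrow> bool" where
  "is_gauge absK S q \<longleftrightarrow>
     (\<forall>x\<in>topspace (lt_top S). 0 \<le> q x)
   \<and> (\<forall>t. \<forall>x\<in>topspace (lt_top S). q (lt_smul S t x) = absK t * q x)
   \<and> (\<forall>r>0. \<exists>Nb. openin (lt_top S) Nb \<and> lt_zero S \<in> Nb
              \<and> Nb \<subseteq> {x \<in> topspace (lt_top S). q x < r})"

definition holder0 :: "('k::field \<Rightarrow> real) \<Rightarrow> ('a, 'k) lin_top \<Rightarrow> ('f, 'k) lin_top \<Rightarrow> real
     \<Rightarrow> 'a set \<Rightarrow> ('a \<Rightarrow> 'f) \<Rightarrow> bool" where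
  "holder0 absK S F \<sigma> V g \<longleftrightarrow>
     (\<forall>x0\<in>V. \<forall>q. is_gauge absK F q \<longrightarrow>
        (\<exists>p W. is_gauge absK S p \<and> W \<subseteq> V
           \<and> (\<exists>Nb. openin (subtopology (lt_top S) V) Nb \<and> x0 \<in> Nb \<and> Nb \<subseteq> W)
           \<and> (\<forall>x\<in>W. \<forall>y\<in>W. q (lt_sub F (g y) (g x)) \<le> (p (lt_sub S y x)) powr \<sigma>)))"

definition bgn_Cks :: "('k::field \<Rightarrow> real) \<Rightarrow> ('a, 'k) lin_top \<Rightarrow> ('f, 'k) lin_top \<Rightarrow> 'a set
     \<Rightarrow> ('a \<Rightarrow> 'f) \<Rightarrow> nat \<Rightarrow> real \<Rightarrow> bool" where
  "bgn_Cks absK S F V g k \<sigma> \<longleftrightarrow> bgn_C absK S F V g k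
     \<and> (\<forall>j\<le>k. holder0 absK (iter_sp absK S j) F \<sigma> (bgn_dom absK S V j) (bgn_der absK S F V g j))"

end

(* A map is C^{k,sigma} iff it starts a chain g, g^[1], ..., g^[k] of locally Hoelder continuous maps, each of
   which extends the difference quotient of the preceding one. By the chain rule such chains can be composed with
   smooth maps, and C^1 maps are locally Lipschitz with respect to gauges, which gives one implication.

   For the converse suppose that g is C^{k,sigma} along all smooth maps of k + 1 variables, k > 0. If
   (gamma1, gamma2, gamma3) is a smooth map of k variables into the domain of g^[1], then the difference quotient
   of g along this map is the one of (s, tau) |-> g(gamma1(s) + tau gamma2(s)) at (s, 0) in the direction tau with
   increment gamma3(s). Hence g^[1] exists and is C^{k-1,sigma} along all smooth maps of k variables. Near points
   with gamma3 = 0 a cutoff keeps gamma1(s) + tau gamma2(s) inside the domain; near the other points the quotient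
   is a product with the smooth function 1/gamma3.

   It remains to see that a map which is Hoelder continuous along smooth curves is Hoelder continuous. If this
   fails at a point x, there are rapidly converging pairs of points violating the estimates, and a smooth curve
   passing through the n-th pair at times rho^n and rho^n + tau_n for a suitable small tau_n. The curve is a rapidly
   converging series of bumps with disjoint supports; at each point almost all terms of its iterated difference
   quotients vanish, so that completeness of the space is not needed. *)

theory Submission
  imports Defs
begin

section \<open>Neighbourhood criteria for continuity, transported topologies, the topology of an
  absolute value\<close>

section \<open>Topologies\<close>

text \<open>Since \<open>bgn_der\<close> picks its extensions by choice, the work is done with
  arbitrary chains of functions linked by \<open>g (x + t y) = g x + t G (x, y, t)\<close>;
  uniqueness of limits at t = 0 identifies them with \<open>bgn_der\<close>. A chain may start at
  any level of the iterated spaces, so every induction on the order passes from a map to its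
  quotient without a change of the underlying space. The l + 1 variables are spent one by one: each
  quotient takes one for the increment, and the last one parametrizes the curves. The distinction
  between the real and the ultrametric case matters only for the construction of a smooth bump
  function, from which cutoffs, reciprocals away from zero and curves are made. Metrizability is
  used through a countable base at zero, which supplies a single sequence of neighbourhoods that
  controls the series of bumps.\<close>

lemma continuous_map_nbhd:
  "continuous_map X Y f \<longleftrightarrow> (\<forall>x\<in>topspace X. f x \<in> topspace Y \<and>
     (\<forall>V. openin Y V \<and> f x \<in> V \<longrightarrow> (\<exists>N. openin X N \<and> x \<in> N \<and> (\<forall>y\<in>N. f y \<in> V))))"
  (is "?l \<longleftrightarrow> ?r")
proof
  assume l: ?l
  show ?r
  proof (intro ballI conjI allI impI)
    fix x assume x: "x \<in> topspace X"
    show "f x \<in> topspace Y" using l x by (auto simp: continuous_map_def)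
    fix V assume V: "openin Y V \<and> f x \<in> V"
    show "\<exists>N. openin X N \<and> x \<in> N \<and> (\<forall>y\<in>N. f y \<in> V)"
      using l V x by (intro exI[of _ "{x \<in> topspace X. f x \<in> V}"]) (auto simp: continuous_map_def)
  qed
next
  assume r: ?r
  show ?l unfolding continuous_map_def
  proof (intro conjI allI impI)
    show "f \<in> topspace X \<rightarrow> topspace Y" using r by auto
    fix V assume V: "openin Y V"
    show "openin X {x \<in> topspace X. f x \<in> V}"
    proof (subst openin_subopen, intro ballI)
      fix x assume x: "x \<in> {x \<in> topspace X. f x \<in> V}"
      then obtain N where N: "openin X N" "x \<in> N" "\<forall>y\<in>N. f y \<in> V" using r V by blast
      then show "\<exists>T. openin X T \<and> x \<in> T \<and> T \<subseteq> {x \<in> topspace X. f x \<in> V}"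
        using openin_subset by blast
    qed
  qed
qed

lemma openin_img_top:
  "openin (img_top h T) S \<longleftrightarrow> S \<subseteq> h ` topspace T \<and> openin T {x \<in> topspace T. h x \<in> S}"
proof -
  have "istopology (\<lambda>S. S \<subseteq> h ` topspace T \<and> openin T {x \<in> topspace T. h x \<in> S})"
    unfolding istopology_def
  proof (intro conjI allI impI)
    fix S S' assume a: "S \<subseteq> h ` topspace T \<and> openin T {x \<in> topspace T. h x \<in> S}"
      "S' \<subseteq> h ` topspace T \<and> openin T {x \<in> topspace T. h x \<in> S'}"
    show "S \<inter> S' \<subseteq> h ` topspace T" using a by auto
    have "{x \<in> topspace T. h x \<in> S \<inter> S'} = {x \<in> topspace T. h x \<in> S} \<inter> {x \<in> topspace T. h x \<in> S'}"
      by auto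
    then show "openin T {x \<in> topspace T. h x \<in> S \<inter> S'}" using a by auto
  next
    fix K assume a: "\<forall>S\<in>K. S \<subseteq> h ` topspace T \<and> openin T {x \<in> topspace T. h x \<in> S}"
    show "\<Union>K \<subseteq> h ` topspace T" using a by auto
    have "{x \<in> topspace T. h x \<in> \<Union>K} = (\<Union>S\<in>K. {x \<in> topspace T. h x \<in> S})" by auto
    then show "openin T {x \<in> topspace T. h x \<in> \<Union>K}" using a by auto
  qed
  then show ?thesis by (simp add: img_top_def topology_inverse')
qed

lemma topspace_img_top: "topspace (img_top h T) = h ` topspace T"
proof -
  have "{x \<in> topspace T. h x \<in> h ` topspace T} = topspace T" by auto
  then have "openin (img_top h T) (h ` topspace T)" by (auto simp: openin_img_top)
  then show ?thesis
    using openin_img_top[of h T "topspace (img_top h T)"] openin_subset by blast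
qed

lemma continuous_map_into_img_top: "continuous_map T (img_top h T) h"
  by (auto simp: continuous_map_def topspace_img_top openin_img_top)

lemma continuous_map_from_img_top:
  assumes "continuous_map T Y (g \<circ> h)"
  shows "continuous_map (img_top h T) Y g"
  using assms unfolding continuous_map_def
  by (auto simp: topspace_img_top openin_img_top) (smt (verit) Collect_cong image_eqI)

lemma openin_ktop: "openin (ktop absK) S \<longleftrightarrow> (\<forall>x\<in>S. \<exists>e>0. \<forall>y. absK (y - x) < e \<longrightarrow> y \<in> S)"
proof -
  have "istopology (\<lambda>S. \<forall>x\<in>S. \<exists>e>0. \<forall>y. absK (y - x) < e \<longrightarrow> y \<in> S)"
    unfolding istopology_def
  proof (intro conjI allI impI ballI)
    fix S T x assume a: "\<forall>x\<in>S. \<exists>e>0. \<forall>y. absK (y - x) < e \<longrightarrow> y \<in> S"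
      "\<forall>x\<in>T. \<exists>e>0. \<forall>y. absK (y - x) < e \<longrightarrow> y \<in> T" "x \<in> S \<inter> T"
    obtain e e' where "e > 0" "\<forall>y. absK (y - x) < e \<longrightarrow> y \<in> S"
      "e' > 0" "\<forall>y. absK (y - x) < e' \<longrightarrow> y \<in> T" using a by blast
    then show "\<exists>e>0. \<forall>y. absK (y - x) < e \<longrightarrow> y \<in> S \<inter> T"
      by (intro exI[of _ "min e e'"]) auto
  next
    fix K x assume "\<forall>S\<in>K. \<forall>x\<in>S. \<exists>e>0. \<forall>y. absK (y - x) < e \<longrightarrow> y \<in> S" "x \<in> \<Union>K"
    then show "\<exists>e>0. \<forall>y. absK (y - x) < e \<longrightarrow> y \<in> \<Union>K" by (meson UnionE UnionI)
  qed
  then show ?thesis by (simp add: ktop_def topology_inverse')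
qed

lemma topspace_ktop [simp]: "topspace (ktop absK) = UNIV"
proof -
  have "openin (ktop absK) UNIV" by (auto simp: openin_ktop intro: exI[of _ 1])
  then show ?thesis using openin_subset by blast
qed

abbreviation carr :: "('a, 'k) lin_top \<Rightarrow> 'a set" where
  "carr S \<equiv> topspace (lt_top S)"

text \<open>What the real and the ultrametric case have in common. \<open>nontrivial\<close> is
  non-discreteness in the form in which it is used: a supply of arbitrarily small nonzero
  scalars.\<close>

locale valued_field =
  fixes absK :: "'k::field \<Rightarrow> real"
  assumes abs_value: "abs_value absK"
    and nontrivial: "\<And>e. 0 < e \<Longrightarrow> \<exists>c. c \<noteq> 0 \<and> absK c < e"
begin

lemma absK_nonneg [simp]: "0 \<le> absK x"
  and absK_eq_0 [simp]: "absK x = 0 \<longleftrightarrow> x = 0"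
  and absK_mult: "absK (x * y) = absK x * absK y"
  and absK_add: "absK (x + y) \<le> absK x + absK y"
  using abs_value by (auto simp: abs_value_def)

lemma absK_0 [simp]: "absK 0 = 0"
  by simp

lemma absK_pos [simp]: "0 < absK x \<longleftrightarrow> x \<noteq> 0"
  using absK_nonneg[of x] absK_eq_0[of x] by linarith

lemma absK_1 [simp]: "absK 1 = 1"
  using absK_mult[of 1 1] by simp

lemma absK_neg1 [simp]: "absK (-1) = 1"
proof -
  have "absK (-1) * absK (-1) = 1" using absK_mult[of "-1" "-1"] by simp
  then show ?thesis using absK_nonneg[of "-1"] by (metis abs_of_nonneg real_sqrt_abs2 real_sqrt_one)
qed

lemma absK_minus [simp]: "absK (- x) = absK x"
  using absK_mult[of "-1" x] by simp

lemma absK_diff_commute: "absK (x - y) = absK (y - x)"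
  using absK_minus[of "x - y"] by simp

lemma absK_diff: "absK (x - y) \<le> absK x + absK y"
  using absK_add[of x "- y"] by simp

lemma absK_inverse: "absK (inverse x) = inverse (absK x)"
proof (cases "x = 0")
  case False
  then have "absK x * absK (inverse x) = 1" using absK_mult[of x "inverse x"] by simp
  then show ?thesis by (metis inverse_unique)
qed simp

lemma absK_power: "absK (x ^ n) = absK x ^ n"
  by (induction n) (auto simp: absK_mult)

lemma absK_divide: "absK (x / y) = absK x / absK y"
  by (simp add: divide_inverse absK_mult absK_inverse)

lemma openin_ball: "openin (ktop absK) {y. absK (y - x) < e}"
  unfolding openin_ktop
proof (intro ballI)
  fix z assume z: "z \<in> {y. absK (y - x) < e}"
  have "absK (y - x) < e" if "absK (y - z) < e - absK (z - x)" for y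
    using absK_add[of "y - z" "z - x"] that by simp
  then show "\<exists>d>0. \<forall>y. absK (y - z) < d \<longrightarrow> y \<in> {y. absK (y - x) < e}"
    using z by (intro exI[of _ "e - absK (z - x)"]) auto
qed

lemma continuous_map_ktop:
  "continuous_map T (ktop absK) f \<longleftrightarrow>
    (\<forall>x\<in>topspace T. \<forall>e>0. \<exists>N. openin T N \<and> x \<in> N \<and> (\<forall>y\<in>N. absK (f y - f x) < e))"
  (is "?l \<longleftrightarrow> ?r")
proof
  assume l: ?l
  show ?r
  proof (intro ballI allI impI)
    fix x e assume "x \<in> topspace T" "0 < (e::real)"
    then show "\<exists>N. openin T N \<and> x \<in> N \<and> (\<forall>y\<in>N. absK (f y - f x) < e)"
      using l openin_ball[of "f x" e] unfolding continuous_map_nbhd by force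
  qed
next
  assume r: ?r
  show ?l unfolding continuous_map_nbhd
  proof (intro ballI conjI allI impI)
    fix x V assume x: "x \<in> topspace T" and V: "openin (ktop absK) V \<and> f x \<in> V"
    then obtain e where e: "e > 0" "\<forall>y. absK (y - f x) < e \<longrightarrow> y \<in> V" by (auto simp: openin_ktop)
    then obtain N where "openin T N" "x \<in> N" "\<forall>y\<in>N. absK (f y - f x) < e" using r x by meson
    then show "\<exists>N. openin T N \<and> x \<in> N \<and> (\<forall>y\<in>N. f y \<in> V)" using e by blast
  qed simp
qed

lemma continuous_map_ktop_add:
  assumes "continuous_map T (ktop absK) f" "continuous_map T (ktop absK) g"
  shows "continuous_map T (ktop absK) (\<lambda>x. f x + g x)"
  unfolding continuous_map_ktop
proof (intro ballI allI impI)
  fix x e assume x: "x \<in> topspace T" and e: "0 < (e::real)"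
  obtain N M where N: "openin T N" "x \<in> N" "\<forall>y\<in>N. absK (f y - f x) < e/2"
    and M: "openin T M" "x \<in> M" "\<forall>y\<in>M. absK (g y - g x) < e/2"
    using assms[unfolded continuous_map_ktop] x e by (metis half_gt_zero)
  have "absK (f y + g y - (f x + g x)) < e" if "y \<in> N \<inter> M" for y
  proof -
    have "absK (f y + g y - (f x + g x)) \<le> absK (f y - f x) + absK (g y - g x)"
      using absK_add[of "f y - f x" "g y - g x"] by (simp add: algebra_simps)
    also have "\<dots> < e" using N M that by force
    finally show ?thesis .
  qed
  then show "\<exists>N. openin T N \<and> x \<in> N \<and> (\<forall>y\<in>N. absK (f y + g y - (f x + g x)) < e)"
    using N M by (intro exI[of _ "N \<inter> M"]) auto
qed

lemma continuous_map_ktop_mult: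
  assumes "continuous_map T (ktop absK) f" "continuous_map T (ktop absK) g"
  shows "continuous_map T (ktop absK) (\<lambda>x. f x * g x)"
  unfolding continuous_map_ktop
proof (intro ballI allI impI)
  fix x e assume x: "x \<in> topspace T" and e: "0 < (e::real)"
  define K where "K = 1 + absK (f x) + absK (g x)"
  have K: "K > 0" by (simp add: K_def add_pos_nonneg)
  \<comment> \<open>The bound 1 keeps \<open>absK (f y)\<close> below \<open>K\<close>; the other
    bound gives each of the two terms at most e/2.\<close>
  define d where "d = min 1 (e / (2 * K))"
  have d: "d > 0" using e K by (auto simp: d_def)
  obtain N M where N: "openin T N" "x \<in> N" "\<forall>y\<in>N. absK (f y - f x) < d"
    and M: "openin T M" "x \<in> M" "\<forall>y\<in>M. absK (g y - g x) < d"
    using assms[unfolded continuous_map_ktop] x d by metis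
  have "absK (f y * g y - f x * g x) < e" if y: "y \<in> N \<inter> M" for y
  proof -
    have f: "absK (f y - f x) < d" and g: "absK (g y - g x) < d" using y N M by auto
    have "absK (f y) \<le> absK (f y - f x) + absK (f x)" using absK_add[of "f y - f x" "f x"] by simp
    then have fy: "absK (f y) \<le> K" using f by (auto simp: d_def K_def intro: order_trans add_nonneg_nonneg) (smt (verit) absK_nonneg)
    have "absK (f y * g y - f x * g x) \<le> absK (f y) * absK (g y - g x) + absK (f y - f x) * absK (g x)"
      using absK_add[of "f y * (g y - g x)" "(f y - f x) * g x"]
      by (simp add: algebra_simps flip: absK_mult)
    also have "\<dots> \<le> K * absK (g y - g x) + absK (f y - f x) * K"
      using fy by (intro add_mono mult_mono) (auto simp: K_def)
    also have "\<dots> < K * d + d * K" using f g K by (intro add_strict_mono) auto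
    also have "\<dots> \<le> e" using K by (simp add: d_def min_def field_simps)
    finally show ?thesis .
  qed
  then show "\<exists>N. openin T N \<and> x \<in> N \<and> (\<forall>y\<in>N. absK (f y * g y - f x * g x) < e)"
    using N M by (intro exI[of _ "N \<inter> M"]) auto
qed

lemma Hausdorff_ktop: "Hausdorff_space (ktop absK)"
  unfolding Hausdorff_space_def
proof (intro allI impI)
  fix x y :: 'k assume xy: "x \<in> topspace (ktop absK) \<and> y \<in> topspace (ktop absK) \<and> x \<noteq> y"
  define e where "e = absK (x - y) / 2"
  have e: "e > 0" using xy by (simp add: e_def)
  have "disjnt {z. absK (z - x) < e} {z. absK (z - y) < e}"
  proof -
    have False if "absK (z - x) < e" "absK (z - y) < e" for z
      using absK_diff[of "z - y" "z - x"] that by (simp add: e_def)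
    then show ?thesis by (auto simp: disjnt_def)
  qed
  then show "\<exists>U V. openin (ktop absK) U \<and> openin (ktop absK) V \<and> x \<in> U \<and> y \<in> V \<and> disjnt U V"
    using e openin_ball by (intro exI[of _ "{z. absK (z - x) < e}"] exI[of _ "{z. absK (z - y) < e}"]) simp
qed

end

lemma valued_field_real:
  assumes "is_real_field absK"
  shows "valued_field absK"
proof -
  obtain \<phi> :: "'a \<Rightarrow> real" where \<phi>: "bij \<phi>" "\<phi> 1 = 1"
    "\<And>x y. \<phi> (x + y) = \<phi> x + \<phi> y" "\<And>x y. \<phi> (x * y) = \<phi> x * \<phi> y" "\<And>x. absK x = \<bar>\<phi> x\<bar>"
    using assms unfolding is_real_field_def by blast
  have z: "\<phi> 0 = 0" using \<phi>(3)[of 0 0] by simp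
  have inj: "\<phi> x = 0 \<longleftrightarrow> x = 0" for x using \<phi>(1) z by (metis bij_pointE)
  show ?thesis
  proof
    show "abs_value absK" by (auto simp: abs_value_def \<phi> inj abs_mult abs_triangle_ineq)
    fix e :: real assume e: "0 < e"
    obtain c where c: "\<phi> c = e / 2" using \<phi>(1) by (metis bij_pointE)
    then have "c \<noteq> 0" using z e by auto
    moreover have "absK c < e" using c e by (simp add: \<phi>(5))
    ultimately show "\<exists>c. c \<noteq> 0 \<and> absK c < e" by blast
  qed
qed

text \<open>If some ball around 0 contained no nonzero scalar, all balls of that radius would be
  singletons and the topology would be discrete.\<close>

lemma valued_field_ultrametric:
  assumes "ultrametric_field absK"
  shows "valued_field absK"
proof
  show "abs_value absK" using assms by (simp add: ultrametric_field_def)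
  fix e :: real assume e: "0 < e"
  show "\<exists>c. c \<noteq> 0 \<and> absK c < e"
  proof (rule ccontr)
    assume "\<not> ?thesis"
    then have "\<forall>x. openin (ktop absK) {x}" using e
      by (auto simp: openin_ktop) (metis eq_iff_diff_eq_0)
    then show False using assms by (simp add: ultrametric_field_def)
  qed
qed

section \<open>Vector calculus on carriers and continuity of the operations at a point\<close>

section \<open>Topological vector spaces\<close>

context valued_field
begin

abbreviation "tvs \<equiv> is_tvs absK"

lemmas tvs_axioms_1 = iffD1[OF is_tvs_def[of absK, unfolded Let_def]]
lemmas tvs_zero = tvs_axioms_1[THEN conjunct1, rule_format]
lemmas tvs_axioms_2 = tvs_axioms_1[THEN conjunct2]
lemmas tvs_add = tvs_axioms_2[THEN conjunct1, rule_format]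
lemmas tvs_axioms_3 = tvs_axioms_2[THEN conjunct2]
lemmas tvs_smul = tvs_axioms_3[THEN conjunct1, rule_format]
lemmas tvs_axioms_4 = tvs_axioms_3[THEN conjunct2]
lemmas tvs_assoc = tvs_axioms_4[THEN conjunct1, rule_format]
lemmas tvs_axioms_5 = tvs_axioms_4[THEN conjunct2]
lemmas tvs_comm = tvs_axioms_5[THEN conjunct1, rule_format]
lemmas tvs_axioms_6 = tvs_axioms_5[THEN conjunct2]
lemmas tvs_zero_left = tvs_axioms_6[THEN conjunct1, rule_format]
lemmas tvs_axioms_7 = tvs_axioms_6[THEN conjunct2]
lemmas tvs_ex_minus = tvs_axioms_7[THEN conjunct1, rule_format]
lemmas tvs_axioms_8 = tvs_axioms_7[THEN conjunct2]
lemmas tvs_smul_add = tvs_axioms_8[THEN conjunct1, rule_format]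
lemmas tvs_axioms_9 = tvs_axioms_8[THEN conjunct2]
lemmas tvs_add_smul = tvs_axioms_9[THEN conjunct1, rule_format]
lemmas tvs_axioms_10 = tvs_axioms_9[THEN conjunct2]
lemmas tvs_smul_smul = tvs_axioms_10[THEN conjunct1, rule_format]
lemmas tvs_axioms_11 = tvs_axioms_10[THEN conjunct2]
lemmas tvs_one = tvs_axioms_11[THEN conjunct1, rule_format]
lemmas tvs_axioms_12 = tvs_axioms_11[THEN conjunct2]
lemmas tvs_continuous_add = tvs_axioms_12[THEN conjunct1, rule_format]
lemmas tvs_axioms_13 = tvs_axioms_12[THEN conjunct2]
lemmas tvs_continuous_smul = tvs_axioms_13[THEN conjunct1, rule_format]
lemmas tvs_Hausdorff = tvs_axioms_13[THEN conjunct2]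

lemma tvs_left_comm:
  "tvs S \<Longrightarrow> x \<in> carr S \<Longrightarrow> y \<in> carr S \<Longrightarrow> z \<in> carr S \<Longrightarrow>
      lt_add S x (lt_add S y z) = lt_add S y (lt_add S x z)"
  by (metis tvs_assoc tvs_comm)

lemma tvs_zero_right: "tvs S \<Longrightarrow> x \<in> carr S \<Longrightarrow> lt_add S x (lt_zero S) = x"
  by (metis tvs_comm tvs_zero tvs_zero_left)

lemma tvs_cancel:
  assumes "tvs S" "x \<in> carr S" "y \<in> carr S" "z \<in> carr S"
  shows "lt_add S x y = lt_add S x z \<longleftrightarrow> y = z"
proof
  assume a: "lt_add S x y = lt_add S x z"
  obtain w where w: "w \<in> carr S" "lt_add S x w = lt_zero S" using tvs_ex_minus[OF assms(1,2)] by blast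
  have "lt_add S w (lt_add S x y) = lt_add S w (lt_add S x z)" using a by simp
  moreover have "lt_add S w (lt_add S x v) = v" if "v \<in> carr S" for v
    using that assms w by (metis tvs_assoc tvs_comm tvs_zero_left)
  ultimately show "y = z" using assms by simp
qed simp

lemma tvs_smul_0:
  assumes "tvs S" "x \<in> carr S"
  shows "lt_smul S 0 x = lt_zero S"
proof -
  have "lt_add S (lt_smul S 0 x) (lt_smul S 0 x) = lt_add S (lt_smul S 0 x) (lt_zero S)"
    using assms tvs_add_smul[OF assms, of 0 0] by (simp add: tvs_zero_right tvs_smul)
  then show ?thesis using assms by (simp add: tvs_cancel tvs_smul tvs_zero)
qed

lemma tvs_smul_zero:
  assumes "tvs S"
  shows "lt_smul S c (lt_zero S) = lt_zero S"
  using tvs_smul_smul[OF assms tvs_zero[OF assms], of c 0] tvs_smul_0[OF assms] tvs_zero[OF assms]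
  by simp

lemmas tvs_simps = tvs_zero tvs_add tvs_smul tvs_assoc tvs_comm tvs_left_comm tvs_zero_left
  tvs_zero_right tvs_smul_add tvs_add_smul tvs_smul_smul tvs_one tvs_smul_0 tvs_smul_zero

lemmas tvs_closed = tvs_zero tvs_add tvs_smul

lemma tvs_minus_right:
  assumes "tvs S" "x \<in> carr S"
  shows "lt_add S x (lt_smul S (-1) x) = lt_zero S"
  using tvs_add_smul[OF assms, of 1 "-1"] assms by (simp add: tvs_one tvs_smul_0)

lemma tvs_sub: "tvs S \<Longrightarrow> x \<in> carr S \<Longrightarrow> y \<in> carr S \<Longrightarrow> lt_sub S y x \<in> carr S"
  by (simp add: lt_sub_def tvs_closed)

lemma tvs_add_sub: "tvs S \<Longrightarrow> x \<in> carr S \<Longrightarrow> y \<in> carr S \<Longrightarrow> lt_add S x (lt_sub S y x) = y"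
  unfolding lt_sub_def
  by (subst tvs_left_comm) (simp_all add: tvs_minus_right tvs_closed tvs_zero_right)

lemma tvs_sub_eq_iff:
  "tvs S \<Longrightarrow> x \<in> carr S \<Longrightarrow> y \<in> carr S \<Longrightarrow> v \<in> carr S \<Longrightarrow> lt_sub S y x = v \<longleftrightarrow> y = lt_add S x v"
  by (metis tvs_add_sub tvs_cancel tvs_sub)

lemma tvs_add_sub_cancel: "tvs S \<Longrightarrow> x \<in> carr S \<Longrightarrow> v \<in> carr S \<Longrightarrow> lt_sub S (lt_add S x v) x = v"
  by (simp add: tvs_sub_eq_iff tvs_add)

lemma tvs_sub_self: "tvs S \<Longrightarrow> x \<in> carr S \<Longrightarrow> lt_sub S x x = lt_zero S"
  by (simp add: lt_sub_def tvs_minus_right)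

lemma tvs_sub_add_sub:
  "tvs S \<Longrightarrow> x \<in> carr S \<Longrightarrow> y \<in> carr S \<Longrightarrow> z \<in> carr S \<Longrightarrow>
    lt_add S (lt_sub S z y) (lt_sub S y x) = lt_sub S z x"
  by (rule sym, simp add: tvs_sub_eq_iff tvs_sub tvs_add)
     (metis tvs_add_sub tvs_comm tvs_left_comm tvs_sub)

lemma tvs_smul_sub:
  "tvs S \<Longrightarrow> x \<in> carr S \<Longrightarrow> y \<in> carr S \<Longrightarrow> lt_smul S c (lt_sub S y x) = lt_sub S (lt_smul S c y) (lt_smul S c x)"
  by (simp add: lt_sub_def tvs_simps mult.commute)

lemma tvs_sub_add_add:
  "tvs S \<Longrightarrow> a \<in> carr S \<Longrightarrow> b \<in> carr S \<Longrightarrow> c \<in> carr S \<Longrightarrow> d \<in> carr S \<Longrightarrow>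
    lt_sub S (lt_add S a b) (lt_add S c d) = lt_add S (lt_sub S a c) (lt_sub S b d)"
  by (simp add: lt_sub_def tvs_simps)

lemma continuous_map_tvs_add:
  assumes "tvs S" "continuous_map T (lt_top S) f" "continuous_map T (lt_top S) g"
  shows "continuous_map T (lt_top S) (\<lambda>x. lt_add S (f x) (g x))"
  using continuous_map_compose[OF continuous_map_pairedI[OF assms(2,3)] tvs_continuous_add[OF assms(1)]]
  by (simp add: o_def)

lemma continuous_map_tvs_smul:
  assumes "tvs S" "continuous_map T (ktop absK) f" "continuous_map T (lt_top S) g"
  shows "continuous_map T (lt_top S) (\<lambda>x. lt_smul S (f x) (g x))"
  using continuous_map_compose[OF continuous_map_pairedI[OF assms(2,3)] tvs_continuous_smul[OF assms(1)]]
  by (simp add: o_def)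

lemma continuous_map_tvs_sub:
  assumes "tvs S" "continuous_map T (lt_top S) f" "continuous_map T (lt_top S) g"
  shows "continuous_map T (lt_top S) (\<lambda>x. lt_sub S (f x) (g x))"
  unfolding lt_sub_def using assms by (intro continuous_map_tvs_add continuous_map_tvs_smul) auto

lemma tvs_add_nbhd:
  assumes "tvs S" "x \<in> carr S" "y \<in> carr S" "openin (lt_top S) V" "lt_add S x y \<in> V"
  obtains A B where "openin (lt_top S) A" "x \<in> A" "openin (lt_top S) B" "y \<in> B"
    "\<And>a b. a \<in> A \<Longrightarrow> b \<in> B \<Longrightarrow> lt_add S a b \<in> V"
proof -
  have "(x, y) \<in> topspace (prod_topology (lt_top S) (lt_top S))" using assms by simp
  then obtain N where N: "openin (prod_topology (lt_top S) (lt_top S)) N" "(x, y) \<in> N"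
    "\<forall>z\<in>N. (\<lambda>(x, y). lt_add S x y) z \<in> V"
    using tvs_continuous_add[OF assms(1), unfolded continuous_map_nbhd, rule_format, of "(x, y)"] assms
    by (simp add: case_prod_beta) meson
  obtain A B where "openin (lt_top S) A" "openin (lt_top S) B" "x \<in> A" "y \<in> B" "A \<times> B \<subseteq> N"
    using N(1)[unfolded openin_prod_topology_alt, rule_format, OF N(2)] by blast
  then show ?thesis using N(3) by (intro that[of A B]) auto
qed

lemma tvs_smul_nbhd:
  assumes "tvs S" "x \<in> carr S" "openin (lt_top S) V" "lt_smul S c x \<in> V"
  obtains e B where "e > 0" "openin (lt_top S) B" "x \<in> B"
    "\<And>a b. absK (a - c) < e \<Longrightarrow> b \<in> B \<Longrightarrow> lt_smul S a b \<in> V"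
proof -
  have "(c, x) \<in> topspace (prod_topology (ktop absK) (lt_top S))" using assms by simp
  then obtain N where N: "openin (prod_topology (ktop absK) (lt_top S)) N" "(c, x) \<in> N"
    "\<forall>z\<in>N. (\<lambda>(c, x). lt_smul S c x) z \<in> V"
    using tvs_continuous_smul[OF assms(1), unfolded continuous_map_nbhd, rule_format, of "(c, x)"] assms
    by (simp add: case_prod_beta) meson
  obtain A B where A: "openin (ktop absK) A" "openin (lt_top S) B" "c \<in> A" "x \<in> B" "A \<times> B \<subseteq> N"
    using N(1)[unfolded openin_prod_topology_alt, rule_format, OF N(2)] by blast
  then obtain e where "e > 0" "\<forall>y. absK (y - c) < e \<longrightarrow> y \<in> A" by (auto simp: openin_ktop)
  moreover have "(a, b) \<in> N" if "absK (a - c) < e" "b \<in> B" for a b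
    using that A(5) \<open>\<forall>y. absK (y - c) < e \<longrightarrow> y \<in> A\<close> by blast
  ultimately show ?thesis using N(3) A by (intro that[of e B]) fastforce+
qed

lemma openin_translate:
  assumes "tvs S" "x \<in> carr S" "openin (lt_top S) V"
  shows "openin (lt_top S) {y \<in> carr S. lt_add S x y \<in> V}"
  using continuous_map_tvs_add[OF assms(1), of "lt_top S" "\<lambda>_. x" "\<lambda>y. y"] assms
  by (simp add: continuous_map_def Pi_iff)

lemma openin_sub_translate:
  assumes "tvs S" "x \<in> carr S" "openin (lt_top S) V"
  shows "openin (lt_top S) {y \<in> carr S. lt_sub S y x \<in> V}"
  using continuous_map_tvs_sub[OF assms(1), of "lt_top S" "\<lambda>y. y" "\<lambda>_. x"] assms
  by (simp add: continuous_map_def Pi_iff)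

lemma openin_scale:
  assumes "tvs S" "openin (lt_top S) V"
  shows "openin (lt_top S) {y \<in> carr S. lt_smul S c y \<in> V}"
  using continuous_map_tvs_smul[OF assms(1), of "lt_top S" "\<lambda>_. c" "\<lambda>y. y"] assms
  by (simp add: continuous_map_def Pi_iff)

text \<open>Continuity of subtraction at (x, x), with the same neighbourhood for both arguments.
  This turns smallness near zero into smallness of differences near x.\<close>

lemma openin_diff_nbhd:
  assumes "tvs S" "x \<in> carr S" "openin (lt_top S) V" "lt_zero S \<in> V"
  obtains N where "openin (lt_top S) N" "x \<in> N" "\<And>y z. y \<in> N \<Longrightarrow> z \<in> N \<Longrightarrow> lt_sub S z y \<in> V"
proof -
  have "lt_add S x (lt_smul S (-1) x) \<in> V" using assms by (simp add: tvs_minus_right)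
  then obtain A B where A: "openin (lt_top S) A" "x \<in> A" "openin (lt_top S) B" "lt_smul S (-1) x \<in> B"
    "\<And>a b. a \<in> A \<Longrightarrow> b \<in> B \<Longrightarrow> lt_add S a b \<in> V"
    using tvs_add_nbhd[OF assms(1) assms(2) _ assms(3)] assms tvs_smul by metis
  show ?thesis
    by (rule that[of "A \<inter> {y \<in> carr S. lt_smul S (-1) y \<in> B}"])
      (use A assms openin_scale[OF assms(1) A(3)] in \<open>auto simp: lt_sub_def intro!: openin_Int\<close>)
qed

end

section \<open>Gauges without convexity: Minkowski functionals of balanced neighbourhoods\<close>

section \<open>Gauges\<close>

context valued_field
begin

definition balanced_nbhd :: "('a, 'k) lin_top \<Rightarrow> 'a set \<Rightarrow> bool" where
  "balanced_nbhd S W \<longleftrightarrow> openin (lt_top S) W \<and> lt_zero S \<in> W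
     \<and> (\<forall>c. \<forall>w\<in>W. absK c \<le> 1 \<longrightarrow> lt_smul S c w \<in> W)"

lemma balanced_nbhdD:
  assumes "balanced_nbhd S W"
  shows "openin (lt_top S) W" "lt_zero S \<in> W" "w \<in> W \<Longrightarrow> absK c \<le> 1 \<Longrightarrow> lt_smul S c w \<in> W"
    "W \<subseteq> carr S"
  using assms openin_subset by (auto simp: balanced_nbhd_def)

text \<open>W is the union of the sets c B with 0 < |c| < e, where scalars of size below e map B
  into V. Leaving out c = 0 makes W open, but requires a separate case a = 0 for
  balancedness.\<close>

lemma balanced_nbhd_exists:
  assumes S: "tvs S" and V: "openin (lt_top S) V" "lt_zero S \<in> V"
  obtains W where "balanced_nbhd S W" "W \<subseteq> V"
proof -
  have "lt_smul S 0 (lt_zero S) \<in> V" using S V by (simp add: tvs_simps)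
  then obtain e B where e: "e > 0" "openin (lt_top S) B" "lt_zero S \<in> B"
    "\<And>a b. absK (a - 0) < e \<Longrightarrow> b \<in> B \<Longrightarrow> lt_smul S a b \<in> V"
    using tvs_smul_nbhd[OF S tvs_zero[OF S] V(1), of 0] by metis
  define W where "W = (\<Union>c\<in>{c. c \<noteq> 0 \<and> absK c < e}. {y \<in> carr S. lt_smul S (inverse c) y \<in> B})"
  have "openin (lt_top S) W" unfolding W_def using openin_scale[OF S e(2)] by auto
  moreover have "lt_zero S \<in> W"
    unfolding W_def using nontrivial[OF e(1)] e S by (auto simp: tvs_simps)
  moreover have "lt_smul S a y \<in> W" if yW: "y \<in> W" and a: "absK a \<le> 1" for a y
  proof (cases "a = 0")
    case True
    then show ?thesis using yW calculation(2) S by (auto simp: tvs_simps W_def)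
  next
    case False
    obtain c where c: "c \<noteq> 0" "absK c < e" "y \<in> carr S" "lt_smul S (inverse c) y \<in> B"
      using yW by (auto simp: W_def)
    have "absK (a * c) \<le> absK c" using a mult_right_mono[of "absK a" 1 "absK c"] by (simp add: absK_mult)
    then have "absK (a * c) < e" using c by linarith
    moreover have "lt_smul S (inverse (a * c)) (lt_smul S a y) \<in> B"
      using c False S by (simp add: tvs_smul_smul field_simps)
    ultimately show ?thesis unfolding W_def using c False S
      by (intro UN_I[of "a * c"]) (auto simp: tvs_smul)
  qed
  ultimately have "balanced_nbhd S W" by (simp add: balanced_nbhd_def)
  moreover have "W \<subseteq> V"
  proof
    fix y assume "y \<in> W"
    then obtain c where c: "c \<noteq> 0" "absK c < e" "y \<in> carr S" "lt_smul S (inverse c) y \<in> B"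
      by (auto simp: W_def)
    then have "lt_smul S c (lt_smul S (inverse c) y) \<in> V" using e(4)[of c] by simp
    then show "y \<in> V" using c S by (simp add: tvs_simps)
  qed
  ultimately show ?thesis using that by blast
qed

lemma half_nbhd:
  assumes S: "tvs S" and V: "openin (lt_top S) V" "lt_zero S \<in> V"
  obtains W where "balanced_nbhd S W" "W \<subseteq> V" "\<And>v w. v \<in> W \<Longrightarrow> w \<in> W \<Longrightarrow> lt_add S v w \<in> V"
proof -
  have "lt_add S (lt_zero S) (lt_zero S) \<in> V" using S V by (simp add: tvs_simps)
  then obtain A B where A: "openin (lt_top S) A" "lt_zero S \<in> A" "openin (lt_top S) B" "lt_zero S \<in> B"
    "\<And>a b. a \<in> A \<Longrightarrow> b \<in> B \<Longrightarrow> lt_add S a b \<in> V"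
    using tvs_add_nbhd[OF S tvs_zero[OF S] tvs_zero[OF S] V(1)] by metis
  have "openin (lt_top S) (A \<inter> B \<inter> V)" "lt_zero S \<in> A \<inter> B \<inter> V" using A V by auto
  then obtain W where "balanced_nbhd S W" "W \<subseteq> A \<inter> B \<inter> V" using balanced_nbhd_exists[OF S] by metis
  then show ?thesis using that[of W] A(5) by blast
qed

lemma absorbing:
  assumes S: "tvs S" and W: "openin (lt_top S) W" "lt_zero S \<in> W" and x: "x \<in> carr S"
  obtains t where "t \<noteq> 0" "lt_smul S (inverse t) x \<in> W"
proof -
  have "lt_smul S 0 x \<in> W" using S W x by (simp add: tvs_simps)
  then obtain e B where e: "e > 0" "openin (lt_top S) B" "x \<in> B"
    "\<And>a b. absK (a - 0) < e \<Longrightarrow> b \<in> B \<Longrightarrow> lt_smul S a b \<in> W"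
    using tvs_smul_nbhd[OF S x W(1)] by metis
  obtain c where "c \<noteq> 0" "absK c < e" using nontrivial[OF e(1)] by blast
  then show ?thesis using e(3) e(4)[of c x] by (intro that[of "inverse c"]) simp_all
qed

text \<open>The infimum runs over absolute values of nonzero scalars of K, which may form a discrete
  subset of the positive reals. W need not be convex, so there is no triangle inequality.\<close>

definition minkowski :: "('a, 'k) lin_top \<Rightarrow> 'a set \<Rightarrow> 'a \<Rightarrow> real" where
  "minkowski S W x = Inf {absK t | t. t \<noteq> 0 \<and> lt_smul S (inverse t) x \<in> W}"

text \<open>The infimum need not be attained, so the functional is used only through strict
  inequalities: each one hands out a scalar t with x in t W and |t| under control.\<close>

lemma minkowski_less_iff:
  assumes S: "tvs S" and W: "openin (lt_top S) W" "lt_zero S \<in> W" and x: "x \<in> carr S"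
  shows "minkowski S W x < r \<longleftrightarrow> (\<exists>t. t \<noteq> 0 \<and> absK t < r \<and> lt_smul S (inverse t) x \<in> W)"
proof -
  obtain t where "t \<noteq> 0" "lt_smul S (inverse t) x \<in> W" by (rule absorbing[OF S W x])
  then have "{absK t | t. t \<noteq> 0 \<and> lt_smul S (inverse t) x \<in> W} \<noteq> {}" by auto
  moreover have "bdd_below {absK t | t. t \<noteq> 0 \<and> lt_smul S (inverse t) x \<in> W}"
    by (rule bdd_belowI[of _ 0]) auto
  ultimately show ?thesis unfolding minkowski_def by (subst cInf_less_iff) auto
qed

lemma minkowski_nonneg:
  assumes S: "tvs S" and W: "openin (lt_top S) W" "lt_zero S \<in> W" and x: "x \<in> carr S"
  shows "0 \<le> minkowski S W x"
  using minkowski_less_iff[OF assms, of 0] by (metis absK_nonneg leI linorder_not_less)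

lemma eq_if_less_iff:
  fixes a b :: real
  assumes "\<And>r. a < r \<longleftrightarrow> b < r"
  shows "a = b"
  using assms[of a] assms[of b] by simp

lemma minkowski_smul:
  assumes S: "tvs S" and W: "openin (lt_top S) W" "lt_zero S \<in> W" and x: "x \<in> carr S"
  shows "minkowski S W (lt_smul S c x) = absK c * minkowski S W x"
proof (cases "c = 0")
  \<comment> \<open>For the zero vector every nonzero t is admissible, and there are arbitrarily
    small ones.\<close>
  case True
  have "minkowski S W (lt_zero S) < r" if "r > 0" for r
    unfolding minkowski_less_iff[OF S W tvs_zero[OF S]]
    using nontrivial[OF that] W S by (auto simp: tvs_simps)
  then have "minkowski S W (lt_zero S) = 0"
    using minkowski_nonneg[OF S W tvs_zero[OF S]] by (metis less_irrefl order_le_less)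
  then show ?thesis using True S x by (simp add: tvs_simps)
next
  case False
  show ?thesis
  proof (rule eq_if_less_iff)
    fix r
    have "minkowski S W (lt_smul S c x) < r \<longleftrightarrow>
        (\<exists>t. t \<noteq> 0 \<and> absK t < r \<and> lt_smul S (inverse t) (lt_smul S c x) \<in> W)"
      by (rule minkowski_less_iff[OF S W tvs_smul[OF S x]])
    also have "\<dots> \<longleftrightarrow> (\<exists>t. t \<noteq> 0 \<and> absK t < r / absK c \<and> lt_smul S (inverse t) x \<in> W)"
    proof (intro iffI; elim exE conjE)
      fix t assume t: "t \<noteq> 0" "absK t < r" "lt_smul S (inverse t) (lt_smul S c x) \<in> W"
      then show "\<exists>t. t \<noteq> 0 \<and> absK t < r / absK c \<and> lt_smul S (inverse t) x \<in> W"
        using False S x by (intro exI[of _ "t / c"])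
          (auto simp: tvs_smul_smul absK_divide divide_strict_right_mono mult.commute simp flip: divide_inverse)
    next
      fix t assume t: "t \<noteq> 0" "absK t < r / absK c" "lt_smul S (inverse t) x \<in> W"
      then show "\<exists>t. t \<noteq> 0 \<and> absK t < r \<and> lt_smul S (inverse t) (lt_smul S c x) \<in> W"
        using False S x by (intro exI[of _ "t * c"])
          (auto simp: tvs_smul_smul absK_mult pos_less_divide_eq mult.assoc)
    qed
    also have "\<dots> \<longleftrightarrow> minkowski S W x < r / absK c" by (rule minkowski_less_iff[OF S W x, symmetric])
    also have "\<dots> \<longleftrightarrow> absK c * minkowski S W x < r" using False by (simp add: pos_less_divide_eq mult.commute)
    finally show "minkowski S W (lt_smul S c x) < r \<longleftrightarrow> absK c * minkowski S W x < r" .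
  qed
qed

lemma is_gauge_minkowski:
  assumes S: "tvs S" and W: "openin (lt_top S) W" "lt_zero S \<in> W"
  shows "is_gauge absK S (minkowski S W)"
  unfolding is_gauge_def
proof (intro conjI ballI allI impI)
  fix r :: real assume r: "r > 0"
  obtain t where t: "t \<noteq> 0" "absK t < r" using nontrivial[OF r] by blast
  have "minkowski S W y < r" if "y \<in> carr S" "lt_smul S (inverse t) y \<in> W" for y
    using minkowski_less_iff[OF S W that(1)] that t by blast
  then show "\<exists>Nb. openin (lt_top S) Nb \<and> lt_zero S \<in> Nb \<and> Nb \<subseteq> {x \<in> carr S. minkowski S W x < r}"
    using openin_scale[OF S W(1), of "inverse t"] W S
    by (intro exI[of _ "{y \<in> carr S. lt_smul S (inverse t) y \<in> W}"]) (auto simp: tvs_simps)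
qed (simp_all add: minkowski_nonneg[OF S W] minkowski_smul[OF S W])

lemma minkowski_less_one:
  assumes S: "tvs S" and W: "balanced_nbhd S W" and x: "x \<in> carr S" "minkowski S W x < 1"
  shows "x \<in> W"
proof -
  obtain t where t: "t \<noteq> 0" "absK t < 1" "lt_smul S (inverse t) x \<in> W"
    using minkowski_less_iff[OF S balanced_nbhdD(1,2)[OF W] x(1)] x by blast
  have "lt_smul S t (lt_smul S (inverse t) x) \<in> W" using balanced_nbhdD(3)[OF W t(3)] t by simp
  then show ?thesis using t S x by (simp add: tvs_simps)
qed

lemma gauge_nonneg: "is_gauge absK S q \<Longrightarrow> x \<in> carr S \<Longrightarrow> 0 \<le> q x"
  and gauge_smul: "is_gauge absK S q \<Longrightarrow> x \<in> carr S \<Longrightarrow> q (lt_smul S t x) = absK t * q x"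
  by (auto simp: is_gauge_def)

lemma gauge_nbhd:
  assumes "is_gauge absK S q" "r > 0"
  obtains N where "openin (lt_top S) N" "lt_zero S \<in> N" "\<And>x. x \<in> N \<Longrightarrow> q x < r"
proof -
  obtain N where "openin (lt_top S) N \<and> lt_zero S \<in> N \<and> N \<subseteq> {x \<in> carr S. q x < r}"
    using assms unfolding is_gauge_def by blast
  then show ?thesis by (intro that[of N]) auto
qed

lemma gauge_zero: "tvs S \<Longrightarrow> is_gauge absK S q \<Longrightarrow> q (lt_zero S) = 0"
  using gauge_smul[of S q "lt_zero S" 0] by (simp add: tvs_simps)

lemma gauge_scale:
  assumes q: "is_gauge absK S q" and c: "0 < (c::real)"
  shows "is_gauge absK S (\<lambda>x. c * q x)"
  unfolding is_gauge_def
proof (intro conjI ballI allI impI)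
  fix r :: real assume "r > 0"
  then obtain N where "openin (lt_top S) N" "lt_zero S \<in> N" "\<And>x. x \<in> N \<Longrightarrow> q x < r / c"
    using gauge_nbhd[OF q, of "r / c"] c by auto
  then show "\<exists>Nb. openin (lt_top S) Nb \<and> lt_zero S \<in> Nb \<and> Nb \<subseteq> {x \<in> carr S. c * q x < r}"
    using c openin_subset by (intro exI[of _ N]) (fastforce simp: field_simps)
qed (use q c in \<open>auto simp: gauge_nonneg gauge_smul\<close>)

lemma gauge_max:
  assumes q: "is_gauge absK S q" and p: "is_gauge absK S p"
  shows "is_gauge absK S (\<lambda>x. max (q x) (p x))"
  unfolding is_gauge_def
proof (intro conjI ballI allI impI)
  fix r :: real assume "r > 0"
  obtain N where N: "openin (lt_top S) N" "lt_zero S \<in> N" "\<And>x. x \<in> N \<Longrightarrow> q x < r"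
    using gauge_nbhd[OF q \<open>r > 0\<close>] by blast
  obtain M where M: "openin (lt_top S) M" "lt_zero S \<in> M" "\<And>x. x \<in> M \<Longrightarrow> p x < r"
    using gauge_nbhd[OF p \<open>r > 0\<close>] by blast
  have "N \<inter> M \<subseteq> {x \<in> carr S. max (q x) (p x) < r}"
    using N M openin_subset by fastforce
  then show "\<exists>Nb. openin (lt_top S) Nb \<and> lt_zero S \<in> Nb \<and> Nb \<subseteq> {x \<in> carr S. max (q x) (p x) < r}"
    using N M by (intro exI[of _ "N \<inter> M"]) auto
qed (use q p in \<open>auto simp: gauge_nonneg gauge_smul max_mult_distrib_left le_max_iff_disj\<close>)

text \<open>Take a balanced W with W + W inside a neighbourhood on which q < 1, and its Minkowski
  functional as q'. If a lies in t W and b in s W with |t| \<le> |s|, balancedness puts both into s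
  W, whence q (a + b) \<le> |s|.\<close>

lemma gauge_triangle:
  assumes S: "tvs S" and q: "is_gauge absK S q"
  obtains q' where "is_gauge absK S q'"
    "\<And>a b. a \<in> carr S \<Longrightarrow> b \<in> carr S \<Longrightarrow> q (lt_add S a b) \<le> max (q' a) (q' b)"
proof -
  obtain N where N: "openin (lt_top S) N" "lt_zero S \<in> N" "\<And>x. x \<in> N \<Longrightarrow> q x < 1"
    using gauge_nbhd[OF q, of 1] by auto
  obtain W where W: "balanced_nbhd S W" "\<And>v w. v \<in> W \<Longrightarrow> w \<in> W \<Longrightarrow> lt_add S v w \<in> N"
    using half_nbhd[OF S N(1,2)] by metis
  note W' = balanced_nbhdD[OF W(1)]
  have small: "q (lt_add S a b) \<le> absK s"
    if "a \<in> carr S" "b \<in> carr S" "t \<noteq> 0" "s \<noteq> 0" "absK t \<le> absK s"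
      "lt_smul S (inverse t) a \<in> W" "lt_smul S (inverse s) b \<in> W" for a b s t
  proof -
    have "absK (t / s) \<le> 1" using that by (simp add: absK_divide divide_le_eq_1)
    then have "absK (inverse s * t) \<le> 1" by (simp add: divide_inverse mult.commute)
    then have "lt_smul S (inverse s * t) (lt_smul S (inverse t) a) \<in> W" using W'(3) that by blast
    moreover have "inverse s * t * inverse t = inverse s" using that by simp
    ultimately have "lt_smul S (inverse s) a \<in> W" using that S by (simp add: tvs_smul_smul)
    then have "q (lt_add S (lt_smul S (inverse s) a) (lt_smul S (inverse s) b)) < 1"
      using W(2) that N(3) by blast
    moreover have "lt_add S a b = lt_smul S s (lt_add S (lt_smul S (inverse s) a) (lt_smul S (inverse s) b))"
      using that S by (simp add: tvs_simps)
    moreover have "lt_add S (lt_smul S (inverse s) a) (lt_smul S (inverse s) b) \<in> carr S"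
      using that S by (simp add: tvs_simps)
    ultimately show ?thesis using gauge_smul[OF q, of _ s]
      by (metis absK_nonneg less_eq_real_def mult.right_neutral mult_left_mono)
  qed
  show ?thesis
  proof (rule that[of "minkowski S W"])
    show "is_gauge absK S (minkowski S W)" using is_gauge_minkowski S W' by blast
    fix a b assume ab: "a \<in> carr S" "b \<in> carr S"
    show "q (lt_add S a b) \<le> max (minkowski S W a) (minkowski S W b)"
    \<comment> \<open>The maximum itself need not be the size of an admissible scalar, so an
      arbitrary excess e is allowed and removed at the end.\<close>
    proof (rule field_le_epsilon)
      fix e :: real assume "e > 0"
      define r where "r = max (minkowski S W a) (minkowski S W b) + e"
      have "minkowski S W a < r" "minkowski S W b < r" using \<open>e > 0\<close> by (auto simp: r_def)
      then obtain t s where "t \<noteq> 0" "absK t < r" "lt_smul S (inverse t) a \<in> W"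
        "s \<noteq> 0" "absK s < r" "lt_smul S (inverse s) b \<in> W"
        using minkowski_less_iff[OF S W'(1,2)] ab by metis
      then show "q (lt_add S a b) \<le> r"
        using small[of a b t s] small[of b a s t] ab tvs_comm[OF S ab]
        by (cases "absK t \<le> absK s") fastforce+
    qed
  qed
qed

definition lin :: "('a, 'k) lin_top \<Rightarrow> ('b, 'k) lin_top \<Rightarrow> ('a \<Rightarrow> 'b) \<Rightarrow> bool" where
  "lin S T L \<longleftrightarrow> continuous_map (lt_top S) (lt_top T) L
     \<and> (\<forall>x\<in>carr S. \<forall>y\<in>carr S. L (lt_add S x y) = lt_add T (L x) (L y))
     \<and> (\<forall>c. \<forall>x\<in>carr S. L (lt_smul S c x) = lt_smul T c (L x))"

lemma lin_carr: "lin S T L \<Longrightarrow> x \<in> carr S \<Longrightarrow> L x \<in> carr T"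
  by (auto simp: lin_def continuous_map_def)

lemma lin_add: "lin S T L \<Longrightarrow> x \<in> carr S \<Longrightarrow> y \<in> carr S \<Longrightarrow> L (lt_add S x y) = lt_add T (L x) (L y)"
  and lin_smul: "lin S T L \<Longrightarrow> x \<in> carr S \<Longrightarrow> L (lt_smul S c x) = lt_smul T c (L x)"
  and lin_continuous: "lin S T L \<Longrightarrow> continuous_map (lt_top S) (lt_top T) L"
  by (auto simp: lin_def)

lemma lin_zero: "tvs S \<Longrightarrow> tvs T \<Longrightarrow> lin S T L \<Longrightarrow> L (lt_zero S) = lt_zero T"
  using lin_smul[of S T L "lt_zero S" 0] by (simp add: tvs_zero tvs_smul_0 lin_carr)

lemma lin_sub: "tvs S \<Longrightarrow> lin S T L \<Longrightarrow> x \<in> carr S \<Longrightarrow> y \<in> carr S \<Longrightarrow>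
    L (lt_sub S y x) = lt_sub T (L y) (L x)"
  by (simp add: lt_sub_def lin_add lin_smul tvs_smul)

lemma gauge_lin:
  assumes S: "tvs S" "tvs T" and L: "lin S T L" and q: "is_gauge absK T q"
  shows "is_gauge absK S (\<lambda>x. q (L x))"
  unfolding is_gauge_def
proof (intro conjI ballI allI impI)
  fix r :: real assume "r > 0"
  then obtain N where N: "openin (lt_top T) N" "lt_zero T \<in> N" "\<And>x. x \<in> N \<Longrightarrow> q x < r"
    using gauge_nbhd[OF q] by metis
  then have "openin (lt_top S) {x \<in> carr S. L x \<in> N}"
    using lin_continuous[OF L] by (auto simp: continuous_map_def)
  then show "\<exists>Nb. openin (lt_top S) Nb \<and> lt_zero S \<in> Nb \<and> Nb \<subseteq> {x \<in> carr S. q (L x) < r}"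
    using N S lin_zero[OF S L] tvs_zero[OF S(1)] by (intro exI[of _ "{x \<in> carr S. L x \<in> N}"]) auto
qed (use q L in \<open>auto simp: gauge_nonneg gauge_smul lin_smul lin_carr\<close>)

end

section \<open>Iterated spaces as topological vector spaces, their open domains and countable
  bases\<close>

section \<open>The iterated spaces\<close>

definition pfst :: "('a, 'k) pt \<Rightarrow> ('a, 'k) pt" where
  "pfst p = (case p of Base a \<Rightarrow> p | Triple x y t \<Rightarrow> x)"

definition psnd :: "('a, 'k) pt \<Rightarrow> ('a, 'k) pt" where
  "psnd p = (case p of Base a \<Rightarrow> p | Triple x y t \<Rightarrow> y)"

definition pthd :: "('a, 'k) pt \<Rightarrow> 'k" where
  "pthd p = (case p of Base a \<Rightarrow> undefined | Triple x y t \<Rightarrow> t)"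

definition unBase :: "('a, 'k) pt \<Rightarrow> 'a" where
  "unBase p = (case p of Base a \<Rightarrow> a | Triple _ _ _ \<Rightarrow> undefined)"

lemma pt_proj_simps [simp]:
  "pfst (Triple x y t) = x" "psnd (Triple x y t) = y" "pthd (Triple x y t) = t" "unBase (Base a) = a"
  by (simp_all add: pfst_def psnd_def pthd_def unBase_def)

text \<open>The field as a space over itself, so that scalar functions are covered by the results on
  vector-valued maps.\<close>

definition Kt :: "('k::field \<Rightarrow> real) \<Rightarrow> ('k, 'k) lin_top" where
  "Kt absK = \<lparr>lt_top = ktop absK, lt_add = (+), lt_smul = (*), lt_zero = 0\<rparr>"

lemma Kt_simps [simp]:
  "lt_top (Kt absK) = ktop absK" "lt_add (Kt absK) = (+)" "lt_smul (Kt absK) = (*)" "lt_zero (Kt absK) = 0"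
  by (simp_all add: Kt_def)

lemma lt_sub_Kt [simp]: "lt_sub (Kt absK) y x = y - x"
  by (simp add: lt_sub_def)

lemma Kpow_simps [simp]:
  "lt_top (Kpow absK) = product_topology (\<lambda>_. ktop absK) UNIV"
  "lt_add (Kpow absK) = (\<lambda>x y i. x i + y i)" "lt_smul (Kpow absK) = (\<lambda>c x i. c * x i)"
  "lt_zero (Kpow absK) = (\<lambda>_. 0)"
  by (simp_all add: Kpow_def)

context valued_field
begin

lemma lt_add_iter_sp [simp]: "lt_add (iter_sp absK S j) = pt_add (lt_add S)"
  by (cases j) auto

lemma lt_smul_iter_sp [simp]: "lt_smul (iter_sp absK S j) = pt_smul (lt_smul S)"
  by (cases j) auto

lemma carr_iter_sp_0: "carr (iter_sp absK S 0) = Base ` carr S"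
  by (simp add: topspace_img_top)

lemma carr_iter_sp_Suc: "carr (iter_sp absK S (Suc j)) =
    {Triple x y t | x y t. x \<in> carr (iter_sp absK S j) \<and> y \<in> carr (iter_sp absK S j)}"
  by (auto simp: topspace_img_top image_iff)

declare iter_sp.simps [simp del]

lemma carr_iter_sp_SucE:
  assumes "p \<in> carr (iter_sp absK S (Suc j))"
  obtains x y t where "p = Triple x y t" "x \<in> carr (iter_sp absK S j)" "y \<in> carr (iter_sp absK S j)"
  using assms unfolding carr_iter_sp_Suc by blast

lemma Base_in_carr [simp]: "Base x \<in> carr (iter_sp absK S 0) \<longleftrightarrow> x \<in> carr S"
  by (auto simp: carr_iter_sp_0)

lemma Triple_in_carr [simp]: "Triple x y t \<in> carr (iter_sp absK S (Suc j)) \<longleftrightarrow>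
    x \<in> carr (iter_sp absK S j) \<and> y \<in> carr (iter_sp absK S j)"
  by (auto simp: carr_iter_sp_Suc)

lemma lt_zero_iter_sp_Suc [simp]: "lt_zero (iter_sp absK S (Suc j)) =
    Triple (lt_zero (iter_sp absK S j)) (lt_zero (iter_sp absK S j)) 0"
  by (simp add: iter_sp.simps)

lemma lt_zero_iter_sp_0 [simp]: "lt_zero (iter_sp absK S 0) = Base (lt_zero S)"
  by (simp add: iter_sp.simps)

lemma continuous_map_Base: "continuous_map (lt_top S) (lt_top (iter_sp absK S 0)) Base"
  by (simp add: continuous_map_into_img_top iter_sp.simps)

lemma continuous_map_unBase: "continuous_map (lt_top (iter_sp absK S 0)) (lt_top S) unBase"
  unfolding iter_sp.simps by (simp, rule continuous_map_from_img_top) (simp add: o_def)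

lemma continuous_map_pfst:
  "continuous_map (lt_top (iter_sp absK S (Suc j))) (lt_top (iter_sp absK S j)) pfst"
  unfolding iter_sp.simps(2)
  by (simp, rule continuous_map_from_img_top, rule continuous_map_eq[OF continuous_map_fst]) auto

lemma continuous_map_psnd:
  "continuous_map (lt_top (iter_sp absK S (Suc j))) (lt_top (iter_sp absK S j)) psnd"
  unfolding iter_sp.simps(2)
  by (simp, rule continuous_map_from_img_top,
      rule continuous_map_eq[OF continuous_map_compose[OF continuous_map_snd continuous_map_fst]]) auto

lemma continuous_map_pthd:
  "continuous_map (lt_top (iter_sp absK S (Suc j))) (ktop absK) pthd"
  unfolding iter_sp.simps(2)
  by (simp, rule continuous_map_from_img_top,
      rule continuous_map_eq[OF continuous_map_compose[OF continuous_map_snd continuous_map_snd]]) auto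

lemma continuous_map_Triple:
  assumes "continuous_map T (lt_top (iter_sp absK S j)) f" "continuous_map T (lt_top (iter_sp absK S j)) g"
    "continuous_map T (ktop absK) h"
  shows "continuous_map T (lt_top (iter_sp absK S (Suc j))) (\<lambda>z. Triple (f z) (g z) (h z))"
proof -
  let ?P = "prod_topology (lt_top (iter_sp absK S j)) (prod_topology (lt_top (iter_sp absK S j)) (ktop absK))"
  have "continuous_map T ?P (\<lambda>z. (f z, g z, h z))"
    using assms by (intro continuous_map_pairedI) auto
  from continuous_map_compose[OF this continuous_map_into_img_top[of ?P "\<lambda>(x, y, t). Triple x y t"]]
  show ?thesis by (simp add: iter_sp.simps o_def)
qed

text \<open>Asks for 0 x = 0 in place of additive inverses; (-1) x is then an inverse of x.\<close>

lemma is_tvsI: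
  assumes "lt_zero S \<in> carr S"
    "\<And>x y. x \<in> carr S \<Longrightarrow> y \<in> carr S \<Longrightarrow> lt_add S x y \<in> carr S"
    "\<And>c x. x \<in> carr S \<Longrightarrow> lt_smul S c x \<in> carr S"
    "\<And>x y z. x \<in> carr S \<Longrightarrow> y \<in> carr S \<Longrightarrow> z \<in> carr S \<Longrightarrow>
      lt_add S (lt_add S x y) z = lt_add S x (lt_add S y z)"
    "\<And>x y. x \<in> carr S \<Longrightarrow> y \<in> carr S \<Longrightarrow> lt_add S x y = lt_add S y x"
    "\<And>x. x \<in> carr S \<Longrightarrow> lt_add S (lt_zero S) x = x"
    "\<And>x. x \<in> carr S \<Longrightarrow> lt_smul S 0 x = lt_zero S"
    "\<And>c x y. x \<in> carr S \<Longrightarrow> y \<in> carr S \<Longrightarrow> lt_smul S c (lt_add S x y) = lt_add S (lt_smul S c x) (lt_smul S c y)"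
    "\<And>a b x. x \<in> carr S \<Longrightarrow> lt_smul S (a + b) x = lt_add S (lt_smul S a x) (lt_smul S b x)"
    "\<And>a b x. x \<in> carr S \<Longrightarrow> lt_smul S a (lt_smul S b x) = lt_smul S (a * b) x"
    "\<And>x. x \<in> carr S \<Longrightarrow> lt_smul S 1 x = x"
    "continuous_map (prod_topology (lt_top S) (lt_top S)) (lt_top S) (\<lambda>(x, y). lt_add S x y)"
    "continuous_map (prod_topology (ktop absK) (lt_top S)) (lt_top S) (\<lambda>(c, x). lt_smul S c x)"
    "Hausdorff_space (lt_top S)"
  shows "tvs S"
proof -
  have "\<exists>y\<in>carr S. lt_add S x y = lt_zero S" if x: "x \<in> carr S" for x
  proof
    show "lt_add S x (lt_smul S (-1) x) = lt_zero S"
      using assms(9)[OF x, of 1 "-1"] assms(7,11)[OF x] by simp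
  qed (use assms(3) x in auto)
  then show ?thesis unfolding is_tvs_def Let_def using assms by (intro conjI ballI allI) (assumption | simp)+
qed

lemma tvs_Kt: "tvs (Kt absK)"
proof (rule is_tvsI)
  have "continuous_map (prod_topology (ktop absK) (ktop absK)) (ktop absK) fst"
    "continuous_map (prod_topology (ktop absK) (ktop absK)) (ktop absK) snd"
    by (rule continuous_map_fst continuous_map_snd)+
  then show "continuous_map (prod_topology (lt_top (Kt absK)) (lt_top (Kt absK))) (lt_top (Kt absK)) (\<lambda>(x, y). lt_add (Kt absK) x y)"
   "continuous_map (prod_topology (ktop absK) (lt_top (Kt absK))) (lt_top (Kt absK)) (\<lambda>(x, y). lt_smul (Kt absK) x y)"
    by (simp_all add: case_prod_beta' continuous_map_ktop_add continuous_map_ktop_mult)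
qed (auto simp: algebra_simps Hausdorff_ktop)

lemma tvs_Kpow: "tvs (Kpow absK :: ('n \<Rightarrow> 'k, 'k) lin_top)"
proof (rule is_tvsI)
  let ?P = "product_topology (\<lambda>_. ktop absK) (UNIV :: 'n set)"
  have 1: "continuous_map (prod_topology ?P ?P) (ktop absK) (\<lambda>x. fst x i)"
    "continuous_map (prod_topology ?P ?P) (ktop absK) (\<lambda>x. snd x i)"
    "continuous_map (prod_topology (ktop absK) ?P) (ktop absK) fst"
    "continuous_map (prod_topology (ktop absK) ?P) (ktop absK) (\<lambda>x. snd x i)" for i
    using continuous_map_compose[OF continuous_map_fst continuous_map_product_projection[of i UNIV "\<lambda>_. ktop absK"]]
      continuous_map_compose[OF continuous_map_snd continuous_map_product_projection[of i UNIV "\<lambda>_. ktop absK"]]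
    by (auto simp: o_def continuous_map_fst)
  show "continuous_map (prod_topology (lt_top (Kpow absK)) (lt_top (Kpow absK)))
      (lt_top (Kpow absK :: ('n \<Rightarrow> 'k, 'k) lin_top)) (\<lambda>(x, y). lt_add (Kpow absK) x y)"
   "continuous_map (prod_topology (ktop absK) (lt_top (Kpow absK)))
      (lt_top (Kpow absK :: ('n \<Rightarrow> 'k, 'k) lin_top)) (\<lambda>(x, y). lt_smul (Kpow absK) x y)"
    using 1 by (auto simp: case_prod_beta' continuous_map_componentwise_UNIV
        intro!: continuous_map_ktop_add continuous_map_ktop_mult)
  show "Hausdorff_space (lt_top (Kpow absK :: ('n \<Rightarrow> 'k, 'k) lin_top))"
    by (simp add: Hausdorff_space_product_topology Hausdorff_ktop)
qed (auto simp: algebra_simps topspace_product_topology)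

lemma carr_Kpow [simp]: "carr (Kpow absK) = UNIV"
  by (simp add: topspace_product_topology)

text \<open>Level 0 is a copy of S along \<open>Base\<close>, each further level a product
  transported along \<open>Triple\<close>. The operations are continuous because they can be
  rewritten through the continuous projections.\<close>

lemma tvs_iter_sp:
  assumes S: "tvs S"
  shows "tvs (iter_sp absK S j)"
proof (induction j)
  case 0
  let ?X = "iter_sp absK S 0"
  have *: "tvs S" using S .
  show ?case
  proof (rule is_tvsI)
    have u: "continuous_map (prod_topology (lt_top ?X) (lt_top ?X)) (lt_top S) (\<lambda>z. unBase (fst z))"
      "continuous_map (prod_topology (lt_top ?X) (lt_top ?X)) (lt_top S) (\<lambda>z. unBase (snd z))"
      "continuous_map (prod_topology (ktop absK) (lt_top ?X)) (lt_top S) (\<lambda>z. unBase (snd z))"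
      "continuous_map (prod_topology (ktop absK) (lt_top ?X)) (ktop absK) fst"
      using continuous_map_compose[OF continuous_map_fst continuous_map_unBase]
        continuous_map_compose[OF continuous_map_snd continuous_map_unBase]
      by (auto simp: o_def continuous_map_fst)
    have "continuous_map (prod_topology (lt_top ?X) (lt_top ?X)) (lt_top ?X)
        (\<lambda>z. Base (lt_add S (unBase (fst z)) (unBase (snd z))))"
      using continuous_map_compose[OF continuous_map_tvs_add[OF S u(1,2)] continuous_map_Base]
      by (simp add: o_def)
    then show "continuous_map (prod_topology (lt_top ?X) (lt_top ?X)) (lt_top ?X) (\<lambda>(x, y). lt_add ?X x y)"
      by (rule continuous_map_eq) (auto simp: carr_iter_sp_0)
    have "continuous_map (prod_topology (ktop absK) (lt_top ?X)) (lt_top ?X)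
        (\<lambda>z. Base (lt_smul S (fst z) (unBase (snd z))))"
      using continuous_map_compose[OF continuous_map_tvs_smul[OF S u(4,3)] continuous_map_Base]
      by (simp add: o_def)
    then show "continuous_map (prod_topology (ktop absK) (lt_top ?X)) (lt_top ?X) (\<lambda>(x, y). lt_smul ?X x y)"
      by (rule continuous_map_eq) (auto simp: carr_iter_sp_0)
    show "Hausdorff_space (lt_top ?X)"
      by (rule Hausdorff_space_injective_preimage[OF tvs_Hausdorff[OF S] continuous_map_unBase])
         (auto simp: carr_iter_sp_0 inj_on_def)
  qed (auto simp: carr_iter_sp_0 S[THEN tvs_zero] * tvs_simps tvs_assoc)
next
  case (Suc j)
  let ?Y = "iter_sp absK S j" and ?X = "iter_sp absK S (Suc j)"
  note Y = Suc.IH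
  note al = tvs_simps[OF Y, unfolded lt_add_iter_sp lt_smul_iter_sp]
  show ?case
  proof (rule is_tvsI)
    let ?P = "prod_topology (lt_top ?X) (lt_top ?X)" and ?Q = "prod_topology (ktop absK) (lt_top ?X)"
    have u: "continuous_map ?P (lt_top ?Y) (\<lambda>z. pfst (fst z))" "continuous_map ?P (lt_top ?Y) (\<lambda>z. pfst (snd z))"
      "continuous_map ?P (lt_top ?Y) (\<lambda>z. psnd (fst z))" "continuous_map ?P (lt_top ?Y) (\<lambda>z. psnd (snd z))"
      "continuous_map ?P (ktop absK) (\<lambda>z. pthd (fst z))" "continuous_map ?P (ktop absK) (\<lambda>z. pthd (snd z))"
      "continuous_map ?Q (lt_top ?Y) (\<lambda>z. pfst (snd z))" "continuous_map ?Q (lt_top ?Y) (\<lambda>z. psnd (snd z))"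
      "continuous_map ?Q (ktop absK) (\<lambda>z. pthd (snd z))" "continuous_map ?Q (ktop absK) fst"
      using continuous_map_compose[OF continuous_map_fst continuous_map_pfst]
        continuous_map_compose[OF continuous_map_fst continuous_map_psnd]
        continuous_map_compose[OF continuous_map_fst continuous_map_pthd]
        continuous_map_compose[OF continuous_map_snd continuous_map_pfst]
        continuous_map_compose[OF continuous_map_snd continuous_map_psnd]
        continuous_map_compose[OF continuous_map_snd continuous_map_pthd]
      by (auto simp: o_def continuous_map_fst)
    have "continuous_map ?P (lt_top ?X) (\<lambda>z. Triple (lt_add ?Y (pfst (fst z)) (pfst (snd z)))
        (lt_add ?Y (psnd (fst z)) (psnd (snd z))) (pthd (fst z) + pthd (snd z)))"
      by (intro continuous_map_Triple continuous_map_tvs_add[OF Y] continuous_map_ktop_add u)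
    then show "continuous_map ?P (lt_top ?X) (\<lambda>(x, y). lt_add ?X x y)"
      by (rule continuous_map_eq) (auto simp: carr_iter_sp_Suc)
    have "continuous_map ?Q (lt_top ?X) (\<lambda>z. Triple (lt_smul ?Y (fst z) (pfst (snd z)))
        (lt_smul ?Y (fst z) (psnd (snd z))) (fst z * pthd (snd z)))"
      by (intro continuous_map_Triple continuous_map_tvs_smul[OF Y] continuous_map_ktop_mult u)
    then show "continuous_map ?Q (lt_top ?X) (\<lambda>(x, y). lt_smul ?X x y)"
      by (rule continuous_map_eq) (auto simp: carr_iter_sp_Suc)
    have "Hausdorff_space (prod_topology (lt_top ?Y) (prod_topology (lt_top ?Y) (ktop absK)))"
      using tvs_Hausdorff[OF Y] Hausdorff_ktop by (simp add: Hausdorff_space_prod_topology)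
    moreover have "continuous_map (lt_top ?X) (prod_topology (lt_top ?Y) (prod_topology (lt_top ?Y) (ktop absK)))
        (\<lambda>p. (pfst p, psnd p, pthd p))"
      by (intro continuous_map_pairedI continuous_map_pfst continuous_map_psnd continuous_map_pthd)
    ultimately show "Hausdorff_space (lt_top ?X)"
      by (rule Hausdorff_space_injective_preimage) (auto simp: carr_iter_sp_Suc inj_on_def)
  qed (auto simp: carr_iter_sp_Suc al ring_distribs mult.assoc add.assoc add.commute)
qed

lemmas iter_simps = tvs_simps[OF tvs_iter_sp, unfolded lt_add_iter_sp lt_smul_iter_sp]
lemmas iter_closed = tvs_closed[OF tvs_iter_sp, unfolded lt_add_iter_sp lt_smul_iter_sp]

lemma lin_Base: "lin S (iter_sp absK S 0) Base"
  by (simp add: lin_def continuous_map_Base)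

lemma lin_unBase: "lin (iter_sp absK S 0) S unBase"
  by (auto simp: lin_def continuous_map_unBase carr_iter_sp_0)

lemma lin_pfst: "lin (iter_sp absK S (Suc j)) (iter_sp absK S j) pfst"
  and lin_psnd: "lin (iter_sp absK S (Suc j)) (iter_sp absK S j) psnd"
  and lin_pthd: "lin (iter_sp absK S (Suc j)) (Kt absK) pthd"
  by (auto simp: lin_def continuous_map_pfst continuous_map_psnd continuous_map_pthd carr_iter_sp_Suc)

lemma lin_Triple:
  assumes "lin T (iter_sp absK S j) f" "lin T (iter_sp absK S j) g" "lin T (Kt absK) h"
  shows "lin T (iter_sp absK S (Suc j)) (\<lambda>z. Triple (f z) (g z) (h z))"
  using assms continuous_map_Triple[of "lt_top T" S j f g h] by (auto simp: lin_def)

lemma lin_compose: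
  assumes "lin S T f" "lin T R g"
  shows "lin S R (\<lambda>x. g (f x))"
  using assms continuous_map_compose[OF lin_continuous[OF assms(1)] lin_continuous[OF assms(2)]]
  by (simp add: lin_def[of S R] o_def lin_add[OF assms(1)] lin_add[OF assms(2)]
      lin_smul[OF assms(1)] lin_smul[OF assms(2)] lin_carr[OF assms(1)])

lemma lin_id: "lin S S (\<lambda>x. x)"
  by (simp add: lin_def)

lemma lin_const_zero: "tvs T \<Longrightarrow> lin S T (\<lambda>x. lt_zero T)"
  by (simp add: lin_def tvs_simps)

subsection \<open>Domains\<close>

lemma bgn_dom_subset: "V \<subseteq> carr S \<Longrightarrow> bgn_dom absK S V j \<subseteq> carr (iter_sp absK S j)"
  by (induction j) auto

lemma bgn_dom_SucE:
  assumes "p \<in> bgn_dom absK S V (Suc j)"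
  obtains x y t where "p = Triple x y t" "x \<in> bgn_dom absK S V j" "y \<in> carr (iter_sp absK S j)"
    "pt_add (lt_add S) x (pt_smul (lt_smul S) t y) \<in> bgn_dom absK S V j"
  using assms by auto

text \<open>Passing to the next level imposes two conditions, on x and on x + t y, both of which are
  preimages of an open set under continuous maps.\<close>

lemma openin_bgn_dom:
  assumes S: "tvs S" and V: "openin (lt_top S) V"
  shows "openin (lt_top (iter_sp absK S j)) (bgn_dom absK S V j)"
proof (induction j)
  case 0
  have "bgn_dom absK S V 0 = {p \<in> carr (iter_sp absK S 0). unBase p \<in> V}"
    using openin_subset[OF V] by (auto simp: carr_iter_sp_0)
  then show ?case using continuous_map_unBase[of S] V by (simp add: continuous_map_def)
next
  case (Suc j)
  let ?Y = "iter_sp absK S j" and ?X = "iter_sp absK S (Suc j)"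
  let ?D = "bgn_dom absK S V j"
  have D: "?D \<subseteq> carr ?Y" using bgn_dom_subset openin_subset[OF V] by metis
  have "continuous_map (lt_top ?X) (lt_top ?Y) (\<lambda>p. lt_add ?Y (pfst p) (lt_smul ?Y (pthd p) (psnd p)))"
    by (intro continuous_map_tvs_add continuous_map_tvs_smul tvs_iter_sp S
        continuous_map_pfst continuous_map_psnd continuous_map_pthd)
  then have "openin (lt_top ?X) {p \<in> carr ?X. lt_add ?Y (pfst p) (lt_smul ?Y (pthd p) (psnd p)) \<in> ?D}"
    using Suc by (simp add: continuous_map_def)
  moreover have "openin (lt_top ?X) {p \<in> carr ?X. pfst p \<in> ?D}"
    using Suc continuous_map_pfst[of S j] by (simp add: continuous_map_def)
  moreover have "bgn_dom absK S V (Suc j) = {p \<in> carr ?X. pfst p \<in> ?D} \<inter>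
     {p \<in> carr ?X. lt_add ?Y (pfst p) (lt_smul ?Y (pthd p) (psnd p)) \<in> ?D}"
    using D by (auto simp: carr_iter_sp_Suc)
  ultimately show ?case by (simp only: openin_Int)
qed

lemma bgn_dom_carr: "tvs S \<Longrightarrow> bgn_dom absK S (carr S) j = carr (iter_sp absK S j)"
  by (induction j) (auto simp: carr_iter_sp_0 carr_iter_sp_Suc iter_closed)

lemma bgn_dom_mono: "V \<subseteq> V' \<Longrightarrow> bgn_dom absK S V j \<subseteq> bgn_dom absK S V' j"
  by (induction j) auto

subsection \<open>Countable neighbourhood bases\<close>

text \<open>All that is kept of metrizability. It passes to the iterated spaces by taking boxes,
  without a metric on them.\<close>

definition countable_base_at_zero :: "('a, 'k) lin_top \<Rightarrow> bool" where
  "countable_base_at_zero S \<longleftrightarrow> (\<exists>W :: nat \<Rightarrow> 'a set. (\<forall>n. openin (lt_top S) (W n) \<and> lt_zero S \<in> W n)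
     \<and> (\<forall>V. openin (lt_top S) V \<and> lt_zero S \<in> V \<longrightarrow> (\<exists>n. W n \<subseteq> V)))"

lemma countable_base_if_metrizable:
  assumes "tvs S" "metrizable_space (lt_top S)"
  shows "countable_base_at_zero S"
proof -
  obtain M d where M: "Metric_space M d" "lt_top S = Metric_space.mtopology M d"
    using assms(2) unfolding metrizable_space_def by blast
  interpret Metric_space M d by fact
  have z: "lt_zero S \<in> M" using tvs_zero[OF assms(1)] M(2) by simp
  show ?thesis unfolding countable_base_at_zero_def
  proof (intro exI[of _ "\<lambda>n. mball (lt_zero S) (inverse (real (Suc n)))"] conjI allI impI)
    fix V assume V: "openin (lt_top S) V \<and> lt_zero S \<in> V"
    then obtain r where r: "r > 0" "mball (lt_zero S) r \<subseteq> V"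
      using M(2) openin_mtopology by metis
    then obtain n where "inverse (real (Suc n)) < r" using reals_Archimedean by blast
    then have "mball (lt_zero S) (inverse (real (Suc n))) \<subseteq> mball (lt_zero S) r"
      by (auto simp: in_mball)
    then show "\<exists>n. mball (lt_zero S) (inverse (real (Suc n))) \<subseteq> V" using r by blast
  qed (use M z in \<open>auto simp: openin_mball\<close>)
qed

lemma countable_base_iter_sp:
  assumes S: "tvs S" and c: "countable_base_at_zero S"
  shows "countable_base_at_zero (iter_sp absK S j)"
proof (induction j)
  case 0
  obtain W :: "nat \<Rightarrow> 'a set" where W: "\<And>n. openin (lt_top S) (W n)" "\<And>n. lt_zero S \<in> W n"
    "\<And>V. openin (lt_top S) V \<Longrightarrow> lt_zero S \<in> V \<Longrightarrow> \<exists>n. W n \<subseteq> V"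
    using c unfolding countable_base_at_zero_def by blast
  have im: "openin (lt_top (iter_sp absK S 0)) (Base ` A)" if "openin (lt_top S) A" for A
    using openin_bgn_dom[OF S that, of 0] by simp
  show ?case unfolding countable_base_at_zero_def
  proof (intro exI[of _ "\<lambda>n. Base ` W n"] conjI allI impI)
    fix V assume V: "openin (lt_top (iter_sp absK S 0)) V \<and> lt_zero (iter_sp absK S 0) \<in> V"
    have "openin (lt_top S) {x \<in> carr S. Base x \<in> V}"
      using V continuous_map_Base[of S] by (simp add: continuous_map_def)
    then show "\<exists>n. Base ` W n \<subseteq> V" using W(3)[of "{x \<in> carr S. Base x \<in> V}"] V tvs_zero[OF S] by auto
  qed (use W im in auto)
next
  case (Suc j)
  let ?Y = "iter_sp absK S j" and ?X = "iter_sp absK S (Suc j)"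
  have Y: "tvs ?Y" using tvs_iter_sp[OF S] .
  obtain W where W: "\<And>n::nat. openin (lt_top ?Y) (W n)" "\<And>n. lt_zero ?Y \<in> W n"
    "\<And>V. openin (lt_top ?Y) V \<Longrightarrow> lt_zero ?Y \<in> V \<Longrightarrow> \<exists>n. W n \<subseteq> V"
    using Suc unfolding countable_base_at_zero_def by blast
  define B where "B \<equiv> \<lambda>(n, m, k). {p \<in> carr ?X. pfst p \<in> W n} \<inter> {p \<in> carr ?X. psnd p \<in> W m}
      \<inter> {p \<in> carr ?X. pthd p \<in> {t. absK (t - 0) < inverse (real (Suc k))}}"
  have op: "openin (lt_top ?X) (B i)" for i
  proof -
    obtain n m k where i: "i = (n, m, k)" by (cases i)
    have "openin (lt_top ?X) {p \<in> carr ?X. pfst p \<in> W n}" "openin (lt_top ?X) {p \<in> carr ?X. psnd p \<in> W m}"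
      "openin (lt_top ?X) {p \<in> carr ?X. pthd p \<in> {t. absK (t - 0) < inverse (real (Suc k))}}"
      using openin_continuous_map_preimage[OF continuous_map_pfst W(1)]
        openin_continuous_map_preimage[OF continuous_map_psnd W(1)]
        openin_continuous_map_preimage[OF continuous_map_pthd openin_ball] by blast+
    then show ?thesis unfolding B_def i prod.case by (intro openin_Int)
  qed
  show ?case unfolding countable_base_at_zero_def
  proof (intro exI[of _ "\<lambda>n. B (from_nat n)"] conjI allI impI)
    fix V assume V: "openin (lt_top ?X) V \<and> lt_zero ?X \<in> V"
    let ?P = "prod_topology (lt_top ?Y) (prod_topology (lt_top ?Y) (ktop absK))"
    have "openin ?P {z \<in> topspace ?P. (case z of (x, y, t) \<Rightarrow> Triple x y t) \<in> V}" (is "openin _ ?N")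
      using V by (simp add: iter_sp.simps openin_img_top)
    moreover have "(lt_zero ?Y, lt_zero ?Y, 0) \<in> ?N" using V tvs_zero[OF Y] by simp
    ultimately obtain A R where A: "openin (lt_top ?Y) A" "lt_zero ?Y \<in> A"
      and R: "openin (prod_topology (lt_top ?Y) (ktop absK)) R" "(lt_zero ?Y, 0) \<in> R" "A \<times> R \<subseteq> ?N"
      unfolding openin_prod_topology_alt[of _ _ ?N] by blast
    obtain A' T where A': "openin (lt_top ?Y) A'" "lt_zero ?Y \<in> A'" and T: "openin (ktop absK) T" "0 \<in> T"
      "A' \<times> T \<subseteq> R" using R(1,2) unfolding openin_prod_topology_alt[of _ _ R] by blast
    obtain n m where "W n \<subseteq> A" "W m \<subseteq> A'" using W(3) A A' by meson
    obtain e where e: "e > 0" "\<forall>y. absK (y - 0) < e \<longrightarrow> y \<in> T" using T by (auto simp: openin_ktop)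
    then obtain k where k: "inverse (real (Suc k)) < e" using reals_Archimedean by blast
    have "B (n, m, k) \<subseteq> V"
    proof
      fix p assume p: "p \<in> B (n, m, k)"
      then obtain x y t where xyt: "p = Triple x y t" by (auto simp: B_def carr_iter_sp_Suc)
      then have "x \<in> A" "y \<in> A'" "t \<in> T" using p e k \<open>W n \<subseteq> A\<close> \<open>W m \<subseteq> A'\<close> by (auto simp: B_def)
      then have "(x, y, t) \<in> ?N" using T(3) R(3) by blast
      then show "p \<in> V" using xyt by simp
    qed
    then show "\<exists>n. B (from_nat n) \<subseteq> V" by (intro exI[of _ "to_nat (n, m, k)"]) simp
  next
    fix n show "lt_zero ?X \<in> B (from_nat n)"
      using tvs_zero[OF Y] W(2) by (cases "from_nat n :: nat \<times> nat \<times> nat") (auto simp: B_def)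
  qed (rule op)
qed

end

section \<open>Local Hoelder continuity with respect to gauges and its closure properties\<close>

section \<open>Hoelder continuous maps\<close>

context valued_field
begin

text \<open>\<open>holder0\<close> does not force values into the carrier of F, and gauges are
  unconstrained outside of it; hence the separate condition.\<close>

definition hoelder :: "('a, 'k) lin_top \<Rightarrow> ('f, 'k) lin_top \<Rightarrow> 'a set \<Rightarrow> real \<Rightarrow> ('a \<Rightarrow> 'f) \<Rightarrow> bool" where
  "hoelder S F D \<sigma> g \<longleftrightarrow> (\<forall>x\<in>D. g x \<in> carr F) \<and> holder0 absK S F \<sigma> D g"

lemma hoelder_carr: "hoelder S F D \<sigma> g \<Longrightarrow> x \<in> D \<Longrightarrow> g x \<in> carr F"
  by (simp add: hoelder_def)

lemma hoelderD:
  assumes "hoelder S F D \<sigma> g" "openin (lt_top S) D" "x0 \<in> D" "is_gauge absK F q"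
  obtains p N where "is_gauge absK S p" "openin (lt_top S) N" "x0 \<in> N" "N \<subseteq> D"
    "\<And>x y. x \<in> N \<Longrightarrow> y \<in> N \<Longrightarrow> q (lt_sub F (g y) (g x)) \<le> p (lt_sub S y x) powr \<sigma>"
proof -
  obtain p W N where *: "is_gauge absK S p" "openin (subtopology (lt_top S) D) N" "x0 \<in> N" "N \<subseteq> W" "W \<subseteq> D"
    "\<forall>x\<in>W. \<forall>y\<in>W. q (lt_sub F (g y) (g x)) \<le> (p (lt_sub S y x)) powr \<sigma>"
    using assms(1)[unfolded hoelder_def holder0_def] assms(3,4) by blast
  have "openin (lt_top S) N" using *(2) assms(2) openin_trans_full by blast
  moreover have "N \<subseteq> D" using * by blast
  moreover have "q (lt_sub F (g y) (g x)) \<le> p (lt_sub S y x) powr \<sigma>" if "x \<in> N" "y \<in> N" for x y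
    using * that by (meson subsetD)
  ultimately show ?thesis using * by (intro that[of p N])
qed

lemma hoelderI:
  assumes D: "openin (lt_top S) D" and c: "\<And>x. x \<in> D \<Longrightarrow> g x \<in> carr F"
    and *: "\<And>x0 q. x0 \<in> D \<Longrightarrow> is_gauge absK F q \<Longrightarrow> \<exists>p N. is_gauge absK S p \<and> openin (lt_top S) N \<and> x0 \<in> N
      \<and> (\<forall>x\<in>N. \<forall>y\<in>N. x \<in> D \<longrightarrow> y \<in> D \<longrightarrow> q (lt_sub F (g y) (g x)) \<le> p (lt_sub S y x) powr \<sigma>)"
  shows "hoelder S F D \<sigma> g"
  unfolding hoelder_def holder0_def
proof (intro conjI ballI allI impI)
  fix x0 q assume "x0 \<in> D" "is_gauge absK F q"
  then obtain p N where N: "is_gauge absK S p" "openin (lt_top S) N" "x0 \<in> N"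
    "\<forall>x\<in>N. \<forall>y\<in>N. x \<in> D \<longrightarrow> y \<in> D \<longrightarrow> q (lt_sub F (g y) (g x)) \<le> p (lt_sub S y x) powr \<sigma>"
    using * by blast
  have "openin (subtopology (lt_top S) D) (N \<inter> D)"
    using N(2) by (auto simp: openin_subtopology)
  then show "\<exists>p W. is_gauge absK S p \<and> W \<subseteq> D
           \<and> (\<exists>Nb. openin (subtopology (lt_top S) D) Nb \<and> x0 \<in> Nb \<and> Nb \<subseteq> W)
           \<and> (\<forall>x\<in>W. \<forall>y\<in>W. q (lt_sub F (g y) (g x)) \<le> (p (lt_sub S y x)) powr \<sigma>)"
    using N \<open>x0 \<in> D\<close> by (intro exI[of _ p] exI[of _ "N \<inter> D"]) blast
qed (use c in auto)

lemma hoelder_local: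
  assumes D: "openin (lt_top S) D"
    and *: "\<And>x0. x0 \<in> D \<Longrightarrow> \<exists>N h. openin (lt_top S) N \<and> x0 \<in> N \<and> hoelder S F D \<sigma> h \<and> (\<forall>x\<in>N \<inter> D. g x = h x)"
  shows "hoelder S F D \<sigma> g"
proof (rule hoelderI[OF D])
  fix x assume "x \<in> D" then show "g x \<in> carr F" using * by (metis IntI hoelder_carr)
next
  fix x0 q assume x0: "x0 \<in> D" and q: "is_gauge absK F q"
  obtain N h where N: "openin (lt_top S) N" "x0 \<in> N" "hoelder S F D \<sigma> h" "\<forall>x\<in>N \<inter> D. g x = h x"
    using *[OF x0] by blast
  obtain p M where "is_gauge absK S p" "openin (lt_top S) M" "x0 \<in> M" "M \<subseteq> D"
    "\<And>x y. x \<in> M \<Longrightarrow> y \<in> M \<Longrightarrow> q (lt_sub F (h y) (h x)) \<le> p (lt_sub S y x) powr \<sigma>"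
    by (rule hoelderD[OF N(3) D x0 q]) blast
  then show "\<exists>p N. is_gauge absK S p \<and> openin (lt_top S) N \<and> x0 \<in> N
      \<and> (\<forall>x\<in>N. \<forall>y\<in>N. x \<in> D \<longrightarrow> y \<in> D \<longrightarrow> q (lt_sub F (g y) (g x)) \<le> p (lt_sub S y x) powr \<sigma>)"
    using N by (intro exI[of _ p] exI[of _ "N \<inter> M"]) auto
qed

lemma hoelder_cong:
  assumes "openin (lt_top S) D" "hoelder S F D \<sigma> h" "\<And>x. x \<in> D \<Longrightarrow> g x = h x"
  shows "hoelder S F D \<sigma> g"
  using assms by (intro hoelder_local) (auto simp: intro!: exI[of _ D] exI[of _ h])

text \<open>A neighbourhood of \<open>g x0\<close> contains a translate of a balanced W. Testing
  with the Minkowski functional of W, it suffices that the gauge of y - x0 is less than 1, because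
  its power \<sigma> is then less than 1 as well.\<close>

lemma hoelder_continuous:
  assumes S: "tvs S" "tvs F" and D: "openin (lt_top S) D" and \<sigma>: "0 < \<sigma>" and g: "hoelder S F D \<sigma> g"
  shows "continuous_map (subtopology (lt_top S) D) (lt_top F) g"
  unfolding continuous_map_nbhd
proof (intro ballI conjI allI impI)
  fix x0 assume "x0 \<in> topspace (subtopology (lt_top S) D)"
  then have x0: "x0 \<in> D" "x0 \<in> carr S" by auto
  then show gx0: "g x0 \<in> carr F" using hoelder_carr[OF g] by auto
  fix V assume V: "openin (lt_top F) V \<and> g x0 \<in> V"
  have "openin (lt_top F) {v \<in> carr F. lt_add F (g x0) v \<in> V}" using openin_translate[OF S(2) gx0] V by auto
  moreover have "lt_zero F \<in> {v \<in> carr F. lt_add F (g x0) v \<in> V}"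
    using V gx0 S by (simp add: tvs_zero tvs_zero_right)
  ultimately obtain W where W: "balanced_nbhd F W" "W \<subseteq> {v \<in> carr F. lt_add F (g x0) v \<in> V}"
    by (rule balanced_nbhd_exists[OF S(2)])
  have q: "is_gauge absK F (minkowski F W)" using is_gauge_minkowski[OF S(2)] balanced_nbhdD[OF W(1)] by blast
  obtain p N where N: "is_gauge absK S p" "openin (lt_top S) N" "x0 \<in> N" "N \<subseteq> D"
    "\<And>x y. x \<in> N \<Longrightarrow> y \<in> N \<Longrightarrow> minkowski F W (lt_sub F (g y) (g x)) \<le> p (lt_sub S y x) powr \<sigma>"
    by (rule hoelderD[OF g D x0(1) q]) blast
  obtain M where M: "openin (lt_top S) M" "lt_zero S \<in> M" "\<And>x. x \<in> M \<Longrightarrow> p x < 1"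
    using gauge_nbhd[OF N(1), of 1] by auto
  define M' where "M' = {y \<in> carr S. lt_sub S y x0 \<in> M}"
  have M': "openin (lt_top S) M'" "x0 \<in> M'"
    unfolding M'_def using openin_sub_translate[OF S(1) x0(2) M(1)] M(2) x0 S by (auto simp: tvs_sub_self)
  have "g y \<in> V" if y: "y \<in> N \<inter> M'" for y
  proof -
    have yc: "y \<in> carr S" "g y \<in> carr F" using y N(4) hoelder_carr[OF g] by (auto simp: M'_def)
    have "p (lt_sub S y x0) < 1" using y M by (auto simp: M'_def)
    moreover have "0 \<le> p (lt_sub S y x0)" using gauge_nonneg[OF N(1)] S yc x0 by (simp add: tvs_sub)
    ultimately have "p (lt_sub S y x0) powr \<sigma> < 1" using \<sigma>
      by (metis powr_less_mono2 powr_one_eq_one)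
    then have "minkowski F W (lt_sub F (g y) (g x0)) < 1" using N(5)[OF N(3), of y] y by auto
    then have "lt_sub F (g y) (g x0) \<in> W"
      by (intro minkowski_less_one[OF S(2) W(1)]) (simp_all add: tvs_sub S gx0 yc)
    then have "lt_add F (g x0) (lt_sub F (g y) (g x0)) \<in> V" using W by auto
    then show "g y \<in> V" using S gx0 yc by (simp add: tvs_add_sub)
  qed
  moreover have "openin (subtopology (lt_top S) D) (N \<inter> M')"
    using N M' openin_Int[of "lt_top S" N M'] by (auto simp: openin_subtopology)
  ultimately show "\<exists>U. openin (subtopology (lt_top S) D) U \<and> x0 \<in> U \<and> (\<forall>y\<in>U. g y \<in> V)"
    using N M' by (intro exI[of _ "N \<inter> M'"]) auto
qed

lemma gauge_small_diff:
  assumes S: "tvs S" and p: "is_gauge absK S p" and x: "x \<in> carr S" and r: "r > 0"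
  obtains M where "openin (lt_top S) M" "x \<in> M" "\<And>y z. y \<in> M \<Longrightarrow> z \<in> M \<Longrightarrow> p (lt_sub S z y) < r"
proof -
  obtain N where N: "openin (lt_top S) N" "lt_zero S \<in> N" "\<And>x. x \<in> N \<Longrightarrow> p x < r"
    by (rule gauge_nbhd[OF p r]) blast
  obtain M where "openin (lt_top S) M" "x \<in> M" "\<And>y z. y \<in> M \<Longrightarrow> z \<in> M \<Longrightarrow> lt_sub S z y \<in> N"
    by (rule openin_diff_nbhd[OF S x N(1,2)]) blast
  then show ?thesis using that N(3) by blast
qed

text \<open>Near x0 the gauge s of a difference is less than 1, and then
  \<open>s \<le> s powr \<sigma>\<close>.\<close>

lemma hoelder_mono:
  assumes S: "tvs S" and D: "openin (lt_top S) D" and \<sigma>: "0 < \<sigma>" "\<sigma> \<le> 1" and g: "hoelder S F D 1 g"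
  shows "hoelder S F D \<sigma> g"
proof (rule hoelderI[OF D hoelder_carr[OF g]], assumption)
  fix x0 q assume x0: "x0 \<in> D" and q: "is_gauge absK F q"
  obtain p N where N: "is_gauge absK S p" "openin (lt_top S) N" "x0 \<in> N" "N \<subseteq> D"
    "\<And>x y. x \<in> N \<Longrightarrow> y \<in> N \<Longrightarrow> q (lt_sub F (g y) (g x)) \<le> p (lt_sub S y x) powr 1"
    by (rule hoelderD[OF g D x0 q]) blast
  have x0': "x0 \<in> carr S" using x0 D openin_subset by blast
  obtain M where M: "openin (lt_top S) M" "x0 \<in> M" "\<And>y z. y \<in> M \<Longrightarrow> z \<in> M \<Longrightarrow> p (lt_sub S z y) < 1"
    by (rule gauge_small_diff[OF S N(1) x0' zero_less_one]) blast
  have "q (lt_sub F (g y) (g x)) \<le> p (lt_sub S y x) powr \<sigma>" if "x \<in> N \<inter> M" "y \<in> N \<inter> M" for x y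
  proof -
    have "x \<in> carr S" "y \<in> carr S" using that N(2) openin_subset by auto
    then have 0: "0 \<le> p (lt_sub S y x)" using gauge_nonneg[OF N(1)] S by (simp add: tvs_sub)
    have "p (lt_sub S y x) powr 1 \<le> p (lt_sub S y x) powr \<sigma>"
      using 0 M(3)[of x y] that \<sigma> powr_mono'[of \<sigma> 1 "p (lt_sub S y x)"] by auto
    then show ?thesis using N(5)[of x y] that by auto
  qed
  then show "\<exists>p N. is_gauge absK S p \<and> openin (lt_top S) N \<and> x0 \<in> N
      \<and> (\<forall>x\<in>N. \<forall>y\<in>N. x \<in> D \<longrightarrow> y \<in> D \<longrightarrow> q (lt_sub F (g y) (g x)) \<le> p (lt_sub S y x) powr \<sigma>)"
    using N M by (intro exI[of _ p] exI[of _ "N \<inter> M"]) auto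
qed

lemma powr_max:
  assumes "0 \<le> a" "0 \<le> b" "0 \<le> (\<sigma>::real)"
  shows "max (a powr \<sigma>) (b powr \<sigma>) = max a b powr \<sigma>"
  using assms powr_mono2[of \<sigma> a b] powr_mono2[of \<sigma> b a] by (auto simp: max_def)

lemma hoelder_add:
  assumes S: "tvs S" "tvs F" and D: "openin (lt_top S) D" and \<sigma>: "0 < \<sigma>"
    and g: "hoelder S F D \<sigma> g" and h: "hoelder S F D \<sigma> h"
  shows "hoelder S F D \<sigma> (\<lambda>x. lt_add F (g x) (h x))"
proof (rule hoelderI[OF D])
  fix x assume "x \<in> D" then show "lt_add F (g x) (h x) \<in> carr F"
    using hoelder_carr[OF g] hoelder_carr[OF h] S by (simp add: tvs_add)
next
  fix x0 q assume x0: "x0 \<in> D" and q: "is_gauge absK F q"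
  obtain q' where q': "is_gauge absK F q'"
    "\<And>a b. a \<in> carr F \<Longrightarrow> b \<in> carr F \<Longrightarrow> q (lt_add F a b) \<le> max (q' a) (q' b)"
    by (rule gauge_triangle[OF S(2) q]) blast
  obtain p N where N: "is_gauge absK S p" "openin (lt_top S) N" "x0 \<in> N" "N \<subseteq> D"
    "\<And>x y. x \<in> N \<Longrightarrow> y \<in> N \<Longrightarrow> q' (lt_sub F (g y) (g x)) \<le> p (lt_sub S y x) powr \<sigma>"
    by (rule hoelderD[OF g D x0 q'(1)]) blast
  obtain r M where M: "is_gauge absK S r" "openin (lt_top S) M" "x0 \<in> M" "M \<subseteq> D"
    "\<And>x y. x \<in> M \<Longrightarrow> y \<in> M \<Longrightarrow> q' (lt_sub F (h y) (h x)) \<le> r (lt_sub S y x) powr \<sigma>"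
    by (rule hoelderD[OF h D x0 q'(1)]) blast
  have "q (lt_sub F (lt_add F (g y) (h y)) (lt_add F (g x) (h x))) \<le> max (p (lt_sub S y x)) (r (lt_sub S y x)) powr \<sigma>"
    if xy: "x \<in> N \<inter> M" "y \<in> N \<inter> M" for x y
  proof -
    have c: "g x \<in> carr F" "g y \<in> carr F" "h x \<in> carr F" "h y \<in> carr F" "x \<in> carr S" "y \<in> carr S"
      using xy N(2,4) hoelder_carr[OF g] hoelder_carr[OF h] openin_subset by blast+
    have "lt_sub F (lt_add F (g y) (h y)) (lt_add F (g x) (h x)) =
        lt_add F (lt_sub F (g y) (g x)) (lt_sub F (h y) (h x))"
      using tvs_sub_add_add[OF S(2)] c by simp
    then have "q (lt_sub F (lt_add F (g y) (h y)) (lt_add F (g x) (h x))) \<le>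
        max (q' (lt_sub F (g y) (g x))) (q' (lt_sub F (h y) (h x)))"
      using q'(2) c S by (simp add: tvs_sub)
    also have "\<dots> \<le> max (p (lt_sub S y x) powr \<sigma>) (r (lt_sub S y x) powr \<sigma>)"
      using N(5)[of x y] M(5)[of x y] xy by (intro max.mono) auto
    also have "\<dots> = max (p (lt_sub S y x)) (r (lt_sub S y x)) powr \<sigma>"
      using gauge_nonneg[OF N(1)] gauge_nonneg[OF M(1)] c S \<sigma> by (intro powr_max) (auto simp: tvs_sub)
    finally show ?thesis .
  qed
  then show "\<exists>p N. is_gauge absK S p \<and> openin (lt_top S) N \<and> x0 \<in> N
      \<and> (\<forall>x\<in>N. \<forall>y\<in>N. x \<in> D \<longrightarrow> y \<in> D \<longrightarrow>
        q (lt_sub F (lt_add F (g y) (h y)) (lt_add F (g x) (h x))) \<le> p (lt_sub S y x) powr \<sigma>)"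
    using N M gauge_max[OF N(1) M(1)] by (intro exI[of _ "\<lambda>x. max (p x) (r x)"] exI[of _ "N \<inter> M"]) auto
qed

lemma hoelder_lin_outer:
  assumes S: "tvs F" "tvs F'" and L: "lin F F' L" and D: "openin (lt_top S) D" and g: "hoelder S F D \<sigma> g"
  shows "hoelder S F' D \<sigma> (\<lambda>x. L (g x))"
proof (rule hoelderI[OF D])
  fix x assume "x \<in> D" then show "L (g x) \<in> carr F'" using hoelder_carr[OF g] lin_carr[OF L] by blast
next
  fix x0 q assume x0: "x0 \<in> D" and q: "is_gauge absK F' q"
  obtain p N where N: "is_gauge absK S p" "openin (lt_top S) N" "x0 \<in> N" "N \<subseteq> D"
    "\<And>x y. x \<in> N \<Longrightarrow> y \<in> N \<Longrightarrow> q (L (lt_sub F (g y) (g x))) \<le> p (lt_sub S y x) powr \<sigma>"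
    by (rule hoelderD[OF g D x0 gauge_lin[OF S L q]]) blast
  have "lt_sub F' (L (g y)) (L (g x)) = L (lt_sub F (g y) (g x))" if "x \<in> D" "y \<in> D" for x y
    using lin_sub[OF S(1) L] hoelder_carr[OF g] that by simp
  then show "\<exists>p N. is_gauge absK S p \<and> openin (lt_top S) N \<and> x0 \<in> N
      \<and> (\<forall>x\<in>N. \<forall>y\<in>N. x \<in> D \<longrightarrow> y \<in> D \<longrightarrow> q (lt_sub F' (L (g y)) (L (g x))) \<le> p (lt_sub S y x) powr \<sigma>)"
    using N by (intro exI[of _ p] exI[of _ N]) auto
qed

lemma hoelder_lin:
  assumes S: "tvs S" "tvs F" and L: "lin S F L" and D: "openin (lt_top S) D"
  shows "hoelder S F D 1 L"
proof (rule hoelderI[OF D])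
  fix x assume "x \<in> D" then show "L x \<in> carr F" using lin_carr[OF L] openin_subset[OF D] by blast
next
  fix x0 q assume x0: "x0 \<in> D" and q: "is_gauge absK F q"
  have "q (lt_sub F (L y) (L x)) \<le> q (L (lt_sub S y x)) powr 1" if "x \<in> carr S" "y \<in> carr S" for x y
    using lin_sub[OF S(1) L] lin_carr[OF L] gauge_nonneg[OF q] S that by (simp add: tvs_sub)
  then show "\<exists>p N. is_gauge absK S p \<and> openin (lt_top S) N \<and> x0 \<in> N
      \<and> (\<forall>x\<in>N. \<forall>y\<in>N. x \<in> D \<longrightarrow> y \<in> D \<longrightarrow> q (lt_sub F (L y) (L x)) \<le> p (lt_sub S y x) powr 1)"
    using gauge_lin[OF S L q] D x0 openin_subset[OF D]
    by (intro exI[of _ "\<lambda>x. q (L x)"] exI[of _ D]) blast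
qed

lemma is_gauge_zero: "tvs S \<Longrightarrow> is_gauge absK S (\<lambda>x. 0)"
  by (auto simp: is_gauge_def intro!: exI[of _ "carr S"] tvs_zero)

lemma hoelder_const:
  assumes S: "tvs S" "tvs F" and c: "c \<in> carr F" and D: "openin (lt_top S) D"
  shows "hoelder S F D \<sigma> (\<lambda>x. c)"
  using assms is_gauge_zero[OF S(1)]
  by (intro hoelderI) (auto simp: tvs_sub_self gauge_zero intro!: exI[of _ "\<lambda>x. 0"] exI[of _ D])

text \<open>The inner map is taken Lipschitz, so that the exponent of the outer map is preserved;
  composing two Hoelder maps would multiply exponents.\<close>

lemma hoelder_compose:
  assumes S: "tvs S" "tvs T" and D: "openin (lt_top S) D" and D': "openin (lt_top T) D'" and \<sigma>: "0 < \<sigma>"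
    and b: "hoelder S T D 1 b" "\<And>x. x \<in> D \<Longrightarrow> b x \<in> D'" and g: "hoelder T F D' \<sigma> g"
  shows "hoelder S F D \<sigma> (\<lambda>x. g (b x))"
proof (rule hoelderI[OF D])
  fix x assume "x \<in> D" then show "g (b x) \<in> carr F" using hoelder_carr[OF g] b(2) by blast
next
  fix x0 q assume x0: "x0 \<in> D" and q: "is_gauge absK F q"
  obtain p N where N: "is_gauge absK T p" "openin (lt_top T) N" "b x0 \<in> N" "N \<subseteq> D'"
    "\<And>x y. x \<in> N \<Longrightarrow> y \<in> N \<Longrightarrow> q (lt_sub F (g y) (g x)) \<le> p (lt_sub T y x) powr \<sigma>"
    by (rule hoelderD[OF g D' b(2)[OF x0] q]) blast
  obtain r M where M: "is_gauge absK S r" "openin (lt_top S) M" "x0 \<in> M" "M \<subseteq> D"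
    "\<And>x y. x \<in> M \<Longrightarrow> y \<in> M \<Longrightarrow> p (lt_sub T (b y) (b x)) \<le> r (lt_sub S y x) powr 1"
    by (rule hoelderD[OF b(1) D x0 N(1)]) blast
  have "openin (subtopology (lt_top S) D) {x \<in> D. b x \<in> N}"
    using openin_continuous_map_preimage[OF hoelder_continuous[OF S D zero_less_one b(1)] N(2)]
      openin_subset[OF D] by (simp add: Int_absorb1)
  then have B: "openin (lt_top S) {x \<in> D. b x \<in> N}" using D openin_trans_full by blast
  have "q (lt_sub F (g (b y)) (g (b x))) \<le> r (lt_sub S y x) powr \<sigma>"
    if xy: "x \<in> M \<inter> {x \<in> D. b x \<in> N}" "y \<in> M \<inter> {x \<in> D. b x \<in> N}" for x y
  proof -
    have c: "x \<in> carr S" "y \<in> carr S" "b x \<in> carr T" "b y \<in> carr T"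
      using xy openin_subset[OF D] hoelder_carr[OF b(1)] by auto
    have "q (lt_sub F (g (b y)) (g (b x))) \<le> p (lt_sub T (b y) (b x)) powr \<sigma>" using N(5) xy by blast
    also have "\<dots> \<le> r (lt_sub S y x) powr \<sigma>"
      using M(5)[of x y] xy c S \<sigma> gauge_nonneg[OF N(1)] gauge_nonneg[OF M(1)]
      by (intro powr_mono2) (auto simp: tvs_sub)
    finally show ?thesis .
  qed
  then show "\<exists>p N. is_gauge absK S p \<and> openin (lt_top S) N \<and> x0 \<in> N
      \<and> (\<forall>x\<in>N. \<forall>y\<in>N. x \<in> D \<longrightarrow> y \<in> D \<longrightarrow> q (lt_sub F (g (b y)) (g (b x))) \<le> p (lt_sub S y x) powr \<sigma>)"
    using M B N(3) x0 openin_Int[OF M(2) B] by (intro exI[of _ r] exI[of _ "M \<inter> {x \<in> D. b x \<in> N}"]) auto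
qed

lemma is_gauge_absK: "is_gauge absK (Kt absK) absK"
  unfolding is_gauge_def
proof (intro conjI allI impI)
  fix r :: real assume "r > 0"
  then show "\<exists>Nb. openin (lt_top (Kt absK)) Nb \<and> lt_zero (Kt absK) \<in> Nb \<and> Nb \<subseteq> {x \<in> carr (Kt absK). absK x < r}"
    using openin_ball[of 0 r] by (intro exI[of _ "{y. absK (y - 0) < r}"]) auto
qed (auto simp: absK_mult)

text \<open>The increment is m(y) (g(y) - g(x)) + (m(y) - m(x)) g(x), and both m and g are bounded
  near x0, the latter with respect to a gauge.\<close>

lemma hoelder_smul:
  assumes S: "tvs S" "tvs F" and D: "openin (lt_top S) D" and \<sigma>: "0 < \<sigma>" "\<sigma> \<le> 1"
    and m: "hoelder S (Kt absK) D 1 m" and g: "hoelder S F D \<sigma> g"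
  shows "hoelder S F D \<sigma> (\<lambda>x. lt_smul F (m x) (g x))"
proof (rule hoelderI[OF D])
  fix x assume "x \<in> D" then show "lt_smul F (m x) (g x) \<in> carr F"
    using hoelder_carr[OF g] S by (simp add: tvs_smul)
next
  fix x0 q assume x0: "x0 \<in> D" and q: "is_gauge absK F q"
  have x0': "x0 \<in> carr S" using x0 D openin_subset by blast
  have gx0: "g x0 \<in> carr F" using hoelder_carr[OF g x0] .
  obtain q' where q': "is_gauge absK F q'"
    "\<And>a b. a \<in> carr F \<Longrightarrow> b \<in> carr F \<Longrightarrow> q (lt_add F a b) \<le> max (q' a) (q' b)"
    by (rule gauge_triangle[OF S(2) q]) blast
  \<comment> \<open>\<open>q'\<close> takes care of the sum of the two terms, \<open>q''\<close> of
    the bound for \<open>q' (g x)\<close> in terms of g(x0) and an increment of g.\<close>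
  obtain q'' where q'': "is_gauge absK F q''"
    "\<And>a b. a \<in> carr F \<Longrightarrow> b \<in> carr F \<Longrightarrow> q' (lt_add F a b) \<le> max (q'' a) (q'' b)"
    by (rule gauge_triangle[OF S(2) q'(1)]) blast
  have m\<sigma>: "hoelder S (Kt absK) D \<sigma> m" by (rule hoelder_mono[OF S(1) D \<sigma> m])
  obtain p N where N: "is_gauge absK S p" "openin (lt_top S) N" "x0 \<in> N" "N \<subseteq> D"
    "\<And>x y. x \<in> N \<Longrightarrow> y \<in> N \<Longrightarrow> q' (lt_sub F (g y) (g x)) \<le> p (lt_sub S y x) powr \<sigma>"
    by (rule hoelderD[OF g D x0 q'(1)]) blast
  obtain p2 N2 where N2: "is_gauge absK S p2" "openin (lt_top S) N2" "x0 \<in> N2" "N2 \<subseteq> D"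
    "\<And>x y. x \<in> N2 \<Longrightarrow> y \<in> N2 \<Longrightarrow> q'' (lt_sub F (g y) (g x)) \<le> p2 (lt_sub S y x) powr \<sigma>"
    by (rule hoelderD[OF g D x0 q''(1)]) blast
  obtain r M where M: "is_gauge absK S r" "openin (lt_top S) M" "x0 \<in> M" "M \<subseteq> D"
    "\<And>x y. x \<in> M \<Longrightarrow> y \<in> M \<Longrightarrow> absK (m y - m x) \<le> r (lt_sub S y x) powr \<sigma>"
    by (rule hoelderD[OF m\<sigma> D x0 is_gauge_absK]) simp
  obtain N3 where N3: "openin (lt_top S) N3" "x0 \<in> N3" "\<And>y z. y \<in> N3 \<Longrightarrow> z \<in> N3 \<Longrightarrow> p2 (lt_sub S z y) < 1"
    by (rule gauge_small_diff[OF S(1) N2(1) x0' zero_less_one]) blast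
  obtain N4 where N4: "openin (lt_top S) N4" "x0 \<in> N4" "\<And>y z. y \<in> N4 \<Longrightarrow> z \<in> N4 \<Longrightarrow> r (lt_sub S z y) < 1"
    by (rule gauge_small_diff[OF S(1) M(1) x0' zero_less_one]) blast
  define O' where "O' = N \<inter> N2 \<inter> N3 \<inter> N4 \<inter> M"
  have O': "openin (lt_top S) O'" "x0 \<in> O'" unfolding O'_def using N N2 N3 N4 M by auto
  \<comment> \<open>Bounds both \<open>absK (m y)\<close> and \<open>q' (g x)\<close>, since near x0
    the respective increments are at most 1.\<close>
  define c where "c = 1 + absK (m x0) + q'' (g x0)"
  have c1: "c \<ge> 1" using gauge_nonneg[OF q''(1) gx0] by (simp add: c_def)
  \<comment> \<open>The factor c has to be moved inside the power \<sigma> before a gauge can absorb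
    it.\<close>
  define b where "b = c powr (1 / \<sigma>)"
  have b: "b > 0" "b powr \<sigma> = c" using c1 \<sigma> by (auto simp: b_def powr_powr)
  have less1: "a powr \<sigma> \<le> 1" if "0 \<le> a" "a < 1" for a :: real
    using powr_mono2[of \<sigma> a 1] that \<sigma> by simp
  have "q (lt_sub F (lt_smul F (m y) (g y)) (lt_smul F (m x) (g x))) \<le>
      (b * max (p (lt_sub S y x)) (r (lt_sub S y x))) powr \<sigma>"
    if xy: "x \<in> O'" "y \<in> O'" for x y
  proof -
    have cc: "g x \<in> carr F" "g y \<in> carr F" "x \<in> carr S" "y \<in> carr S" "x \<in> D" "y \<in> D"
      using xy N(2,4) hoelder_carr[OF g] openin_subset[OF D] by (auto simp: O'_def)
    have pos: "0 \<le> p (lt_sub S y x)" "0 \<le> r (lt_sub S y x)" "0 \<le> r (lt_sub S y x0)" "0 \<le> p2 (lt_sub S x x0)"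
      using gauge_nonneg[OF N(1)] gauge_nonneg[OF M(1)] gauge_nonneg[OF N2(1)] cc x0' S by (auto simp: tvs_sub)
    have my: "absK (m y) \<le> c"
    proof -
      have "absK (m y - m x0) \<le> r (lt_sub S y x0) powr \<sigma>" using M(5)[of x0 y] M(3) xy by (auto simp: O'_def)
      also have "\<dots> \<le> 1" using N4(3)[of x0 y] N4(2) xy pos by (intro less1) (auto simp: O'_def)
      finally have "absK (m y - m x0) \<le> 1" .
      moreover have "absK (m y) \<le> absK (m y - m x0) + absK (m x0)" using absK_add[of "m y - m x0" "m x0"] by simp
      ultimately show ?thesis using gauge_nonneg[OF q''(1) gx0] by (simp add: c_def)
    qed
    have gx: "q' (g x) \<le> c"
    proof -
      have "q'' (lt_sub F (g x) (g x0)) \<le> p2 (lt_sub S x x0) powr \<sigma>" using N2(5)[of x0 x] N2(3) xy by (auto simp: O'_def)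
      also have "\<dots> \<le> 1" using N3(3)[of x0 x] N3(2) xy pos by (intro less1) (auto simp: O'_def)
      finally have "q'' (lt_sub F (g x) (g x0)) \<le> 1" .
      moreover have "q' (g x) \<le> max (q'' (g x0)) (q'' (lt_sub F (g x) (g x0)))"
        using q''(2)[of "g x0" "lt_sub F (g x) (g x0)"] cc gx0 S by (simp add: tvs_sub tvs_add_sub)
      moreover have "0 \<le> q'' (g x0)" using gauge_nonneg[OF q''(1) gx0] .
      moreover have "0 \<le> absK (m x0)" by simp
      ultimately show ?thesis unfolding c_def by linarith
    qed
    have "lt_sub F (lt_smul F (m y) (g y)) (lt_smul F (m x) (g x)) =
        lt_add F (lt_smul F (m y) (lt_sub F (g y) (g x))) (lt_smul F (m y - m x) (g x))"
    proof -
      have "lt_smul F (m y) (g x) = lt_add F (lt_smul F (m x) (g x)) (lt_smul F (m y - m x) (g x))"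
        using tvs_add_smul[OF S(2) cc(1), of "m x" "m y - m x"] by simp
      then have "lt_smul F (m y - m x) (g x) = lt_sub F (lt_smul F (m y) (g x)) (lt_smul F (m x) (g x))"
        using S cc by (simp add: tvs_add_sub_cancel tvs_smul)
      then show ?thesis using S cc by (simp add: tvs_smul_sub tvs_smul tvs_sub_add_sub)
    qed
    then have "q (lt_sub F (lt_smul F (m y) (g y)) (lt_smul F (m x) (g x))) \<le>
        max (q' (lt_smul F (m y) (lt_sub F (g y) (g x)))) (q' (lt_smul F (m y - m x) (g x)))"
      using q'(2) cc S by (simp add: tvs_sub tvs_smul)
    also have "\<dots> = max (absK (m y) * q' (lt_sub F (g y) (g x))) (absK (m y - m x) * q' (g x))"
      using gauge_smul[OF q'(1)] cc S by (simp add: tvs_sub)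
    also have "\<dots> \<le> max (c * p (lt_sub S y x) powr \<sigma>) (c * r (lt_sub S y x) powr \<sigma>)"
    proof (rule max.mono)
      show "absK (m y) * q' (lt_sub F (g y) (g x)) \<le> c * p (lt_sub S y x) powr \<sigma>"
        using my N(5)[of x y] xy c1 gauge_nonneg[OF q'(1)] cc S
        by (intro mult_mono) (auto simp: O'_def tvs_sub)
      have "absK (m y - m x) * q' (g x) \<le> r (lt_sub S y x) powr \<sigma> * c"
        using gx M(5)[of x y] xy c1 gauge_nonneg[OF q'(1)] cc S
        by (intro mult_mono) (auto simp: O'_def)
      then show "absK (m y - m x) * q' (g x) \<le> c * r (lt_sub S y x) powr \<sigma>" by (simp add: mult.commute)
    qed
    also have "\<dots> = c * max (p (lt_sub S y x)) (r (lt_sub S y x)) powr \<sigma>"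
      using powr_max[OF pos(1,2), of \<sigma>, symmetric] \<sigma> c1 by (simp add: max_mult_distrib_left)
    also have "\<dots> = (b * max (p (lt_sub S y x)) (r (lt_sub S y x))) powr \<sigma>"
      using b pos by (simp add: powr_mult)
    finally show ?thesis .
  qed
  then show "\<exists>p N. is_gauge absK S p \<and> openin (lt_top S) N \<and> x0 \<in> N
      \<and> (\<forall>x\<in>N. \<forall>y\<in>N. x \<in> D \<longrightarrow> y \<in> D \<longrightarrow>
        q (lt_sub F (lt_smul F (m y) (g y)) (lt_smul F (m x) (g x))) \<le> p (lt_sub S y x) powr \<sigma>)"
    using O' gauge_scale[OF gauge_max[OF N(1) M(1)] b(1)]
    by (intro exI[of _ "\<lambda>x. b * max (p x) (r x)"] exI[of _ O']) auto
qed

end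

section \<open>Chains linked by difference quotients, and their agreement with
  \<open>bgn_der\<close>\<close>

section \<open>Chains of difference quotients\<close>

context valued_field
begin

abbreviation step :: "('a, 'k) lin_top \<Rightarrow> ('a, 'k) pt \<Rightarrow> 'k \<Rightarrow> ('a, 'k) pt \<Rightarrow> ('a, 'k) pt" where
  "step A x t y \<equiv> pt_add (lt_add A) x (pt_smul (lt_smul A) t y)"

text \<open>The quotient identity with the denominator cleared. At t = 0 it is empty as soon as G
  takes values in F; the value of G there is determined by continuity instead.\<close>

definition diff_rel :: "('a, 'k) lin_top \<Rightarrow> ('f, 'k) lin_top \<Rightarrow> 'a set \<Rightarrow> nat \<Rightarrow>
    (('a, 'k) pt \<Rightarrow> 'f) \<Rightarrow> (('a, 'k) pt \<Rightarrow> 'f) \<Rightarrow> bool" where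
  "diff_rel A F V i g G \<longleftrightarrow> (\<forall>x y t. Triple x y t \<in> bgn_dom absK A V (Suc i) \<longrightarrow>
      g (step A x t y) = lt_add F (g x) (lt_smul F t (G (Triple x y t))))"

lemma diff_relD: "diff_rel A F V i g G \<Longrightarrow> Triple x y t \<in> bgn_dom absK A V (Suc i) \<Longrightarrow>
    g (step A x t y) = lt_add F (g x) (lt_smul F t (G (Triple x y t)))"
  by (simp only: diff_rel_def)

text \<open>\<open>DC A F V P k i g\<close>: there are \<open>g, g\<^sup>[\<^sup>1\<^sup>], \<dots>, g\<^sup>[\<^sup>k\<^sup>]\<close>, starting on the \<open>i\<close>-th iterated domain, which satisfy \<open>P\<close>.
  For \<open>i = 0\<close> this is \<open>C\<^sup>k\<close> if \<open>P\<close> is continuity, and \<open>C\<^sup>k\<^sup>,\<^sup>\<sigma>\<close> if \<open>P\<close> is local Hoelder continuity.\<close>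

primrec DC :: "('a, 'k) lin_top \<Rightarrow> ('f, 'k) lin_top \<Rightarrow> 'a set \<Rightarrow> (nat \<Rightarrow> (('a, 'k) pt \<Rightarrow> 'f) \<Rightarrow> bool) \<Rightarrow>
    nat \<Rightarrow> nat \<Rightarrow> (('a, 'k) pt \<Rightarrow> 'f) \<Rightarrow> bool" where
  "DC A F V P 0 i g = P i g"
| "DC A F V P (Suc k) i g = (P i g \<and> (\<exists>G. diff_rel A F V i g G \<and> DC A F V P k (Suc i) G))"

abbreviation Cont :: "('a, 'k) lin_top \<Rightarrow> ('f, 'k) lin_top \<Rightarrow> 'a set \<Rightarrow> nat \<Rightarrow> (('a, 'k) pt \<Rightarrow> 'f) \<Rightarrow> bool" where
  "Cont A F V i \<equiv> continuous_map (subtopology (lt_top (iter_sp absK A i)) (bgn_dom absK A V i)) (lt_top F)"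

abbreviation Hol :: "('a, 'k) lin_top \<Rightarrow> ('f, 'k) lin_top \<Rightarrow> 'a set \<Rightarrow> real \<Rightarrow> nat \<Rightarrow> (('a, 'k) pt \<Rightarrow> 'f) \<Rightarrow> bool" where
  "Hol A F V \<sigma> i \<equiv> hoelder (iter_sp absK A i) F (bgn_dom absK A V i) \<sigma>"

lemma DC_base: "DC A F V P k i g \<Longrightarrow> P i g"
  by (cases k) auto

lemma DC_Suc: "DC A F V P (Suc k) i g \<Longrightarrow> DC A F V P k i g"
  by (induction k arbitrary: i g) auto

lemma DC_mono: "DC A F V P k i g \<Longrightarrow> (\<And>i g. P i g \<Longrightarrow> Q i g) \<Longrightarrow> DC A F V Q k i g"
  by (induction k arbitrary: i g) auto

text \<open>Only the first member of the chain is replaced; it enters the relation to the second one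
  through its values on the domain.\<close>

lemma DC_cong:
  assumes "\<And>i g h. P i g \<Longrightarrow> (\<And>p. p \<in> bgn_dom absK A V i \<Longrightarrow> h p = g p) \<Longrightarrow> P i h"
    and "DC A F V P k i g" "\<And>p. p \<in> bgn_dom absK A V i \<Longrightarrow> h p = g p"
  shows "DC A F V P k i h"
proof (cases k)
  case 0
  then show ?thesis using assms by auto
next
  case (Suc k')
  then obtain G where "P i g" "diff_rel A F V i g G" "DC A F V P k' (Suc i) G" using assms(2) by auto
  moreover have "diff_rel A F V i h G" using calculation(2) assms(3) by (auto simp: diff_rel_def)
  ultimately show ?thesis using assms(1)[of i g h] assms(3) by (auto simp: Suc)
qed

lemma DC_cong_Hol:
  assumes A: "tvs A" and V: "openin (lt_top A) V"
    and "DC A F V (Hol A F V \<sigma>) k i g" "\<And>p. p \<in> bgn_dom absK A V i \<Longrightarrow> h p = g p"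
  shows "DC A F V (Hol A F V \<sigma>) k i h"
  by (rule DC_cong[OF _ assms(3,4)]) (use hoelder_cong[OF openin_bgn_dom[OF A V]] in blast)+

lemma DC_chain:
  "DC A F V P k i g \<longleftrightarrow> (\<exists>H. H 0 = g \<and> (\<forall>j\<le>k. P (i + j) (H j)) \<and> (\<forall>j<k. diff_rel A F V (i + j) (H j) (H (Suc j))))"
proof (induction k arbitrary: i g)
  case 0
  then show ?case by (auto intro: exI[of _ "\<lambda>_. g"])
next
  case (Suc k)
  show ?case
  proof
    assume "DC A F V P (Suc k) i g"
    then obtain G H where *: "P i g" "diff_rel A F V i g G" "H 0 = G" "\<forall>j\<le>k. P (Suc i + j) (H j)"
      "\<forall>j<k. diff_rel A F V (Suc i + j) (H j) (H (Suc j))" using Suc by auto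
    show "\<exists>H. H 0 = g \<and> (\<forall>j\<le>Suc k. P (i + j) (H j)) \<and> (\<forall>j<Suc k. diff_rel A F V (i + j) (H j) (H (Suc j)))"
      using * by (intro exI[of _ "\<lambda>j. case j of 0 \<Rightarrow> g | Suc m \<Rightarrow> H m"]) (auto split: nat.split)
  next
    assume "\<exists>H. H 0 = g \<and> (\<forall>j\<le>Suc k. P (i + j) (H j)) \<and> (\<forall>j<Suc k. diff_rel A F V (i + j) (H j) (H (Suc j)))"
    then obtain H where H: "H 0 = g" "\<forall>j\<le>Suc k. P (i + j) (H j)"
      "\<forall>j<Suc k. diff_rel A F V (i + j) (H j) (H (Suc j))" by blast
    have "DC A F V P k (Suc i) (H (Suc 0))"
      unfolding Suc using H(2,3) by (intro exI[of _ "\<lambda>j. H (Suc j)"]) (auto dest: spec[of _ "Suc _"])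
    then show "DC A F V P (Suc k) i g"
      using H(1) H(2)[rule_format, of 0] H(3)[rule_format, of 0] by auto
  qed
qed

subsection \<open>Limits at zero and uniqueness of difference quotients\<close>

definition lim0 :: "('f, 'k) lin_top \<Rightarrow> ('k \<Rightarrow> 'f) \<Rightarrow> 'f \<Rightarrow> bool" where
  "lim0 F h v \<longleftrightarrow> v \<in> carr F \<and>
     (\<forall>V. openin (lt_top F) V \<and> v \<in> V \<longrightarrow> (\<exists>e>0. \<forall>t. t \<noteq> 0 \<and> absK t < e \<longrightarrow> h t \<in> V))"

text \<open>As K is not discrete, there is a nonzero t near 0 for which \<open>h t\<close> would lie
  in two disjoint neighbourhoods.\<close>

lemma lim0_unique:
  assumes F: "tvs F" and "lim0 F h v" "lim0 F h w"
  shows "v = w"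
proof (rule ccontr)
  assume "v \<noteq> w"
  then obtain V W where "openin (lt_top F) V" "openin (lt_top F) W" "v \<in> V" "w \<in> W" "disjnt V W"
    using tvs_Hausdorff[OF F] assms(2,3) unfolding Hausdorff_space_def lim0_def by meson
  moreover obtain d where "d > 0" "\<forall>t. t \<noteq> 0 \<and> absK t < d \<longrightarrow> h t \<in> V"
    using assms(2) calculation unfolding lim0_def by meson
  moreover obtain e where "e > 0" "\<forall>t. t \<noteq> 0 \<and> absK t < e \<longrightarrow> h t \<in> W"
    using assms(3) calculation unfolding lim0_def by meson
  moreover obtain t where "t \<noteq> 0" "absK t < min d e"
    using nontrivial[of "min d e"] calculation by auto
  ultimately show False by (auto simp: disjnt_def)
qed

lemma lim0_cong:
  assumes "lim0 F h v" "0 < e" "\<And>t. t \<noteq> 0 \<Longrightarrow> absK t < e \<Longrightarrow> h' t = h t"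
  shows "lim0 F h' v"
  unfolding lim0_def
proof (intro conjI allI impI)
  fix V assume "openin (lt_top F) V \<and> v \<in> V"
  then obtain d where "d > 0" "\<forall>t. t \<noteq> 0 \<and> absK t < d \<longrightarrow> h t \<in> V"
    using assms(1) unfolding lim0_def by blast
  then show "\<exists>e>0. \<forall>t. t \<noteq> 0 \<and> absK t < e \<longrightarrow> h' t \<in> V"
    using assms(2,3) by (intro exI[of _ "min d e"]) auto
qed (use assms(1) in \<open>simp add: lim0_def\<close>)

lemma box_nbhd:
  assumes "openin (lt_top (iter_sp absK A (Suc i))) N" "Triple x y t \<in> N"
  obtains B C e where "openin (lt_top (iter_sp absK A i)) B" "x \<in> B" "openin (lt_top (iter_sp absK A i)) C" "y \<in> C"
    "e > 0" "\<And>x' y' t'. x' \<in> B \<Longrightarrow> y' \<in> C \<Longrightarrow> absK (t' - t) < e \<Longrightarrow> Triple x' y' t' \<in> N"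
proof -
  let ?Y = "iter_sp absK A i"
  let ?P = "prod_topology (lt_top ?Y) (prod_topology (lt_top ?Y) (ktop absK))"
  have o: "openin ?P {z \<in> topspace ?P. (case z of (x, y, t) \<Rightarrow> Triple x y t) \<in> N}" (is "openin _ ?N")
    using assms(1) by (simp add: iter_sp.simps openin_img_top)
  have "Triple x y t \<in> carr (iter_sp absK A (Suc i))" using assms openin_subset by blast
  then have m: "(x, y, t) \<in> ?N" using assms by simp
  define S where "S = ?N"
  note o = o[folded S_def] and m = m[folded S_def]
  obtain B R where B: "openin (lt_top ?Y) B" "x \<in> B"
    and R: "openin (prod_topology (lt_top ?Y) (ktop absK)) R" "(y, t) \<in> R" "B \<times> R \<subseteq> S"
    using openin_prod_topology_alt[THEN iffD1, OF o, rule_format, OF m] by blast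
  obtain C T where C: "openin (lt_top ?Y) C" "y \<in> C" and T: "openin (ktop absK) T" "t \<in> T"
    "C \<times> T \<subseteq> R" using R(1)[unfolded openin_prod_topology_alt, rule_format, OF R(2)] by blast
  obtain e where e: "e > 0" "\<forall>y. absK (y - t) < e \<longrightarrow> y \<in> T" using T by (auto simp: openin_ktop)
  have "Triple x' y' t' \<in> N" if "x' \<in> B" "y' \<in> C" "absK (t' - t) < e" for x' y' t'
  proof -
    have "(x', y', t') \<in> S" using that e T(3) R(3) by blast
    then show ?thesis by (simp add: S_def)
  qed
  then show ?thesis using that B C e by blast
qed

lemma bgn_dom_open_line:
  assumes A: "tvs A" and V: "openin (lt_top A) V" and p: "Triple x y 0 \<in> bgn_dom absK A V (Suc i)"
  obtains e where "e > 0" "\<And>t. absK t < e \<Longrightarrow> Triple x y t \<in> bgn_dom absK A V (Suc i)"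
proof -
  obtain B C e where b: "x \<in> B" "y \<in> C" "e > 0"
    "\<And>x' y' t'. x' \<in> B \<Longrightarrow> y' \<in> C \<Longrightarrow> absK (t' - 0) < e \<Longrightarrow> Triple x' y' t' \<in> bgn_dom absK A V (Suc i)"
    by (rule box_nbhd[OF openin_bgn_dom[OF A V] p]) blast
  show ?thesis by (rule that[OF b(3)]) (use b(4)[OF b(1,2)] in simp)
qed

lemma Cont_lim0:
  assumes A: "tvs A" and V: "openin (lt_top A) V" and G: "Cont A F V (Suc i) G"
    and p: "Triple x y 0 \<in> bgn_dom absK A V (Suc i)"
  shows "lim0 F (\<lambda>t. G (Triple x y t)) (G (Triple x y 0))"
proof -
  let ?X = "iter_sp absK A (Suc i)" and ?D = "bgn_dom absK A V (Suc i)"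
  have D: "openin (lt_top ?X) ?D" by (rule openin_bgn_dom[OF A V])
  have top: "topspace (subtopology (lt_top ?X) ?D) = ?D" using openin_subset[OF D] by auto
  show ?thesis unfolding lim0_def
  proof (intro conjI allI impI)
    show "G (Triple x y 0) \<in> carr F" using G[unfolded continuous_map_nbhd top] p by blast
    fix W assume W: "openin (lt_top F) W \<and> G (Triple x y 0) \<in> W"
    then obtain N where N: "openin (subtopology (lt_top ?X) ?D) N" "Triple x y 0 \<in> N" "\<forall>z\<in>N. G z \<in> W"
      using G[unfolded continuous_map_nbhd top] p by meson
    have N': "openin (lt_top ?X) N" using N(1) D openin_trans_full by blast
    obtain B C e where "x \<in> B" "y \<in> C" "e > 0"
      "\<And>x' y' t'. x' \<in> B \<Longrightarrow> y' \<in> C \<Longrightarrow> absK (t' - 0) < e \<Longrightarrow> Triple x' y' t' \<in> N"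
      by (rule box_nbhd[OF N' N(2)]) blast
    then show "\<exists>e>0. \<forall>t. t \<noteq> 0 \<and> absK t < e \<longrightarrow> G (Triple x y t) \<in> W"
      using N(3) by (intro exI[of _ e]) auto
  qed
qed

lemma lim0_const: "v \<in> carr F \<Longrightarrow> lim0 F (\<lambda>_. v) v"
  unfolding lim0_def by (auto intro: exI[of _ 1])

lemma Cont_carr:
  assumes A: "tvs A" and V: "openin (lt_top A) V" and "Cont A F V i g" "p \<in> bgn_dom absK A V i"
  shows "g p \<in> carr F"
  using continuous_map_funspace[OF assms(3)] assms(4) openin_subset[OF openin_bgn_dom[OF A V, of i]] by auto

lemma smul_cancel:
  assumes "tvs F" "v \<in> carr F" "w \<in> carr F" "t \<noteq> 0" "lt_smul F t v = lt_smul F t w"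
  shows "v = w"
proof -
  have "lt_smul F (inverse t) (lt_smul F t v) = lt_smul F (inverse t) (lt_smul F t w)"
    by (simp only: assms(5))
  then show ?thesis using assms(4)
    by (simp add: tvs_smul_smul[OF assms(1,2)] tvs_smul_smul[OF assms(1,3)] tvs_one[OF assms(1,2)] tvs_one[OF assms(1,3)])
qed

text \<open>For t \<noteq> 0 the relation can be solved for G. At t = 0 both candidates are the
  limit of the values at (x, y, t), and these points lie in the domain for small t because V is
  open.\<close>

lemma diff_rel_unique:
  assumes A: "tvs A" "tvs F" and V: "openin (lt_top A) V" and G: "Cont A F V (Suc i) G" "Cont A F V (Suc i) G'"
    and r: "diff_rel A F V i g G" "diff_rel A F V i g G'"
    and c: "\<And>p. p \<in> bgn_dom absK A V i \<Longrightarrow> g p \<in> carr F" and p: "p \<in> bgn_dom absK A V (Suc i)"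
  shows "G p = G' p"
proof -
  have ne: "G (Triple x y t) = G' (Triple x y t)"
    if "Triple x y t \<in> bgn_dom absK A V (Suc i)" "t \<noteq> 0" for x y t
  proof -
    have 1: "G (Triple x y t) \<in> carr F" "G' (Triple x y t) \<in> carr F"
      using Cont_carr[OF A(1) V G(1)] Cont_carr[OF A(1) V G(2)] that by auto
    have "g x \<in> carr F" using c that by auto
    then have "lt_smul F t (G (Triple x y t)) = lt_smul F t (G' (Triple x y t))"
      using diff_relD[OF r(1) that(1)] diff_relD[OF r(2) that(1)] tvs_cancel[OF A(2)] 1 A(2)
      by (simp add: tvs_smul)
    then show ?thesis using smul_cancel[OF A(2) 1 that(2)] by simp
  qed
  obtain x y t where xyt: "p = Triple x y t" using p by auto
  show ?thesis
  proof (cases "t = 0")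
    case True
    then have p0: "Triple x y 0 \<in> bgn_dom absK A V (Suc i)" using p xyt by simp
    obtain e where e: "e > 0" "\<And>t. absK t < e \<Longrightarrow> Triple x y t \<in> bgn_dom absK A V (Suc i)"
      by (rule bgn_dom_open_line[OF A(1) V p0]) blast
    have "lim0 F (\<lambda>t. G (Triple x y t)) (G' (Triple x y 0))"
      by (rule lim0_cong[OF Cont_lim0[OF A(1) V G(2) p0] e(1)]) (use ne e in auto)
    then show ?thesis using lim0_unique[OF A(2) Cont_lim0[OF A(1) V G(1) p0]] xyt True by simp
  qed (use ne p xyt in auto)
qed

lemma bgn_ext_ok_iff:
  assumes A: "tvs A" "tvs F" and V: "openin (lt_top A) V"
    and c: "\<And>p. p \<in> bgn_dom absK A V i \<Longrightarrow> g p \<in> carr F"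
  shows "bgn_ext_ok absK A F V i g G \<longleftrightarrow> Cont A F V (Suc i) G \<and> diff_rel A F V i g G"
proof -
  have "(\<forall>x y t. Triple x y t \<in> bgn_dom absK A V (Suc i) \<and> t \<noteq> 0 \<longrightarrow>
        G (Triple x y t) = lt_smul F (inverse t) (lt_sub F (g (step A x t y)) (g x)))
      \<longleftrightarrow> diff_rel A F V i g G" if G: "Cont A F V (Suc i) G"
    unfolding diff_rel_def
  proof (intro iff_allI)
    fix x y t
    show "(Triple x y t \<in> bgn_dom absK A V (Suc i) \<and> t \<noteq> 0 \<longrightarrow>
        G (Triple x y t) = lt_smul F (inverse t) (lt_sub F (g (step A x t y)) (g x))) \<longleftrightarrow>
      (Triple x y t \<in> bgn_dom absK A V (Suc i) \<longrightarrow>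
        g (step A x t y) = lt_add F (g x) (lt_smul F t (G (Triple x y t))))"
    proof (cases "Triple x y t \<in> bgn_dom absK A V (Suc i)")
      case True
      then have 1: "g x \<in> carr F" "g (step A x t y) \<in> carr F" "G (Triple x y t) \<in> carr F"
        using c Cont_carr[OF A(1) V G True] by auto
      show ?thesis
      proof (cases "t = 0")
        case t: True
        \<comment> \<open>For t = 0 the quotient condition demands nothing, and the cleared one
          reduces to g x = g x.\<close>
        have "x \<in> carr (iter_sp absK A i)" "y \<in> carr (iter_sp absK A i)"
          using True bgn_dom_subset[OF openin_subset[OF V], of i] by auto
        then have "step A x t y = x" using t iter_simps[OF A(1)] by simp
        then show ?thesis using t 1 A(2) by (simp add: tvs_smul_0 tvs_zero_right)
      next
        case t: False
        have "G (Triple x y t) = lt_smul F (inverse t) (lt_sub F (g (step A x t y)) (g x)) \<longleftrightarrow>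
            lt_sub F (g (step A x t y)) (g x) = lt_smul F t (G (Triple x y t))"
          using t 1 A(2) by (auto simp: tvs_smul_smul tvs_one tvs_sub)
        also have "\<dots> \<longleftrightarrow> g (step A x t y) = lt_add F (g x) (lt_smul F t (G (Triple x y t)))"
          using 1 A(2) by (intro tvs_sub_eq_iff) (auto simp: tvs_smul)
        finally show ?thesis using True t by simp
      qed
    qed (simp only: simp_thms)
  qed
  then show ?thesis unfolding bgn_ext_ok_def by blast
qed

lemma Cont_cong:
  assumes "Cont A F V i g" "\<And>p. p \<in> bgn_dom absK A V i \<Longrightarrow> h p = g p"
  shows "Cont A F V i h"
  by (rule continuous_map_eq[OF assms(1)]) (use assms(2) in auto)

lemma diff_rel_cong:
  assumes "diff_rel A F V i g G" "\<And>p. p \<in> bgn_dom absK A V i \<Longrightarrow> h p = g p"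
    "\<And>p. p \<in> bgn_dom absK A V (Suc i) \<Longrightarrow> H p = G p"
  shows "diff_rel A F V i h H"
  using assms(1,2) assms(3)[of "Triple _ _ _"] unfolding diff_rel_def by auto

text \<open>The choice in \<open>bgn_der\<close> is harmless: at each level the given chain H shows
  that an extension exists, and uniqueness makes the chosen one agree with H on the domain.\<close>

lemma bgn_der_chain:
  assumes A: "tvs A" "tvs F" and V: "openin (lt_top A) V"
    and H: "\<And>p. p \<in> bgn_dom absK A V 0 \<Longrightarrow> H 0 p = bgn_der absK A F V g 0 p"
      "\<And>j. j \<le> k \<Longrightarrow> Cont A F V j (H j)" "\<And>j. j < k \<Longrightarrow> diff_rel A F V j (H j) (H (Suc j))"
    and j: "j \<le> k"
  shows "(\<forall>p\<in>bgn_dom absK A V j. bgn_der absK A F V g j p = H j p)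
    \<and> (\<forall>i<j. bgn_ext_ok absK A F V i (bgn_der absK A F V g i) (bgn_der absK A F V g (Suc i)))"
  using j
proof (induction j)
  case 0
  then show ?case using H(1) by auto
next
  case (Suc j)
  let ?d = "bgn_der absK A F V g"
  have IH: "\<And>p. p \<in> bgn_dom absK A V j \<Longrightarrow> ?d j p = H j p"
    "\<forall>i<j. bgn_ext_ok absK A F V i (?d i) (?d (Suc i))" using Suc by auto
  have c: "?d j p \<in> carr F" if "p \<in> bgn_dom absK A V j" for p
    using Cont_carr[OF A(1) V H(2)] IH(1) that Suc.prems by simp
  have "diff_rel A F V j (?d j) (H (Suc j))"
    by (rule diff_rel_cong[OF H(3)]) (use Suc.prems IH(1) in auto)
  then have "bgn_ext_ok absK A F V j (?d j) (H (Suc j))"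
    using bgn_ext_ok_iff[OF A V, where i=j and g="?d j", OF c] H(2)[OF Suc.prems] by blast
  then have ok: "bgn_ext_ok absK A F V j (?d j) (?d (Suc j))"
    unfolding bgn_der.simps by (rule someI[of "bgn_ext_ok absK A F V j (?d j)"])
  then have "Cont A F V (Suc j) (?d (Suc j))" "diff_rel A F V j (?d j) (?d (Suc j))"
    using bgn_ext_ok_iff[OF A V, where i=j and g="?d j", OF c] by blast+
  then have "?d (Suc j) p = H (Suc j) p" if "p \<in> bgn_dom absK A V (Suc j)" for p
    using diff_rel_unique[OF A V _ H(2)[OF Suc.prems] _ \<open>diff_rel A F V j (?d j) (H (Suc j))\<close> c that] by blast
  then show ?case using IH(2) ok less_Suc_eq by auto
qed

lemma Cont_0_iff:
  assumes A: "tvs A" and V: "openin (lt_top A) V"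
  shows "Cont A F V 0 (\<lambda>p. g (unBase p)) \<longleftrightarrow> continuous_map (subtopology (lt_top A) V) (lt_top F) g"
proof
  have im: "V \<subseteq> carr A" using openin_subset[OF V] .
  assume l: "Cont A F V 0 (\<lambda>p. g (unBase p))"
  have "continuous_map (subtopology (lt_top A) V) (subtopology (lt_top (iter_sp absK A 0)) (bgn_dom absK A V 0)) Base"
    by (auto simp: continuous_map_in_subtopology continuous_map_from_subtopology continuous_map_Base)
  from continuous_map_compose[OF this l] show "continuous_map (subtopology (lt_top A) V) (lt_top F) g"
    by (simp add: o_def)
next
  assume r: "continuous_map (subtopology (lt_top A) V) (lt_top F) g"
  have "continuous_map (subtopology (lt_top (iter_sp absK A 0)) (bgn_dom absK A V 0)) (subtopology (lt_top A) V) unBase"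
    by (auto simp: continuous_map_in_subtopology continuous_map_from_subtopology continuous_map_unBase)
  from continuous_map_compose[OF this r] show "Cont A F V 0 (\<lambda>p. g (unBase p))" by (simp add: o_def)
qed

text \<open>By uniqueness, the existence of some chain with property P amounts to P for the chosen
  \<open>bgn_der\<close>. This bridge is used for P continuity and for P Hoelder continuity.\<close>

lemma DC_0_iff_chain:
  assumes A: "tvs A" "tvs F" and V: "openin (lt_top A) V"
    and P: "\<And>i g. P i g \<Longrightarrow> Cont A F V i g"
    "\<And>i g h. P i g \<Longrightarrow> (\<And>p. p \<in> bgn_dom absK A V i \<Longrightarrow> h p = g p) \<Longrightarrow> P i h"
  shows "DC A F V P k 0 (\<lambda>p. g (unBase p)) \<longleftrightarrow>
    (\<forall>j\<le>k. P j (bgn_der absK A F V g j)) \<and>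
    (\<forall>j<k. bgn_ext_ok absK A F V j (bgn_der absK A F V g j) (bgn_der absK A F V g (Suc j)))"
proof
  let ?d = "bgn_der absK A F V g"
  assume "DC A F V P k 0 (\<lambda>p. g (unBase p))"
  then obtain H where H: "H 0 = (\<lambda>p. g (unBase p))" "\<forall>j\<le>k. P j (H j)" "\<forall>j<k. diff_rel A F V j (H j) (H (Suc j))"
    unfolding DC_chain by auto
  have 1: "H 0 p = ?d 0 p" if "p \<in> bgn_dom absK A V 0" for p using that H(1) by auto
  have c: "(\<forall>p\<in>bgn_dom absK A V j. ?d j p = H j p) \<and> (\<forall>i<j. bgn_ext_ok absK A F V i (?d i) (?d (Suc i)))"
    if "j \<le> k" for j
    by (rule bgn_der_chain[OF A V, of H g k]) (use 1 H P(1) that in auto)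
  show "(\<forall>j\<le>k. P j (?d j)) \<and> (\<forall>j<k. bgn_ext_ok absK A F V j (?d j) (?d (Suc j)))"
    using c P(2) H(2) by blast
next
  let ?d = "bgn_der absK A F V g"
  assume r: "(\<forall>j\<le>k. P j (?d j)) \<and> (\<forall>j<k. bgn_ext_ok absK A F V j (?d j) (?d (Suc j)))"
  have "diff_rel A F V j (?d j) (?d (Suc j))" if "j < k" for j
  proof -
    have "?d j p \<in> carr F" if "p \<in> bgn_dom absK A V j" for p
      using Cont_carr[OF A(1) V P(1) that] r \<open>j < k\<close> less_imp_le by blast
    then show ?thesis
      using bgn_ext_ok_iff[OF A V, where i=j and g="?d j" and G="?d (Suc j)"] r that by blast
  qed
  then have "DC A F V P k 0 (?d 0)"
    unfolding DC_chain using r by (intro exI[of _ ?d]) auto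
  then show "DC A F V P k 0 (\<lambda>p. g (unBase p))"
    by (rule DC_cong[OF P(2), rotated -2]) auto
qed

lemma bgn_C_iff:
  assumes A: "tvs A" "tvs F" and V: "openin (lt_top A) V"
  shows "bgn_C absK A F V g k \<longleftrightarrow> DC A F V (Cont A F V) k 0 (\<lambda>p. g (unBase p))"
proof -
  let ?d = "bgn_der absK A F V g"
  have 0: "continuous_map (subtopology (lt_top A) V) (lt_top F) g \<longleftrightarrow> Cont A F V 0 (?d 0)"
    unfolding Cont_0_iff[OF A(1) V, of F g, symmetric]
    by (intro iffI; erule Cont_cong) auto
  have "Cont A F V j (?d j)" if "Cont A F V 0 (?d 0)" "\<forall>j<k. bgn_ext_ok absK A F V j (?d j) (?d (Suc j))" "j \<le> k" for j
    using that by (cases j) (auto simp: bgn_ext_ok_def simp del: bgn_der.simps)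
  then show ?thesis
    unfolding bgn_C_def 0 using openin_subset[OF V]
    by (subst DC_0_iff_chain[OF A V]) (auto simp del: bgn_der.simps bgn_dom.simps intro: Cont_cong)
qed

lemma bgn_Cks_iff:
  assumes A: "tvs A" "tvs F" and V: "openin (lt_top A) V" and \<sigma>: "0 < \<sigma>"
  shows "bgn_Cks absK A F V g k \<sigma> \<longleftrightarrow> DC A F V (Hol A F V \<sigma>) k 0 (\<lambda>p. g (unBase p))"
proof -
  let ?d = "bgn_der absK A F V g"
  note D = openin_bgn_dom[OF A(1) V]
  have HC: "Cont A F V i h" if "Hol A F V \<sigma> i h" for i h
    by (rule hoelder_continuous[OF tvs_iter_sp[OF A(1)] A(2) D \<sigma> that])
  have *: "DC A F V (Hol A F V \<sigma>) k 0 (\<lambda>p. g (unBase p)) \<longleftrightarrow> (\<forall>j\<le>k. Hol A F V \<sigma> j (?d j)) \<and>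
    (\<forall>j<k. bgn_ext_ok absK A F V j (?d j) (?d (Suc j)))"
    by (rule DC_0_iff_chain[OF A V HC]) (auto intro: hoelder_cong[OF D])
  have **: "DC A F V (Cont A F V) k 0 (\<lambda>p. g (unBase p)) \<longleftrightarrow> (\<forall>j\<le>k. Cont A F V j (?d j)) \<and>
    (\<forall>j<k. bgn_ext_ok absK A F V j (?d j) (?d (Suc j)))"
    by (rule DC_0_iff_chain[OF A V]) (auto intro: Cont_cong)
  have h: "Hol A F V \<sigma> j (?d j) \<longleftrightarrow> Cont A F V j (?d j) \<and>
      holder0 absK (iter_sp absK A j) F \<sigma> (bgn_dom absK A V j) (?d j)" for j
    using HC[of j "?d j"] Cont_carr[OF A(1) V, where F=F and i=j and g="?d j"] unfolding hoelder_def by blast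
  show ?thesis
    unfolding bgn_Cks_def bgn_C_iff[OF A V] * ** h by meson
qed

text \<open>C^1 maps are locally Lipschitz. Since G vanishes at (x0, 0, 0), q o G is less than 1 on
  a box around that point. For W balanced inside the second side of the box, y - x = t v with v in W
  and |t| below any given bound above the Minkowski functional of y - x, and q (g y - g x) = |t| q
  (G (x, v, t)) \<le> |t|.\<close>

lemma Cont_diff_rel_hoelder:
  assumes A: "tvs A" "tvs F" and V: "openin (lt_top A) V" and g: "Cont A F V i g" "Cont A F V (Suc i) G"
    and r: "diff_rel A F V i g G"
  shows "Hol A F V 1 i g"
proof (rule hoelderI[OF openin_bgn_dom[OF A(1) V] Cont_carr[OF A(1) V g(1)]], assumption)
  let ?X = "iter_sp absK A i" and ?D = "bgn_dom absK A V i" and ?D' = "bgn_dom absK A V (Suc i)"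
  let ?X' = "iter_sp absK A (Suc i)"
  have X: "tvs ?X" by (rule tvs_iter_sp[OF A(1)])
  have D: "openin (lt_top ?X) ?D" by (rule openin_bgn_dom[OF A(1) V])
  have D': "openin (lt_top ?X') ?D'" by (rule openin_bgn_dom[OF A(1) V])
  fix x0 q assume x0: "x0 \<in> ?D" and q: "is_gauge absK F q"
  have x0c: "x0 \<in> carr ?X" using x0 openin_subset[OF D] by blast
  let ?z = "lt_zero ?X"
  have z: "?z \<in> carr ?X" using tvs_zero[OF X] .
  have stz: "step A x0 t ?z = x0" for t using iter_simps[OF A(1)] x0c by simp
  have inD: "Triple x0 ?z t \<in> ?D'" for t using x0 z stz by simp
  \<comment> \<open>A step from x0 in direction 0 goes nowhere, so G vanishes at (x0, 0, t) for t
    \<noteq> 0, and hence in the limit.\<close>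
  have G0: "G (Triple x0 ?z 0) = lt_zero F"
  proof (rule lim0_unique[OF A(2) Cont_lim0[OF A(1) V g(2) inD]])
    have "G (Triple x0 ?z t) = lt_zero F" if "t \<noteq> 0" for t
    proof -
      have c: "g x0 \<in> carr F" "G (Triple x0 ?z t) \<in> carr F"
        using Cont_carr[OF A(1) V g(1) x0] Cont_carr[OF A(1) V g(2) inD] by auto
      have "lt_add F (g x0) (lt_zero F) = lt_add F (g x0) (lt_smul F t (G (Triple x0 ?z t)))"
        using diff_relD[OF r inD, of t] c A(2) by (simp add: stz tvs_zero_right)
      then have "lt_smul F t (lt_zero F) = lt_smul F t (G (Triple x0 ?z t))"
        using tvs_cancel[OF A(2) c(1) tvs_zero[OF A(2)] tvs_smul[OF A(2) c(2)]] tvs_smul_zero[OF A(2)]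
        by simp
      then show ?thesis using smul_cancel[OF A(2) tvs_zero[OF A(2)] c(2) that] by simp
    qed
    then show "lim0 F (\<lambda>t. G (Triple x0 ?z t)) (lt_zero F)"
      by (intro lim0_cong[OF lim0_const[OF tvs_zero[OF A(2)]] zero_less_one]) auto
  qed
  obtain M where M: "openin (lt_top F) M" "lt_zero F \<in> M" "\<And>x. x \<in> M \<Longrightarrow> q x < 1"
    by (rule gauge_nbhd[OF q zero_less_one]) blast
  have top: "topspace (subtopology (lt_top ?X') ?D') = ?D'" using openin_subset[OF D'] by auto
  obtain N where N: "openin (subtopology (lt_top ?X') ?D') N" "Triple x0 ?z 0 \<in> N" "\<forall>z\<in>N. G z \<in> M"
    using g(2)[unfolded continuous_map_nbhd top, rule_format, OF inD] M(1,2) G0 by (metis (no_types, lifting))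
  have N': "openin (lt_top ?X') N" "N \<subseteq> ?D'" using N(1) D' openin_trans_full openin_subset top by blast+
  obtain B C e where B: "openin (lt_top ?X) B" "x0 \<in> B" and C: "openin (lt_top ?X) C" "?z \<in> C" and e: "e > 0"
    "\<And>x' y' t'. x' \<in> B \<Longrightarrow> y' \<in> C \<Longrightarrow> absK (t' - 0) < e \<Longrightarrow> Triple x' y' t' \<in> N"
    by (rule box_nbhd[OF N'(1) N(2)]) blast
  obtain W where W: "balanced_nbhd ?X W" "W \<subseteq> C" by (rule balanced_nbhd_exists[OF X C])
  note W' = balanced_nbhdD(1,2)[OF W(1)]
  define p where "p = minkowski ?X W"
  have p: "is_gauge absK ?X p" unfolding p_def by (rule is_gauge_minkowski[OF X W'])
  obtain R where R: "openin (lt_top ?X) R" "x0 \<in> R" "\<And>y z. y \<in> R \<Longrightarrow> z \<in> R \<Longrightarrow> p (lt_sub ?X z y) < e"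
    by (rule gauge_small_diff[OF X p x0c e(1)]) blast
  have "q (lt_sub F (g y) (g x)) \<le> p (lt_sub ?X y x) powr 1" if xy: "x \<in> R \<inter> B" "y \<in> R \<inter> B" for x y
  proof -
    have c: "x \<in> carr ?X" "y \<in> carr ?X" using xy openin_subset[OF R(1)] by auto
    define h where "h = lt_sub ?X y x"
    have h: "h \<in> carr ?X" "lt_add ?X x h = y"
      unfolding h_def by (rule tvs_sub[OF X c], rule tvs_add_sub[OF X c])
    have "q (lt_sub F (g y) (g x)) \<le> p h"
    \<comment> \<open>The infimum defining p need not be attained, so s > p h is used; s < e ensures
      that (x, v, t) stays in the box.\<close>
    proof (rule dense_ge_bounded)
      show "p h < e" using R(3) xy by (simp add: h_def)
      fix s assume s: "p h < s" "s < e"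
      then obtain t where t: "t \<noteq> 0" "absK t < s" "lt_smul ?X (inverse t) h \<in> W"
        using minkowski_less_iff[OF X W' h(1)] unfolding p_def by blast
      let ?v = "lt_smul ?X (inverse t) h"
      have vc: "?v \<in> carr ?X" by (rule tvs_smul[OF X h(1)])
      have inN: "Triple x ?v t \<in> N" using e(2)[of x ?v t] t s W(2) xy by auto
      have tv: "lt_smul ?X t ?v = h" using tvs_smul_smul[OF X h(1), of t "inverse t"] t tvs_one[OF X h(1)] by simp
      then have "step A x t ?v = y" using h by simp
      then have gy: "g y = lt_add F (g x) (lt_smul F t (G (Triple x ?v t)))"
        using diff_relD[OF r, of x ?v t] inN N'(2) by auto
      have cc: "g x \<in> carr F" "G (Triple x ?v t) \<in> carr F"
        using inN N'(2) Cont_carr[OF A(1) V g(1)] Cont_carr[OF A(1) V g(2)] by auto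
      have "lt_sub F (g y) (g x) = lt_smul F t (G (Triple x ?v t))"
        unfolding gy using cc A(2) by (simp add: tvs_add_sub_cancel tvs_smul)
      then have "q (lt_sub F (g y) (g x)) = absK t * q (G (Triple x ?v t))"
        using gauge_smul[OF q cc(2)] by simp
      also have "\<dots> \<le> absK t * 1"
        using M(3)[of "G (Triple x ?v t)"] N(3) inN by (intro mult_left_mono) auto
      finally show "q (lt_sub F (g y) (g x)) \<le> s" using t by simp
    qed
    moreover have "0 \<le> p h" by (rule gauge_nonneg[OF p h(1)])
    ultimately show ?thesis by (simp add: h_def)
  qed
  then show "\<exists>p N. is_gauge absK ?X p \<and> openin (lt_top ?X) N \<and> x0 \<in> N
      \<and> (\<forall>x\<in>N. \<forall>y\<in>N. x \<in> ?D \<longrightarrow> y \<in> ?D \<longrightarrow> q (lt_sub F (g y) (g x)) \<le> p (lt_sub ?X y x) powr 1)"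
    using p R B by (intro exI[of _ p] exI[of _ "R \<inter> B"]) auto
qed

text \<open>The last member of a chain has no quotient and is known only to be continuous, so one
  order is lost. For smooth maps this costs nothing.\<close>

lemma DC_Cont_Hol:
  assumes A: "tvs A" "tvs F" and V: "openin (lt_top A) V" and g: "DC A F V (Cont A F V) (Suc k) i g"
  shows "DC A F V (Hol A F V 1) k i g"
  using g
proof (induction k arbitrary: i g)
  case 0
  then show ?case using Cont_diff_rel_hoelder[OF A V, of i g] by auto
next
  case (Suc k)
  then obtain G where G: "Cont A F V i g" "diff_rel A F V i g G" "DC A F V (Cont A F V) (Suc k) (Suc i) G" by auto
  then have "Hol A F V 1 i g" using Cont_diff_rel_hoelder[OF A V G(1) _ G(2)] by auto
  then show ?case using Suc.IH[OF G(3)] G(2) by auto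
qed

end

section \<open>Sums, products, projections and triples of chains, and the chain rule\<close>

section \<open>Closure properties\<close>

context valued_field
begin

lemma DC_add:
  assumes F: "tvs F"
    and P: "\<And>i g h. P i g \<Longrightarrow> P i h \<Longrightarrow> P i (\<lambda>p. lt_add F (g p) (h p))"
    "\<And>i g p. P i g \<Longrightarrow> p \<in> bgn_dom absK A V i \<Longrightarrow> g p \<in> carr F"
    and "DC A F V P k i g" "DC A F V P k i h"
  shows "DC A F V P k i (\<lambda>p. lt_add F (g p) (h p))"
  using assms(4,5)
proof (induction k arbitrary: i g h)
  case 0
  then show ?case using P by simp
next
  case (Suc k)
  obtain G H where G: "P i g" "diff_rel A F V i g G" "DC A F V P k (Suc i) G"
    and H: "P i h" "diff_rel A F V i h H" "DC A F V P k (Suc i) H" using Suc.prems by auto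
  have "diff_rel A F V i (\<lambda>p. lt_add F (g p) (h p)) (\<lambda>p. lt_add F (G p) (H p))"
    unfolding diff_rel_def
  proof (intro allI impI)
    fix x y t assume d: "Triple x y t \<in> bgn_dom absK A V (Suc i)"
    then have x: "x \<in> bgn_dom absK A V i" by simp
    note c = P(2)[OF G(1) x] P(2)[OF H(1) x] P(2)[OF DC_base[OF G(3)] d] P(2)[OF DC_base[OF H(3)] d]
    show "lt_add F (g (step A x t y)) (h (step A x t y)) =
        lt_add F (lt_add F (g x) (h x)) (lt_smul F t (lt_add F (G (Triple x y t)) (H (Triple x y t))))"
      unfolding diff_relD[OF G(2) d] diff_relD[OF H(2) d] using c F by (simp add: tvs_simps)
  qed
  then show ?case using Suc.IH[OF G(3) H(3)] P(1)[OF G(1) H(1)] by auto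
qed

text \<open>If G is the quotient of g, then the quotient of g o pfst at (x, y, t) is G at (pfst x,
  pfst y, t). So the projection reappears one level deeper in each further quotient; r is this
  depth.\<close>

primrec lift_pfst :: "nat \<Rightarrow> ('a, 'k) pt \<Rightarrow> ('a, 'k) pt" where
  "lift_pfst 0 = pfst"
| "lift_pfst (Suc r) = (\<lambda>p. Triple (lift_pfst r (pfst p)) (lift_pfst r (psnd p)) (pthd p))"

lemma lin_lift_pfst: "r \<le> j \<Longrightarrow> lin (iter_sp absK A (Suc j)) (iter_sp absK A j) (lift_pfst r)"
proof (induction r arbitrary: j)
  case 0
  then show ?case by (simp add: lin_pfst)
next
  case (Suc r)
  then obtain j' where j: "j = Suc j'" "r \<le> j'" by (metis Suc_le_D Suc_le_mono)
  then show ?case using Suc.IH[OF j(2)]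
    by (auto intro!: lin_Triple lin_compose[OF lin_pfst] lin_compose[OF lin_psnd] lin_pthd)
qed

lemma lift_pfst_carr: "r \<le> j \<Longrightarrow> p \<in> carr (iter_sp absK A (Suc j)) \<Longrightarrow> lift_pfst r p \<in> carr (iter_sp absK A j)"
  using lin_carr[OF lin_lift_pfst] .

lemma lift_pfst_step:
  assumes A: "tvs A" and r: "r \<le> j" and x: "x \<in> carr (iter_sp absK A (Suc j))" "y \<in> carr (iter_sp absK A (Suc j))"
  shows "lift_pfst r (step A x t y) = step A (lift_pfst r x) t (lift_pfst r y)"
  using lin_add[OF lin_lift_pfst[OF r] x(1) tvs_smul[OF tvs_iter_sp[OF A] x(2)]] lin_smul[OF lin_lift_pfst[OF r] x(2)]
  by simp

lemma lift_pfst_dom: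
  assumes A: "tvs A" and V: "V \<subseteq> carr A"
  shows "r \<le> j \<Longrightarrow> p \<in> bgn_dom absK A V (Suc j) \<Longrightarrow> lift_pfst r p \<in> bgn_dom absK A V j"
proof (induction r arbitrary: j p)
  case 0
  then show ?case by auto
next
  case (Suc r)
  then obtain j' where j: "j = Suc j'" "r \<le> j'" by (metis Suc_le_D Suc_le_mono)
  obtain x y t where p: "p = Triple x y t" "x \<in> bgn_dom absK A V j" "y \<in> carr (iter_sp absK A j)"
    "step A x t y \<in> bgn_dom absK A V j" using bgn_dom_SucE[OF Suc.prems(2)] by metis
  have x: "x \<in> carr (iter_sp absK A j)" using bgn_dom_subset[OF V] p(2) by blast
  have "step A (lift_pfst r x) t (lift_pfst r y) \<in> bgn_dom absK A V j'"
    using Suc.IH[OF j(2), of "step A x t y"] p(4) lift_pfst_step[OF A j(2), of x y t] x p(3) j by simp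
  then show ?case using Suc.IH[OF j(2), of x] p lift_pfst_carr[OF j(2), of y A] j by simp
qed

lemma DC_lift_pfst:
  assumes A: "tvs A" and V: "V \<subseteq> carr A"
    and P: "\<And>j r g. r \<le> j \<Longrightarrow> P j g \<Longrightarrow> P (Suc j) (\<lambda>p. g (lift_pfst r p))"
  shows "r \<le> j \<Longrightarrow> DC A F V P k j g \<Longrightarrow> DC A F V P k (Suc j) (\<lambda>p. g (lift_pfst r p))"
proof (induction k arbitrary: j r g)
  case 0
  then show ?case using P by simp
next
  case (Suc k)
  obtain G where G: "P j g" "diff_rel A F V j g G" "DC A F V P k (Suc j) G" using Suc.prems by auto
  have "diff_rel A F V (Suc j) (\<lambda>p. g (lift_pfst r p)) (\<lambda>p. G (lift_pfst (Suc r) p))"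
    unfolding diff_rel_def
  proof (intro allI impI)
    fix x y t assume d: "Triple x y t \<in> bgn_dom absK A V (Suc (Suc j))"
    have "x \<in> carr (iter_sp absK A (Suc j))" "y \<in> carr (iter_sp absK A (Suc j))"
      using bgn_dom_subset[OF V, of "Suc (Suc j)"] d by (auto simp del: bgn_dom.simps)
    then show "g (lift_pfst r (step A x t y)) =
        lt_add F (g (lift_pfst r x)) (lt_smul F t (G (lift_pfst (Suc r) (Triple x y t))))"
      using diff_relD[OF G(2), of "lift_pfst r x" "lift_pfst r y" t] lift_pfst_step[OF A Suc.prems(1), of x y t]
        lift_pfst_dom[OF A V, of "Suc r" "Suc j" "Triple x y t"] d Suc.prems(1) by (simp del: bgn_dom.simps)
  qed
  moreover have "DC A F V P k (Suc (Suc j)) (\<lambda>p. G (lift_pfst (Suc r) p))"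
    using Suc.IH[of "Suc r" "Suc j" G] Suc.prems(1) G(3) by simp
  ultimately show ?case using P[OF Suc.prems(1) G(1)] by auto
qed

lemma DC_pfst:
  assumes A: "tvs A" and V: "V \<subseteq> carr A"
    and P: "\<And>j r g. r \<le> j \<Longrightarrow> P j g \<Longrightarrow> P (Suc j) (\<lambda>p. g (lift_pfst r p))"
    and "DC A F V P k j g"
  shows "DC A F V P k (Suc j) (\<lambda>p. g (pfst p))"
proof -
  have "DC A F V P k (Suc j) (\<lambda>p. g (lift_pfst 0 p))"
    by (rule DC_lift_pfst[where P=P, OF A V]) (use P assms(4) in auto)
  then show ?thesis by simp
qed

text \<open>Product rule: the quotient of m g is m G + M g + t M G. The classes P and Q are separate
  because the scalar factor may have to be more regular than the vector one. In the quotient m and g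
  appear composed with \<open>pfst\<close>, with one order to spare, so the induction applies to
  each summand.\<close>

lemma DC_smul:
  assumes A: "tvs A" "tvs F" and V: "V \<subseteq> carr A"
    and Q: "\<And>i g h. Q i g \<Longrightarrow> Q i h \<Longrightarrow> Q i (\<lambda>p. lt_add F (g p) (h p))"
    "\<And>i g p. Q i g \<Longrightarrow> p \<in> bgn_dom absK A V i \<Longrightarrow> g p \<in> carr F"
    "\<And>j r g. r \<le> j \<Longrightarrow> Q j g \<Longrightarrow> Q (Suc j) (\<lambda>p. g (lift_pfst r p))"
    "\<And>i m g. P i m \<Longrightarrow> Q i g \<Longrightarrow> Q i (\<lambda>p. lt_smul F (m p) (g p))"
    and P: "\<And>j r g. r \<le> j \<Longrightarrow> P j g \<Longrightarrow> P (Suc j) (\<lambda>p. g (lift_pfst r p))"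
      "\<And>k i. DC A (Kt absK) V P k (Suc i) pthd"
    and "DC A (Kt absK) V P k i m" "DC A F V Q k i g"
  shows "DC A F V Q k i (\<lambda>p. lt_smul F (m p) (g p))"
  using assms(10,11)
proof (induction k arbitrary: i m g)
  case 0
  then show ?case using Q(4) by simp
next
  case (Suc k)
  obtain G M where G: "Q i g" "diff_rel A F V i g G" "DC A F V Q k (Suc i) G"
    and M: "P i m" "diff_rel A (Kt absK) V i m M" "DC A (Kt absK) V P k (Suc i) M" using Suc.prems by auto
  define H where "H = (\<lambda>p. lt_add F (lt_smul F (m (pfst p)) (G p))
      (lt_add F (lt_smul F (M p) (g (pfst p))) (lt_smul F (pthd p) (lt_smul F (M p) (G p)))))"
  have "diff_rel A F V i (\<lambda>p. lt_smul F (m p) (g p)) H"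
    unfolding diff_rel_def
  proof (intro allI impI)
    fix x y t assume d: "Triple x y t \<in> bgn_dom absK A V (Suc i)"
    then have x: "x \<in> bgn_dom absK A V i" by simp
    note c = Q(2)[OF G(1) x] Q(2)[OF DC_base[OF G(3)] d]
    have m: "m (step A x t y) = m x + t * M (Triple x y t)" using diff_relD[OF M(2) d] by simp
    show "lt_smul F (m (step A x t y)) (g (step A x t y)) =
        lt_add F (lt_smul F (m x) (g x)) (lt_smul F t (H (Triple x y t)))"
      unfolding diff_relD[OF G(2) d] m H_def using c A(2) by (simp add: tvs_simps mult_ac distrib_left)
  qed
  moreover have "DC A F V Q k (Suc i) H"
    unfolding H_def
  proof (intro DC_add[where P=Q, OF A(2)])
    show "DC A F V Q k (Suc i) (\<lambda>p. lt_smul F (m (pfst p)) (G p))"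
      by (rule Suc.IH[OF DC_pfst[where P=P, OF A(1) V _ DC_Suc[OF Suc.prems(1)]] G(3)]) (rule P(1))
    show "DC A F V Q k (Suc i) (\<lambda>p. lt_smul F (M p) (g (pfst p)))"
      by (rule Suc.IH[OF M(3) DC_pfst[where P=Q, OF A(1) V _ DC_Suc[OF Suc.prems(2)]]]) (rule Q(3))
    show "DC A F V Q k (Suc i) (\<lambda>p. lt_smul F (pthd p) (lt_smul F (M p) (G p)))"
      by (rule Suc.IH[OF P(2) Suc.IH[OF M(3) G(3)]])
  qed (use Q(1,2) in auto)
  ultimately show ?case using Q(4)[OF M(1) G(1)] by auto
qed

lemma Hol_lift_pfst:
  assumes A: "tvs A" "tvs F" and V: "openin (lt_top A) V" and \<sigma>: "0 < \<sigma>" and r: "r \<le> j" and g: "Hol A F V \<sigma> j g"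
  shows "Hol A F V \<sigma> (Suc j) (\<lambda>p. g (lift_pfst r p))"
proof (rule hoelder_compose[OF tvs_iter_sp[OF A(1)] tvs_iter_sp[OF A(1)] openin_bgn_dom[OF A(1) V] openin_bgn_dom[OF A(1) V] \<sigma> _ _ g])
  show "hoelder (iter_sp absK A (Suc j)) (iter_sp absK A j) (bgn_dom absK A V (Suc j)) 1 (lift_pfst r)"
    by (rule hoelder_lin[OF tvs_iter_sp[OF A(1)] tvs_iter_sp[OF A(1)] lin_lift_pfst[OF r] openin_bgn_dom[OF A(1) V]])
  show "\<And>p. p \<in> bgn_dom absK A V (Suc j) \<Longrightarrow> lift_pfst r p \<in> bgn_dom absK A V j"
    by (rule lift_pfst_dom[OF A(1) openin_subset[OF V] r])
qed

lemma diff_rel_lin: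
  assumes A: "tvs A" and V: "V \<subseteq> carr A" and L: "lin (iter_sp absK A i) F L"
  shows "diff_rel A F V i L (\<lambda>p. L (psnd p))"
  unfolding diff_rel_def
proof (intro allI impI)
  fix x y t assume "Triple x y t \<in> bgn_dom absK A V (Suc i)"
  then have "Triple x y t \<in> carr (iter_sp absK A (Suc i))" using bgn_dom_subset[OF V] by blast
  then have c: "x \<in> carr (iter_sp absK A i)" "y \<in> carr (iter_sp absK A i)" by auto
  show "L (step A x t y) = lt_add F (L x) (lt_smul F t (L (psnd (Triple x y t))))"
    using lin_add[OF L c(1) tvs_smul[OF tvs_iter_sp[OF A] c(2)]] lin_smul[OF L c(2)] by simp
qed

lemma DC_Hol_lin:
  assumes A: "tvs A" "tvs F" and V: "openin (lt_top A) V" and L: "lin (iter_sp absK A i) F L"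
  shows "DC A F V (Hol A F V 1) k i L"
  using L
proof (induction k arbitrary: i L)
  case 0
  then show ?case using hoelder_lin[OF tvs_iter_sp[OF A(1)] A(2) _ openin_bgn_dom[OF A(1) V]] by simp
next
  case (Suc k)
  have "Hol A F V 1 i L" using hoelder_lin[OF tvs_iter_sp[OF A(1)] A(2) Suc.prems openin_bgn_dom[OF A(1) V]] .
  moreover have "DC A F V (Hol A F V 1) k (Suc i) (\<lambda>p. L (psnd p))"
    by (rule Suc.IH[OF lin_compose[OF lin_psnd Suc.prems]])
  ultimately show ?case using diff_rel_lin[OF A(1) openin_subset[OF V] Suc.prems] by auto
qed

lemma DC_Hol_const:
  assumes A: "tvs A" "tvs F" and V: "openin (lt_top A) V" and c: "c \<in> carr F"
  shows "DC A F V (Hol A F V 1) k i (\<lambda>_. c)"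
proof (cases k)
  case 0
  then show ?thesis using hoelder_const[OF tvs_iter_sp[OF A(1)] A(2) c openin_bgn_dom[OF A(1) V]] by simp
next
  case (Suc k')
  have "diff_rel A F V i (\<lambda>_. c) (\<lambda>_. lt_zero F)"
    using c A(2) by (simp add: diff_rel_def tvs_simps)
  moreover have "DC A F V (Hol A F V 1) k' (Suc i) (\<lambda>_. lt_zero F)"
    by (rule DC_Hol_lin[OF A V lin_const_zero[OF A(2)]])
  ultimately show ?thesis using hoelder_const[OF tvs_iter_sp[OF A(1)] A(2) c openin_bgn_dom[OF A(1) V]]
    by (auto simp: Suc)
qed

lemma DC_lin_outer:
  assumes F: "tvs F" and L: "lin F F' L"
    and P: "\<And>i g p. P i g \<Longrightarrow> p \<in> bgn_dom absK A V i \<Longrightarrow> g p \<in> carr F"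
      "\<And>i g. P i g \<Longrightarrow> Q i (\<lambda>p. L (g p))"
    and "DC A F V P k i g"
  shows "DC A F' V Q k i (\<lambda>p. L (g p))"
  using assms(5)
proof (induction k arbitrary: i g)
  case 0
  then show ?case using P by simp
next
  case (Suc k)
  obtain G where G: "P i g" "diff_rel A F V i g G" "DC A F V P k (Suc i) G" using Suc.prems by auto
  have "diff_rel A F' V i (\<lambda>p. L (g p)) (\<lambda>p. L (G p))"
    unfolding diff_rel_def
  proof (intro allI impI)
    fix x y t assume d: "Triple x y t \<in> bgn_dom absK A V (Suc i)"
    then have x: "x \<in> bgn_dom absK A V i" by simp
    note c = P(1)[OF G(1) x] P(1)[OF DC_base[OF G(3)] d]
    show "L (g (step A x t y)) = lt_add F' (L (g x)) (lt_smul F' t (L (G (Triple x y t))))"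
      unfolding diff_relD[OF G(2) d] using c F by (simp add: lin_add[OF L] lin_smul[OF L] tvs_smul)
  qed
  then show ?case using Suc.IH[OF G(3)] P(2)[OF G(1)] by auto
qed

lemma DC_Hol_lin_outer:
  assumes A: "tvs A" "tvs F" "tvs F'" and V: "openin (lt_top A) V" and L: "lin F F' L"
    and g: "DC A F V (Hol A F V \<sigma>) k i g"
  shows "DC A F' V (Hol A F' V \<sigma>) k i (\<lambda>p. L (g p))"
  by (rule DC_lin_outer[OF A(2) L _ _ g])
    (auto simp del: bgn_dom.simps intro: hoelder_lin_outer[OF A(2,3) L openin_bgn_dom[OF A(1) V]] hoelder_carr)

lemma DC_Hol_add:
  assumes A: "tvs A" "tvs F" and V: "openin (lt_top A) V" and \<sigma>: "0 < \<sigma>"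
    and "DC A F V (Hol A F V \<sigma>) k i g" "DC A F V (Hol A F V \<sigma>) k i h"
  shows "DC A F V (Hol A F V \<sigma>) k i (\<lambda>p. lt_add F (g p) (h p))"
  by (rule DC_add[where P="Hol A F V \<sigma>", OF A(2) _ _ assms(5,6)])
     (rule hoelder_add[OF tvs_iter_sp[OF A(1)] A(2) openin_bgn_dom[OF A(1) V] \<sigma>] hoelder_carr; assumption)+

lemma DC_Hol_pfst:
  assumes A: "tvs A" "tvs F" and V: "openin (lt_top A) V" and \<sigma>: "0 < \<sigma>"
    and "DC A F V (Hol A F V \<sigma>) k j g"
  shows "DC A F V (Hol A F V \<sigma>) k (Suc j) (\<lambda>p. g (pfst p))"
  by (rule DC_pfst[where P="Hol A F V \<sigma>", OF A(1) openin_subset[OF V] _ assms(5)])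
     (rule Hol_lift_pfst[OF A V \<sigma>])

lemma DC_Hol_smul:
  assumes A: "tvs A" "tvs F" and V: "openin (lt_top A) V" and \<sigma>: "0 < \<sigma>" "\<sigma> \<le> 1"
    and "DC A (Kt absK) V (Hol A (Kt absK) V 1) k i m" "DC A F V (Hol A F V \<sigma>) k i g"
  shows "DC A F V (Hol A F V \<sigma>) k i (\<lambda>p. lt_smul F (m p) (g p))"
proof (rule DC_smul[where Q="Hol A F V \<sigma>" and P="Hol A (Kt absK) V 1", OF A openin_subset[OF V] _ _ _ _ _ _ assms(6,7)])
  note X = tvs_iter_sp[OF A(1)] and D = openin_bgn_dom[OF A(1) V]
  show "Hol A F V \<sigma> i (\<lambda>p. lt_add F (g p) (h p))" if "Hol A F V \<sigma> i g" "Hol A F V \<sigma> i h" for i g h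
    by (rule hoelder_add[OF X A(2) D \<sigma>(1) that])
  show "g p \<in> carr F" if "Hol A F V \<sigma> i g" "p \<in> bgn_dom absK A V i" for i g p
    by (rule hoelder_carr[OF that])
  show "Hol A F V \<sigma> (Suc j) (\<lambda>p. g (lift_pfst r p))" if "r \<le> j" "Hol A F V \<sigma> j g" for j r g
    by (rule Hol_lift_pfst[OF A V \<sigma>(1) that])
  show "Hol A F V \<sigma> i (\<lambda>p. lt_smul F (m p) (g p))" if "Hol A (Kt absK) V 1 i m" "Hol A F V \<sigma> i g" for i m g
    by (rule hoelder_smul[OF X A(2) D \<sigma> that])
  show "Hol A (Kt absK) V 1 (Suc j) (\<lambda>p. g (lift_pfst r p))" if "r \<le> j" "Hol A (Kt absK) V 1 j g" for j r g
    by (rule Hol_lift_pfst[OF A(1) tvs_Kt V zero_less_one that])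
  show "DC A (Kt absK) V (Hol A (Kt absK) V 1) k (Suc i) pthd" for k i
    by (rule DC_Hol_lin[OF A(1) tvs_Kt V lin_pthd])
qed

lemma DC_Hol_Cont:
  assumes A: "tvs A" "tvs F" and V: "openin (lt_top A) V" and \<sigma>: "0 < \<sigma>"
    and "DC A F V (Hol A F V \<sigma>) k i g"
  shows "DC A F V (Cont A F V) k i g"
  by (rule DC_mono[OF assms(5)]) (rule hoelder_continuous[OF tvs_iter_sp[OF A(1)] A(2) openin_bgn_dom[OF A(1) V] \<sigma>])

text \<open>A triple is the sum of three images under continuous linear maps, which reduces the
  claim to sums and linear outer maps.\<close>

lemma DC_Hol_Triple:
  assumes A: "tvs A" "tvs E" and V: "openin (lt_top A) V" and \<sigma>: "0 < \<sigma>"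
    and g: "DC A (iter_sp absK E j) V (Hol A (iter_sp absK E j) V \<sigma>) k i g"
    and h: "DC A (iter_sp absK E j) V (Hol A (iter_sp absK E j) V \<sigma>) k i h"
    and c: "DC A (Kt absK) V (Hol A (Kt absK) V \<sigma>) k i c"
  shows "DC A (iter_sp absK E (Suc j)) V (Hol A (iter_sp absK E (Suc j)) V \<sigma>) k i (\<lambda>p. Triple (g p) (h p) (c p))"
proof -
  let ?Y = "iter_sp absK E j" and ?Z = "iter_sp absK E (Suc j)"
  have Y: "tvs ?Y" and Z: "tvs ?Z" using tvs_iter_sp[OF A(2)] by auto
  let ?z = "lt_zero ?Y"
  have 0: "lin S (Kt absK) (\<lambda>x. 0)" for S :: "('z, 'k) lin_top"
    using lin_const_zero[OF tvs_Kt] by simp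
  note z = lin_const_zero[OF Y]
  have g': "DC A ?Z V (Hol A ?Z V \<sigma>) k i (\<lambda>p. Triple (g p) ?z 0)"
    by (rule DC_Hol_lin_outer[OF A(1) Y Z V lin_Triple[OF lin_id z 0] g])
  have h': "DC A ?Z V (Hol A ?Z V \<sigma>) k i (\<lambda>p. Triple ?z (h p) 0)"
    by (rule DC_Hol_lin_outer[OF A(1) Y Z V lin_Triple[OF z lin_id 0] h])
  have c': "DC A ?Z V (Hol A ?Z V \<sigma>) k i (\<lambda>p. Triple ?z ?z (c p))"
    by (rule DC_Hol_lin_outer[OF A(1) tvs_Kt Z V lin_Triple[OF z z lin_id] c])
  have s: "DC A ?Z V (Hol A ?Z V \<sigma>) k i
      (\<lambda>p. lt_add ?Z (Triple (g p) ?z 0) (lt_add ?Z (Triple ?z (h p) 0) (Triple ?z ?z (c p))))"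
    by (intro DC_Hol_add[OF A(1) Z V \<sigma>] g' h' c')
  show ?thesis
  proof (rule DC_cong_Hol[OF A(1) V s])
    fix p assume p: "p \<in> bgn_dom absK A V i"
    have "g p \<in> carr ?Y" "h p \<in> carr ?Y" using hoelder_carr[OF DC_base[OF g] p] hoelder_carr[OF DC_base[OF h] p] .
    then show "Triple (g p) (h p) (c p) =
        lt_add ?Z (Triple (g p) ?z 0) (lt_add ?Z (Triple ?z (h p) 0) (Triple ?z ?z (c p)))"
      using iter_simps[OF A(2)] by simp
  qed
qed

text \<open>The chain rule: the difference quotient of the composition with \<open>b\<close> at \<open>(x, y, t)\<close> is the one of \<open>f\<close>
  at \<open>(b x, b\<^sup>[\<^sup>1\<^sup>] (x, y, t), t)\<close>.\<close>

lemma DC_Hol_compose: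
  assumes A: "tvs A" "tvs E" "tvs F" and V: "openin (lt_top A) V" and U: "openin (lt_top E) U" and \<sigma>: "0 < \<sigma>"
    and "DC E F U (Hol E F U \<sigma>) k j f"
    and "DC A (iter_sp absK E j) V (Hol A (iter_sp absK E j) V 1) k i b"
    and "\<And>p. p \<in> bgn_dom absK A V i \<Longrightarrow> b p \<in> bgn_dom absK E U j"
  shows "DC A F V (Hol A F V \<sigma>) k i (\<lambda>p. f (b p))"
  using assms(7-9)
proof (induction k arbitrary: i j f b)
  case 0
  then show ?case
    using hoelder_compose[OF tvs_iter_sp[OF A(1)] tvs_iter_sp[OF A(2)] openin_bgn_dom[OF A(1) V]
        openin_bgn_dom[OF A(2) U] \<sigma>, where b=b and g=f] by simp
next
  case (Suc k)
  let ?Y = "iter_sp absK E j"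
  obtain G where G: "Hol E F U \<sigma> j f" "diff_rel E F U j f G" "DC E F U (Hol E F U \<sigma>) k (Suc j) G"
    using Suc.prems(1) by auto
  obtain B where B: "Hol A ?Y V 1 i b" "diff_rel A ?Y V i b B" "DC A ?Y V (Hol A ?Y V 1) k (Suc i) B"
    using Suc.prems(2) by auto
  define b' where "b' = (\<lambda>p. Triple (b (pfst p)) (B p) (pthd p))"
  have b': "DC A (iter_sp absK E (Suc j)) V (Hol A (iter_sp absK E (Suc j)) V 1) k (Suc i) b'"
    unfolding b'_def
    by (rule DC_Hol_Triple[OF A(1,2) V zero_less_one
          DC_Hol_pfst[OF A(1) tvs_iter_sp[OF A(2)] V zero_less_one DC_Suc[OF Suc.prems(2)]] B(3)
          DC_Hol_lin[OF A(1) tvs_Kt V lin_pthd]])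
  have dom: "b' p \<in> bgn_dom absK E U (Suc j)" if p: "p \<in> bgn_dom absK A V (Suc i)" for p
  proof -
    obtain x y t where xyt: "p = Triple x y t" using p by auto
    have d: "x \<in> bgn_dom absK A V i" "step A x t y \<in> bgn_dom absK A V i" using p xyt by auto
    have "b (step A x t y) = step E (b x) t (B (Triple x y t))"
      using diff_relD[OF B(2), of x y t] p xyt by (simp del: bgn_dom.simps)
    then show ?thesis
      using Suc.prems(3)[OF d(1)] Suc.prems(3)[OF d(2)] hoelder_carr[OF DC_base[OF B(3)] p]
      by (simp add: b'_def xyt)
  qed
  have "DC A F V (Hol A F V \<sigma>) k (Suc i) (\<lambda>p. G (b' p))"
    by (rule Suc.IH[OF G(3) b' dom])
  moreover have "diff_rel A F V i (\<lambda>p. f (b p)) (\<lambda>p. G (b' p))"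
    unfolding diff_rel_def
  proof (intro allI impI)
    fix x y t assume d: "Triple x y t \<in> bgn_dom absK A V (Suc i)"
    have "b (step A x t y) = step E (b x) t (B (Triple x y t))"
      using diff_relD[OF B(2) d] by simp
    then show "f (b (step A x t y)) = lt_add F (f (b x)) (lt_smul F t (G (b' (Triple x y t))))"
      using diff_relD[OF G(2), of "b x" "B (Triple x y t)" t] dom[OF d] by (simp add: b'_def del: bgn_dom.simps)
  qed
  moreover have "Hol A F V \<sigma> i (\<lambda>p. f (b p))"
    using hoelder_compose[OF tvs_iter_sp[OF A(1)] tvs_iter_sp[OF A(2)] openin_bgn_dom[OF A(1) V]
        openin_bgn_dom[OF A(2) U] \<sigma> B(1) Suc.prems(3) G(1)] .
  ultimately show ?case by auto
qed

end

section \<open>Scalar functions on iterated powers of K with Lipschitz bounds on bounded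
  sets\<close>

section \<open>Scalar functions that are Lipschitz on bounded sets\<close>

context valued_field
begin

primrec nrm :: "('n::finite \<Rightarrow> 'k, 'k) pt \<Rightarrow> real" where
  "nrm (Base z) = Max (range (\<lambda>i. absK (z i)))"
| "nrm (Triple x y t) = max (max (nrm x) (nrm y)) (absK t)"

text \<open>The norm \<open>nrm\<close> of a difference, for points of equal shape. Points of
  different shape never lie in the same iterated space, so the value 0 for them is a mere
  default.\<close>

fun ptd :: "('n::finite \<Rightarrow> 'k, 'k) pt \<Rightarrow> ('n \<Rightarrow> 'k, 'k) pt \<Rightarrow> real" where
  "ptd (Base z) (Base w) = Max (range (\<lambda>i. absK (z i - w i)))"
| "ptd (Triple x y t) (Triple x' y' t') = max (max (ptd x x') (ptd y y')) (absK (t - t'))"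
| "ptd _ _ = 0"

abbreviation Kn :: "('n::finite \<Rightarrow> 'k, 'k) lin_top" where "Kn \<equiv> Kpow absK"

abbreviation XX :: "nat \<Rightarrow> ('n::finite \<Rightarrow> 'k, 'k) pt set" where "XX i \<equiv> carr (iter_sp absK Kn i)"

lemma bgn_dom_Kn [simp]: "bgn_dom absK Kn UNIV i = XX i"
  using bgn_dom_carr[OF tvs_Kpow] by (simp only: carr_Kpow)

lemma openin_Kn_UNIV: "openin (lt_top (Kn :: ('n::finite \<Rightarrow> 'k, 'k) lin_top)) UNIV"
  using openin_topspace[of "lt_top (Kn :: ('n \<Rightarrow> 'k, 'k) lin_top)"] by (simp only: carr_Kpow)

lemma nrm_nonneg: "0 \<le> nrm p"
proof (induction p)
  case (Base z)
  have "absK (z undefined) \<le> Max (range (\<lambda>i. absK (z i)))" by (rule Max_ge) auto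
  then show ?case using absK_nonneg[of "z undefined"] by (simp only: nrm.simps)
qed (auto simp: le_max_iff_disj)

lemma ptd_nonneg: "0 \<le> ptd p q"
proof (induction p q rule: ptd.induct)
  case (1 z w)
  have "absK (z undefined - w undefined) \<le> Max (range (\<lambda>i. absK (z i - w i)))" by (rule Max_ge) auto
  then show ?case using absK_nonneg[of "z undefined - w undefined"] by (simp only: ptd.simps)
qed (auto simp: le_max_iff_disj)

lemma ptd_self [simp]: "ptd p p = 0"
  by (induction p) auto

lemma XX_cases:
  assumes "p \<in> XX (Suc i)"
  obtains x y t where "p = Triple x y t" "x \<in> XX i" "y \<in> XX i"
  using carr_iter_sp_SucE[OF assms] by blast

lemma nrm_le_add_ptd: "p \<in> XX i \<Longrightarrow> q \<in> XX i \<Longrightarrow> nrm q \<le> nrm p + ptd q p"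
proof (induction i arbitrary: p q)
  case 0
  obtain z w where pq: "p = Base z" "q = Base w" using 0 by (auto simp: carr_iter_sp_0)
  have "absK (w i) \<le> nrm p + ptd q p" for i
  proof -
    have "absK (z i) \<le> nrm p" unfolding pq nrm.simps by (rule Max_ge) auto
    moreover have "absK (w i - z i) \<le> ptd q p" unfolding pq ptd.simps by (rule Max_ge) auto
    moreover have "absK (w i) \<le> absK (z i) + absK (w i - z i)" using absK_add[of "z i" "w i - z i"] by simp
    ultimately show ?thesis by linarith
  qed
  then have "Max (range (\<lambda>i. absK (w i))) \<le> nrm p + ptd q p" by (intro Max.boundedI) auto
  then show ?case by (simp only: pq nrm.simps)
next
  case (Suc i)
  obtain x y t where p: "p = Triple x y t" "x \<in> XX i" "y \<in> XX i" by (rule XX_cases[OF Suc.prems(1)])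
  obtain x' y' t' where q: "q = Triple x' y' t'" "x' \<in> XX i" "y' \<in> XX i" by (rule XX_cases[OF Suc.prems(2)])
  have "absK t' \<le> absK t + absK (t' - t)" using absK_add[of t "t' - t"] by simp
  then show ?case using Suc.IH[OF p(2) q(2)] Suc.IH[OF p(3) q(3)] by (auto simp: p q)
qed

lemma ptd_nbhd: "p \<in> XX i \<Longrightarrow> 0 < e \<Longrightarrow>
    \<exists>N. openin (lt_top (iter_sp absK Kn i)) N \<and> p \<in> N \<and> (\<forall>q\<in>N. ptd q p < e)"
proof (induction i arbitrary: p)
  case 0
  obtain z where p: "p = Base z" using 0 by (auto simp: carr_iter_sp_0)
  have "openin (product_topology (\<lambda>_. ktop absK) UNIV) (\<Pi>\<^sub>E i\<in>UNIV. {y. absK (y - z i) < e})"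
    by (rule product_topology_basis) (auto simp: openin_ball)
  from openin_continuous_map_preimage[OF continuous_map_unBase[of Kn], of "\<Pi>\<^sub>E i\<in>UNIV. {y. absK (y - z i) < e}"] this
  have "openin (lt_top (iter_sp absK Kn 0)) {q \<in> XX 0. unBase q \<in> (\<Pi>\<^sub>E i\<in>UNIV. {y. absK (y - z i) < e})}"
    by simp
  moreover have "ptd q p < e" if "q \<in> {q \<in> XX 0. unBase q \<in> (\<Pi>\<^sub>E i\<in>UNIV. {y. absK (y - z i) < e})}" for q
    using that by (auto simp: p carr_iter_sp_0 PiE_iff)
  moreover have "p \<in> {q \<in> XX 0. unBase q \<in> (\<Pi>\<^sub>E i\<in>UNIV. {y. absK (y - z i) < e})}"
    using 0 by (auto simp: p)
  ultimately show ?case by blast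
next
  case (Suc i)
  obtain x y t where p: "p = Triple x y t" "x \<in> XX i" "y \<in> XX i" by (rule XX_cases[OF Suc.prems(1)])
  obtain N M where N: "openin (lt_top (iter_sp absK Kn i)) N" "x \<in> N" "\<forall>q\<in>N. ptd q x < e"
    and M: "openin (lt_top (iter_sp absK Kn i)) M" "y \<in> M" "\<forall>q\<in>M. ptd q y < e"
    using Suc.IH[OF p(2) Suc.prems(2)] Suc.IH[OF p(3) Suc.prems(2)] by blast
  define O' where "O' = {q \<in> XX (Suc i). pfst q \<in> N} \<inter> {q \<in> XX (Suc i). psnd q \<in> M}
      \<inter> {q \<in> XX (Suc i). pthd q \<in> {s. absK (s - t) < e}}"
  have "openin (lt_top (iter_sp absK Kn (Suc i))) O'"
    unfolding O'_def
    by (intro openin_Int openin_continuous_map_preimage[OF continuous_map_pfst N(1)]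
      openin_continuous_map_preimage[OF continuous_map_psnd M(1)]
      openin_continuous_map_preimage[OF continuous_map_pthd openin_ball])
  moreover have "p \<in> O'" using p N M Suc.prems by (simp add: O'_def)
  moreover have "ptd q p < e" if "q \<in> O'" for q
  proof -
    have "q \<in> XX (Suc i)" using that by (simp add: O'_def)
    then obtain x' y' t' where q: "q = Triple x' y' t'" by (rule XX_cases)
    then show ?thesis using that N(3) M(3) by (auto simp: O'_def p)
  qed
  ultimately show ?case by blast
qed

text \<open>Bounds on bounded sets, rather than local ones, are what makes a series of bump functions converge;
  they have to be carried along since an ultrametric field need not be locally compact.\<close>

definition Lb :: "nat \<Rightarrow> (('n::finite \<Rightarrow> 'k, 'k) pt \<Rightarrow> 'k) \<Rightarrow> bool" where
  "Lb i g \<longleftrightarrow> (\<forall>R. \<exists>C\<ge>0. \<forall>p\<in>XX i. nrm p \<le> R \<longrightarrow> absK (g p) \<le> C \<and>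
      (\<forall>q\<in>XX i. nrm q \<le> R \<longrightarrow> absK (g p - g q) \<le> C * ptd p q))"

lemma LbI:
  assumes "\<And>R. \<exists>C\<ge>0. \<exists>D\<ge>0. (\<forall>p\<in>XX i. nrm p \<le> R \<longrightarrow> absK (g p) \<le> C) \<and>
    (\<forall>p\<in>XX i. \<forall>q\<in>XX i. nrm p \<le> R \<longrightarrow> nrm q \<le> R \<longrightarrow> absK (g p - g q) \<le> D * ptd p q)"
  shows "Lb i g"
  unfolding Lb_def
proof
  fix R
  obtain C D where CD: "C \<ge> 0" "D \<ge> 0" "\<forall>p\<in>XX i. nrm p \<le> R \<longrightarrow> absK (g p) \<le> C"
    "\<forall>p\<in>XX i. \<forall>q\<in>XX i. nrm p \<le> R \<longrightarrow> nrm q \<le> R \<longrightarrow> absK (g p - g q) \<le> D * ptd p q" using assms by blast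
  have le: "C \<le> max C D" "D * ptd p q \<le> max C D * ptd p q" for p q
    using ptd_nonneg[of p q] by (auto intro!: mult_right_mono)
  show "\<exists>C\<ge>0. \<forall>p\<in>XX i. nrm p \<le> R \<longrightarrow> absK (g p) \<le> C \<and>
      (\<forall>q\<in>XX i. nrm q \<le> R \<longrightarrow> absK (g p - g q) \<le> C * ptd p q)"
  proof (intro exI[of _ "max C D"] conjI ballI impI)
    show "0 \<le> max C D" using CD by auto
  next
    fix p :: "('a \<Rightarrow> 'k, 'k) pt" assume "p \<in> XX i" "nrm p \<le> R"
    then show "absK (g p) \<le> max C D" using CD(3) by (meson le(1) order_trans)
  next
    fix p q :: "('a \<Rightarrow> 'k, 'k) pt" assume "p \<in> XX i" "nrm p \<le> R" "q \<in> XX i" "nrm q \<le> R"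
    then show "absK (g p - g q) \<le> max C D * ptd p q" using CD(4) by (meson le(2) order_trans)
  qed
qed

lemma LbE:
  assumes "Lb i g"
  obtains C where "C \<ge> 0" "\<And>p. p \<in> XX i \<Longrightarrow> nrm p \<le> R \<Longrightarrow> absK (g p) \<le> C"
    "\<And>p q. p \<in> XX i \<Longrightarrow> q \<in> XX i \<Longrightarrow> nrm p \<le> R \<Longrightarrow> nrm q \<le> R \<Longrightarrow> absK (g p - g q) \<le> C * ptd p q"
  using assms unfolding Lb_def by meson

lemma Lb_Cont:
  assumes "Lb i (g :: ('n::finite \<Rightarrow> 'k, 'k) pt \<Rightarrow> 'k)"
  shows "Cont Kn (Kt absK) UNIV i g"
proof -
  have "continuous_map (lt_top (iter_sp absK Kn i)) (ktop absK) g"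
    unfolding continuous_map_ktop
  proof (intro ballI allI impI)
    fix p :: "('n \<Rightarrow> 'k, 'k) pt" and e :: real assume p: "p \<in> XX i" and e: "0 < e"
    obtain C where C: "C \<ge> 0" "\<And>q r. q \<in> XX i \<Longrightarrow> r \<in> XX i \<Longrightarrow> nrm q \<le> nrm p + 1 \<Longrightarrow> nrm r \<le> nrm p + 1 \<Longrightarrow>
        absK (g q - g r) \<le> C * ptd q r"
      by (rule LbE[OF assms, of "nrm p + 1"]) blast
    \<comment> \<open>The bound 1 keeps q in the ball of radius \<open>nrm p + 1\<close>, for which
      C was chosen; C + 1 avoids a division by 0.\<close>
    define d where "d = min 1 (e / (C + 1))"
    have d: "d > 0" using e C by (simp add: d_def)
    obtain N where N: "openin (lt_top (iter_sp absK Kn i)) N" "p \<in> N" "\<forall>q\<in>N. ptd q p < d"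
      using ptd_nbhd[OF p d] by blast
    have "absK (g q - g p) < e" if q: "q \<in> N" for q
    proof -
      have qX: "q \<in> XX i" using q N(1) openin_subset by blast
      have dq: "ptd q p < d" using N q by blast
      then have "nrm q \<le> nrm p + 1" using nrm_le_add_ptd[OF p qX] by (simp add: d_def)
      then have "absK (g q - g p) \<le> C * ptd q p" using C(2)[OF qX p] by simp
      also have "\<dots> \<le> C * d" using C dq by (intro mult_left_mono) auto
      also have "\<dots> \<le> C * (e / (C + 1))" using C by (intro mult_left_mono) (auto simp: d_def)
      also have "\<dots> < e" using C e by (simp add: field_simps)
      finally show ?thesis .
    qed
    then show "\<exists>N. openin (lt_top (iter_sp absK Kn i)) N \<and> p \<in> N \<and> (\<forall>y\<in>N. absK (g y - g p) < e)"
      using N by blast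
  qed
  then show ?thesis by (simp add: continuous_map_from_subtopology)
qed

lemma Lb_const: "Lb i (\<lambda>_. c)"
  by (intro LbI exI[of _ "absK c"] exI[of _ 0] conjI) auto

lemma Lb_add:
  assumes g: "Lb i g" and h: "Lb i h"
  shows "Lb i (\<lambda>p. g p + h p)"
proof (rule LbI)
  fix R
  obtain C where C: "C \<ge> 0" "\<And>p. p \<in> XX i \<Longrightarrow> nrm p \<le> R \<Longrightarrow> absK (g p) \<le> C"
    "\<And>p q. p \<in> XX i \<Longrightarrow> q \<in> XX i \<Longrightarrow> nrm p \<le> R \<Longrightarrow> nrm q \<le> R \<Longrightarrow> absK (g p - g q) \<le> C * ptd p q"
    by (rule LbE[OF g, of R]) blast
  obtain D where D: "D \<ge> 0" "\<And>p. p \<in> XX i \<Longrightarrow> nrm p \<le> R \<Longrightarrow> absK (h p) \<le> D"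
    "\<And>p q. p \<in> XX i \<Longrightarrow> q \<in> XX i \<Longrightarrow> nrm p \<le> R \<Longrightarrow> nrm q \<le> R \<Longrightarrow> absK (h p - h q) \<le> D * ptd p q"
    by (rule LbE[OF h, of R]) blast
  have 1: "absK (g p + h p) \<le> C + D" if "p \<in> XX i" "nrm p \<le> R" for p
    using C(2)[OF that] D(2)[OF that] absK_add[of "g p" "h p"] by linarith
  have 2: "absK (g p + h p - (g q + h q)) \<le> (C + D) * ptd p q"
    if "p \<in> XX i" "q \<in> XX i" "nrm p \<le> R" "nrm q \<le> R" for p q
    using C(3)[OF that] D(3)[OF that] absK_add[of "g p - g q" "h p - h q"] by (simp add: algebra_simps)
  show "\<exists>C'\<ge>0. \<exists>D'\<ge>0. (\<forall>p\<in>XX i. nrm p \<le> R \<longrightarrow> absK (g p + h p) \<le> C') \<and>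
    (\<forall>p\<in>XX i. \<forall>q\<in>XX i. nrm p \<le> R \<longrightarrow> nrm q \<le> R \<longrightarrow> absK (g p + h p - (g q + h q)) \<le> D' * ptd p q)"
    using C(1) D(1) 1 2 by (intro exI[of _ "C + D"] conjI ballI impI) auto
qed

lemma Lb_mult:
  assumes g: "Lb i g" and h: "Lb i h"
  shows "Lb i (\<lambda>p. g p * h p)"
proof (rule LbI)
  fix R
  obtain C where C: "C \<ge> 0" "\<And>p. p \<in> XX i \<Longrightarrow> nrm p \<le> R \<Longrightarrow> absK (g p) \<le> C"
    "\<And>p q. p \<in> XX i \<Longrightarrow> q \<in> XX i \<Longrightarrow> nrm p \<le> R \<Longrightarrow> nrm q \<le> R \<Longrightarrow> absK (g p - g q) \<le> C * ptd p q"
    by (rule LbE[OF g, of R]) blast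
  obtain D where D: "D \<ge> 0" "\<And>p. p \<in> XX i \<Longrightarrow> nrm p \<le> R \<Longrightarrow> absK (h p) \<le> D"
    "\<And>p q. p \<in> XX i \<Longrightarrow> q \<in> XX i \<Longrightarrow> nrm p \<le> R \<Longrightarrow> nrm q \<le> R \<Longrightarrow> absK (h p - h q) \<le> D * ptd p q"
    by (rule LbE[OF h, of R]) blast
  have 1: "absK (g p * h p) \<le> C * D" if "p \<in> XX i" "nrm p \<le> R" for p
    using C(2)[OF that] D(2)[OF that] C(1) by (simp add: absK_mult mult_mono)
  have 2: "absK (g p * h p - g q * h q) \<le> (2 * C * D) * ptd p q"
    if "p \<in> XX i" "q \<in> XX i" "nrm p \<le> R" "nrm q \<le> R" for p q
  proof -
    have "absK (g p * h p - g q * h q) \<le> absK (g p) * absK (h p - h q) + absK (g p - g q) * absK (h q)"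
      using absK_add[of "g p * (h p - h q)" "(g p - g q) * h q"] by (simp add: algebra_simps flip: absK_mult)
    also have "\<dots> \<le> C * (D * ptd p q) + (C * ptd p q) * D"
      using C(2)[OF that(1,3)] D(2)[OF that(2,4)] C(3)[OF that] D(3)[OF that] C(1) D(1) ptd_nonneg
      by (intro add_mono mult_mono) (auto intro!: mult_nonneg_nonneg ptd_nonneg)
    also have "\<dots> = (2 * C * D) * ptd p q" by simp
    finally show ?thesis .
  qed
  show "\<exists>C'\<ge>0. \<exists>D'\<ge>0. (\<forall>p\<in>XX i. nrm p \<le> R \<longrightarrow> absK (g p * h p) \<le> C') \<and>
    (\<forall>p\<in>XX i. \<forall>q\<in>XX i. nrm p \<le> R \<longrightarrow> nrm q \<le> R \<longrightarrow> absK (g p * h p - g q * h q) \<le> D' * ptd p q)"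
    using C(1) D(1) 1 2 by (intro exI[of _ "C * D"] exI[of _ "2 * C * D"] conjI ballI impI) auto
qed

text \<open>Control of h is required only on values of g. This admits the reciprocal as h when g
  stays away from 0.\<close>

lemma Lb_comp_Lipschitz:
  assumes g: "Lb i g" and h: "\<And>C. \<exists>D\<ge>0. \<forall>u v. absK u \<le> C \<longrightarrow> absK v \<le> C \<longrightarrow> u \<in> g ` XX i \<longrightarrow> v \<in> g ` XX i \<longrightarrow>
      absK (h u) \<le> D \<and> absK (h u - h v) \<le> D * absK (u - v)"
  shows "Lb i (\<lambda>p. h (g p))"
proof (rule LbI)
  fix R
  obtain C where C: "C \<ge> 0" "\<And>p. p \<in> XX i \<Longrightarrow> nrm p \<le> R \<Longrightarrow> absK (g p) \<le> C"
    "\<And>p q. p \<in> XX i \<Longrightarrow> q \<in> XX i \<Longrightarrow> nrm p \<le> R \<Longrightarrow> nrm q \<le> R \<Longrightarrow> absK (g p - g q) \<le> C * ptd p q"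
    by (rule LbE[OF g, of R]) blast
  obtain D where D: "D \<ge> 0" "\<And>u v. absK u \<le> C \<Longrightarrow> absK v \<le> C \<Longrightarrow> u \<in> g ` XX i \<Longrightarrow> v \<in> g ` XX i \<Longrightarrow>
      absK (h u) \<le> D \<and> absK (h u - h v) \<le> D * absK (u - v)" using h[of C] by blast
  have 2: "absK (h (g p) - h (g q)) \<le> (D * C) * ptd p q"
    if "p \<in> XX i" "q \<in> XX i" "nrm p \<le> R" "nrm q \<le> R" for p q
  proof -
    have "absK (h (g p) - h (g q)) \<le> D * absK (g p - g q)"
      using D(2)[OF C(2)[OF that(1,3)] C(2)[OF that(2,4)]] that by blast
    also have "\<dots> \<le> D * (C * ptd p q)" using C(3)[OF that] D(1) by (intro mult_left_mono)
    finally show ?thesis by simp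
  qed
  have 1: "absK (h (g p)) \<le> D" if "p \<in> XX i" "nrm p \<le> R" for p
    using D(2)[OF C(2)[OF that] C(2)[OF that]] that by blast
  show "\<exists>C'\<ge>0. \<exists>D'\<ge>0. (\<forall>p\<in>XX i. nrm p \<le> R \<longrightarrow> absK (h (g p)) \<le> C') \<and>
    (\<forall>p\<in>XX i. \<forall>q\<in>XX i. nrm p \<le> R \<longrightarrow> nrm q \<le> R \<longrightarrow> absK (h (g p) - h (g q)) \<le> D' * ptd p q)"
    using C(1) D(1) 1 2 by (intro exI[of _ D] exI[of _ "D * C"] conjI ballI impI) auto
qed

lemma Lb_comp_nonexpansive:
  assumes g: "Lb i g" and L: "\<And>p. p \<in> XX j \<Longrightarrow> L p \<in> XX i" "\<And>p. p \<in> XX j \<Longrightarrow> nrm (L p) \<le> nrm p"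
    "\<And>p q. p \<in> XX j \<Longrightarrow> q \<in> XX j \<Longrightarrow> ptd (L p) (L q) \<le> ptd p q"
  shows "Lb j (\<lambda>p. g (L p))"
proof (rule LbI)
  fix R
  obtain C where C: "C \<ge> 0" "\<And>p. p \<in> XX i \<Longrightarrow> nrm p \<le> R \<Longrightarrow> absK (g p) \<le> C"
    "\<And>p q. p \<in> XX i \<Longrightarrow> q \<in> XX i \<Longrightarrow> nrm p \<le> R \<Longrightarrow> nrm q \<le> R \<Longrightarrow> absK (g p - g q) \<le> C * ptd p q"
    by (rule LbE[OF g, of R]) blast
  have 1: "absK (g (L p)) \<le> C" if "p \<in> XX j" "nrm p \<le> R" for p
    using C(2) L(1,2) that by (meson order_trans)
  have 2: "absK (g (L p) - g (L q)) \<le> C * ptd p q" if "p \<in> XX j" "q \<in> XX j" "nrm p \<le> R" "nrm q \<le> R" for p q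
  proof -
    have "absK (g (L p) - g (L q)) \<le> C * ptd (L p) (L q)" using C(3) L(1,2) that by (meson order_trans)
    also have "\<dots> \<le> C * ptd p q" using L(3) that C(1) by (intro mult_left_mono) auto
    finally show ?thesis .
  qed
  show "\<exists>C'\<ge>0. \<exists>D'\<ge>0. (\<forall>p\<in>XX j. nrm p \<le> R \<longrightarrow> absK (g (L p)) \<le> C') \<and>
    (\<forall>p\<in>XX j. \<forall>q\<in>XX j. nrm p \<le> R \<longrightarrow> nrm q \<le> R \<longrightarrow> absK (g (L p) - g (L q)) \<le> D' * ptd p q)"
    using C(1) 1 2 by (intro exI[of _ C] conjI ballI impI) auto
qed

lemma nrm_lift_pfst: "r \<le> j \<Longrightarrow> p \<in> XX (Suc j) \<Longrightarrow> nrm (lift_pfst r p) \<le> nrm p"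
proof (induction r arbitrary: j p)
  case 0
  then show ?case by (auto elim!: XX_cases)
next
  case (Suc r)
  obtain x y t where p: "p = Triple x y t" "x \<in> XX j" "y \<in> XX j" by (rule XX_cases[OF Suc.prems(2)])
  obtain j' where "j = Suc j'" "r \<le> j'" using Suc.prems(1) by (metis Suc_le_D Suc_le_mono)
  then show ?case using Suc.IH[of j' x] Suc.IH[of j' y] p by auto
qed

lemma ptd_lift_pfst: "r \<le> j \<Longrightarrow> p \<in> XX (Suc j) \<Longrightarrow> q \<in> XX (Suc j) \<Longrightarrow> ptd (lift_pfst r p) (lift_pfst r q) \<le> ptd p q"
proof (induction r arbitrary: j p q)
  case 0
  then show ?case by (auto elim!: XX_cases)
next
  case (Suc r)
  obtain x y t where p: "p = Triple x y t" "x \<in> XX j" "y \<in> XX j" by (rule XX_cases[OF Suc.prems(2)])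
  obtain x' y' t' where q: "q = Triple x' y' t'" "x' \<in> XX j" "y' \<in> XX j" by (rule XX_cases[OF Suc.prems(3)])
  obtain j' where "j = Suc j'" "r \<le> j'" using Suc.prems(1) by (metis Suc_le_D Suc_le_mono)
  then show ?case using Suc.IH[of j' x x'] Suc.IH[of j' y y'] p q by auto
qed

lemma Lb_lift_pfst: "r \<le> j \<Longrightarrow> Lb j g \<Longrightarrow> Lb (Suc j) (\<lambda>p. g (lift_pfst r p))"
  using Lb_comp_nonexpansive[of j g "Suc j" "lift_pfst r"] lift_pfst_carr[of r j _ Kn] nrm_lift_pfst[of r j]
    ptd_lift_pfst[of r j] by blast

abbreviation BB :: "nat \<Rightarrow> nat \<Rightarrow> (('n::finite \<Rightarrow> 'k, 'k) pt \<Rightarrow> 'k) \<Rightarrow> bool" where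
  "BB \<equiv> DC Kn (Kt absK) UNIV Lb"

abbreviation nonexp :: "nat \<Rightarrow> (('n::finite \<Rightarrow> 'k, 'k) pt \<Rightarrow> 'k) \<Rightarrow> bool" where
  "nonexp i L \<equiv> (\<forall>p\<in>XX i. absK (L p) \<le> nrm p \<and> (\<forall>q\<in>XX i. absK (L p - L q) \<le> ptd p q))"

lemma Lb_nonexp:
  assumes "nonexp i L"
  shows "Lb i L"
proof (rule LbI)
  fix R show "\<exists>C\<ge>0. \<exists>D\<ge>0. (\<forall>p\<in>XX i. nrm p \<le> R \<longrightarrow> absK (L p) \<le> C) \<and>
    (\<forall>p\<in>XX i. \<forall>q\<in>XX i. nrm p \<le> R \<longrightarrow> nrm q \<le> R \<longrightarrow> absK (L p - L q) \<le> D * ptd p q)"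
    using assms by (intro exI[of _ "max R 0"] exI[of _ 1] conjI ballI impI) fastforce+
qed

lemma BB_lin:
  assumes "lin (iter_sp absK Kn i) (Kt absK) L" "nonexp i L"
  shows "BB k i L"
  using assms
proof (induction k arbitrary: i L)
  case 0
  then show ?case by (simp add: Lb_nonexp)
next
  case (Suc k i L)
  have "nonexp (Suc i) (\<lambda>p. L (psnd p))"
    using Suc.prems(2) by (fastforce elim!: XX_cases simp: le_max_iff_disj)
  then have "BB k (Suc i) (\<lambda>p. L (psnd p))"
    by (intro Suc.IH lin_compose[OF lin_psnd Suc.prems(1)])
  then show ?case
    using diff_rel_lin[OF tvs_Kpow _ Suc.prems(1), of UNIV] Lb_nonexp[OF Suc.prems(2)] by auto
qed

lemma BB_pthd: "BB k (Suc i) pthd"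
  by (rule BB_lin[OF lin_pthd]) (auto elim!: XX_cases)

lemma lin_coord: "lin (iter_sp absK Kn 0) (Kt absK) (\<lambda>p. unBase p m)"
proof (rule lin_compose[OF lin_unBase])
  show "lin Kn (Kt absK) (\<lambda>z. z m)"
    using continuous_map_product_projection[of m UNIV "\<lambda>_. ktop absK"] by (simp add: lin_def)
qed

lemma BB_coord: "BB k 0 (\<lambda>p. unBase p m)"
proof (rule BB_lin[OF lin_coord])
  show "nonexp 0 (\<lambda>p. unBase p m)"
    by (auto simp: carr_iter_sp_0 intro!: Max_ge)
qed

lemma BB_add:
  assumes "BB k i g" "BB k i h"
  shows "BB k i (\<lambda>p. g p + h p)"
proof -
  have "BB k i (\<lambda>p. lt_add (Kt absK) (g p) (h p))"
    by (rule DC_add[where P=Lb, OF tvs_Kt _ _ assms]) (simp_all add: Lb_add)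
  then show ?thesis by simp
qed

lemma BB_pfst: "BB k i g \<Longrightarrow> BB k (Suc i) (\<lambda>p. g (pfst p))"
  by (rule DC_pfst[where P=Lb, OF tvs_Kpow]) (auto intro: Lb_lift_pfst)

lemma BB_mult:
  assumes "BB k i g" "BB k i h"
  shows "BB k i (\<lambda>p. g p * h p)"
proof -
  have "BB k i (\<lambda>p. lt_smul (Kt absK) (g p) (h p))"
    by (rule DC_smul[where P=Lb and Q=Lb, OF tvs_Kpow tvs_Kt _ _ _ _ _ _ _ assms])
       (simp_all add: Lb_add Lb_mult Lb_lift_pfst BB_pthd)
  then show ?thesis by simp
qed

lemma BB_const: "BB k i (\<lambda>_. c)"
proof (induction k arbitrary: i c)
  case (Suc k)
  have "diff_rel Kn (Kt absK) UNIV i (\<lambda>_. c) (\<lambda>_. 0)" by (simp add: diff_rel_def)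
  then show ?case using Suc Lb_const by auto
qed (simp add: Lb_const)

lemma BB_diff: "BB k i g \<Longrightarrow> BB k i h \<Longrightarrow> BB k i (\<lambda>p. g p - h p)"
  using BB_add[of k i g "\<lambda>p. (-1) * h p"] BB_mult[OF BB_const[of k i "-1"], of h] by simp

lemma BB_SucE:
  assumes "BB (Suc k) i g"
  obtains G where "Lb i g" "BB k (Suc i) G"
    "\<And>x y t. x \<in> XX i \<Longrightarrow> y \<in> XX i \<Longrightarrow> g (step Kn x t y) = g x + t * G (Triple x y t)"
  using assms by (auto simp: diff_rel_def simp del: Kpow_simps bgn_dom.simps)

lemma BB_SucI:
  assumes "Lb i g" "BB k (Suc i) G"
    "\<And>x y t. x \<in> XX i \<Longrightarrow> y \<in> XX i \<Longrightarrow> g (step Kn x t y) = g x + t * G (Triple x y t)"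
  shows "BB (Suc k) i g"
  using assms by (auto simp: diff_rel_def simp del: Kpow_simps bgn_dom.simps)

lemma XX_step: "x \<in> XX i \<Longrightarrow> y \<in> XX i \<Longrightarrow> step Kn x t y \<in> XX i"
  using iter_closed[OF tvs_Kpow] by metis

lemma Lb_inverse:
  assumes w: "Lb i w" and c: "0 < c" "\<And>p. p \<in> XX i \<Longrightarrow> c \<le> absK (w p)"
  shows "Lb i (\<lambda>p. inverse (w p))"
proof (rule Lb_comp_Lipschitz[OF w])
  fix C
  define D where "D = max (1 / c) (1 / (c * c))"
  have D: "1 / c \<le> D" "1 / (c * c) \<le> D" "0 \<le> D" using c(1) by (auto simp: D_def le_max_iff_disj)
  have "absK (inverse u) \<le> D \<and> absK (inverse u - inverse v) \<le> D * absK (u - v)"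
    if "u \<in> w ` XX i" "v \<in> w ` XX i" for u v
  proof -
    have uv: "c \<le> absK u" "c \<le> absK v" using that c(2) by auto
    then have pos: "0 < absK u" "0 < absK v" using c(1) by linarith+
    then have nz: "u \<noteq> 0" "v \<noteq> 0" by auto
    have "absK (inverse u) \<le> 1 / c" using le_imp_inverse_le[OF uv(1) c(1)] by (simp only: absK_inverse flip: inverse_eq_divide)
    moreover have "inverse u - inverse v = (v - u) / (u * v)" using nz by (simp add: field_simps)
    then have "absK (inverse u - inverse v) = 1 / (absK u * absK v) * absK (u - v)"
      by (simp add: absK_divide absK_mult absK_diff_commute[of v u])
    moreover have "1 / (absK u * absK v) \<le> 1 / (c * c)"
      using uv c(1) pos by (intro divide_left_mono mult_mono mult_pos_pos) auto
    then have "1 / (absK u * absK v) * absK (u - v) \<le> D * absK (u - v)"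
      using D by (intro mult_right_mono) auto
    ultimately show ?thesis using D by linarith
  qed
  then show "\<exists>D\<ge>0. \<forall>u v. absK u \<le> C \<longrightarrow> absK v \<le> C \<longrightarrow> u \<in> w ` XX i \<longrightarrow> v \<in> w ` XX i \<longrightarrow>
      absK (inverse u) \<le> D \<and> absK (inverse u - inverse v) \<le> D * absK (u - v)"
    using D(3) by blast
qed

text \<open>The quotient of 1/w is - W / (w(x) w(x + t y)). Both factors of the denominator are
  functions on the next level with the same lower bound c, so the induction hypothesis applies to
  each of them.\<close>

lemma BB_inverse:
  assumes "BB k i w" "0 < c" "\<And>p. p \<in> XX i \<Longrightarrow> c \<le> absK (w p)"
  shows "BB k i (\<lambda>p. inverse (w p))"
  using assms
proof (induction k arbitrary: i w)
  case (0 i w)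
  then show ?case using Lb_inverse[OF _ 0(2,3)] by simp
next
  case (Suc k i w)
  obtain W where W: "Lb i w" "BB k (Suc i) W"
    "\<And>x y t. x \<in> XX i \<Longrightarrow> y \<in> XX i \<Longrightarrow> w (step Kn x t y) = w x + t * W (Triple x y t)"
    by (rule BB_SucE[OF Suc.prems(1)]) blast
  \<comment> \<open>This is w(x + t y), written by means of W as a function on the next level, so
    that no composition with the step has to be studied.\<close>
  define w' where "w' = (\<lambda>p. w (pfst p) + pthd p * W p)"
  have 1: "BB k (Suc i) (\<lambda>p. w (pfst p))" by (rule BB_pfst[OF DC_Suc[OF Suc.prems(1)]])
  have 2: "BB k (Suc i) w'" unfolding w'_def by (intro BB_add 1 BB_mult BB_pthd W(2))
  have 3: "c \<le> absK (w (pfst p))" if "p \<in> XX (Suc i)" for p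
    using that Suc.prems(3) by (auto elim!: XX_cases)
  have 4: "c \<le> absK (w' p)" if pX: "p \<in> XX (Suc i)" for p
  proof -
    obtain x y t where p: "p = Triple x y t" "x \<in> XX i" "y \<in> XX i" by (rule XX_cases[OF pX])
    then have "w' p = w (step Kn x t y)" using W(3)[of x y t] by (simp add: w'_def)
    then show ?thesis using Suc.prems(3)[OF XX_step[of x i y t]] p by simp
  qed
  have nz: "w p \<noteq> 0" if "p \<in> XX i" for p using Suc.prems(2) Suc.prems(3)[OF that] by auto
  show ?case
  proof (rule BB_SucI)
    show "Lb i (\<lambda>p. inverse (w p))" by (rule Lb_inverse[OF W(1) Suc.prems(2,3)])
    show "BB k (Suc i) (\<lambda>p. (- 1) * W p * (inverse (w (pfst p)) * inverse (w' p)))"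
      by (intro BB_mult BB_const W(2) Suc.IH[OF 1 Suc.prems(2) 3] Suc.IH[OF 2 Suc.prems(2) 4])
    fix x y :: "('a \<Rightarrow> 'k, 'k) pt" and t assume xy: "x \<in> XX i" "y \<in> XX i"
    show "inverse (w (step Kn x t y)) = inverse (w x) +
       t * ((- 1) * W (Triple x y t) * (inverse (w (pfst (Triple x y t))) * inverse (w' (Triple x y t))))"
    proof -
      have w': "w' (Triple x y t) = w (step Kn x t y)" "t * W (Triple x y t) = w (step Kn x t y) - w x"
        using W(3)[OF xy, of t] by (simp_all add: w'_def)
      have "inverse (w x) - inverse (w (step Kn x t y)) =
          inverse (w x) * (t * W (Triple x y t)) * inverse (w (step Kn x t y))"
        using division_ring_inverse_diff[OF nz[OF xy(1)] nz[OF XX_step[OF xy, of t]]] w'(2) by simp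
      then show ?thesis using w'(1) by (simp add: algebra_simps)
    qed
  qed
qed

end

section \<open>Scalar functions that preserve chains, and smooth bumps in both cases\<close>

section \<open>Bump functions\<close>

context valued_field
begin

text \<open>Smoothness of h in the form in which it is used: h may be applied to any scalar chain at
  any level. The type argument records the number of variables, which is not visible in the type of
  h.\<close>

definition smooth_scalar :: "'n::finite itself \<Rightarrow> ('k \<Rightarrow> 'k) \<Rightarrow> bool" where
  "smooth_scalar _ h \<longleftrightarrow> (\<forall>k i (g :: ('n \<Rightarrow> 'k, 'k) pt \<Rightarrow> 'k). BB k i g \<longrightarrow> BB k i (\<lambda>p. h (g p)))"

lemma smooth_scalarD: "smooth_scalar TYPE('n::finite) h \<Longrightarrow> BB k i (g :: ('n \<Rightarrow> 'k, 'k) pt \<Rightarrow> 'k) \<Longrightarrow> BB k i (\<lambda>p. h (g p))"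
  by (simp add: smooth_scalar_def)

definition bump :: "('k \<Rightarrow> 'k) \<Rightarrow> bool" where
  "bump \<eta> \<longleftrightarrow> (\<forall>s. absK s \<le> 1 \<longrightarrow> \<eta> s = 1) \<and> (\<forall>s. 2 \<le> absK s \<longrightarrow> \<eta> s = 0) \<and> (\<forall>s. absK (\<eta> s) \<le> 1)"

subsection \<open>The ultrametric case\<close>

text \<open>The indicator function \<open>\<eta>\<close> of the unit ball and the truncated inverse \<open>\<psi>\<close> have difference quotients which
  are polynomials in \<open>\<eta>\<close> and \<open>\<psi>\<close>, since \<open>\<eta> u \<noteq> \<eta> v\<close> forces \<open>\<bar>u - v\<bar> > 1\<close> and then
  \<open>\<psi> (u - v) = 1 / (u - v)\<close>.\<close>

lemma ultrametric_bump:
  assumes um: "\<And>x y. absK (x + y) \<le> max (absK x) (absK y)"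
  shows "\<exists>\<eta>. bump \<eta> \<and> smooth_scalar TYPE('n::finite) \<eta>"
proof -
  define \<eta> :: "'k \<Rightarrow> 'k" where "\<eta> = (\<lambda>u. if absK u \<le> 1 then 1 else 0)"
  define \<psi> :: "'k \<Rightarrow> 'k" where "\<psi> = (\<lambda>u. if absK u \<le> 1 then 0 else inverse u)"
  \<comment> \<open>By the ultrametric inequality, a point of the closed unit ball and a point
    outside of it are more than 1 apart.\<close>
  have far: "1 < absK (u - v)" if "absK u \<le> 1" "1 < absK v" for u v
    using um[of u "v - u"] that by (simp add: absK_diff_commute)
  have far': "1 < absK (u - v)" if "\<not> absK u \<le> 1" "absK v \<le> 1" for u v
    using far[of v u] that by (simp add: absK_diff_commute)
  have \<eta>1: "absK (\<eta> u) \<le> 1" "absK (\<psi> u) \<le> 1" for u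
    by (auto simp: \<eta>_def \<psi>_def absK_inverse inverse_le_1_iff)
  have \<eta>2: "absK (\<eta> u - \<eta> v) \<le> absK (u - v)" for u v
    using far[of u v] far'[of u v] by (auto simp: \<eta>_def)
  have \<psi>2: "absK (\<psi> u - \<psi> v) \<le> absK (u - v)" for u v
  proof -
    consider "absK u \<le> 1 \<longleftrightarrow> \<not> absK v \<le> 1" | "absK u \<le> 1" "absK v \<le> 1" | "1 < absK u" "1 < absK v" by linarith
    then show ?thesis
    proof cases
      case 1
      then have "1 \<le> absK (u - v)" using far[of u v] far'[of u v] by linarith
      moreover have "absK (\<psi> u - \<psi> v) \<le> 1" using 1 \<eta>1(2)[of u] \<eta>1(2)[of v] by (auto simp: \<psi>_def)
      ultimately show ?thesis by linarith
    next
      case 3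
      then have nz: "u \<noteq> 0" "v \<noteq> 0" by auto
      have "\<psi> u - \<psi> v = (v - u) * (\<psi> u * \<psi> v)" using nz 3 by (simp add: \<psi>_def field_simps)
      then have "absK (\<psi> u - \<psi> v) = absK (u - v) * (absK (\<psi> u) * absK (\<psi> v))"
        by (simp add: absK_mult absK_diff_commute[of v u])
      also have "\<dots> \<le> absK (u - v) * (1 * 1)" using \<eta>1 by (intro mult_left_mono mult_mono) auto
      finally show ?thesis by simp
    qed (auto simp: \<psi>_def)
  qed
  have Lb1: "Lb i (\<lambda>p. \<eta> (g p))" "Lb i (\<lambda>p. \<psi> (g p))" if "Lb i (g :: ('n \<Rightarrow> 'k, 'k) pt \<Rightarrow> 'k)" for i g
    using Lb_comp_Lipschitz[OF that, of \<eta>] Lb_comp_Lipschitz[OF that, of \<psi>] \<eta>1 \<eta>2 \<psi>2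
    by (metis mult_1 zero_le_one)+
  have main: "BB k i (\<lambda>p. \<eta> (g p)) \<and> BB k i (\<lambda>p. \<psi> (g p))" if "BB k i (g :: ('n \<Rightarrow> 'k, 'k) pt \<Rightarrow> 'k)" for k i g
    using that
  proof (induction k arbitrary: i g)
    case 0
    then show ?case using Lb1 by simp
  next
    case (Suc k i g)
    obtain G where G: "Lb i g" "BB k (Suc i) G"
      "\<And>x y t. x \<in> XX i \<Longrightarrow> y \<in> XX i \<Longrightarrow> g (step Kn x t y) = g x + t * G (Triple x y t)"
      by (rule BB_SucE[OF Suc.prems]) blast
    define u where "u = (\<lambda>p. g (pfst p))"
    define d where "d = (\<lambda>p. pthd p * G p)"
    define u' where "u' = (\<lambda>p. u p + d p)"
    have u: "BB k (Suc i) u" unfolding u_def by (rule BB_pfst[OF DC_Suc[OF Suc.prems]])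
    have d: "BB k (Suc i) d" unfolding d_def by (rule BB_mult[OF BB_pthd G(2)])
    have u': "BB k (Suc i) u'" unfolding u'_def by (rule BB_add[OF u d])
    note IH = conjunct1[OF Suc.IH] conjunct2[OF Suc.IH]
    have gs: "g (step Kn x t y) = u' (Triple x y t)" "g x = u (Triple x y t)" "t * G (Triple x y t) = d (Triple x y t)"
      if "x \<in> XX i" "y \<in> XX i" for x y t
      using G(3)[OF that] by (simp_all add: u'_def u_def d_def)
    have inv: "v * \<psi> v = 1" if "1 < absK v" for v using that by (cases "v = 0") (auto simp: \<psi>_def)
    have "BB (Suc k) i (\<lambda>p. \<eta> (g p))"
    proof (rule BB_SucI[OF Lb1(1)[OF G(1)]])
      \<comment> \<open>If \<open>\<eta>\<close> differs at u and u' = u + d, then |d| > 1 and d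
        \<open>\<psi> d\<close> = 1, so inserting this factor changes nothing. As d = t G, it
        contains the t that has to be split off.\<close>
      show "BB k (Suc i) (\<lambda>p. (\<eta> (u' p) - \<eta> (u p)) * (\<psi> (d p) * G p))"
        by (intro BB_mult BB_diff IH u u' d G(2))
      fix x y :: "('n \<Rightarrow> 'k, 'k) pt" and t assume xy: "x \<in> XX i" "y \<in> XX i"
      let ?p = "Triple x y t"
      have "\<eta> (u' ?p) - \<eta> (u ?p) = (\<eta> (u' ?p) - \<eta> (u ?p)) * (d ?p * \<psi> (d ?p))"
      proof (cases "\<eta> (u' ?p) = \<eta> (u ?p)")
        case False
        then have "1 < absK (u' ?p - u ?p)" using far[of "u' ?p" "u ?p"] far'[of "u' ?p" "u ?p"]
          by (auto simp: \<eta>_def split: if_splits)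
        then have "1 < absK (d ?p)" by (simp add: u'_def)
        then show ?thesis using inv by simp
      qed simp
      then have "\<eta> (u' ?p) = \<eta> (u ?p) + (\<eta> (u' ?p) - \<eta> (u ?p)) * (d ?p * \<psi> (d ?p))"
        by (metis add_diff_cancel_left' diff_add_cancel add.commute)
      then show "\<eta> (g (step Kn x t y)) = \<eta> (g x) + t * ((\<eta> (u' ?p) - \<eta> (u ?p)) * (\<psi> (d ?p) * G ?p))"
        unfolding gs(1,2)[OF xy, of t] by (simp add: gs(3)[OF xy, of t, symmetric] mult_ac)
    qed
    moreover have "BB (Suc k) i (\<lambda>p. \<psi> (g p))"
    proof (rule BB_SucI[OF Lb1(2)[OF G(1)]])
      \<comment> \<open>Indicator of the event that exactly one of u and u' lies in the unit ball;
        squared because the difference may be -1.\<close>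
      let ?e = "\<lambda>p. (\<eta> (u' p) - \<eta> (u p)) * (\<eta> (u' p) - \<eta> (u p))"
      \<comment> \<open>If both points are outside the ball, the first summand comes from 1/u' - 1/u
        = - d / (u u') and the second one vanishes. If exactly one is outside, the first vanishes
        and the second accounts for the jump. If both are inside, everything is 0.\<close>
      let ?H = "\<lambda>p. (- 1) * (G p * (\<psi> (u p) * \<psi> (u' p))) + ?e p * ((\<psi> (u' p) - \<psi> (u p)) * (\<psi> (d p) * G p))"
      show "BB k (Suc i) ?H"
        by (intro BB_mult BB_diff BB_add BB_const IH u u' d G(2))
      fix x y :: "('n \<Rightarrow> 'k, 'k) pt" and t assume xy: "x \<in> XX i" "y \<in> XX i"
      let ?p = "Triple x y t"
      have "\<psi> (u' ?p) = \<psi> (u ?p) + ((- 1) * (d ?p * (\<psi> (u ?p) * \<psi> (u' ?p))) + ?e ?p * ((\<psi> (u' ?p) - \<psi> (u ?p)) * (d ?p * \<psi> (d ?p))))"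
      proof -
        consider "absK (u' ?p) \<le> 1 \<longleftrightarrow> \<not> absK (u ?p) \<le> 1" | "absK (u ?p) \<le> 1" "absK (u' ?p) \<le> 1"
          | "\<not> absK (u ?p) \<le> 1" "\<not> absK (u' ?p) \<le> 1" by linarith
        then show ?thesis
        proof cases
          case 1
          then have "1 < absK (u' ?p - u ?p)" using far[of "u' ?p" "u ?p"] far'[of "u' ?p" "u ?p"] by linarith
          then have "d ?p * \<psi> (d ?p) = 1" using inv by (simp add: u'_def)
          moreover have "?e ?p = 1" "\<psi> (u ?p) * \<psi> (u' ?p) = 0" using 1 by (auto simp: \<eta>_def \<psi>_def)
          ultimately show ?thesis by simp
        next
          case 2
          then show ?thesis by (simp add: \<psi>_def)
        next
          case 3
          then have nz: "u ?p \<noteq> 0" "u' ?p \<noteq> 0" by auto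
          have "?e ?p = 0" using 3 by (simp add: \<eta>_def)
          moreover have "d ?p = u' ?p - u ?p" by (simp add: u'_def)
          ultimately show ?thesis using nz 3 by (simp add: \<psi>_def field_simps)
        qed
      qed
      then show "\<psi> (g (step Kn x t y)) = \<psi> (g x) + t * ?H ?p"
        unfolding gs(1,2)[OF xy, of t] by (simp add: gs(3)[OF xy, of t, symmetric] algebra_simps)
    qed
    ultimately show ?case by blast
  qed
  have "bump \<eta>" unfolding bump_def using \<eta>1 by (auto simp: \<eta>_def)
  then show ?thesis using main unfolding smooth_scalar_def by blast
qed

subsection \<open>The real case\<close>

text \<open>Affine maps \<open>L s\<close> with a common linear part \<Lambda>, Lipschitz in s: the
  data for parameter integrals of H (L s p). The quotient of such an integral is an integral over
  the family of triples (L s x, \<Lambda> y, t), which is of the same kind. The excess 1 in the norm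
  leaves room for the parameter s itself.\<close>

definition affine_family :: "nat \<Rightarrow> nat \<Rightarrow> (real \<Rightarrow> ('n::finite \<Rightarrow> 'k, 'k) pt \<Rightarrow> ('n \<Rightarrow> 'k, 'k) pt) \<Rightarrow>
    (('n \<Rightarrow> 'k, 'k) pt \<Rightarrow> ('n \<Rightarrow> 'k, 'k) pt) \<Rightarrow> bool" where
  "affine_family i i' L \<Lambda> \<longleftrightarrow> (\<forall>p\<in>XX i. \<Lambda> p \<in> XX i' \<and> nrm (\<Lambda> p) \<le> nrm p \<and>
      (\<forall>q\<in>XX i. ptd (\<Lambda> p) (\<Lambda> q) \<le> ptd p q \<and> (\<forall>t. \<Lambda> (step Kn p t q) = step Kn (\<Lambda> p) t (\<Lambda> q))) \<and>
      (\<forall>s\<in>{0..1}. L s p \<in> XX i' \<and> nrm (L s p) \<le> nrm p + 1 \<and>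
        (\<forall>q\<in>XX i. ptd (L s p) (L s q) \<le> ptd p q \<and> (\<forall>t. L s (step Kn p t q) = step Kn (L s p) t (\<Lambda> q))) \<and>
        (\<forall>s'\<in>{0..1}. ptd (L s p) (L s' p) \<le> \<bar>s - s'\<bar>)))"

lemma affine_familyD:
  assumes "affine_family i i' L \<Lambda>" "p \<in> XX i"
  shows "\<Lambda> p \<in> XX i'" "nrm (\<Lambda> p) \<le> nrm p" "q \<in> XX i \<Longrightarrow> ptd (\<Lambda> p) (\<Lambda> q) \<le> ptd p q"
    "q \<in> XX i \<Longrightarrow> \<Lambda> (step Kn p t q) = step Kn (\<Lambda> p) t (\<Lambda> q)"
    "s \<in> {0..1} \<Longrightarrow> L s p \<in> XX i'" "s \<in> {0..1} \<Longrightarrow> nrm (L s p) \<le> nrm p + 1"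
    "s \<in> {0..1} \<Longrightarrow> q \<in> XX i \<Longrightarrow> ptd (L s p) (L s q) \<le> ptd p q"
    "s \<in> {0..1} \<Longrightarrow> q \<in> XX i \<Longrightarrow> L s (step Kn p t q) = step Kn (L s p) t (\<Lambda> q)"
    "s \<in> {0..1} \<Longrightarrow> s' \<in> {0..1} \<Longrightarrow> ptd (L s p) (L s' p) \<le> \<bar>s - s'\<bar>"
  using assms unfolding affine_family_def by blast+

lemma affine_familyI:
  assumes "\<And>p. p \<in> XX i \<Longrightarrow> \<Lambda> p \<in> XX i'" "\<And>p. p \<in> XX i \<Longrightarrow> nrm (\<Lambda> p) \<le> nrm p"
    "\<And>p q. p \<in> XX i \<Longrightarrow> q \<in> XX i \<Longrightarrow> ptd (\<Lambda> p) (\<Lambda> q) \<le> ptd p q"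
    "\<And>p q t. p \<in> XX i \<Longrightarrow> q \<in> XX i \<Longrightarrow> \<Lambda> (step Kn p t q) = step Kn (\<Lambda> p) t (\<Lambda> q)"
    "\<And>p s. p \<in> XX i \<Longrightarrow> s \<in> {0..1} \<Longrightarrow> L s p \<in> XX i'"
    "\<And>p s. p \<in> XX i \<Longrightarrow> s \<in> {0..1} \<Longrightarrow> nrm (L s p) \<le> nrm p + 1"
    "\<And>p q s. p \<in> XX i \<Longrightarrow> s \<in> {0..1} \<Longrightarrow> q \<in> XX i \<Longrightarrow> ptd (L s p) (L s q) \<le> ptd p q"
    "\<And>p q s t. p \<in> XX i \<Longrightarrow> s \<in> {0..1} \<Longrightarrow> q \<in> XX i \<Longrightarrow> L s (step Kn p t q) = step Kn (L s p) t (\<Lambda> q)"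
    "\<And>p s s'. p \<in> XX i \<Longrightarrow> s \<in> {0..1} \<Longrightarrow> s' \<in> {0..1} \<Longrightarrow> ptd (L s p) (L s' p) \<le> \<bar>s - s'\<bar>"
  shows "affine_family i i' L \<Lambda>"
  unfolding affine_family_def by (intro ballI conjI allI) (rule assms; assumption)+

lemma affine_family_Triple:
  fixes L :: "real \<Rightarrow> ('n::finite \<Rightarrow> 'k, 'k) pt \<Rightarrow> ('n \<Rightarrow> 'k, 'k) pt"
  assumes a: "affine_family i i' L \<Lambda>"
  shows "affine_family (Suc i) (Suc i') (\<lambda>s p. Triple (L s (pfst p)) (\<Lambda> (psnd p)) (pthd p))
    (\<lambda>p. Triple (\<Lambda> (pfst p)) (\<Lambda> (psnd p)) (pthd p))"
  (is "affine_family _ _ ?L ?\<Lambda>")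
proof (rule affine_familyI)
  note * = affine_familyD[OF a]
  fix p :: "('n \<Rightarrow> 'k, 'k) pt" assume "p \<in> XX (Suc i)"
  then obtain x y t where p: "p = Triple x y t" "x \<in> XX i" "y \<in> XX i" by (rule XX_cases)
  show "?\<Lambda> p \<in> XX (Suc i')" using *(1) p by simp
  show "nrm (?\<Lambda> p) \<le> nrm p" using *(2)[OF p(2)] *(2)[OF p(3)] by (auto simp: p)
  {
    fix s :: real assume s: "s \<in> {0..1}"
    show "?L s p \<in> XX (Suc i')" using *(1)[OF p(3)] *(5)[OF p(2) s] by (simp add: p)
    show "nrm (?L s p) \<le> nrm p + 1" using *(2)[OF p(3)] *(6)[OF p(2) s] by (auto simp: p)
    fix s' :: real assume "s' \<in> {0..1}"
    then show "ptd (?L s p) (?L s' p) \<le> \<bar>s - s'\<bar>" using *(9)[OF p(2) s] by (simp add: p)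
  }
  fix q :: "('n \<Rightarrow> 'k, 'k) pt" assume "q \<in> XX (Suc i)"
  then obtain x' y' t' where q: "q = Triple x' y' t'" "x' \<in> XX i" "y' \<in> XX i" by (rule XX_cases)
  show "ptd (?\<Lambda> p) (?\<Lambda> q) \<le> ptd p q" using *(3)[OF p(2) q(2)] *(3)[OF p(3) q(3)] by (auto simp: p q)
  show "?\<Lambda> (step Kn p u q) = step Kn (?\<Lambda> p) u (?\<Lambda> q)" for u
    using *(4)[OF p(2) q(2), of u] *(4)[OF p(3) q(3), of u] by (simp add: p q)
  fix s :: real assume s: "s \<in> {0..1}"
  show "ptd (?L s p) (?L s q) \<le> ptd p q" using *(7)[OF p(2) s q(2)] *(3)[OF p(3) q(3)] by (auto simp: p q)
  show "?L s (step Kn p u q) = step Kn (?L s p) u (?\<Lambda> q)" for u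
    using *(8)[OF p(2) s q(2), of u] *(4)[OF p(3) q(3), of u] by (simp add: p q)
qed

end

text \<open>K is merely isomorphic to the reals; \<phi> carries integration and differentiation over
  to K.\<close>

locale real_valued_field = valued_field absK for absK :: "'k::field \<Rightarrow> real" +
  fixes \<phi> :: "'k \<Rightarrow> real"
  assumes bij_phi: "bij \<phi>" and phi_1: "\<phi> 1 = 1"
    and phi_add: "\<phi> (x + y) = \<phi> x + \<phi> y" and phi_mult: "\<phi> (x * y) = \<phi> x * \<phi> y"
    and absK_phi: "absK x = \<bar>\<phi> x\<bar>"
begin

definition \<iota> :: "real \<Rightarrow> 'k" where "\<iota> = inv \<phi>"

lemma phi_iota [simp]: "\<phi> (\<iota> r) = r"
  unfolding \<iota>_def using bij_phi by (simp add: bij_is_surj surj_f_inv_f)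

lemma iota_phi [simp]: "\<iota> (\<phi> x) = x"
  unfolding \<iota>_def using bij_phi by (simp add: bij_is_inj)

lemma phi_eq_iff: "x = y \<longleftrightarrow> \<phi> x = \<phi> y"
  by (metis iota_phi)

lemma phi_0 [simp]: "\<phi> 0 = 0"
  using phi_add[of 0 0] by simp

lemma phi_minus: "\<phi> (- x) = - \<phi> x"
  using phi_add[of x "- x"] by simp

lemma phi_diff: "\<phi> (x - y) = \<phi> x - \<phi> y"
  using phi_add[of x "- y"] phi_minus[of y] by simp

lemma absK_iota [simp]: "absK (\<iota> r) = \<bar>r\<bar>"
  by (simp add: absK_phi)

lemma absK_iota_diff: "absK (\<iota> r - \<iota> s) = \<bar>r - s\<bar>"
  by (simp add: absK_phi phi_diff)

lemma continuous_on_affine_family: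
  assumes H: "Lb i' H" and a: "affine_family i i' L \<Lambda>" and p: "p \<in> XX i"
  shows "continuous_on {0..1} (\<lambda>s. \<phi> (H (L s p)))"
proof -
  note * = affine_familyD[OF a p]
  obtain C where C: "C \<ge> 0" "\<And>q r. q \<in> XX i' \<Longrightarrow> r \<in> XX i' \<Longrightarrow> nrm q \<le> nrm p + 1 \<Longrightarrow> nrm r \<le> nrm p + 1 \<Longrightarrow>
      absK (H q - H r) \<le> C * ptd q r"
    by (rule LbE[OF H, of "nrm p + 1"]) blast
  have "dist (\<phi> (H (L s p))) (\<phi> (H (L s' p))) \<le> C * dist s s'" if "s \<in> {0..1}" "s' \<in> {0..1}" for s s'
  proof -
    have "dist (\<phi> (H (L s p))) (\<phi> (H (L s' p))) = absK (H (L s p) - H (L s' p))"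
      by (simp add: dist_real_def absK_phi phi_diff)
    also have "\<dots> \<le> C * ptd (L s p) (L s' p)" using C(2) *(5,6) that by blast
    also have "\<dots> \<le> C * dist s s'" using *(9) that C(1) by (intro mult_left_mono) (auto simp: dist_real_def)
    finally show ?thesis .
  qed
  then have "C-lipschitz_on {0..1} (\<lambda>s. \<phi> (H (L s p)))" using C(1) by (intro lipschitz_onI)
  then show ?thesis by (rule lipschitz_on_continuous_on)
qed

lemma Lb_integral:
  assumes H: "Lb i' H" and a: "affine_family i i' L \<Lambda>"
  shows "Lb i (\<lambda>p. \<iota> (integral {0..1} (\<lambda>s. \<phi> (H (L s p)))))"
proof (rule LbI)
  fix R
  note * = affine_familyD[OF a]
  note cont = continuous_on_affine_family[OF H a]
  obtain C where C: "C \<ge> 0" "\<And>p. p \<in> XX i' \<Longrightarrow> nrm p \<le> R + 1 \<Longrightarrow> absK (H p) \<le> C"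
    "\<And>p q. p \<in> XX i' \<Longrightarrow> q \<in> XX i' \<Longrightarrow> nrm p \<le> R + 1 \<Longrightarrow> nrm q \<le> R + 1 \<Longrightarrow> absK (H p - H q) \<le> C * ptd p q"
    by (rule LbE[OF H, of "R + 1"]) blast
  have nr: "nrm (L s p) \<le> R + 1" if "p \<in> XX i" "nrm p \<le> R" "s \<in> {0..1}" for s p
    using *(6)[OF that(1,3)] that(2) by linarith
  have 1: "absK (\<iota> (integral {0..1} (\<lambda>s. \<phi> (H (L s p))))) \<le> C" if p: "p \<in> XX i" "nrm p \<le> R" for p
  proof -
    have "norm (integral {0..1} (\<lambda>s. \<phi> (H (L s p)))) \<le> C * (1 - 0)"
      by (rule integral_bound[OF _ cont[OF p(1)]]) (use C(2)[OF *(5)[OF p(1)] nr[OF p]] in \<open>auto simp: absK_phi\<close>)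
    then show ?thesis by simp
  qed
  have 2: "absK (\<iota> (integral {0..1} (\<lambda>s. \<phi> (H (L s p)))) - \<iota> (integral {0..1} (\<lambda>s. \<phi> (H (L s q))))) \<le> C * ptd p q"
    if p: "p \<in> XX i" and q: "q \<in> XX i" and n: "nrm p \<le> R" "nrm q \<le> R" for p q
  proof -
    have "integral {0..1} (\<lambda>s. \<phi> (H (L s p))) - integral {0..1} (\<lambda>s. \<phi> (H (L s q))) =
        integral {0..1} (\<lambda>s. \<phi> (H (L s p)) - \<phi> (H (L s q)))"
      using cont[OF p] cont[OF q] by (intro integral_diff[symmetric] integrable_continuous_interval)
    moreover have "norm (integral {0..1} (\<lambda>s. \<phi> (H (L s p)) - \<phi> (H (L s q)))) \<le> (C * ptd p q) * (1 - 0)"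
    proof (rule integral_bound)
      show "continuous_on {0..1} (\<lambda>s. \<phi> (H (L s p)) - \<phi> (H (L s q)))"
        by (intro continuous_on_diff cont p q)
      fix s :: real assume s: "s \<in> {0..1}"
      have "norm (\<phi> (H (L s p)) - \<phi> (H (L s q))) = absK (H (L s p) - H (L s q))"
        by (simp add: absK_phi phi_diff)
      also have "\<dots> \<le> C * ptd (L s p) (L s q)"
        by (rule C(3)[OF *(5)[OF p s] *(5)[OF q s] nr[OF p n(1) s] nr[OF q n(2) s]])
      also have "\<dots> \<le> C * ptd p q" using *(7)[OF p s q] C(1) by (rule mult_left_mono)
      finally show "norm (\<phi> (H (L s p)) - \<phi> (H (L s q))) \<le> C * ptd p q" .
    qed simp
    ultimately show ?thesis by (simp add: absK_iota_diff)
  qed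
  show "\<exists>C\<ge>0. \<exists>D\<ge>0. (\<forall>p\<in>XX i. nrm p \<le> R \<longrightarrow> absK (\<iota> (integral {0..1} (\<lambda>s. \<phi> (H (L s p))))) \<le> C) \<and>
    (\<forall>p\<in>XX i. \<forall>q\<in>XX i. nrm p \<le> R \<longrightarrow> nrm q \<le> R \<longrightarrow>
      absK (\<iota> (integral {0..1} (\<lambda>s. \<phi> (H (L s p)))) - \<iota> (integral {0..1} (\<lambda>s. \<phi> (H (L s q))))) \<le> D * ptd p q)"
    using C(1) 1 2 by (intro exI[of _ C] conjI ballI impI) auto
qed

text \<open>The relation between H and G along \<open>L s\<close> is integrated over s; the
  increment t does not depend on s and comes out of the integral.\<close>

lemma BB_integral:
  assumes "BB k i' H" "affine_family i i' L \<Lambda>"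
  shows "BB k i (\<lambda>p. \<iota> (integral {0..1} (\<lambda>s. \<phi> (H (L s p)))))"
  using assms
proof (induction k arbitrary: i i' L \<Lambda> H)
  case 0
  then show ?case using Lb_integral by simp
next
  case (Suc k i i' L \<Lambda> H)
  note a = affine_familyD[OF Suc.prems(2)]
  note a' = affine_family_Triple[OF Suc.prems(2)]
  let ?L = "\<lambda>s p. Triple (L s (pfst p)) (\<Lambda> (psnd p)) (pthd p)"
  obtain G where G: "Lb i' H" "BB k (Suc i') G"
    "\<And>x y t. x \<in> XX i' \<Longrightarrow> y \<in> XX i' \<Longrightarrow> H (step Kn x t y) = H x + t * G (Triple x y t)"
    by (rule BB_SucE[OF Suc.prems(1)]) blast
  show ?case
  proof (rule BB_SucI[OF Lb_integral[OF G(1) Suc.prems(2)] Suc.IH[OF G(2) a']])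
    fix x y :: "('a \<Rightarrow> 'k, 'k) pt" and t assume xy: "x \<in> XX i" "y \<in> XX i"
    have T: "Triple x y t \<in> XX (Suc i)" using xy by simp
    have "integral {0..1} (\<lambda>s. \<phi> (H (L s (step Kn x t y)))) =
        integral {0..1} (\<lambda>s. \<phi> (H (L s x)) + \<phi> t * \<phi> (G (?L s (Triple x y t))))"
    proof (rule integral_cong)
      fix s :: real assume s: "s \<in> {0..1}"
      have "H (L s (step Kn x t y)) = H (L s x) + t * G (?L s (Triple x y t))"
        using a(8)[OF xy(1) s xy(2), of t] G(3)[OF a(5)[OF xy(1) s] a(1)[OF xy(2)], of t] by simp
      then show "\<phi> (H (L s (step Kn x t y))) = \<phi> (H (L s x)) + \<phi> t * \<phi> (G (?L s (Triple x y t)))"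
        by (simp only: phi_add phi_mult)
    qed
    also have "\<dots> = integral {0..1} (\<lambda>s. \<phi> (H (L s x))) + integral {0..1} (\<lambda>s. \<phi> t * \<phi> (G (?L s (Triple x y t))))"
      using continuous_on_affine_family[OF G(1) Suc.prems(2) xy(1)]
        continuous_on_affine_family[OF DC_base[OF G(2)] a' T]
      by (intro integral_add integrable_continuous_interval continuous_on_mult_left)
    also have "\<dots> = integral {0..1} (\<lambda>s. \<phi> (H (L s x))) + \<phi> t * integral {0..1} (\<lambda>s. \<phi> (G (?L s (Triple x y t))))"
      by simp
    finally show "\<iota> (integral {0..1} (\<lambda>s. \<phi> (H (L s (step Kn x t y))))) = \<iota> (integral {0..1} (\<lambda>s. \<phi> (H (L s x)))) +
         t * \<iota> (integral {0..1} (\<lambda>s. \<phi> (G (?L s (Triple x y t)))))"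
      by (simp only: phi_eq_iff phi_add phi_mult phi_iota)
  qed
qed

text \<open>The derivative h' belongs to the class as well and is therefore continuous, hence
  bounded on [-C, C]; the mean value inequality turns this into a Lipschitz constant.\<close>

lemma Lb_comp_real:
  assumes \<H>: "\<And>h. h \<in> \<H> \<Longrightarrow> \<exists>h'\<in>\<H>. \<forall>x. (h has_real_derivative h' x) (at x)"
    and h: "h \<in> \<H>" and g: "Lb i g"
  shows "Lb i (\<lambda>p. \<iota> (h (\<phi> (g p))))"
proof (rule Lb_comp_Lipschitz[OF g])
  fix C :: real
  obtain h' where h': "h' \<in> \<H>" "\<And>x. (h has_real_derivative h' x) (at x)" using \<H>[OF h] by blast
  have "continuous_on {-C..C} h" using h'(2) DERIV_isCont continuous_at_imp_continuous_on by blast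
  then have "bounded (h ` {-C..C})" by (intro compact_imp_bounded compact_continuous_image) auto
  then obtain M where "\<forall>y\<in>h ` {-C..C}. norm y \<le> M" unfolding bounded_iff by blast
  then have M: "\<And>x. x \<in> {-C..C} \<Longrightarrow> \<bar>h x\<bar> \<le> M" by auto
  have "continuous_on {-C..C} h'" using \<H>[OF h'(1)] DERIV_isCont continuous_at_imp_continuous_on by blast
  then have "bounded (h' ` {-C..C})" by (intro compact_imp_bounded compact_continuous_image) auto
  then obtain B where "\<forall>y\<in>h' ` {-C..C}. norm y \<le> B" unfolding bounded_iff by blast
  then have B: "\<And>x. x \<in> {-C..C} \<Longrightarrow> \<bar>h' x\<bar> \<le> B" by auto
  have L: "\<bar>h x - h y\<bar> \<le> B * \<bar>x - y\<bar>" if "x \<in> {-C..C}" "y \<in> {-C..C}" for x y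
    using field_differentiable_bound[of "{-C..C}" h h' B x y] h'(2) B that
    by (auto intro: has_field_derivative_at_within)
  show "\<exists>D\<ge>0. \<forall>u v. absK u \<le> C \<longrightarrow> absK v \<le> C \<longrightarrow> u \<in> g ` XX i \<longrightarrow> v \<in> g ` XX i \<longrightarrow>
      absK (\<iota> (h (\<phi> u))) \<le> D \<and> absK (\<iota> (h (\<phi> u)) - \<iota> (h (\<phi> v))) \<le> D * absK (u - v)"
  proof (intro exI[of _ "max 0 (max M B)"] conjI allI impI)
    fix u v assume uv: "absK u \<le> C" "absK v \<le> C"
    then have c: "\<phi> u \<in> {-C..C}" "\<phi> v \<in> {-C..C}" by (auto simp: absK_phi)
    show "absK (\<iota> (h (\<phi> u))) \<le> max 0 (max M B)" using M[OF c(1)] by simp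
    have "absK (\<iota> (h (\<phi> u)) - \<iota> (h (\<phi> v))) \<le> B * absK (u - v)"
      using L[OF c] by (simp add: absK_iota_diff absK_phi phi_diff)
    also have "\<dots> \<le> max 0 (max M B) * absK (u - v)" by (intro mult_right_mono) auto
    finally show "absK (\<iota> (h (\<phi> u)) - \<iota> (h (\<phi> v))) \<le> max 0 (max M B) * absK (u - v)" .
  qed simp
qed

text \<open>The integration variable becomes the scalar entry of a point one level higher, with
  direction 0. A function of p and s is thereby a function on an iterated space, to which the
  results on chains apply.\<close>

lemma affine_family_param:
  "affine_family i (Suc i) (\<lambda>s p. Triple p (lt_zero (iter_sp absK Kn i)) (\<iota> s)) (\<lambda>p. Triple p (lt_zero (iter_sp absK Kn i)) 0)"
proof -
  let ?z = "lt_zero (iter_sp absK Kn i)"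
  have z: "?z \<in> XX i" by (rule tvs_zero[OF tvs_iter_sp[OF tvs_Kpow]])
  have zz: "step Kn ?z t ?z = ?z" for t using iter_simps[OF tvs_Kpow] z by metis
  have nz: "nrm (lt_zero (iter_sp absK Kn i)) = 0" for i
    by (induction i) auto
  show ?thesis
    by (rule affine_familyI) (auto simp: z zz[simplified] nz nrm_nonneg ptd_nonneg absK_iota_diff intro: add_increasing)
qed

text \<open>Hadamard's formula: h(a + b) - h(a) is b times the integral of h'(a + s b) over s in
  [0, 1], used with a = g(x) and b = t G. The class is closed under differentiation because the
  induction hypothesis is applied to h'.\<close>

lemma BB_comp_real:
  assumes \<H>: "\<And>h. h \<in> \<H> \<Longrightarrow> \<exists>h'\<in>\<H>. \<forall>x. (h has_real_derivative h' x) (at x)"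
    and "h \<in> \<H>" "BB k i (g :: ('n::finite \<Rightarrow> 'k, 'k) pt \<Rightarrow> 'k)"
  shows "BB k i (\<lambda>p. \<iota> (h (\<phi> (g p))))"
  using assms(2,3)
proof (induction k arbitrary: i g h)
  case (0 i g h)
  then show ?case using Lb_comp_real[OF \<H>] by simp
next
  case (Suc k i g h)
  obtain h' where h': "h' \<in> \<H>" "\<And>x. (h has_real_derivative h' x) (at x)" using \<H>[OF Suc.prems(1)] by blast
  obtain G where G: "Lb i g" "BB k (Suc i) G"
    "\<And>x y t. x \<in> XX i \<Longrightarrow> y \<in> XX i \<Longrightarrow> g (step Kn x t y) = g x + t * G (Triple x y t)"
    by (rule BB_SucE[OF Suc.prems(2)]) blast
  \<comment> \<open>At the point (p, 0, s) with p = (x, y, t) this is g(x) + s t G(p), the argument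
    of h' under the integral.\<close>
  define \<Phi> where "\<Phi> = (\<lambda>p. g (pfst (pfst p)) + pthd p * (pthd (pfst p) * G (pfst p)))"
  have "BB k (Suc (Suc i)) \<Phi>"
    unfolding \<Phi>_def
    by (intro BB_add BB_mult BB_pthd BB_pfst[OF BB_pfst[OF DC_Suc[OF Suc.prems(2)]]] BB_pfst[OF BB_pthd] BB_pfst[OF G(2)])
  then have H: "BB k (Suc (Suc i)) (\<lambda>p. \<iota> (h' (\<phi> (\<Phi> p))))" by (rule Suc.IH[OF h'(1)])
  let ?z = "lt_zero (iter_sp absK (Kn :: ('n \<Rightarrow> 'k, 'k) lin_top) (Suc i))"
  let ?J = "\<lambda>p. \<iota> (integral {0..1} (\<lambda>s. \<phi> (\<iota> (h' (\<phi> (\<Phi> (Triple p ?z (\<iota> s))))))))"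
  have J: "BB k (Suc i) ?J" by (rule BB_integral[OF H affine_family_param])
  show ?case
  proof (rule BB_SucI[OF Lb_comp_real[OF \<H> Suc.prems(1) G(1)] BB_mult[OF G(2) J]])
    fix x y :: "('n \<Rightarrow> 'k, 'k) pt" and t assume xy: "x \<in> XX i" "y \<in> XX i"
    define a b where "a = \<phi> (g x)" and "b = \<phi> (t * G (Triple x y t))"
    have "((\<lambda>s. b * h' (a + s * b)) has_integral (h (a + 1 * b) - h (a + 0 * b))) {0..1}"
    proof (rule fundamental_theorem_of_calculus)
      fix s :: real
      have "((\<lambda>s. h (a + s * b)) has_real_derivative h' (a + s * b) * b) (at s)"
        by (rule DERIV_chain2[OF h'(2)]) (auto intro!: derivative_eq_intros)
      then show "((\<lambda>s. h (a + s * b)) has_vector_derivative b * h' (a + s * b)) (at s within {0..1})"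
        by (simp add: has_real_derivative_iff_has_vector_derivative mult.commute has_vector_derivative_at_within)
    qed simp
    then have "integral {0..1} (\<lambda>s. b * h' (a + s * b)) = h (a + 1 * b) - h (a + 0 * b)"
      by (rule integral_unique)
    then have "h (a + b) = h a + integral {0..1} (\<lambda>s. b * h' (a + s * b))" by simp
    also have "\<dots> = h a + b * integral {0..1} (\<lambda>s. h' (a + s * b))" by simp
    finally have e: "h (a + b) = h a + b * integral {0..1} (\<lambda>s. h' (a + s * b))" .
    have J': "?J (Triple x y t) = \<iota> (integral {0..1} (\<lambda>s. h' (a + s * b)))"
      by (simp add: \<Phi>_def a_def b_def phi_add phi_mult)
    have "\<phi> (g (step Kn x t y)) = a + b" using G(3)[OF xy, of t] by (simp only: a_def b_def phi_add)
    then show "\<iota> (h (\<phi> (g (step Kn x t y)))) = \<iota> (h (\<phi> (g x))) + t * (G (Triple x y t) * ?J (Triple x y t))"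
      unfolding J' using e by (simp only: phi_eq_iff phi_add phi_mult phi_iota) (simp add: a_def b_def phi_mult)
  qed
qed

end

text \<open>The functions that arise by differentiating exp(-1/x): powers of 1/x times this
  function, extended by 0.\<close>

definition flat :: "nat \<Rightarrow> real \<Rightarrow> real" where
  "flat m x = (if 0 < x then exp (- inverse x) * inverse x ^ m else 0)"

lemma flat_has_derivative: "(flat m has_real_derivative flat (m + 2) x - real m * flat (m + 1) x) (at x)"
proof -
  consider "0 < x" | "x < 0" | "x = 0" by linarith
  then show ?thesis
  proof cases
    case 1
    have "((\<lambda>x. exp (- inverse x) * inverse x ^ m) has_real_derivative flat (m + 2) x - real m * flat (m + 1) x) (at x)"
      using 1 by (cases m) (auto intro!: derivative_eq_intros simp: flat_def power2_eq_square algebra_simps,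
        metis Suc_pred neq0_conv power_Suc)
    then show ?thesis
      by (rule has_field_derivative_transform_within_open[of _ _ _ "{0<..}"]) (use 1 in \<open>auto simp: flat_def\<close>)
  next
    case 2
    have "((\<lambda>x. 0) has_real_derivative flat (m + 2) x - real m * flat (m + 1) x) (at x)"
      using 2 by (simp add: flat_def)
    then show ?thesis
      by (rule has_field_derivative_transform_within_open[of _ _ _ "{..<0}"]) (use 2 in \<open>auto simp: flat_def\<close>)
  next
    case 3
    have "((\<lambda>y. flat m y / y) \<longlongrightarrow> 0) (at_left 0)"
      by (rule tendsto_eventually) (auto simp: flat_def eventually_at_left_field intro: exI[of _ "-1"])
    \<comment> \<open>With z = 1/y this is the fact that exp z grows faster than any power of
      z.\<close>
    moreover have "((\<lambda>y. flat m y / y) \<longlongrightarrow> 0) (at_right 0)"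
    proof (rule Lim_transform_eventually)
      show "((\<lambda>y. inverse y ^ (m + 1) / exp (inverse y :: real)) \<longlongrightarrow> 0) (at_right 0)"
        by (rule filterlim_compose[OF tendsto_power_div_exp_0 filterlim_inverse_at_top_right])
      have "\<forall>\<^sub>F y in at_right 0. (0::real) < y" by (simp add: eventually_at_right_less)
      then show "\<forall>\<^sub>F y in at_right 0. inverse y ^ (m + 1) / exp (inverse y) = flat m y / y"
        by eventually_elim (simp add: flat_def exp_minus divide_inverse)
    qed
    ultimately have "((\<lambda>y. flat m y / y) \<longlongrightarrow> 0) (at 0)" by (simp add: filterlim_split_at_real)
    then show ?thesis using 3 by (simp add: has_field_derivative_iff flat_def)
  qed
qed

text \<open>The linear span of the functions \<open>flat m\<close>; it is closed under
  differentiation, as \<open>BB_comp_real\<close> demands.\<close>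

inductive_set flats :: "(real \<Rightarrow> real) set" where
  "flat m \<in> flats"
| "h \<in> flats \<Longrightarrow> (\<lambda>x. c * h x) \<in> flats"
| "h \<in> flats \<Longrightarrow> h' \<in> flats \<Longrightarrow> (\<lambda>x. h x + h' x) \<in> flats"

lemma flats_derivative: "h \<in> flats \<Longrightarrow> \<exists>h'\<in>flats. \<forall>x. (h has_real_derivative h' x) (at x)"
proof (induction rule: flats.induct)
  case (1 m)
  have "(\<lambda>x. flat (m + 2) x + (- real m) * flat (m + 1) x) \<in> flats" by (intro flats.intros)
  then show ?case using flat_has_derivative[of m] by (intro bexI) auto
next
  case (2 h c)
  then obtain h' where "h' \<in> flats" "\<forall>x. (h has_real_derivative h' x) (at x)" by blast
  then show ?case by (intro bexI[of _ "\<lambda>x. c * h' x"]) (auto intro: flats.intros DERIV_cmult)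
next
  case (3 h g)
  then obtain h' g' where "h' \<in> flats" "\<forall>x. (h has_real_derivative h' x) (at x)"
    "g' \<in> flats" "\<forall>x. (g has_real_derivative g' x) (at x)" by blast
  then show ?case by (intro bexI[of _ "\<lambda>x. h' x + g' x"]) (auto intro: flats.intros DERIV_add)
qed

definition smooth_step :: "real \<Rightarrow> real" where
  "smooth_step x = flat 0 x * inverse (flat 0 x + flat 0 (1 - x))"

lemma flat_0_nonneg: "0 \<le> flat 0 x"
  by (simp add: flat_def)

text \<open>One of x and 1 - x is at least 1/2, and there \<open>flat 0\<close> is at least exp(-2).
  The bound is uniform in x, as required for taking reciprocals with
  \<open>BB_inverse\<close>.\<close>

lemma flat_0_sum_ge: "exp (-2) \<le> flat 0 x + flat 0 (1 - x)"
proof -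
  have "exp (-2) \<le> flat 0 y" if "1/2 \<le> y" for y :: real
  proof -
    have "inverse y \<le> inverse (1/2)" using that by (intro le_imp_inverse_le) auto
    then show ?thesis using that by (simp add: flat_def)
  qed
  then show ?thesis using flat_0_nonneg[of x] flat_0_nonneg[of "1 - x"]
    by (cases "1/2 \<le> x") (auto intro: add_increasing add_increasing2)
qed

lemma smooth_step_bounds: "0 \<le> smooth_step x" "smooth_step x \<le> 1"
  and smooth_step_0: "x \<le> 0 \<Longrightarrow> smooth_step x = 0" and smooth_step_1: "1 \<le> x \<Longrightarrow> smooth_step x = 1"
proof -
  have p: "0 < flat 0 x + flat 0 (1 - x)" using flat_0_sum_ge[of x] exp_gt_zero[of "-2::real"] by linarith
  show "0 \<le> smooth_step x" "smooth_step x \<le> 1"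
    using p flat_0_nonneg[of x] flat_0_nonneg[of "1 - x"]
    by (auto simp: smooth_step_def field_simps)
  show "x \<le> 0 \<Longrightarrow> smooth_step x = 0" by (simp add: smooth_step_def flat_def)
  show "1 \<le> x \<Longrightarrow> smooth_step x = 1" using p by (simp add: smooth_step_def flat_def)
qed

context real_valued_field
begin

lemma BB_smooth_step:
  assumes "BB k i (g :: ('n::finite \<Rightarrow> 'k, 'k) pt \<Rightarrow> 'k)"
  shows "BB k i (\<lambda>p. \<iota> (smooth_step (\<phi> (g p))))"
proof -
  have f: "BB k i (\<lambda>p. \<iota> (flat 0 (\<phi> (h p))))" if "BB k i h" for h :: "('n \<Rightarrow> 'k, 'k) pt \<Rightarrow> 'k"
    by (rule BB_comp_real[OF flats_derivative flats.intros(1) that])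
  let ?w = "\<lambda>p. \<iota> (flat 0 (\<phi> (g p))) + \<iota> (flat 0 (\<phi> (1 - g p)))"
  have w: "BB k i ?w" by (intro BB_add f BB_diff BB_const assms)
  have w': "\<phi> (?w p) = flat 0 (\<phi> (g p)) + flat 0 (1 - \<phi> (g p))" for p
    by (simp add: phi_add phi_diff phi_1)
  have "BB k i (\<lambda>p. inverse (?w p))"
    by (rule BB_inverse[OF w, of "exp (-2)"]) (use flat_0_sum_ge in \<open>auto simp: absK_phi w' intro: order_trans[OF _ abs_ge_self]\<close>)
  from BB_mult[OF f[OF assms] this]
  have "BB k i (\<lambda>p. \<iota> (flat 0 (\<phi> (g p))) * inverse (?w p))" .
  moreover have "\<iota> (flat 0 (\<phi> (g p))) * inverse (?w p) = \<iota> (smooth_step (\<phi> (g p)))" for p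
  proof -
    have "?w p \<noteq> 0" using w'[of p] flat_0_sum_ge[of "\<phi> (g p)"] exp_gt_zero[of "-2::real"] by auto
    then have "\<phi> (inverse (?w p)) * \<phi> (?w p) = 1" by (simp add: phi_1 flip: phi_mult)
    then have "\<phi> (inverse (?w p)) = inverse (\<phi> (?w p))" by (metis inverse_unique mult.commute)
    then show ?thesis by (simp only: phi_eq_iff phi_mult w' phi_iota smooth_step_def)
  qed
  ultimately show ?thesis by simp
qed

lemma real_bump: "\<exists>\<eta>. bump \<eta> \<and> smooth_scalar TYPE('n::finite) \<eta>"
proof -
  \<comment> \<open>For |s| \<le> 1 both arguments are at least 1; for |s| \<ge> 2 one of them is at
    most 0.\<close>
  define \<eta> where "\<eta> = (\<lambda>s. \<iota> (smooth_step (\<phi> (\<iota> 2 + s))) * \<iota> (smooth_step (\<phi> (\<iota> 2 - s))))"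
  have \<phi>: "\<phi> (\<eta> s) = smooth_step (2 + \<phi> s) * smooth_step (2 - \<phi> s)" for s
    by (simp add: \<eta>_def phi_mult phi_add phi_diff)
  have "smooth_scalar TYPE('n) \<eta>"
    unfolding smooth_scalar_def \<eta>_def
    by (intro allI impI BB_mult BB_smooth_step BB_add BB_diff BB_const)
  moreover have "bump \<eta>"
    unfolding bump_def
  proof (intro conjI allI impI)
    fix s assume "absK s \<le> 1"
    then have "\<phi> (\<eta> s) = 1" unfolding \<phi> by (subst (1 2) smooth_step_1) (auto simp: absK_phi)
    then show "\<eta> s = 1" by (simp add: phi_eq_iff phi_1)
  next
    fix s assume "2 \<le> absK s"
    then have "\<phi> s \<ge> 2 \<or> \<phi> s \<le> -2" by (auto simp: absK_phi abs_if split: if_splits)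
    then have "\<phi> (\<eta> s) = 0" unfolding \<phi> by (auto simp: smooth_step_0)
    then show "\<eta> s = 0" by (simp add: phi_eq_iff)
  next
    fix s show "absK (\<eta> s) \<le> 1"
      unfolding absK_phi \<phi> using smooth_step_bounds by (simp add: abs_mult mult_le_one)
  qed
  ultimately show ?thesis by blast
qed

end

text \<open>The place where the two kinds of fields are treated separately; afterwards only the
  properties of \<open>\<eta>\<close> are used.\<close>

lemma bump_exists:
  fixes absK :: "'k::field \<Rightarrow> real"
  assumes "is_real_field absK \<or> ultrametric_field absK"
  obtains \<eta> where "valued_field absK" "valued_field.bump absK \<eta>" "valued_field.smooth_scalar absK TYPE('n::finite) \<eta>"
  using assms
proof
  assume r: "is_real_field absK"
  interpret valued_field absK by (rule valued_field_real[OF r])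
  obtain \<phi> :: "'k \<Rightarrow> real" where \<phi>: "bij \<phi>" "\<phi> 1 = 1"
    "\<And>x y. \<phi> (x + y) = \<phi> x + \<phi> y" "\<And>x y. \<phi> (x * y) = \<phi> x * \<phi> y" "\<And>x. absK x = \<bar>\<phi> x\<bar>"
    using r unfolding is_real_field_def by blast
  interpret real_valued_field absK \<phi> by unfold_locales (use \<phi> in auto)
  show thesis using that real_bump valued_field_axioms by blast
next
  assume u: "ultrametric_field absK"
  interpret valued_field absK by (rule valued_field_ultrametric[OF u])
  show thesis using that ultrametric_bump valued_field_axioms u unfolding ultrametric_field_def by blast
qed

section \<open>Cutoffs, reciprocals and locality of Hoelder differentiability on powers of K\<close>

section \<open>Locality\<close>

context valued_field
begin

lemma smooth_scalar_compose:
  "smooth_scalar TYPE('n::finite) h \<Longrightarrow> smooth_scalar TYPE('n) h' \<Longrightarrow> smooth_scalar TYPE('n) (\<lambda>s. h (h' s))"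
  by (simp add: smooth_scalar_def)

lemma smooth_scalar_mult:
  "smooth_scalar TYPE('n::finite) h \<Longrightarrow> smooth_scalar TYPE('n) h' \<Longrightarrow> smooth_scalar TYPE('n) (\<lambda>s. h s * h' s)"
  by (simp add: smooth_scalar_def BB_mult)

lemma smooth_scalar_add:
  "smooth_scalar TYPE('n::finite) h \<Longrightarrow> smooth_scalar TYPE('n) h' \<Longrightarrow> smooth_scalar TYPE('n) (\<lambda>s. h s + h' s)"
  by (simp add: smooth_scalar_def BB_add)

lemma smooth_scalar_const: "smooth_scalar TYPE('n::finite) (\<lambda>_. c)"
  by (simp add: smooth_scalar_def BB_const)

lemma smooth_scalar_id: "smooth_scalar TYPE('n::finite) (\<lambda>s. s)"
  by (simp add: smooth_scalar_def)

text \<open>A smooth clamp: the identity for |s| \<le> |c| and bounded by 2 |c| everywhere. It makes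
  globally defined maps out of local ones without changing them near a point.\<close>

definition cut :: "('k \<Rightarrow> 'k) \<Rightarrow> 'k \<Rightarrow> 'k \<Rightarrow> 'k" where
  "cut \<eta> c s = s * \<eta> (s / c)"

lemma smooth_scalar_cut: "smooth_scalar TYPE('n::finite) \<eta> \<Longrightarrow> smooth_scalar TYPE('n) (cut \<eta> c)"
  unfolding cut_def divide_inverse
  by (rule smooth_scalar_mult[OF smooth_scalar_id smooth_scalar_compose[of \<eta>]])
     (assumption, rule smooth_scalar_mult[OF smooth_scalar_id smooth_scalar_const])

lemma cut_eq: "bump \<eta> \<Longrightarrow> c \<noteq> 0 \<Longrightarrow> absK s \<le> absK c \<Longrightarrow> cut \<eta> c s = s"
  by (simp add: cut_def bump_def absK_divide)

lemma cut_bound: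
  assumes "bump \<eta>" "c \<noteq> 0"
  shows "absK (cut \<eta> c s) \<le> 2 * absK c"
proof (cases "2 \<le> absK (s / c)")
  case True
  then show ?thesis using assms by (simp add: cut_def bump_def)
next
  case False
  then have "absK s \<le> 2 * absK c" using assms(2) by (simp add: absK_divide field_simps)
  moreover have "absK (cut \<eta> c s) \<le> absK s * 1"
    unfolding cut_def absK_mult using assms(1) by (intro mult_left_mono) (auto simp: bump_def)
  ultimately show ?thesis by simp
qed

lemma reciprocal_near:
  assumes b: "bump \<eta>" "smooth_scalar TYPE('n::finite) \<eta>" and t0: "t0 \<noteq> 0"
  obtains \<rho> c where "0 < c" "c \<le> absK t0" "\<And>s. absK (s - t0) < c \<Longrightarrow> \<rho> s = inverse s" "smooth_scalar TYPE('n) \<rho>"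
proof -
  \<comment> \<open>As the clamp is bounded by 2 |d| < |t0| / 2, the clamped variable keeps a
    distance of at least |t0| / 2 from 0.\<close>
  obtain d where d: "d \<noteq> 0" "absK d < absK t0 / 4" using nontrivial[of "absK t0 / 4"] t0 by auto
  define w where "w = (\<lambda>s. t0 + cut \<eta> d (s - t0))"
  have w_ge: "absK t0 / 2 \<le> absK (w s)" for s
    using cut_bound[OF b(1) d(1), of "s - t0"] d(2) absK_diff[of "w s" "cut \<eta> d (s - t0)"] by (simp add: w_def)
  have "smooth_scalar TYPE('n) w"
    unfolding w_def diff_conv_add_uminus
    by (intro smooth_scalar_add smooth_scalar_const smooth_scalar_id
        smooth_scalar_compose[OF smooth_scalar_cut[OF b(2)]])
  then have "smooth_scalar TYPE('n) (\<lambda>s. inverse (w s))"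
    unfolding smooth_scalar_def using t0 w_ge by (intro allI impI BB_inverse[where c="absK t0 / 2"]) auto
  moreover have "w s = s" if "absK (s - t0) < absK d" for s
    using cut_eq[OF b(1) d(1), of "s - t0"] that by (simp add: w_def)
  moreover have "absK d \<le> absK t0" using d(2) absK_nonneg[of t0] by linarith
  ultimately show ?thesis using that[of "absK d" "\<lambda>s. inverse (w s)"] d(1) by simp
qed

abbreviation DH :: "('f, 'k) lin_top \<Rightarrow> real \<Rightarrow> nat \<Rightarrow> nat \<Rightarrow> (('n::finite \<Rightarrow> 'k, 'k) pt \<Rightarrow> 'f) \<Rightarrow> bool" where
  "DH F \<sigma> \<equiv> DC Kn F UNIV (Hol Kn F UNIV \<sigma>)"

text \<open>\<open>Lb\<close> refers to a norm and \<open>Hol\<close> to gauges. Instead of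
  comparing them, \<open>Lb\<close> is weakened to continuity, and one further order of continuity
  gives the Lipschitz property.\<close>

lemma BB_DH:
  assumes "\<And>k. BB k i g"
  shows "DH (Kt absK) 1 k i g"
proof (rule DC_Cont_Hol[OF tvs_Kpow tvs_Kt openin_Kn_UNIV])
  show "DC Kn (Kt absK) UNIV (Cont Kn (Kt absK) UNIV) (Suc k) i g"
    by (rule DC_mono[OF assms]) (rule Lb_Cont)
qed

definition quot :: "('a, 'k) lin_top \<Rightarrow> ('f, 'k) lin_top \<Rightarrow> (('a, 'k) pt \<Rightarrow> 'f) \<Rightarrow> ('a, 'k) pt \<Rightarrow> ('a, 'k) pt \<Rightarrow> 'k \<Rightarrow> 'f" where
  "quot A F g x y t = lt_smul F (inverse t) (lt_sub F (g (step A x t y)) (g x))"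

text \<open>A candidate for the quotient that is determined by g alone, so that information obtained
  locally or along single test maps concerns one and the same function. At t = 0 it is the punctured
  limit, if there is one.\<close>

definition ext_quot :: "('a, 'k) lin_top \<Rightarrow> ('f, 'k) lin_top \<Rightarrow> (('a, 'k) pt \<Rightarrow> 'f) \<Rightarrow> ('a, 'k) pt \<Rightarrow> 'f" where
  "ext_quot A F g p = (if pthd p = 0 then SOME v. lim0 F (quot A F g (pfst p) (psnd p)) v
     else quot A F g (pfst p) (psnd p) (pthd p))"

lemma ext_quot_zero:
  assumes "tvs F" "lim0 F (quot A F g x y) v"
  shows "ext_quot A F g (Triple x y 0) = v"
  using assms lim0_unique[OF assms(1)] by (auto simp: ext_quot_def intro: someI2)

lemma ext_quot_nonzero: "t \<noteq> 0 \<Longrightarrow> ext_quot A F g (Triple x y t) = quot A F g x y t"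
  by (simp add: ext_quot_def)

lemma step_zero: "tvs A \<Longrightarrow> x \<in> carr (iter_sp absK A i) \<Longrightarrow> y \<in> carr (iter_sp absK A i) \<Longrightarrow> step A x 0 y = x"
  by (simp add: iter_simps)

lemma quot_eqI:
  assumes "tvs F" "g x \<in> carr F" "v \<in> carr F" "t \<noteq> 0" "g (step A x t y) = lt_add F (g x) (lt_smul F t v)"
  shows "quot A F g x y t = v"
  unfolding quot_def assms(5) using assms(1-4) by (simp add: tvs_add_sub_cancel tvs_smul tvs_smul_smul tvs_one)

lemma quot_rel:
  assumes "tvs F" "g x \<in> carr F" "g (step A x t y) \<in> carr F" "t \<noteq> 0"
  shows "g (step A x t y) = lt_add F (g x) (lt_smul F t (quot A F g x y t))"
  unfolding quot_def using assms by (simp add: tvs_smul_smul tvs_one tvs_sub tvs_add_sub)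

lemma diff_rel_ext_quot:
  assumes A: "tvs A" "tvs F" and V: "V \<subseteq> carr A" and g: "\<And>p. p \<in> bgn_dom absK A V i \<Longrightarrow> g p \<in> carr F"
    and q: "\<And>p. p \<in> bgn_dom absK A V (Suc i) \<Longrightarrow> ext_quot A F g p \<in> carr F"
  shows "diff_rel A F V i g (ext_quot A F g)"
  unfolding diff_rel_def
proof (intro allI impI)
  fix x y t assume d: "Triple x y t \<in> bgn_dom absK A V (Suc i)"
  then have c: "g x \<in> carr F" "g (step A x t y) \<in> carr F" using g by auto
  show "g (step A x t y) = lt_add F (g x) (lt_smul F t (ext_quot A F g (Triple x y t)))"
  proof (cases "t = 0")
    case True
    have "Triple x y t \<in> carr (iter_sp absK A (Suc i))" using d bgn_dom_subset[OF V] by blast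
    then have "x \<in> carr (iter_sp absK A i)" "y \<in> carr (iter_sp absK A i)" by auto
    then have "step A x t y = x" using step_zero[OF A(1)] True by blast
    then show ?thesis using True c q[OF d] A(2) by (simp add: tvs_smul_0 tvs_zero_right)
  next
    case False
    then show ?thesis using quot_rel[OF A(2) c False] by (simp add: ext_quot_nonzero)
  qed
qed

lemma openin_step_preimage:
  assumes A: "tvs A" and N: "openin (lt_top (iter_sp absK A i)) N"
  shows "openin (lt_top (iter_sp absK A (Suc i))) {p \<in> carr (iter_sp absK A (Suc i)). step A (pfst p) (pthd p) (psnd p) \<in> N}"
proof -
  have "continuous_map (lt_top (iter_sp absK A (Suc i))) (lt_top (iter_sp absK A i))
      (\<lambda>p. lt_add (iter_sp absK A i) (pfst p) (lt_smul (iter_sp absK A i) (pthd p) (psnd p)))"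
    by (intro continuous_map_tvs_add continuous_map_tvs_smul tvs_iter_sp A
        continuous_map_pfst continuous_map_psnd continuous_map_pthd)
  from openin_continuous_map_preimage[OF this N] show ?thesis by simp
qed

text \<open>The quotient at (x, y, t) involves the two points x and x + t y, which may be far apart.
  For t0 = 0 both lie in one neighbourhood, and the quotient of a single local model serves. For t0
  \<noteq> 0 two local models occur, but division by t is smooth near t0.\<close>

lemma DH_local:
  assumes b: "bump \<eta>" "smooth_scalar TYPE('n::finite) \<eta>" and F: "tvs F" and \<sigma>: "0 < \<sigma>" "\<sigma> \<le> 1"
    and loc: "\<And>p. p \<in> XX i \<Longrightarrow> \<exists>N g'. openin (lt_top (iter_sp absK Kn i)) N \<and> p \<in> N \<and> DH F \<sigma> k i g' \<and> (\<forall>q\<in>N. g q = g' q)"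
  shows "DH F \<sigma> k i (g :: ('n \<Rightarrow> 'k, 'k) pt \<Rightarrow> 'f)"
  using loc
proof (induction k arbitrary: i g)
  case 0
  have "Hol Kn F UNIV \<sigma> i g"
  proof (rule hoelder_local)
    show "openin (lt_top (iter_sp absK (Kn :: ('n \<Rightarrow> 'k, 'k) lin_top) i)) (bgn_dom absK Kn UNIV i)"
      by (rule openin_bgn_dom[OF tvs_Kpow openin_Kn_UNIV])
    fix p :: "('n \<Rightarrow> 'k, 'k) pt" assume "p \<in> bgn_dom absK Kn UNIV i"
    then show "\<exists>N h. openin (lt_top (iter_sp absK Kn i)) N \<and> p \<in> N \<and> Hol Kn F UNIV \<sigma> i h \<and> (\<forall>x\<in>N \<inter> bgn_dom absK Kn UNIV i. g x = h x)"
      using 0[of p] by (simp add: DC.simps) blast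
  qed
  then show ?case by simp
next
  case (Suc k i g)
  let ?A = "Kn :: ('n \<Rightarrow> 'k, 'k) lin_top"
  note A = tvs_Kpow[where 'n='n] and V = openin_Kn_UNIV[where 'n='n]
  let ?G = "ext_quot ?A F g"
  have hol: "Hol ?A F UNIV \<sigma> i g"
  proof (rule hoelder_local[OF openin_bgn_dom[OF A V]])
    fix p :: "('n \<Rightarrow> 'k, 'k) pt" assume "p \<in> bgn_dom absK Kn UNIV i"
    then obtain N g' where "openin (lt_top (iter_sp absK ?A i)) N" "p \<in> N" "DH F \<sigma> (Suc k) i g'" "\<forall>q\<in>N. g q = g' q"
      using Suc.prems[of p] by auto
    then show "\<exists>N h. openin (lt_top (iter_sp absK ?A i)) N \<and> p \<in> N \<and> Hol ?A F UNIV \<sigma> i h \<and> (\<forall>x\<in>N \<inter> bgn_dom absK Kn UNIV i. g x = h x)"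
      using DC_base[of ?A F UNIV "Hol ?A F UNIV \<sigma>" "Suc k" i g'] by blast
  qed
  have gc: "g p \<in> carr F" if "p \<in> XX i" for p using hoelder_carr[OF hol] that by simp
  have loc: "\<exists>N h. openin (lt_top (iter_sp absK ?A (Suc i))) N \<and> p0 \<in> N \<and> DH F \<sigma> k (Suc i) h \<and> (\<forall>q\<in>N. ?G q = h q)"
    if p0: "p0 \<in> XX (Suc i)" for p0
  proof -
    obtain x0 y0 t0 where xyt: "p0 = Triple x0 y0 t0" "x0 \<in> XX i" "y0 \<in> XX i" by (rule XX_cases[OF p0])
    obtain N1 g1 where N1: "openin (lt_top (iter_sp absK ?A i)) N1" "x0 \<in> N1" "DH F \<sigma> (Suc k) i g1" "\<forall>q\<in>N1. g q = g1 q"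
      using Suc.prems[OF xyt(2)] by blast
    obtain G1 where G1: "diff_rel ?A F UNIV i g1 G1" "DH F \<sigma> k (Suc i) G1" using N1(3) by auto
    note s0 = XX_step[OF xyt(2,3)]
    obtain N2 g2 where N2: "openin (lt_top (iter_sp absK ?A i)) N2" "step ?A x0 t0 y0 \<in> N2" "DH F \<sigma> (Suc k) i g2" "\<forall>q\<in>N2. g q = g2 q"
      using Suc.prems[OF s0] by blast
    obtain G2 where G2: "diff_rel ?A F UNIV i g2 G2" "DH F \<sigma> k (Suc i) G2" using N2(3) by auto
    have G1c: "G1 p \<in> carr F" if "p \<in> XX (Suc i)" for p
      using that by (intro hoelder_carr[OF DC_base[OF G1(2)]]) (simp only: bgn_dom_Kn)
    have rel: "g1 (step ?A x t y) = lt_add F (g1 x) (lt_smul F t (G1 (Triple x y t)))"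
      "g2 (step ?A x t y) = lt_add F (g2 x) (lt_smul F t (G2 (Triple x y t)))" if "x \<in> XX i" "y \<in> XX i" for x y t
      using diff_relD[OF G1(1), of x y t] diff_relD[OF G2(1), of x y t] that by (simp_all del: bgn_dom.simps Kpow_simps)
    show ?thesis
    proof (cases "t0 = 0")
      case True
      define N where "N = {p \<in> XX (Suc i). pfst p \<in> N1} \<inter> {p \<in> XX (Suc i). step ?A (pfst p) (pthd p) (psnd p) \<in> N1}"
      have "openin (lt_top (iter_sp absK ?A (Suc i))) N"
        unfolding N_def by (intro openin_Int openin_continuous_map_preimage[OF continuous_map_pfst N1(1)]
            openin_step_preimage[OF A N1(1)])
      moreover have "p0 \<in> N" using N1(2) p0 xyt True step_zero[OF A xyt(2,3)] by (simp add: N_def del: Kpow_simps)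
      moreover have "?G q = G1 q" if q: "q \<in> N" for q
      proof -
        obtain x y t where xy: "q = Triple x y t" "x \<in> XX i" "y \<in> XX i"
          using q by (auto simp: N_def elim: XX_cases)
        have xN: "x \<in> N1" "step ?A x t y \<in> N1" using q xy by (auto simp: N_def)
        have quot: "quot ?A F g x y s = G1 (Triple x y s)" if "s \<noteq> 0" "step ?A x s y \<in> N1" for s
          by (rule quot_eqI[where g=g and x=x, OF F gc[OF xy(2)]])
            (use that xy xN N1(4) rel(1)[OF xy(2,3), of s] G1c[of "Triple x y s"] in auto)
        show ?thesis
        proof (cases "t = 0")
          case False
          then show ?thesis using quot xN(2) xy by (simp add: ext_quot_nonzero)
        next
          case t: True
          have T: "Triple x y 0 \<in> {p \<in> XX (Suc i). step ?A (pfst p) (pthd p) (psnd p) \<in> N1}"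
            using xy xN t by simp
          \<comment> \<open>A whole short line through (x, y, 0) has to stay in N1, so that the
            quotients of g on it are values of G1 and converge.\<close>
          obtain e where e: "e > 0" "\<And>s. absK s < e \<Longrightarrow> step ?A x s y \<in> N1"
          proof -
            obtain B C e where *: "x \<in> B" "y \<in> C" "e > 0" "\<And>x' y' t'. x' \<in> B \<Longrightarrow> y' \<in> C \<Longrightarrow> absK (t' - 0) < e \<Longrightarrow>
                Triple x' y' t' \<in> {p \<in> XX (Suc i). step ?A (pfst p) (pthd p) (psnd p) \<in> N1}"
              by (rule box_nbhd[OF openin_step_preimage[OF A N1(1)] T]) blast
            show thesis by (rule that[OF *(3)]) (use *(4)[OF *(1,2)] in simp)
          qed
          have "lim0 F (quot ?A F g x y) (G1 (Triple x y 0))"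
          proof (rule lim0_cong[OF Cont_lim0[OF A V] e(1)])
            show "Cont ?A F UNIV (Suc i) G1" by (rule DC_base[OF DC_Hol_Cont[OF A F V \<sigma>(1) G1(2)]])
            show "Triple x y 0 \<in> bgn_dom absK ?A UNIV (Suc i)" using xy by (simp only: bgn_dom_Kn Triple_in_carr)
          qed (use quot e(2) in auto)
          from ext_quot_zero[OF F this] show ?thesis using xy t by simp
        qed
      qed
      ultimately show ?thesis using G1(2) by blast
    next
      case False
      obtain \<rho> c where \<rho>: "0 < c" "c \<le> absK t0" "\<And>s. absK (s - t0) < c \<Longrightarrow> \<rho> s = inverse s" "smooth_scalar TYPE('n) \<rho>"
        by (rule reciprocal_near[OF b False]) blast
      \<comment> \<open>This is (g2(x + t y) - g1(x)) / t, where g2(x + t y) is replaced by g2(x) +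
        t G2(x, y, t) to avoid a composition with the step.\<close>
      define h where "h = (\<lambda>p. lt_smul F (\<rho> (pthd p)) (lt_add F (lt_add F (g2 (pfst p)) (lt_smul F (pthd p) (G2 p)))
          (lt_smul F (- 1) (g1 (pfst p)))))"
      define N where "N = {p \<in> XX (Suc i). pfst p \<in> N1} \<inter> {p \<in> XX (Suc i). step ?A (pfst p) (pthd p) (psnd p) \<in> N2}
          \<inter> {p \<in> XX (Suc i). pthd p \<in> {s. absK (s - t0) < c}}"
      have "openin (lt_top (iter_sp absK ?A (Suc i))) N"
        unfolding N_def by (intro openin_Int openin_continuous_map_preimage[OF continuous_map_pfst N1(1)]
            openin_continuous_map_preimage[OF continuous_map_pthd openin_ball] openin_step_preimage[OF A N2(1)])
      moreover have "p0 \<in> N" using N1(2) N2(2) p0 xyt \<rho>(1) by (simp add: N_def)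
      moreover have "DH F \<sigma> k (Suc i) h"
        unfolding h_def
        by (intro DC_Hol_smul[OF A F V \<sigma>] DC_Hol_add[OF A F V \<sigma>(1)] DC_Hol_pfst[OF A F V \<sigma>(1)]
            DC_Suc[OF N1(3)] DC_Suc[OF N2(3)] G2(2) BB_DH smooth_scalarD[OF \<rho>(4)] BB_pthd BB_const)
      moreover have "?G q = h q" if q: "q \<in> N" for q
      proof -
        obtain x y t where xy: "q = Triple x y t" "x \<in> XX i" "y \<in> XX i"
          using q by (auto simp: N_def elim: XX_cases)
        have t: "absK (t - t0) < c" using q xy by (simp add: N_def)
        then have "t \<noteq> 0" using \<rho>(2) by auto
        moreover have "g (step ?A x t y) = g2 (step ?A x t y)" "g x = g1 x"
          using q xy N1(4) N2(4) by (auto simp: N_def)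
        ultimately show ?thesis
          using rel(2)[OF xy(2,3), of t] \<rho>(3)[OF t] by (simp add: xy(1) ext_quot_nonzero quot_def h_def lt_sub_def)
      qed
      ultimately show ?thesis by blast
    qed
  qed
  have DG: "DH F \<sigma> k (Suc i) ?G" by (rule Suc.IH[OF loc])
  have "?G p \<in> carr F" if "p \<in> bgn_dom absK ?A UNIV (Suc i)" for p
    by (rule hoelder_carr[OF DC_base[OF DG] that])
  then have "diff_rel ?A F UNIV i g ?G"
    by (intro diff_rel_ext_quot[OF A F]) (use gc in auto)
  then show ?case using hol DG by auto
qed

end

section \<open>Series of pulses, and testing Hoelder continuity by smooth curves\<close>

section \<open>Smooth curves through fast converging sequences\<close>

context valued_field
begin

text \<open>There is a chain of each finite length, and a priori they differ. Uniqueness of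
  quotients makes them agree, so that their diagonal is an infinite chain.\<close>

lemma BB_chain:
  assumes a: "\<And>k. BB k 0 (a :: ('n::finite \<Rightarrow> 'k, 'k) pt \<Rightarrow> 'k)"
  obtains A where "A 0 = a" "\<And>i. Lb i (A i)" "\<And>i. diff_rel Kn (Kt absK) UNIV i (A i) (A (Suc i))"
proof -
  let ?K = "Kn :: ('n \<Rightarrow> 'k, 'k) lin_top"
  note V = openin_Kn_UNIV[where 'n='n]
  have "\<forall>k. \<exists>H. H 0 = a \<and> (\<forall>j\<le>k. Lb j (H j)) \<and> (\<forall>j<k. diff_rel ?K (Kt absK) UNIV j (H j) (H (Suc j)))"
    using a unfolding DC_chain by simp
  then obtain H where H: "\<And>k. H k 0 = a" "\<And>j k. j \<le> k \<Longrightarrow> Lb j (H k j)"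
    "\<And>j k. j < k \<Longrightarrow> diff_rel ?K (Kt absK) UNIV j (H k j) (H k (Suc j))" by metis
  have eq: "H k j p = H k' j p" if "j \<le> k" "j \<le> k'" "p \<in> bgn_dom absK ?K UNIV j" for k k' j p
    using that
  proof (induction j arbitrary: p)
    case (Suc j)
    have "diff_rel ?K (Kt absK) UNIV j (H k j) (H k' (Suc j))"
      by (rule diff_rel_cong[OF H(3)[of j k']]) (use Suc in auto)
    from diff_rel_unique[OF tvs_Kpow tvs_Kt V Lb_Cont[OF H(2)] Lb_Cont[OF H(2)] H(3) this _ Suc.prems(3)] Suc.prems
    show ?case by simp
  qed (simp add: H(1))
  show ?thesis
  proof (rule that[of "\<lambda>j. H j j"])
    fix i
    show "diff_rel ?K (Kt absK) UNIV i (H i i) (H (Suc i) (Suc i))"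
      by (rule diff_rel_cong[OF H(3)[of i "Suc i"]]) (use eq[of i i "Suc i"] in auto)
  qed (use H in auto)
qed

lemma diff_rel_subset:
  assumes "V \<subseteq> V'" "diff_rel A F V' i g G"
  shows "diff_rel A F V i g G"
  using assms(2) bgn_dom_mono[OF assms(1), where S=A and j="Suc i"] unfolding diff_rel_def by blast

lemma Cont_subset:
  assumes "V \<subseteq> V'" "Cont A F V' i g"
  shows "Cont A F V i g"
  using continuous_map_from_subtopology_mono[OF assms(2) bgn_dom_mono[OF assms(1)]] .

text \<open>The zero functions continue the chain over the smaller open set, and quotients are
  unique. Thus the quotients of a pulse vanish wherever all base points involved avoid its
  support.\<close>

lemma chain_vanishes:
  assumes A: "tvs A" "tvs F" and V: "openin (lt_top A) V" "V \<subseteq> V'"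
    and T: "\<And>i. Cont A F V' i (T i)" "\<And>i. diff_rel A F V' i (T i) (T (Suc i))"
    and 0: "\<And>z. z \<in> V \<Longrightarrow> T 0 (Base z) = lt_zero F"
  shows "p \<in> bgn_dom absK A V i \<Longrightarrow> T i p = lt_zero F"
proof (induction i arbitrary: p)
  case 0
  then show ?case using assms(7) by auto
next
  case (Suc i)
  have r: "diff_rel A F V i (T i) (\<lambda>_. lt_zero F)"
    using Suc.IH A(2) by (auto simp: diff_rel_def tvs_simps)
  have "Cont A F V (Suc i) (\<lambda>_. lt_zero F)" using tvs_zero[OF A(2)] by (simp add: continuous_map_const)
  from diff_rel_unique[OF A V(1) Cont_subset[OF V(2) T(1)] this diff_rel_subset[OF V(2) T(2)] r _ Suc.prems]
  show ?case using Suc.IH tvs_zero[OF A(2)] by simp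
qed

text \<open>Membership of a point of an iterated space in the domain over V is a condition on
  finitely many points of the base.\<close>

lemma eventually_bgn_dom:
  assumes "\<And>z. z \<in> carr A \<Longrightarrow> \<exists>N::nat. \<forall>m\<ge>N. z \<in> V m" and A: "tvs A"
  shows "p \<in> carr (iter_sp absK A i) \<Longrightarrow> \<exists>N. \<forall>m\<ge>N. p \<in> bgn_dom absK A (V m) i"
proof (induction i arbitrary: p)
  case 0
  then obtain z where z: "p = Base z" "z \<in> carr A" by (auto simp: carr_iter_sp_0)
  then show ?case using assms(1)[OF z(2)] by (simp add: image_iff)
next
  case (Suc i)
  obtain x y t where p: "p = Triple x y t" "x \<in> carr (iter_sp absK A i)" "y \<in> carr (iter_sp absK A i)"
    by (rule carr_iter_sp_SucE[OF Suc.prems])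
  have s: "step A x t y \<in> carr (iter_sp absK A i)" using iter_closed[OF A] p by metis
  obtain N M where "\<forall>m\<ge>N. x \<in> bgn_dom absK A (V m) i" "\<forall>m\<ge>M. step A x t y \<in> bgn_dom absK A (V m) i"
    using Suc.IH[OF p(2)] Suc.IH[OF s] by blast
  then show ?case using p by (intro exI[of _ "max N M"]) auto
qed

primrec psum :: "('s, 'k) lin_top \<Rightarrow> (nat \<Rightarrow> 'p \<Rightarrow> 's) \<Rightarrow> nat \<Rightarrow> 'p \<Rightarrow> 's" where
  "psum S T 0 p = lt_zero S"
| "psum S T (Suc N) p = lt_add S (psum S T N p) (T N p)"

lemma psum_carr: "tvs S \<Longrightarrow> (\<And>m. T m p \<in> carr S) \<Longrightarrow> psum S T N p \<in> carr S"
  by (induction N) (auto simp: tvs_closed)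

lemma psum_stable:
  assumes S: "tvs S" "\<And>m. T m p \<in> carr S" and "\<And>m. N \<le> m \<Longrightarrow> T m p = lt_zero S" "N \<le> M"
  shows "psum S T M p = psum S T N p"
  using assms(4)
proof (induction M)
  case (Suc M)
  show ?case
  proof (cases "N \<le> M")
    case True
    then show ?thesis using Suc.IH assms(3) psum_carr[where T=T and p=p, OF S] S by (simp add: tvs_zero_right)
  next
    case False
    then show ?thesis using Suc.prems by (simp add: le_Suc_eq)
  qed
qed simp

lemma psum_single:
  assumes S: "tvs S" "\<And>n. T n p \<in> carr S" and "\<And>n. n \<noteq> m \<Longrightarrow> T n p = lt_zero S"
  shows "psum S T M p = (if m < M then T m p else lt_zero S)"
proof (induction M)
  case (Suc M)
  then show ?case using assms by (cases "m = M") (auto simp: tvs_zero tvs_zero_left tvs_zero_right)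
qed simp

text \<open>Collapse from the end: the last term and the remainder w both lie in W (M + 1), so their
  sum is a remainder in W M. Carrying the remainder as a summand avoids differences of partial
  sums.\<close>

lemma psum_tail:
  assumes S: "tvs S" and W: "\<And>n. W n \<subseteq> carr S" "\<And>n v w. v \<in> W (Suc n) \<Longrightarrow> w \<in> W (Suc n) \<Longrightarrow> lt_add S v w \<in> W n"
    and c: "\<And>m. T m p \<in> carr S" and T: "\<And>m. N \<le> m \<Longrightarrow> T m p \<in> W (Suc m)" and "N \<le> M" "w \<in> W M"
  shows "\<exists>r\<in>W N. lt_add S (psum S T M p) w = lt_add S (psum S T N p) r"
  using assms(6,7)
proof (induction M arbitrary: w)
  case 0
  then show ?case by auto
next
  case (Suc M)
  show ?case
  proof (cases "N = Suc M")
    case True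
    then show ?thesis using Suc.prems by blast
  next
    case False
    then have N: "N \<le> M" using Suc.prems by simp
    have "lt_add S (T M p) w \<in> W M" using W(2) T[OF N] Suc.prems(2) .
    from Suc.IH[OF N this]
    have "\<exists>r\<in>W N. lt_add S (psum S T M p) (lt_add S (T M p) w) = lt_add S (psum S T N p) r" .
    moreover have "lt_add S (psum S T M p) (lt_add S (T M p) w) = lt_add S (psum S T (Suc M) p) w"
      using tvs_assoc[OF S psum_carr[where T=T and p=p and N=M, OF S c] c, of w M] subsetD[OF W(1) Suc.prems(2)] by simp
    ultimately show ?thesis by simp
  qed
qed

text \<open>At every point of every level the series is a finite sum, so it has a value without
  completeness of S. The last assumption makes the tails uniformly small on bounded sets, which
  gives continuity.\<close>

lemma series_smooth:
  fixes T :: "nat \<Rightarrow> nat \<Rightarrow> ('n::finite \<Rightarrow> 'k, 'k) pt \<Rightarrow> 's"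
  assumes S: "tvs S" and W: "\<And>n. balanced_nbhd S (W n)"
    "\<And>n v w. v \<in> W (Suc n) \<Longrightarrow> w \<in> W (Suc n) \<Longrightarrow> lt_add S v w \<in> W n"
    "\<And>V. openin (lt_top S) V \<Longrightarrow> lt_zero S \<in> V \<Longrightarrow> \<exists>n. W n \<subseteq> V"
    and T: "\<And>i m. Cont Kn S UNIV i (T i m)" "\<And>i m. diff_rel Kn S UNIV i (T i m) (T (Suc i) m)"
    "\<And>i p. p \<in> XX i \<Longrightarrow> \<exists>N. \<forall>m\<ge>N. T i m p = lt_zero S"
    "\<And>i m p. i \<le> m \<Longrightarrow> p \<in> XX i \<Longrightarrow> nrm p \<le> real m \<Longrightarrow> T i m p \<in> W (Suc m)"
  obtains \<Gamma> where "\<And>k. DC Kn S UNIV (Cont Kn S UNIV) k 0 \<Gamma>"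
    "\<And>p. p \<in> XX 0 \<Longrightarrow> \<exists>N. \<forall>M\<ge>N. \<Gamma> p = psum S (T 0) M p"
proof -
  let ?K = "Kn :: ('n \<Rightarrow> 'k, 'k) lin_top"
  note W' = balanced_nbhdD[OF W(1)]
  have Tc: "T i m p \<in> carr S" if "p \<in> XX i" for i m p
    using Cont_carr[OF tvs_Kpow openin_Kn_UNIV T(1)] that bgn_dom_Kn by blast
  define st where "st = (\<lambda>i p. SOME N. \<forall>m\<ge>N. T i m p = lt_zero S)"
  have st: "T i m p = lt_zero S" if "p \<in> XX i" "st i p \<le> m" for i p m
    using someI_ex[OF T(3)[OF that(1)]] that(2) unfolding st_def by blast
  define \<Gamma> where "\<Gamma> = (\<lambda>i p. psum S (T i) (st i p) p)"
  have \<Gamma>: "\<Gamma> i p = psum S (T i) M p" if "p \<in> XX i" "st i p \<le> M" for i p M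
    unfolding \<Gamma>_def using psum_stable[where T="T i" and p=p and N="st i p" and M=M, OF S Tc[OF that(1)] st[OF that(1)] that(2)] by simp
  have \<Gamma>c: "\<Gamma> i p \<in> carr S" if "p \<in> XX i" for i p
    unfolding \<Gamma>_def by (rule psum_carr[where T="T i" and p=p, OF S Tc[OF that]])
  have Wdec: "W m \<subseteq> W n" if "n \<le> m" for n m
    using that
  proof (induction m)
    case (Suc m)
    have "W (Suc m) \<subseteq> W m"
    proof
      fix w assume w: "w \<in> W (Suc m)"
      then have "lt_add S w (lt_zero S) \<in> W m" using W(2) W'(2) by blast
      then show "w \<in> W m" using w W'(4) S tvs_zero_right[OF S] by (metis subsetD)
    qed
    then show ?case using Suc by (cases "n = Suc m") auto
  qed simp
  have pc: "Cont ?K S UNIV i (psum S (T i) N)" for i N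
  proof (induction N)
    case 0
    have "psum S (T i) 0 = (\<lambda>_. lt_zero S)" by auto
    then show ?case using tvs_zero[OF S] by (simp add: continuous_map_const del: bgn_dom_Kn)
  next
    case (Suc N)
    have "psum S (T i) (Suc N) = (\<lambda>p. lt_add S (psum S (T i) N p) (T i N p))" by auto
    then show ?case using continuous_map_tvs_add[OF S Suc T(1)] by (simp only:)
  qed
  have pr: "psum S (T i) N (step ?K x t y) =
      lt_add S (psum S (T i) N x) (lt_smul S t (psum S (T (Suc i)) N (Triple x y t)))"
    if xy: "x \<in> XX i" "y \<in> XX i" for i N x y t
  proof (induction N)
    case 0
    then show ?case using S by (simp add: tvs_simps)
  next
    case (Suc N)
    have "Triple x y t \<in> bgn_dom absK ?K UNIV (Suc i)" using xy unfolding bgn_dom_Kn by simp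
    then have r: "T i N (step ?K x t y) = lt_add S (T i N x) (lt_smul S t (T (Suc i) N (Triple x y t)))"
      by (rule diff_relD[OF T(2)])
    have c: "psum S (T i) N x \<in> carr S" "T i N x \<in> carr S"
      "psum S (T (Suc i)) N (Triple x y t) \<in> carr S" "T (Suc i) N (Triple x y t) \<in> carr S"
      using xy Tc by (auto intro!: psum_carr[OF S])
    show ?case unfolding psum.simps r Suc using c S by (simp add: tvs_simps)
  qed
  have rel: "diff_rel ?K S UNIV i (\<Gamma> i) (\<Gamma> (Suc i))" for i
    unfolding diff_rel_def
  proof (intro allI impI)
    fix x y :: "('n \<Rightarrow> 'k, 'k) pt" and t assume "Triple x y t \<in> bgn_dom absK ?K UNIV (Suc i)"
    then have T: "Triple x y t \<in> XX (Suc i)" by (simp only: bgn_dom_Kn)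
    then have xy: "x \<in> XX i" "y \<in> XX i" by auto
    \<comment> \<open>One partial sum computes the values at all three points, and the relation is
      inherited from finite sums.\<close>
    define N where "N = max (st i x) (max (st i (step ?K x t y)) (st (Suc i) (Triple x y t)))"
    have "\<Gamma> i x = psum S (T i) N x" "\<Gamma> i (step ?K x t y) = psum S (T i) N (step ?K x t y)"
      "\<Gamma> (Suc i) (Triple x y t) = psum S (T (Suc i)) N (Triple x y t)"
      by (rule \<Gamma>; use xy XX_step[OF xy, of t] T in \<open>simp add: N_def\<close>)+
    then show "\<Gamma> i (step ?K x t y) = lt_add S (\<Gamma> i x) (lt_smul S t (\<Gamma> (Suc i) (Triple x y t)))"
      using pr[OF xy] by simp
  qed
  have cont: "Cont ?K S UNIV i (\<Gamma> i)" for i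
  proof -
    have "continuous_map (lt_top (iter_sp absK ?K i)) (lt_top S) (\<Gamma> i)"
      unfolding continuous_map_nbhd
    proof (intro ballI conjI allI impI)
      fix p :: "('n \<Rightarrow> 'k, 'k) pt" assume p: "p \<in> XX i"
      show "\<Gamma> i p \<in> carr S" by (rule \<Gamma>c[OF p])
      fix V assume V: "openin (lt_top S) V \<and> \<Gamma> i p \<in> V"
      have "lt_add S (\<Gamma> i p) (lt_zero S) \<in> V" using V \<Gamma>c[OF p] S by (simp add: tvs_zero_right)
      then obtain A B where A: "openin (lt_top S) A" "\<Gamma> i p \<in> A" "openin (lt_top S) B" "lt_zero S \<in> B"
        "\<And>a b. a \<in> A \<Longrightarrow> b \<in> B \<Longrightarrow> lt_add S a b \<in> V"
        using tvs_add_nbhd[OF S \<Gamma>c[OF p] tvs_zero[OF S], of V] V by metis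
      obtain n where n: "W n \<subseteq> B" using W(3)[OF A(3,4)] by blast
      obtain R where R: "nrm p + 1 \<le> real R" using real_arch_simple by blast
      \<comment> \<open>Beyond N the terms at level i are small on the unit ball around p, since R
        \<ge> \<open>nrm p\<close> + 1; the tail then lies in W N, hence in W n, and the sum at p
        has already stabilized.\<close>
      define N where "N = max (max n i) (max R (st i p))"
      have N: "n \<le> N" "i \<le> N" "R \<le> N" "st i p \<le> N" by (auto simp: N_def)
      have "\<Gamma> i p = psum S (T i) N p" by (rule \<Gamma>[OF p N(4)])
      moreover have "continuous_map (lt_top (iter_sp absK ?K i)) (lt_top S) (psum S (T i) N)"
        using pc[of i N] by simp
      ultimately obtain O1 where O1: "openin (lt_top (iter_sp absK ?K i)) O1" "p \<in> O1" "\<forall>q\<in>O1. psum S (T i) N q \<in> A"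
        using A(1,2) p unfolding continuous_map_nbhd by metis
      obtain O2 where O2: "openin (lt_top (iter_sp absK ?K i)) O2" "p \<in> O2" "\<forall>q\<in>O2. ptd q p < 1"
        using ptd_nbhd[OF p zero_less_one] by blast
      have "\<Gamma> i q \<in> V" if q: "q \<in> O1 \<inter> O2" for q
      proof -
        have qX: "q \<in> XX i" using q O1(1) openin_subset by blast
        have "ptd q p < 1" using q O2(3) by blast
        then have nq: "nrm q \<le> real N" using nrm_le_add_ptd[OF p qX] R N(3) by linarith
        define M where "M = max N (st i q)"
        have "\<exists>r\<in>W N. lt_add S (psum S (T i) M q) (lt_zero S) = lt_add S (psum S (T i) N q) r"
        proof (rule psum_tail[where T="T i" and p=q and W=W, OF S W'(4) W(2) Tc[OF qX]])
          fix m assume "N \<le> m"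
          then show "T i m q \<in> W (Suc m)" using T(4)[OF _ qX] N(2) nq by simp
        qed (use W'(2) in \<open>auto simp: M_def\<close>)
        then obtain r where r: "r \<in> W N" "psum S (T i) M q = lt_add S (psum S (T i) N q) r"
          using psum_carr[where T="T i" and p=q and N=M, OF S Tc[OF qX]] S by (auto simp: tvs_zero_right)
        have "r \<in> B" using r(1) Wdec[OF N(1)] n by blast
        moreover have "psum S (T i) N q \<in> A" using q O1(3) by blast
        ultimately have "lt_add S (psum S (T i) N q) r \<in> V" by (rule A(5)[rotated])
        moreover have "\<Gamma> i q = psum S (T i) M q" by (rule \<Gamma>[OF qX]) (simp add: M_def)
        ultimately show ?thesis using r(2) by simp
      qed
      then show "\<exists>N. openin (lt_top (iter_sp absK ?K i)) N \<and> p \<in> N \<and> (\<forall>y\<in>N. \<Gamma> i y \<in> V)"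
        using O1 O2 by (intro exI[of _ "O1 \<inter> O2"]) auto
    qed
    then show ?thesis by simp
  qed
  show ?thesis
  proof (rule that[of "\<Gamma> 0"])
    show "DC ?K S UNIV (Cont ?K S UNIV) k 0 (\<Gamma> 0)" for k
      unfolding DC_chain using cont rel by (intro exI[of _ \<Gamma>]) simp
    show "\<exists>N. \<forall>M\<ge>N. \<Gamma> 0 p = psum S (T 0) M p" if "p \<in> XX 0" for p
      using \<Gamma>[OF that] by blast
  qed
qed

text \<open>The order lost between continuous and Lipschitz chains does not matter when all orders
  are available.\<close>

lemma bgn_Cinf_iff:
  assumes S: "tvs S"
  shows "bgn_Cinf absK (Kn :: ('n::finite \<Rightarrow> 'k, 'k) lin_top) S UNIV \<gamma> \<longleftrightarrow> (\<forall>k. DH S 1 k 0 (\<lambda>p. \<gamma> (unBase p)))"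
proof -
  note V = openin_Kn_UNIV[where 'n='n]
  have "(\<forall>k. DC Kn S UNIV (Cont Kn S UNIV) k 0 (\<lambda>p. \<gamma> (unBase p))) \<longleftrightarrow> (\<forall>k. DH S 1 k 0 (\<lambda>p. \<gamma> (unBase p)))"
    using DC_Cont_Hol[OF tvs_Kpow S V] DC_Hol_Cont[OF tvs_Kpow S V zero_less_one] by blast
  then show ?thesis unfolding bgn_Cinf_def bgn_C_iff[OF tvs_Kpow S V] .
qed

text \<open>Dependent choice, halving and intersecting with a countable base in turn. The condition
  on W 0 later keeps sums of series with n-th term in W (n + 1) inside a given
  neighbourhood.\<close>

lemma string_exists:
  assumes S: "tvs S" and c: "countable_base_at_zero S" and O: "openin (lt_top S) O'" "lt_zero S \<in> O'"
  obtains W where "\<And>n. balanced_nbhd S (W n)" "\<And>n v w. v \<in> W (Suc n) \<Longrightarrow> w \<in> W (Suc n) \<Longrightarrow> lt_add S v w \<in> W n"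
    "\<And>V. openin (lt_top S) V \<Longrightarrow> lt_zero S \<in> V \<Longrightarrow> \<exists>n. W n \<subseteq> V" "W 0 \<subseteq> O'"
proof -
  obtain B where B: "\<And>n::nat. openin (lt_top S) (B n)" "\<And>n. lt_zero S \<in> B n"
    "\<And>V. openin (lt_top S) V \<Longrightarrow> lt_zero S \<in> V \<Longrightarrow> \<exists>n. B n \<subseteq> V"
    using c unfolding countable_base_at_zero_def by blast
  have "\<exists>W. \<forall>n. (balanced_nbhd S (W n) \<and> W n \<subseteq> B n \<and> (n = 0 \<longrightarrow> W n \<subseteq> O')) \<and>
      (\<forall>v\<in>W (Suc n). \<forall>w\<in>W (Suc n). lt_add S v w \<in> W n)"
  proof (rule dependent_nat_choice)
    have "openin (lt_top S) (B 0 \<inter> O')" "lt_zero S \<in> B 0 \<inter> O'" using B O by auto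
    then show "\<exists>X. balanced_nbhd S X \<and> X \<subseteq> B 0 \<and> (0 = (0::nat) \<longrightarrow> X \<subseteq> O')"
      using balanced_nbhd_exists[OF S] by (metis le_inf_iff)
    fix X n assume X: "balanced_nbhd S X \<and> X \<subseteq> B n \<and> (n = 0 \<longrightarrow> X \<subseteq> O')"
    have o: "openin (lt_top S) X" "lt_zero S \<in> X" using balanced_nbhdD(1,2) X by blast+
    obtain Y where Y: "balanced_nbhd S Y" "Y \<subseteq> X" "\<And>v w. v \<in> Y \<Longrightarrow> w \<in> Y \<Longrightarrow> lt_add S v w \<in> X"
      by (rule half_nbhd[OF S o]) blast
    have "openin (lt_top S) (Y \<inter> B (Suc n))" "lt_zero S \<in> Y \<inter> B (Suc n)"
      using balanced_nbhdD(1,2)[OF Y(1)] B by auto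
    then obtain Z where "balanced_nbhd S Z" "Z \<subseteq> Y \<inter> B (Suc n)" by (rule balanced_nbhd_exists[OF S])
    then show "\<exists>Z. (balanced_nbhd S Z \<and> Z \<subseteq> B (Suc n) \<and> (Suc n = 0 \<longrightarrow> Z \<subseteq> O')) \<and>
        (\<forall>v\<in>Z. \<forall>w\<in>Z. lt_add S v w \<in> X)"
      using Y(3) by (intro exI[of _ Z]) blast
  qed
  then obtain W where a: "\<forall>n. (balanced_nbhd S (W n) \<and> W n \<subseteq> B n \<and> (n = 0 \<longrightarrow> W n \<subseteq> O')) \<and>
      (\<forall>v\<in>W (Suc n). \<forall>w\<in>W (Suc n). lt_add S v w \<in> W n)" ..
  have W: "balanced_nbhd S (W n)" "W n \<subseteq> B n" "W 0 \<subseteq> O'"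
    "v \<in> W (Suc n) \<Longrightarrow> w \<in> W (Suc n) \<Longrightarrow> lt_add S v w \<in> W n" for n v w
    using a[rule_format, of n] a[rule_format, of 0] by simp_all
  have basis: "\<exists>n. W n \<subseteq> V" if "openin (lt_top S) V" "lt_zero S \<in> V" for V
    using B(3)[OF that] W(2) by (meson order_trans)
  show ?thesis by (rule that[OF W(1) W(4) basis W(3)])
qed

text \<open>The violated estimate is the one for a multiple of the Minkowski functional of W. It
  yields y - x = t w with w in W and |t| bounded in terms of the increment of f. Regrouping as (t /
  \<epsilon>) (\<epsilon> w) gives a direction as short as desired at the price of a longer time
  step.\<close>

lemma nonhoelder_points:
  assumes S: "tvs S" "tvs F" and D: "openin (lt_top S) D" and x0: "x0 \<in> D" and \<sigma>: "0 < \<sigma>"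
    and q: "is_gauge absK F q" and f: "\<And>x. x \<in> D \<Longrightarrow> f x \<in> carr F"
    and neg: "\<And>p N. is_gauge absK S p \<Longrightarrow> openin (lt_top S) N \<Longrightarrow> x0 \<in> N \<Longrightarrow>
      \<exists>x\<in>N. \<exists>y\<in>N. x \<in> D \<and> y \<in> D \<and> \<not> q (lt_sub F (f y) (f x)) \<le> p (lt_sub S y x) powr \<sigma>"
    and W: "balanced_nbhd S W" and e: "\<epsilon> \<noteq> 0" and r: "0 < r" and m: "0 \<le> (m::real)"
  shows "\<exists>x v \<tau>. x \<in> D \<and> lt_smul S (inverse \<epsilon>) (lt_sub S x x0) \<in> W \<and> v \<in> carr S \<and> lt_smul S (inverse \<epsilon>) v \<in> W \<and>
     absK \<tau> \<le> r \<and> lt_add S x (lt_smul S \<tau> v) \<in> D \<and>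
     (m * absK \<tau>) powr \<sigma> < q (lt_sub F (f (lt_add S x (lt_smul S \<tau> v))) (f x))"
proof -
  have x0c: "x0 \<in> carr S" using x0 D openin_subset by blast
  note W' = balanced_nbhdD(1,2)[OF W]
  define \<mu> where "\<mu> = minkowski S W"
  have \<mu>: "is_gauge absK S \<mu>" unfolding \<mu>_def by (rule is_gauge_minkowski[OF S(1) W'])
  \<comment> \<open>The factor 1 / |\<epsilon>| compensates for the passage from t to \<tau> = t /
    \<epsilon>; m + 1 keeps c positive when m = 0.\<close>
  define c where "c = (m + 1) / absK \<epsilon>"
  have c: "c > 0" using m e by (simp add: c_def)
  have re: "0 < r * absK \<epsilon>" using r e by simp
  obtain M where M: "openin (lt_top S) M" "x0 \<in> M" "\<And>y z. y \<in> M \<Longrightarrow> z \<in> M \<Longrightarrow> \<mu> (lt_sub S z y) < r * absK \<epsilon>"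
    by (rule gauge_small_diff[OF S(1) \<mu> x0c re]) blast
  define N where "N = {x \<in> carr S. lt_sub S x x0 \<in> {y \<in> carr S. lt_smul S (inverse \<epsilon>) y \<in> W}}"
  have N: "openin (lt_top S) N" unfolding N_def by (intro openin_sub_translate openin_scale S x0c W')
  have N0: "x0 \<in> N" using S x0c W' by (simp add: N_def tvs_sub_self tvs_zero tvs_smul_zero)
  obtain x y where xy: "x \<in> M \<inter> N" "y \<in> M \<inter> N" "x \<in> D" "y \<in> D"
    "(c * \<mu> (lt_sub S y x)) powr \<sigma> < q (lt_sub F (f y) (f x))"
    using neg[OF gauge_scale[OF \<mu> c], of "M \<inter> N"] M N N0 by (auto simp: not_le)
  have xc: "x \<in> carr S" "y \<in> carr S" using xy by (auto simp: N_def)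
  define d where "d = lt_sub S y x"
  have d: "d \<in> carr S" "lt_add S x d = y" unfolding d_def using S xc by (auto simp: tvs_sub tvs_add_sub)
  define Q where "Q = q (lt_sub F (f y) (f x))"
  have Q0: "0 < Q" using xy(5) powr_ge_zero[of "c * \<mu> d" \<sigma>] unfolding Q_def d_def by linarith
  have \<mu>d: "0 \<le> \<mu> d" by (rule gauge_nonneg[OF \<mu> d(1)])
  have less_iff: "s powr \<sigma> < Q \<longleftrightarrow> s < Q powr (1 / \<sigma>)" if "0 \<le> s" for s
  proof -
    have "s powr \<sigma> < Q \<longleftrightarrow> s powr \<sigma> < (Q powr (1 / \<sigma>)) powr \<sigma>" using \<sigma> Q0 by (simp add: powr_powr)
    also have "\<dots> \<longleftrightarrow> s < Q powr (1 / \<sigma>)"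
      using that \<sigma> powr_less_mono2[of \<sigma> s "Q powr (1 / \<sigma>)"] powr_mono2[of \<sigma> "Q powr (1 / \<sigma>)" s]
      by (cases "s < Q powr (1 / \<sigma>)") auto
    finally show ?thesis .
  qed
  have "c * \<mu> d < Q powr (1 / \<sigma>)" using less_iff[of "c * \<mu> d"] xy(5) c \<mu>d by (simp add: Q_def d_def)
  then have "\<mu> d < Q powr (1 / \<sigma>) / c" using c by (simp add: pos_less_divide_eq mult.commute)
  moreover have "\<mu> d < r * absK \<epsilon>" using M(3) xy unfolding d_def by blast
  ultimately have "\<mu> d < min (Q powr (1 / \<sigma>) / c) (r * absK \<epsilon>)" by simp
  then obtain t where t: "t \<noteq> 0" "absK t < Q powr (1 / \<sigma>) / c" "absK t < r * absK \<epsilon>" "lt_smul S (inverse t) d \<in> W"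
    using minkowski_less_iff[OF S(1) W' d(1)] unfolding \<mu>_def by (metis min_less_iff_conj)
  define \<tau> where "\<tau> = inverse \<epsilon> * t"
  define v where "v = lt_smul S (inverse \<tau>) d"
  have \<tau>: "\<tau> \<noteq> 0" using t e by (simp add: \<tau>_def)
  have a\<tau>: "absK \<tau> = absK t / absK \<epsilon>" by (simp add: \<tau>_def absK_mult absK_inverse divide_inverse mult.commute)
  have "inverse \<epsilon> * inverse \<tau> = inverse t" using e by (simp add: \<tau>_def)
  then have v: "v \<in> carr S" "lt_smul S (inverse \<epsilon>) v = lt_smul S (inverse t) d"
    unfolding v_def using S d by (simp_all add: tvs_smul tvs_smul_smul)
  have \<tau>v: "lt_smul S \<tau> v = d" unfolding v_def using S d \<tau> by (simp add: tvs_smul_smul tvs_one)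
  have "absK \<tau> \<le> r" using t(3) e unfolding a\<tau> by (simp add: pos_divide_le_eq)
  moreover have "(m * absK \<tau>) powr \<sigma> < Q"
  proof -
    have "m * absK \<tau> \<le> c * absK t" unfolding a\<tau> c_def using e m by (simp add: field_simps)
    also have "\<dots> < Q powr (1 / \<sigma>)" using t(2) c by (simp add: pos_less_divide_eq mult.commute)
    finally show ?thesis using less_iff[of "m * absK \<tau>"] m by simp
  qed
  ultimately show ?thesis
    using xy(1,3,4) v t(4) \<tau>v d(2) unfolding Q_def
    by (intro exI[of _ x] exI[of _ v] exI[of _ \<tau>]) (auto simp: N_def)
qed

text \<open>Bumps at \<rho>^m of width comparable to |\<rho>|^(m + 1). For c = 0 the plateau has
  height 1 and will carry a position; for c = 1 it is the local coordinate and will carry a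
  direction. Every point, also 0 where the centres accumulate, avoids almost all supports.\<close>

lemma pulses:
  fixes i0 :: "'n::finite"
  assumes b: "bump \<eta>" "smooth_scalar TYPE('n) \<eta>" and \<rho>: "\<rho> \<noteq> 0" "absK \<rho> \<le> 1/8"
    and c: "c = 0 \<or> c = (1::nat)"
  obtains A :: "nat \<Rightarrow> nat \<Rightarrow> ('n \<Rightarrow> 'k, 'k) pt \<Rightarrow> 'k" where
    "\<And>i m. Lb i (A i m)" "\<And>i m. diff_rel Kn (Kt absK) UNIV i (A i m) (A (Suc i) m)"
    "\<And>i p. p \<in> XX i \<Longrightarrow> \<exists>N. \<forall>m\<ge>N. A i m p = 0"
    "\<And>m z. A 0 m (Base z) = (z i0 - \<rho> ^ m) ^ c * \<eta> ((z i0 - \<rho> ^ m) / \<rho> ^ Suc m)"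
proof -
  let ?K = "Kn :: ('n \<Rightarrow> 'k, 'k) lin_top"
  define a where "a = (\<lambda>m (p :: ('n \<Rightarrow> 'k, 'k) pt). (unBase p i0 - \<rho> ^ m) ^ c * \<eta> ((unBase p i0 - \<rho> ^ m) / \<rho> ^ Suc m))"
  have s: "BB k 0 (\<lambda>p :: ('n \<Rightarrow> 'k, 'k) pt. unBase p i0 - \<rho> ^ m)" for k m
    by (intro BB_diff BB_const BB_coord)
  have e: "BB k 0 (\<lambda>p :: ('n \<Rightarrow> 'k, 'k) pt. \<eta> ((unBase p i0 - \<rho> ^ m) / \<rho> ^ Suc m))" for k m
    unfolding divide_inverse by (rule smooth_scalarD[OF b(2)]) (intro BB_mult s BB_const)
  have "BB k 0 (a m)" for k m
  proof (cases "c = 0")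
    case True
    then show ?thesis using e[of k m] unfolding a_def by simp
  next
    case False
    then have "a m = (\<lambda>p. (unBase p i0 - \<rho> ^ m) * \<eta> ((unBase p i0 - \<rho> ^ m) / \<rho> ^ Suc m))"
      using c unfolding a_def by auto
    then show ?thesis using BB_mult[OF s e] by (simp only:)
  qed
  then have "\<forall>m. \<exists>A. A 0 = a m \<and> (\<forall>i. Lb i (A i)) \<and> (\<forall>i. diff_rel ?K (Kt absK) UNIV i (A i) (A (Suc i)))"
    using BB_chain by metis
  then obtain A where A: "\<And>m. A m 0 = a m" "\<And>m i. Lb i (A m i)" "\<And>m i. diff_rel ?K (Kt absK) UNIV i (A m i) (A m (Suc i))"
    by metis
  \<comment> \<open>The m-th pulse vanishes here, and the strict inequality makes this set open, as
    \<open>chain_vanishes\<close> requires.\<close>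
  define V where "V = (\<lambda>m. {z :: 'n \<Rightarrow> 'k. 2 * absK \<rho> ^ Suc m < absK (z i0 - \<rho> ^ m)})"
  have Vo: "openin (lt_top ?K) (V m)" for m
  proof -
    have "openin (ktop absK) {s. 2 * absK \<rho> ^ Suc m < absK (s - \<rho> ^ m)}"
      unfolding openin_ktop
    proof (intro ballI)
      fix s assume s: "s \<in> {s. 2 * absK \<rho> ^ Suc m < absK (s - \<rho> ^ m)}"
      have "2 * absK \<rho> ^ Suc m < absK (y - \<rho> ^ m)" if "absK (y - s) < absK (s - \<rho> ^ m) - 2 * absK \<rho> ^ Suc m" for y
        using absK_diff[of "y - \<rho> ^ m" "y - s"] that by simp
      then show "\<exists>e>0. \<forall>y. absK (y - s) < e \<longrightarrow> y \<in> {s. 2 * absK \<rho> ^ Suc m < absK (s - \<rho> ^ m)}"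
        using s by (intro exI[of _ "absK (s - \<rho> ^ m) - 2 * absK \<rho> ^ Suc m"]) auto
    qed
    from openin_continuous_map_preimage[OF continuous_map_product_projection[of i0 UNIV "\<lambda>_. ktop absK"] this]
    show ?thesis by (simp add: V_def)
  qed
  have ev: "\<exists>N. \<forall>m\<ge>N. z \<in> V m" for z
  proof (cases "z i0 = 0")
    case True
    \<comment> \<open>The distance from 0 to the centre is |\<rho>|^m, which exceeds the support
      radius 2 |\<rho>|^(m + 1).\<close>
    have "2 * absK \<rho> ^ Suc m < absK (z i0 - \<rho> ^ m)" for m
    proof -
      have "2 * absK \<rho> * absK \<rho> ^ m < 1 * absK \<rho> ^ m"
        using \<rho> by (intro mult_strict_right_mono) auto
      then show ?thesis using True by (simp add: absK_power)
    qed
    then show ?thesis by (auto simp: V_def)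
  next
    case False
    have "absK \<rho> < 1" using \<rho>(2) by linarith
    then have "(\<lambda>m. absK \<rho> ^ m) \<longlonglongrightarrow> 0" by (intro LIMSEQ_realpow_zero) auto
    then have "\<forall>\<^sub>F m in sequentially. absK \<rho> ^ m < absK (z i0) / 3"
      using False by (intro order_tendstoD) auto
    then obtain N where N: "\<forall>m\<ge>N. absK \<rho> ^ m < absK (z i0) / 3" unfolding eventually_sequentially by blast
    have "z \<in> V m" if "m \<ge> N" for m
    proof -
      have "absK (z i0) \<le> absK (z i0 - \<rho> ^ m) + absK \<rho> ^ m"
        using absK_add[of "z i0 - \<rho> ^ m" "\<rho> ^ m"] by (simp add: absK_power)
      moreover have "absK \<rho> ^ Suc m \<le> absK \<rho> ^ m" using \<open>absK \<rho> < 1\<close> by (intro power_decreasing) auto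
      ultimately show ?thesis using N that unfolding V_def by fastforce
    qed
    then show ?thesis by blast
  qed
  show ?thesis
  proof (rule that[of "\<lambda>i m. A m i"])
    fix i and p :: "('n \<Rightarrow> 'k, 'k) pt" assume p: "p \<in> XX i"
    obtain N where N: "\<forall>m\<ge>N. p \<in> bgn_dom absK ?K (V m) i"
      using eventually_bgn_dom[OF ev tvs_Kpow p] by blast
    have "A m i p = 0" if "m \<ge> N" for m
    proof -
      have z: "A m 0 (Base z) = lt_zero (Kt absK)" if "z \<in> V m" for z
      proof -
        have "2 * absK (\<rho> ^ Suc m) \<le> absK (z i0 - \<rho> ^ m)" using that by (simp add: V_def absK_power absK_mult)
        then have "2 \<le> absK ((z i0 - \<rho> ^ m) / \<rho> ^ Suc m)"
          using \<rho>(1) by (simp add: absK_divide pos_le_divide_eq del: power_Suc)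
        then show ?thesis using b(1) by (simp add: A a_def bump_def del: power_Suc)
      qed
      have "A m i p = lt_zero (Kt absK)"
        by (rule chain_vanishes[where T="A m" and V="V m" and V'=UNIV, OF tvs_Kpow tvs_Kt Vo _ Lb_Cont[OF A(2)] A(3) z])
           (use N that in auto)
      then show ?thesis by simp
    qed
    then show "\<exists>N. \<forall>m\<ge>N. A m i p = 0" by blast
  qed (use A in \<open>auto simp: a_def divide_inverse\<close>)
qed

text \<open>As the parameter space is fixed, a curve is a map that depends on the i0-th variable
  alone. Along the curve constructed here the increments of f exceed (m |\<tau>|)^\<sigma>, whereas
  the increments of the parameter are \<tau> times a fixed vector, so no gauge on the parameter
  space can dominate.\<close>

lemma hoelder_if_curves:
  fixes i0 :: "'n::finite"
  assumes b: "bump \<eta>" "smooth_scalar TYPE('n) \<eta>" and S: "tvs S" "tvs F" and cb: "countable_base_at_zero S"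
    and D: "openin (lt_top S) D" and \<sigma>: "0 < \<sigma>" and f: "\<And>x. x \<in> D \<Longrightarrow> f x \<in> carr F"
    and H: "\<And>\<gamma> :: ('n \<Rightarrow> 'k) \<Rightarrow> 's. bgn_Cinf absK Kn S UNIV \<gamma> \<Longrightarrow> range \<gamma> \<subseteq> D \<Longrightarrow>
      (\<And>z z'. z i0 = z' i0 \<Longrightarrow> \<gamma> z = \<gamma> z') \<Longrightarrow> Hol Kn F UNIV \<sigma> 0 (\<lambda>p. f (\<gamma> (unBase p)))"
  shows "hoelder S F D \<sigma> f"
proof (rule hoelderI[OF D f], assumption, rule ccontr)
  let ?K = "Kn :: ('n \<Rightarrow> 'k, 'k) lin_top"
  fix x0 q assume x0: "x0 \<in> D" and q: "is_gauge absK F q"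
    and "\<not> (\<exists>p N. is_gauge absK S p \<and> openin (lt_top S) N \<and> x0 \<in> N
      \<and> (\<forall>x\<in>N. \<forall>y\<in>N. x \<in> D \<longrightarrow> y \<in> D \<longrightarrow> q (lt_sub F (f y) (f x)) \<le> p (lt_sub S y x) powr \<sigma>))"
  then have neg: "\<exists>x\<in>N. \<exists>y\<in>N. x \<in> D \<and> y \<in> D \<and> \<not> q (lt_sub F (f y) (f x)) \<le> p (lt_sub S y x) powr \<sigma>"
    if "is_gauge absK S p" "openin (lt_top S) N" "x0 \<in> N" for p N using that by blast
  have x0c: "x0 \<in> carr S" using x0 D openin_subset by blast
  have "openin (lt_top S) {v \<in> carr S. lt_add S x0 v \<in> D}" by (rule openin_translate[OF S(1) x0c D])
  moreover have "lt_zero S \<in> {v \<in> carr S. lt_add S x0 v \<in> D}" using x0 x0c S by (simp add: tvs_zero tvs_zero_right)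
  ultimately obtain W where W: "\<And>n. balanced_nbhd S (W n)"
    "\<And>n v w. v \<in> W (Suc n) \<Longrightarrow> w \<in> W (Suc n) \<Longrightarrow> lt_add S v w \<in> W n"
    "\<And>V. openin (lt_top S) V \<Longrightarrow> lt_zero S \<in> V \<Longrightarrow> \<exists>n. W n \<subseteq> V" "W 0 \<subseteq> {v \<in> carr S. lt_add S x0 v \<in> D}"
    by (rule string_exists[OF S(1) cb]) blast
  note W' = balanced_nbhdD[OF W(1)]
  \<comment> \<open>1/8 is small enough that all other pulses vanish on the plateau of a given one,
    as \<open>far\<close> shows.\<close>
  obtain \<rho> where "\<rho> \<noteq> 0" "absK \<rho> < 1/8" using nontrivial[of "1/8"] by auto
  then have \<rho>: "\<rho> \<noteq> 0" "absK \<rho> \<le> 1/8" by auto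
  obtain A :: "nat \<Rightarrow> nat \<Rightarrow> ('n \<Rightarrow> 'k, 'k) pt \<Rightarrow> 'k" where
    A: "\<And>i m. Lb i (A i m)" "\<And>i m. diff_rel Kn (Kt absK) UNIV i (A i m) (A (Suc i) m)"
      "\<And>i p. p \<in> XX i \<Longrightarrow> \<exists>N. \<forall>m\<ge>N. A i m p = 0"
      "\<And>m z. A 0 m (Base z) = (z i0 - \<rho> ^ m) ^ 0 * \<eta> ((z i0 - \<rho> ^ m) / \<rho> ^ Suc m)"
    by (rule pulses[OF b \<rho>, of 0 i0]) auto
  obtain B :: "nat \<Rightarrow> nat \<Rightarrow> ('n \<Rightarrow> 'k, 'k) pt \<Rightarrow> 'k" where
    B: "\<And>i m. Lb i (B i m)" "\<And>i m. diff_rel Kn (Kt absK) UNIV i (B i m) (B (Suc i) m)"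
      "\<And>i p. p \<in> XX i \<Longrightarrow> \<exists>N. \<forall>m\<ge>N. B i m p = 0"
      "\<And>m z. B 0 m (Base z) = (z i0 - \<rho> ^ m) ^ 1 * \<eta> ((z i0 - \<rho> ^ m) / \<rho> ^ Suc m)"
    by (rule pulses[OF b \<rho>, of 1 i0]) auto
  have \<rho>1: "absK (\<rho> ^ Suc m) \<le> 1/8" for m
  proof -
    have "absK \<rho> ^ Suc m \<le> absK \<rho> ^ 1" using \<rho>(2) by (intro power_decreasing) auto
    then show ?thesis using \<rho>(2) unfolding absK_power by simp
  qed
  have AB1: "absK (A 0 m (Base z)) \<le> 1" "absK (B 0 m (Base z)) \<le> 1" for m z
  proof -
    show "absK (A 0 m (Base z)) \<le> 1" using b(1) by (simp add: A bump_def)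
    have "B 0 m (Base z) = cut \<eta> (\<rho> ^ Suc m) (z i0 - \<rho> ^ m)" by (simp add: B cut_def)
    then show "absK (B 0 m (Base z)) \<le> 1"
      using cut_bound[OF b(1), of "\<rho> ^ Suc m" "z i0 - \<rho> ^ m"] \<rho>1[of m] \<rho>(1) by simp
  qed
  \<comment> \<open>\<epsilon> absorbs the bounds of the m-th pulses and of their quotients up to
    order m on the ball of radius m. It is fixed first; the points are then chosen close to x0
    relative to it.\<close>
  have "\<exists>\<epsilon>. \<epsilon> \<noteq> 0 \<and> absK \<epsilon> \<le> 1 \<and> (\<forall>i\<le>m. \<forall>p\<in>XX i. nrm p \<le> real m \<longrightarrow>
      absK (A i m p * \<epsilon>) \<le> 1 \<and> absK (B i m p * \<epsilon>) \<le> 1)" for m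
  proof -
    have "\<exists>C\<ge>0. \<forall>p\<in>XX i. nrm p \<le> real m \<longrightarrow> absK (A i m p) \<le> C \<and> absK (B i m p) \<le> C" for i
    proof -
      obtain C1 where C1: "C1 \<ge> 0" "\<And>p. p \<in> XX i \<Longrightarrow> nrm p \<le> real m \<Longrightarrow> absK (A i m p) \<le> C1"
        by (rule LbE[OF A(1)[of i m], where R="real m"]) blast
      obtain C2 where C2: "C2 \<ge> 0" "\<And>p. p \<in> XX i \<Longrightarrow> nrm p \<le> real m \<Longrightarrow> absK (B i m p) \<le> C2"
        by (rule LbE[OF B(1)[of i m], where R="real m"]) blast
      show ?thesis using C1 C2 by (intro exI[of _ "max C1 C2"]) (auto simp: le_max_iff_disj)
    qed
    then obtain C where C: "\<And>i. C i \<ge> 0" "\<And>i p. p \<in> XX i \<Longrightarrow> nrm p \<le> real m \<Longrightarrow> absK (A i m p) \<le> C i \<and> absK (B i m p) \<le> C i"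
      by metis
    define M where "M = 1 + (\<Sum>i\<le>m. C i)"
    have M: "M \<ge> 1" using C(1) by (simp add: M_def sum_nonneg)
    have CM: "C i \<le> M" if "i \<le> m" for i
      using member_le_sum[of i "{..m}" C] C(1) that by (simp add: M_def)
    obtain \<epsilon> where \<epsilon>: "\<epsilon> \<noteq> 0" "absK \<epsilon> < 1 / M" using nontrivial[of "1 / M"] M by auto
    have le: "x * absK \<epsilon> \<le> 1" if "x \<le> M" "0 \<le> x" for x
    proof -
      have "x * absK \<epsilon> \<le> M * (1 / M)" using that \<epsilon>(2) M by (intro mult_mono) auto
      then show ?thesis using M by simp
    qed
    have "absK (A i m p * \<epsilon>) \<le> 1 \<and> absK (B i m p * \<epsilon>) \<le> 1" if "i \<le> m" "p \<in> XX i" "nrm p \<le> real m" for i p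
      unfolding absK_mult using C(2)[OF that(2,3)] CM[OF that(1)] by (auto intro!: le)
    moreover have "absK \<epsilon> \<le> 1" using le[of 1] M by simp
    ultimately show ?thesis using \<epsilon>(1) by blast
  qed
  then obtain \<epsilon> where \<epsilon>: "\<And>m. \<epsilon> m \<noteq> 0" "\<And>m. absK (\<epsilon> m) \<le> 1"
    "\<And>m i p. i \<le> m \<Longrightarrow> p \<in> XX i \<Longrightarrow> nrm p \<le> real m \<Longrightarrow> absK (A i m p * \<epsilon> m) \<le> 1 \<and> absK (B i m p * \<epsilon> m) \<le> 1"
    by metis
  \<comment> \<open>The index m + 2 occurs because position and direction part are added and the sum
    has to lie in W (m + 1). The time step is bounded by the radius of the plateau.\<close>
  have "\<exists>x v \<tau>. x \<in> D \<and> lt_smul S (inverse (\<epsilon> m)) (lt_sub S x x0) \<in> W (Suc (Suc m)) \<and> v \<in> carr S \<and>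
     lt_smul S (inverse (\<epsilon> m)) v \<in> W (Suc (Suc m)) \<and>
     absK \<tau> \<le> absK (\<rho> ^ Suc m) \<and> lt_add S x (lt_smul S \<tau> v) \<in> D \<and>
     (real m * absK \<tau>) powr \<sigma> < q (lt_sub F (f (lt_add S x (lt_smul S \<tau> v))) (f x))" for m
    by (rule nonhoelder_points[OF S D x0 \<sigma> q f neg W(1) \<epsilon>(1)]) (use \<rho>(1) in auto)
  then obtain X v \<tau> where X: "\<And>m. X m \<in> D" "\<And>m. lt_smul S (inverse (\<epsilon> m)) (lt_sub S (X m) x0) \<in> W (Suc (Suc m))"
    "\<And>m. v m \<in> carr S" "\<And>m. lt_smul S (inverse (\<epsilon> m)) (v m) \<in> W (Suc (Suc m))"
    "\<And>m. absK (\<tau> m) \<le> absK (\<rho> ^ Suc m)" "\<And>m. lt_add S (X m) (lt_smul S (\<tau> m) (v m)) \<in> D"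
    "\<And>m. (real m * absK (\<tau> m)) powr \<sigma> < q (lt_sub F (f (lt_add S (X m) (lt_smul S (\<tau> m) (v m)))) (f (X m)))"
    by metis
  have Xc: "X m \<in> carr S" for m using X(1) openin_subset[OF D] by blast
  define u where "u = (\<lambda>m. lt_sub S (X m) x0)"
  have u: "u m \<in> carr S" "lt_add S x0 (u m) = X m" for m
    unfolding u_def using S Xc x0c by (auto simp: tvs_sub tvs_add_sub)
  have Xu: "lt_smul S (inverse (\<epsilon> m)) (u m) \<in> W (Suc (Suc m))" for m
    using X(2) by (simp add: u_def)
  \<comment> \<open>On its plateau the m-th term moves linearly: x0 plus the term is
    \<open>X m\<close> at time \<rho>^m, and \<open>X m\<close> plus \<tau> \<open>v m\<close> at
    time \<rho>^m + \<tau>.\<close>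
  define T where "T = (\<lambda>i m p. lt_add S (lt_smul S (A i m p) (u m)) (lt_smul S (B i m p) (v m)))"
  have Tc: "T i m p \<in> carr S" for i m p unfolding T_def using S u X(3) by (simp add: tvs_closed)
  have inW: "lt_smul S c w \<in> W (Suc (Suc m))"
    if "w \<in> carr S" "lt_smul S (inverse (\<epsilon> m)) w \<in> W (Suc (Suc m))" "absK (c * \<epsilon> m) \<le> 1" for c w m
  proof -
    have "lt_smul S (c * \<epsilon> m) (lt_smul S (inverse (\<epsilon> m)) w) \<in> W (Suc (Suc m))" by (rule W'(3)[OF that(2,3)])
    then show ?thesis using \<epsilon>(1)[of m] S that(1) by (simp add: tvs_smul_smul mult.assoc)
  qed
  have TW: "T i m p \<in> W (Suc m)" if "absK (A i m p * \<epsilon> m) \<le> 1" "absK (B i m p * \<epsilon> m) \<le> 1" for i m p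
    unfolding T_def using W(2) inW[OF u(1) Xu that(1)] inW[OF X(3,4) that(2)] .
  have Tcont: "Cont ?K S UNIV i (T i m)" for i m
    unfolding T_def
    using Lb_Cont[OF A(1)] Lb_Cont[OF B(1)] u(1) X(3)
    by (intro continuous_map_tvs_add[OF S(1)] continuous_map_tvs_smul[OF S(1)]) (simp_all add: continuous_map_const)
  have Trel: "diff_rel ?K S UNIV i (T i m) (T (Suc i) m)" for i m
    unfolding diff_rel_def
  proof (intro allI impI)
    fix x y t assume d: "Triple x y t \<in> bgn_dom absK ?K UNIV (Suc i)"
    show "T i m (step ?K x t y) = lt_add S (T i m x) (lt_smul S t (T (Suc i) m (Triple x y t)))"
      unfolding T_def diff_relD[OF A(2) d] diff_relD[OF B(2) d]
      using S u X(3) by (simp add: tvs_simps)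
  qed
  have Tev: "\<exists>N. \<forall>m\<ge>N. T i m p = lt_zero S" if pX: "p \<in> XX i" for i p
  proof -
    obtain N M where "\<forall>m\<ge>N. A i m p = 0" "\<forall>m\<ge>M. B i m p = 0" using A(3)[OF pX] B(3)[OF pX] by blast
    then have "\<forall>m\<ge>max N M. T i m p = lt_zero S" unfolding T_def using S u X(3) by (simp add: tvs_simps)
    then show ?thesis by blast
  qed
  obtain \<Gamma> where \<Gamma>: "\<And>k. DC ?K S UNIV (Cont ?K S UNIV) k 0 \<Gamma>"
    "\<And>p. p \<in> XX 0 \<Longrightarrow> \<exists>N. \<forall>M\<ge>N. \<Gamma> p = psum S (T 0) M p"
  proof (rule series_smooth[OF S(1) W(1-3) Tcont Trel Tev])
    show "T i m p \<in> W (Suc m)" if "i \<le> m" "p \<in> XX i" "nrm p \<le> real m" for i m p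
      using TW \<epsilon>(3)[OF that] by blast
  qed blast+
  define \<gamma> where "\<gamma> = (\<lambda>z. lt_add S x0 (\<Gamma> (Base z)))"
  have ps: "\<exists>N. \<forall>M\<ge>N. \<Gamma> (Base z) = psum S (T 0) M (Base z)" for z by (rule \<Gamma>(2)) simp
  \<comment> \<open>At level 0 the pulses are bounded by 1 on the whole space, so the terms are
    small for all m and z at once.\<close>
  have T0W: "T 0 m (Base z) \<in> W (Suc m)" for m z
  proof (rule TW)
    have "absK x * absK (\<epsilon> m) \<le> 1 * 1" if "absK x \<le> 1" for x
      using that \<epsilon>(2)[of m] by (intro mult_mono) auto
    then show "absK (A 0 m (Base z) * \<epsilon> m) \<le> 1" "absK (B 0 m (Base z) * \<epsilon> m) \<le> 1"
      unfolding absK_mult using AB1[of m z] by auto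
  qed
  have smooth: "bgn_Cinf absK ?K S UNIV \<gamma>"
    unfolding bgn_Cinf_iff[OF S(1)]
  proof
    fix k
    have "DH S 1 k 0 \<Gamma>" by (rule DC_Cont_Hol[OF tvs_Kpow S(1) openin_Kn_UNIV \<Gamma>(1)])
    then have "DH S 1 k 0 (\<lambda>p. lt_add S x0 (\<Gamma> p))"
      by (intro DC_Hol_add[OF tvs_Kpow S(1) openin_Kn_UNIV] DC_Hol_const[OF tvs_Kpow S(1) openin_Kn_UNIV x0c]) auto
    then show "DH S 1 k 0 (\<lambda>p. \<gamma> (unBase p))"
      by (rule DC_cong_Hol[OF tvs_Kpow openin_Kn_UNIV]) (auto simp: \<gamma>_def)
  qed
  \<comment> \<open>The sum of terms in W (m + 1), m \<ge> 0, lies in W 0, and x0 + W 0 was arranged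
    to lie in D.\<close>
  have range: "range \<gamma> \<subseteq> D"
  proof (intro image_subsetI)
    fix z
    obtain M where M: "\<Gamma> (Base z) = psum S (T 0) M (Base z)" using ps by blast
    have "\<exists>r\<in>W 0. lt_add S (psum S (T 0) M (Base z)) (lt_zero S) = lt_add S (psum S (T 0) 0 (Base z)) r"
      by (rule psum_tail[where T="T 0" and p="Base z" and W=W, OF S(1) W'(4) W(2) Tc T0W])
         (use W'(2) in auto)
    then have "\<Gamma> (Base z) \<in> W 0"
      using M W'(4)[of 0] S psum_carr[where T="T 0" and p="Base z", OF S(1) Tc]
      by (auto simp: tvs_zero_right tvs_zero_left)
    then show "\<gamma> z \<in> D" using W(4) by (auto simp: \<gamma>_def)
  qed
  have dep: "\<gamma> z = \<gamma> z'" if "z i0 = z' i0" for z z'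
  proof -
    have T: "T 0 m (Base z) = T 0 m (Base z')" for m unfolding T_def A B using that by simp
    have "psum S (T 0) M (Base z) = psum S (T 0) M (Base z')" for M
      by (induction M) (auto simp: T)
    moreover obtain N N' where "\<forall>M\<ge>N. \<Gamma> (Base z) = psum S (T 0) M (Base z)"
      "\<forall>M\<ge>N'. \<Gamma> (Base z') = psum S (T 0) M (Base z')" using ps by meson
    ultimately have "\<Gamma> (Base z) = \<Gamma> (Base z')" by (metis nle_le)
    then show ?thesis by (simp add: \<gamma>_def)
  qed
  define \<kappa> where "\<kappa> = (\<lambda>s. Base (\<lambda>i. if i = i0 then s else 0) :: ('n \<Rightarrow> 'k, 'k) pt)"
  \<comment> \<open>The larger of |\<rho>|^m and |\<rho>|^n dominates: the smaller one, t and the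
    support radius are small fractions of it.\<close>
  have far: "2 * absK (\<rho> ^ Suc n) \<le> absK (\<rho> ^ m + t - \<rho> ^ n)" if "n \<noteq> m" "absK t \<le> absK (\<rho> ^ Suc m)" for n m t
  proof -
    have small: "absK \<rho> ^ Suc j \<le> absK \<rho> ^ j / 8" for j
      using mult_right_mono[OF \<rho>(2), of "absK \<rho> ^ j"] by simp
    have mono: "absK \<rho> ^ j \<le> absK \<rho> ^ Suc k" if "k < j" for j k
      using that \<rho>(2) by (intro power_decreasing) auto
    have t: "absK t \<le> absK \<rho> ^ m / 8" using that(2) small[of m] by (simp add: absK_power absK_mult)
    have pos: "0 \<le> absK \<rho> ^ m" "0 \<le> absK \<rho> ^ n" by auto
    have 1: "absK \<rho> ^ m \<le> absK (\<rho> ^ m + t - \<rho> ^ n) + absK \<rho> ^ n + absK t"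
      using absK_add[of "\<rho> ^ m + t - \<rho> ^ n" "\<rho> ^ n - t"] absK_diff[of "\<rho> ^ n" t] by (simp add: absK_power)
    have 2: "absK \<rho> ^ n \<le> absK (\<rho> ^ m + t - \<rho> ^ n) + absK \<rho> ^ m + absK t"
      using absK_diff[of "\<rho> ^ m + t" "\<rho> ^ m + t - \<rho> ^ n"] absK_add[of "\<rho> ^ m" t] by (simp add: absK_power)
    have "2 * absK \<rho> ^ Suc n \<le> absK (\<rho> ^ m + t - \<rho> ^ n)"
    proof (cases "m < n")
      case True
      show ?thesis using mono[OF True] small[of m] small[of n] 1 t pos by linarith
    next
      case False
      then have "n < m" using that(1) by simp
      show ?thesis using mono[OF \<open>n < m\<close>] small[of m] small[of n] 2 t pos by linarith
    qed
    then show ?thesis by (simp only: absK_power)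
  qed
  have val: "\<gamma> (\<lambda>i. if i = i0 then \<rho> ^ m + t else 0) = lt_add S (X m) (lt_smul S t (v m))"
    if t: "absK t \<le> absK (\<rho> ^ Suc m)" for m t
  proof -
    let ?z = "\<lambda>i. if i = i0 then \<rho> ^ m + t else 0"
    have \<rho>m: "\<rho> ^ Suc n \<noteq> 0" for n using \<rho>(1) by simp
    have "T 0 n (Base ?z) = lt_zero S" if "n \<noteq> m" for n
    proof -
      have "2 \<le> absK ((\<rho> ^ m + t - \<rho> ^ n) / \<rho> ^ Suc n)"
        using far[OF that t] \<rho>m[of n] by (simp add: absK_divide pos_le_divide_eq del: power_Suc)
      then have "\<eta> ((\<rho> ^ m + t - \<rho> ^ n) / \<rho> ^ Suc n) = 0" using b(1) by (simp add: bump_def)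
      then show ?thesis using S u X(3) by (simp add: T_def A B tvs_simps del: power_Suc)
    qed
    moreover have "T 0 m (Base ?z) = lt_add S (u m) (lt_smul S t (v m))"
    proof -
      have "absK (t / \<rho> ^ Suc m) \<le> 1" using t \<rho>m[of m] by (simp add: absK_divide divide_le_eq_1 del: power_Suc)
      then have "\<eta> (t / \<rho> ^ Suc m) = 1" using b(1) by (simp add: bump_def)
      then show ?thesis using S u X(3) by (simp add: T_def A B tvs_one del: power_Suc)
    qed
    moreover obtain N where "\<forall>M\<ge>N. \<Gamma> (Base ?z) = psum S (T 0) M (Base ?z)" using ps by blast
    then have "\<Gamma> (Base ?z) = psum S (T 0) (max N (Suc m)) (Base ?z)" by simp
    ultimately have "\<Gamma> (Base ?z) = lt_add S (u m) (lt_smul S t (v m))"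
      using psum_single[where T="T 0" and p="Base ?z" and m=m, OF S(1) Tc] by (simp add: less_max_iff_disj)
    then show ?thesis using S u X(3) x0c tvs_assoc[OF S(1) x0c u(1)[of m], of "lt_smul S t (v m)"]
      by (simp add: \<gamma>_def tvs_smul)
  qed
  let ?X = "iter_sp absK ?K 0"
  have "Hol ?K F UNIV \<sigma> 0 (\<lambda>p. f (\<gamma> (unBase p)))" by (rule H[OF smooth range dep])
  then obtain r N where N: "is_gauge absK ?X r" "openin (lt_top ?X) N" "\<kappa> 0 \<in> N"
    "\<And>x y. x \<in> N \<Longrightarrow> y \<in> N \<Longrightarrow> q (lt_sub F (f (\<gamma> (unBase y))) (f (\<gamma> (unBase x)))) \<le> r (lt_sub ?X y x) powr \<sigma>"
    by (rule hoelderD[OF _ openin_bgn_dom[OF tvs_Kpow openin_Kn_UNIV] _ q, where ?x0.0="\<kappa> 0"]) (auto simp: \<kappa>_def)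
  have lin\<kappa>: "lin (Kt absK) ?X \<kappa>"
  proof -
    have c: "continuous_map (ktop absK) (ktop absK) (\<lambda>s. if i = i0 then s else 0)" for i
      by (cases "i = i0") auto
    have "lin (Kt absK) ?K (\<lambda>s i. if i = i0 then s else 0)"
      using c by (auto simp: lin_def continuous_map_componentwise_UNIV)
    from lin_compose[OF this lin_Base] show ?thesis by (simp add: \<kappa>_def)
  qed
  have "openin (ktop absK) {s \<in> topspace (ktop absK). \<kappa> s \<in> N}"
    using openin_continuous_map_preimage[OF lin_continuous[OF lin\<kappa>] N(2)] by simp
  moreover have "0 \<in> {s \<in> topspace (ktop absK). \<kappa> s \<in> N}" using N(3) by simp
  ultimately obtain e where "0 < e" "\<forall>y. absK (y - 0) < e \<longrightarrow> y \<in> {s \<in> topspace (ktop absK). \<kappa> s \<in> N}"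
    unfolding openin_ktop by blast
  then have e: "0 < e" "\<And>s. absK s < e \<Longrightarrow> \<kappa> s \<in> N" by auto
  have "absK \<rho> < 1" using \<rho>(2) by linarith
  then have "(\<lambda>m. absK \<rho> ^ m) \<longlonglongrightarrow> 0" by (intro LIMSEQ_realpow_zero) auto
  then have "\<forall>\<^sub>F m in sequentially. absK \<rho> ^ m < e / 2"
    using e(1) by (intro order_tendstoD) auto
  then obtain M where M: "\<And>m. m \<ge> M \<Longrightarrow> absK \<rho> ^ m < e / 2" unfolding eventually_sequentially by blast
  have \<kappa>1: "\<kappa> 1 \<in> carr ?X" by (simp add: \<kappa>_def)
  obtain R where R: "r (\<kappa> 1) \<le> real R" using real_arch_simple by blast
  \<comment> \<open>M puts both times into the neighbourhood N, and R bounds the gauge of the unit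
    vector \<open>\<kappa> 1\<close>; then |\<tau>| r(\<open>\<kappa> 1\<close>) \<le> m |\<tau>|
    contradicts the choice of the m-th points.\<close>
  define m where "m = max M R"
  have "M \<le> m" "R \<le> m" by (auto simp: m_def)
  have \<rho>m: "absK (\<rho> ^ m) < e / 2" using M[OF \<open>M \<le> m\<close>] by (simp add: absK_power)
  have "absK \<rho> ^ Suc m \<le> absK \<rho> ^ m" using \<rho>(2) by (intro power_decreasing) auto
  then have \<tau>m: "absK (\<tau> m) < e / 2" using X(5)[of m] \<rho>m unfolding absK_power by linarith
  then have "absK (\<rho> ^ m + \<tau> m) < e" using absK_add[of "\<rho> ^ m" "\<tau> m"] \<rho>m by linarith
  moreover have "absK (\<rho> ^ m) < e" using \<rho>m e(1) by linarith
  ultimately have inN: "\<kappa> (\<rho> ^ m + \<tau> m) \<in> N" "\<kappa> (\<rho> ^ m) \<in> N" using e(2) by blast+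
  have y: "\<gamma> (unBase (\<kappa> (\<rho> ^ m + \<tau> m))) = lt_add S (X m) (lt_smul S (\<tau> m) (v m))"
    unfolding \<kappa>_def using val[OF X(5)] by simp
  have x: "\<gamma> (unBase (\<kappa> (\<rho> ^ m))) = X m"
    unfolding \<kappa>_def using val[of 0 m, unfolded add_0_right] S Xc X(3) by (simp add: tvs_smul_0 tvs_zero_right)
  have "lt_sub ?X (\<kappa> (\<rho> ^ m + \<tau> m)) (\<kappa> (\<rho> ^ m)) = \<kappa> (\<tau> m)"
    using lin_sub[OF tvs_Kt lin\<kappa>, of "\<rho> ^ m" "\<rho> ^ m + \<tau> m"] by simp
  also have "\<dots> = lt_smul ?X (\<tau> m) (\<kappa> 1)" using lin_smul[OF lin\<kappa>, of 1 "\<tau> m"] by simp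
  finally have "r (lt_sub ?X (\<kappa> (\<rho> ^ m + \<tau> m)) (\<kappa> (\<rho> ^ m))) = absK (\<tau> m) * r (\<kappa> 1)"
    using gauge_smul[OF N(1) \<kappa>1] by simp
  then have "q (lt_sub F (f (lt_add S (X m) (lt_smul S (\<tau> m) (v m)))) (f (X m))) \<le> (absK (\<tau> m) * r (\<kappa> 1)) powr \<sigma>"
    using N(4)[OF inN(2,1)] unfolding x y by simp
  also have "\<dots> \<le> (real m * absK (\<tau> m)) powr \<sigma>"
  proof (rule powr_mono2)
    have "absK (\<tau> m) * r (\<kappa> 1) \<le> absK (\<tau> m) * real m" using R \<open>R \<le> m\<close> by (intro mult_left_mono) auto
    then show "absK (\<tau> m) * r (\<kappa> 1) \<le> real m * absK (\<tau> m)" by (simp add: mult.commute)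
  qed (use \<sigma> gauge_nonneg[OF N(1) \<kappa>1] in auto)
  finally show False using X(7)[of m] by linarith
qed

end

section \<open>Passing the test by smooth maps on to difference quotients, and the
  conclusion\<close>

section \<open>Testing difference quotients with smooth maps\<close>

context valued_field
begin

text \<open>\<open>smooth_scalar\<close> speaks of chains with \<open>Lb\<close> only. By the chain
  rule h o m is the function h of a coordinate, composed with the map to the vector all of whose
  entries are m; \<open>undefined\<close> is an arbitrary coordinate.\<close>

lemma DH_smooth_scalar:
  assumes h: "smooth_scalar TYPE('n::finite) h" and m: "DH (Kt absK) 1 k 0 (m :: ('n \<Rightarrow> 'k, 'k) pt \<Rightarrow> 'k)"
  shows "DH (Kt absK) 1 k 0 (\<lambda>p. h (m p))"
proof -
  let ?K = "Kn :: ('n \<Rightarrow> 'k, 'k) lin_top"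
  note V = openin_Kn_UNIV[where 'n='n]
  have o: "DH (Kt absK) 1 k 0 (\<lambda>p :: ('n \<Rightarrow> 'k, 'k) pt. h (unBase p undefined))"
    by (intro BB_DH smooth_scalarD[OF h] BB_coord)
  have "lin (Kt absK) ?K (\<lambda>s i. s)"
    by (simp add: lin_def continuous_map_componentwise_UNIV)
  from lin_compose[OF this lin_Base] have l: "lin (Kt absK) (iter_sp absK ?K 0) (\<lambda>s. Base (\<lambda>i. s))" .
  have i: "DH (iter_sp absK ?K 0) 1 k 0 (\<lambda>p. Base (\<lambda>i. m p))"
    by (rule DC_Hol_lin_outer[OF tvs_Kpow tvs_Kt tvs_iter_sp[OF tvs_Kpow] V l m])
  have "DH (Kt absK) 1 k 0 (\<lambda>p. h (unBase (Base (\<lambda>i. m p) :: ('n \<Rightarrow> 'k, 'k) pt) undefined))"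
    by (rule DC_Hol_compose[OF tvs_Kpow tvs_Kpow tvs_Kt V V zero_less_one o i]) simp
  then show ?thesis by simp
qed

text \<open>The vector is the sum of its entries times unit vectors, built up over finite sets of
  coordinates.\<close>

lemma DH_vector:
  assumes "\<And>m. DH (Kt absK) 1 k 0 (c m :: ('n::finite \<Rightarrow> 'k, 'k) pt \<Rightarrow> 'k)"
  shows "DH (Kn :: ('n \<Rightarrow> 'k, 'k) lin_top) 1 k 0 (\<lambda>p m. c m p)"
proof -
  let ?K = "Kn :: ('n \<Rightarrow> 'k, 'k) lin_top"
  note V = openin_Kn_UNIV[where 'n='n]
  have "DH ?K 1 k 0 (\<lambda>p m. if m \<in> M then c m p else 0)" if "finite M" for M
    using that
  proof (induction M)
    case empty
    have "DH ?K 1 k 0 (\<lambda>_ :: ('n \<Rightarrow> 'k, 'k) pt. lt_zero ?K)" by (rule DC_Hol_const[OF tvs_Kpow tvs_Kpow V tvs_zero[OF tvs_Kpow]])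
    then show ?case by simp
  next
    case (insert a M)
    have e: "DH ?K 1 k 0 (\<lambda>_ :: ('n \<Rightarrow> 'k, 'k) pt. \<lambda>m. if m = a then 1 else 0)"
      by (rule DC_Hol_const[OF tvs_Kpow tvs_Kpow V]) simp
    have s: "DH ?K 1 k 0 (\<lambda>p. lt_add ?K (\<lambda>m. if m \<in> M then c m p else 0) (lt_smul ?K (c a p) (\<lambda>m. if m = a then 1 else 0)))"
      by (intro DC_Hol_add[OF tvs_Kpow tvs_Kpow V zero_less_one] insert.IH
          DC_Hol_smul[OF tvs_Kpow tvs_Kpow V zero_less_one order_refl assms e])
    show ?case
      by (rule DC_cong_Hol[OF tvs_Kpow V s]) (use insert.hyps in \<open>auto simp: fun_eq_iff\<close>)
  qed
  from this[of UNIV] show ?thesis by simp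
qed

lemma Kn_ball:
  assumes A: "openin (lt_top (Kn :: ('n::finite \<Rightarrow> 'k, 'k) lin_top)) A" and z0: "z0 \<in> A"
  obtains e where "0 < e" "\<And>z. (\<And>m. absK (z m - z0 m) < e) \<Longrightarrow> z \<in> A"
proof -
  obtain U where U: "\<And>i. openin (ktop absK) (U i)" "z0 \<in> Pi\<^sub>E UNIV U" "Pi\<^sub>E UNIV U \<subseteq> A"
    using A z0 unfolding Kpow_simps openin_product_topology_alt by (metis UNIV_I)
  have "\<forall>i. \<exists>e>0. \<forall>y. absK (y - z0 i) < e \<longrightarrow> y \<in> U i"
    using U(1,2) unfolding openin_ktop by (auto simp: PiE_iff)
  then obtain e where e: "\<And>i. 0 < e i" "\<And>i y. absK (y - z0 i) < e i \<Longrightarrow> y \<in> U i" by metis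
  show ?thesis
  proof (rule that[of "Min (range e)"])
    show "0 < Min (range e)" using e(1) by (subst Min_gr_iff) auto
    fix z assume z: "\<And>m. absK (z m - z0 m) < Min (range e)"
    have "absK (z m - z0 m) < e m" for m using z[of m] Min_le[of "range e" "e m"] by auto
    then show "z \<in> A" using U(3) e(2) by (auto simp: PiE_iff)
  qed
qed

definition depends_on :: "'n set \<Rightarrow> (('n \<Rightarrow> 'k) \<Rightarrow> 's) \<Rightarrow> bool" where
  "depends_on I \<gamma> \<longleftrightarrow> (\<forall>z z'. (\<forall>m\<in>I. z m = z' m) \<longrightarrow> \<gamma> z = \<gamma> z')"

lemma depends_onD: "depends_on I \<gamma> \<Longrightarrow> (\<And>m. m \<in> I \<Longrightarrow> z m = z' m) \<Longrightarrow> \<gamma> z = \<gamma> z'"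
  unfolding depends_on_def by blast

text \<open>\<open>g\<close> becomes \<open>C\<^sup>k\<^sup>,\<^sup>\<sigma>\<close> when tested with smooth maps that depend only on the variables in \<open>I\<close>.
  Restricting the variables replaces the change of the dimension of the parameter space in the induction.\<close>

definition tested :: "('e, 'k) lin_top \<Rightarrow> ('f, 'k) lin_top \<Rightarrow> 'e set \<Rightarrow> real \<Rightarrow> 'n::finite set \<Rightarrow> nat \<Rightarrow> nat \<Rightarrow>
    (('e, 'k) pt \<Rightarrow> 'f) \<Rightarrow> bool" where
  "tested E F U \<sigma> I j k g \<longleftrightarrow> (\<forall>\<gamma> :: ('n \<Rightarrow> 'k) \<Rightarrow> ('e, 'k) pt. bgn_Cinf absK Kn (iter_sp absK E j) UNIV \<gamma> \<longrightarrow>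
     range \<gamma> \<subseteq> bgn_dom absK E U j \<longrightarrow> depends_on I \<gamma> \<longrightarrow> DH F \<sigma> k 0 (\<lambda>p. g (\<gamma> (unBase p))))"

lemma testedD:
  fixes \<gamma> :: "('n::finite \<Rightarrow> 'k) \<Rightarrow> ('e, 'k) pt"
  assumes "tested E F U \<sigma> (I :: 'n set) j k g" "tvs E" "\<And>k. DH (iter_sp absK E j) 1 k 0 (\<lambda>p. \<gamma> (unBase p))"
    "\<And>z. \<gamma> z \<in> bgn_dom absK E U j" "depends_on I \<gamma>"
  shows "DH F \<sigma> k 0 (\<lambda>p. g (\<gamma> (unBase p)))"
  using assms unfolding tested_def bgn_Cinf_iff[OF tvs_iter_sp[OF assms(2)]] by blast

text \<open>Test with the constant map with value x.\<close>

lemma tested_carr: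
  assumes t: "tested E F U \<sigma> (I :: 'n::finite set) j k g" and E: "tvs E" and U: "U \<subseteq> carr E" and x: "x \<in> bgn_dom absK E U j"
  shows "g x \<in> carr F"
proof -
  have "DH F \<sigma> k 0 (\<lambda>p :: ('n \<Rightarrow> 'k, 'k) pt. g x)"
  proof (rule testedD[OF t E])
    have "x \<in> carr (iter_sp absK E j)" using x bgn_dom_subset[OF U] by blast
    then show "DH (iter_sp absK E j) 1 n 0 (\<lambda>p :: ('n \<Rightarrow> 'k, 'k) pt. x)" for n
      by (rule DC_Hol_const[OF tvs_Kpow tvs_iter_sp[OF E] openin_Kn_UNIV])
  qed (use x in \<open>auto simp: depends_on_def\<close>)
  from hoelder_carr[OF DC_base[OF this], of "Base (\<lambda>_. 0)"] show ?thesis by simp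
qed

lemma openin_Cont_preimage:
  assumes "Cont Kn F UNIV i g" "openin (lt_top F) V"
  shows "openin (lt_top (iter_sp absK Kn i)) {p \<in> XX i. g p \<in> V}"
  using openin_continuous_map_preimage[OF assms] by simp

text \<open>The variable i, on which the test map \<gamma> does not depend, takes over the role of
  the increment \<tau>. The quotient of g along \<gamma> is read off from the quotient of g o
  \<Gamma>, for a test map \<Gamma> that uses i as well, in the direction of the i-th unit
  vector.\<close>

lemma tested_step:
  fixes I :: "'n::finite set" and E :: "('e, 'k) lin_top"
  assumes b: "bump \<eta>" "smooth_scalar TYPE('n) \<eta>" and E: "tvs E" "tvs F" and U: "openin (lt_top E) U"
    and \<sigma>: "0 < \<sigma>" "\<sigma> \<le> 1" and t: "tested E F U \<sigma> I j (Suc k) g" and i: "i \<in> I"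
  shows "tested E F U \<sigma> (I - {i}) (Suc j) k (ext_quot E F g)"
  unfolding tested_def
proof (intro allI impI)
  let ?K = "Kn :: ('n \<Rightarrow> 'k, 'k) lin_top" and ?Y = "iter_sp absK E j" and ?D = "bgn_dom absK E U j"
  note KK = tvs_Kpow[where 'n='n] and V = openin_Kn_UNIV[where 'n='n]
  have Y: "tvs ?Y" "tvs (iter_sp absK E (Suc j))" using tvs_iter_sp[OF E(1)] by auto
  have Uc: "U \<subseteq> carr E" using openin_subset[OF U] .
  have D: "openin (lt_top ?Y) ?D" by (rule openin_bgn_dom[OF E(1) U])
  fix \<gamma> :: "('n \<Rightarrow> 'k) \<Rightarrow> ('e, 'k) pt"
  assume "bgn_Cinf absK ?K (iter_sp absK E (Suc j)) UNIV \<gamma>"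
    and rg: "range \<gamma> \<subseteq> bgn_dom absK E U (Suc j)" and dep: "depends_on (I - {i}) \<gamma>"
  then have sm: "DH (iter_sp absK E (Suc j)) 1 n 0 (\<lambda>p. \<gamma> (unBase p))" for n
    unfolding bgn_Cinf_iff[OF Y(2)] by (elim allE)
  define \<gamma>1 \<gamma>2 \<gamma>3 where "\<gamma>1 = (\<lambda>z. pfst (\<gamma> z))" and "\<gamma>2 = (\<lambda>z. psnd (\<gamma> z))" and "\<gamma>3 = (\<lambda>z. pthd (\<gamma> z))"
  have s1: "DH ?Y 1 n 0 (\<lambda>p. \<gamma>1 (unBase p))" for n
    unfolding \<gamma>1_def by (rule DC_Hol_lin_outer[OF KK Y(2,1) V lin_pfst sm])
  have s2: "DH ?Y 1 n 0 (\<lambda>p. \<gamma>2 (unBase p))" for n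
    unfolding \<gamma>2_def by (rule DC_Hol_lin_outer[OF KK Y(2,1) V lin_psnd sm])
  have s3: "DH (Kt absK) 1 n 0 (\<lambda>p. \<gamma>3 (unBase p))" for n
    unfolding \<gamma>3_def by (rule DC_Hol_lin_outer[OF KK Y(2) tvs_Kt V lin_pthd sm])
  have \<gamma>: "\<gamma> z = Triple (\<gamma>1 z) (\<gamma>2 z) (\<gamma>3 z)" and d1: "\<gamma>1 z \<in> ?D" and c2: "\<gamma>2 z \<in> carr ?Y"
    and ds: "step E (\<gamma>1 z) (\<gamma>3 z) (\<gamma>2 z) \<in> ?D" for z
  proof -
    have "\<gamma> z \<in> bgn_dom absK E U (Suc j)" using rg by blast
    then show "\<gamma> z = Triple (\<gamma>1 z) (\<gamma>2 z) (\<gamma>3 z)" "\<gamma>1 z \<in> ?D" "\<gamma>2 z \<in> carr ?Y"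
      "step E (\<gamma>1 z) (\<gamma>3 z) (\<gamma>2 z) \<in> ?D"
      by (auto simp: \<gamma>1_def \<gamma>2_def \<gamma>3_def)
  qed
  have c1: "\<gamma>1 z \<in> carr ?Y" for z using d1 openin_subset[OF D] by blast
  have dep': "\<gamma>1 z = \<gamma>1 z'" "\<gamma>2 z = \<gamma>2 z'" "\<gamma>3 z = \<gamma>3 z'" if "\<And>m. m \<in> I - {i} \<Longrightarrow> z m = z' m" for z z'
    using depends_onD[OF dep that] by (simp_all add: \<gamma>1_def \<gamma>2_def \<gamma>3_def)
  have gc: "g x \<in> carr F" if "x \<in> ?D" for x by (rule tested_carr[OF t E(1) Uc that])
  have st: "DH ?Y 1 n 0 (\<lambda>p. step E (a p) (r p) (v p))"
    if "\<And>n. DH ?Y 1 n 0 a" "\<And>n. DH (Kt absK) 1 n 0 r" "\<And>n. DH ?Y 1 n 0 v"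
    for n and a v :: "('n \<Rightarrow> 'k, 'k) pt \<Rightarrow> ('e, 'k) pt" and r
    using DC_Hol_add[OF KK Y(1) V zero_less_one that(1) DC_Hol_smul[OF KK Y(1) V zero_less_one order_refl that(2,3)], of n]
    by simp
  \<comment> \<open>Along \<gamma>, the values of g at both ends of the increment are under control.
    This settles the points with \<gamma>3 \<noteq> 0, where division by \<gamma>3 is locally
    smooth.\<close>
  have g1: "DH F \<sigma> (Suc k) 0 (\<lambda>p. g (\<gamma>1 (unBase p)))"
  proof (rule testedD[OF t E(1) s1 d1])
    show "depends_on I \<gamma>1" unfolding depends_on_def by (intro allI impI dep'(1)) simp
  qed
  have g2: "DH F \<sigma> (Suc k) 0 (\<lambda>p. g (step E (\<gamma>1 (unBase p)) (\<gamma>3 (unBase p)) (\<gamma>2 (unBase p))))"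
  proof (rule testedD[OF t E(1) st[OF s1 s3 s2] ds])
    show "depends_on I (\<lambda>z. step E (\<gamma>1 z) (\<gamma>3 z) (\<gamma>2 z))"
      unfolding depends_on_def
    proof (intro allI impI)
      fix z z' :: "'n \<Rightarrow> 'k" assume "\<forall>m\<in>I. z m = z' m"
      then have e: "\<And>m. m \<in> I - {i} \<Longrightarrow> z m = z' m" by simp
      show "step E (\<gamma>1 z) (\<gamma>3 z) (\<gamma>2 z) = step E (\<gamma>1 z') (\<gamma>3 z') (\<gamma>2 z')"
        by (simp only: dep'[OF e])
    qed
  qed
  have cont3: "Cont ?K (Kt absK) UNIV 0 (\<lambda>p. \<gamma>3 (unBase p))"
    by (rule DC_base[OF DC_Hol_Cont[OF KK tvs_Kt V zero_less_one s3[of 0]]])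
  have o3: "openin (lt_top (iter_sp absK ?K 0)) {p \<in> XX 0. \<gamma>3 (unBase p) \<in> {s. absK (s - s0) < e}}" for s0 e
    by (rule openin_Cont_preimage[OF cont3]) (simp add: openin_ball)
  show "DH F \<sigma> k 0 (\<lambda>p. ext_quot E F g (\<gamma> (unBase p)))"
  proof (rule DH_local[OF b E(2) \<sigma>])
    fix p0 :: "('n \<Rightarrow> 'k, 'k) pt" assume "p0 \<in> XX 0"
    then obtain z0 where z0: "p0 = Base z0" by (auto simp: carr_iter_sp_0)
    show "\<exists>N h. openin (lt_top (iter_sp absK ?K 0)) N \<and> p0 \<in> N \<and> DH F \<sigma> k 0 h \<and>
        (\<forall>q\<in>N. ext_quot E F g (\<gamma> (unBase q)) = h q)"
    proof (cases "\<gamma>3 z0 = 0")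
      case False
      obtain \<rho> c where \<rho>: "0 < c" "c \<le> absK (\<gamma>3 z0)" "\<And>s. absK (s - \<gamma>3 z0) < c \<Longrightarrow> \<rho> s = inverse s" "smooth_scalar TYPE('n) \<rho>"
        by (rule reciprocal_near[OF b False]) blast
      define h where "h = (\<lambda>p :: ('n \<Rightarrow> 'k, 'k) pt. lt_smul F (\<rho> (\<gamma>3 (unBase p))) (lt_add F (g (step E (\<gamma>1 (unBase p)) (\<gamma>3 (unBase p)) (\<gamma>2 (unBase p))))
          (lt_smul F (- 1) (g (\<gamma>1 (unBase p))))))"
      have "DH F \<sigma> k 0 h"
        unfolding h_def
        by (intro DC_Hol_smul[OF KK E(2) V \<sigma>] DC_Hol_add[OF KK E(2) V \<sigma>(1)] DC_Suc[OF g1] DC_Suc[OF g2]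
            DH_smooth_scalar[OF \<rho>(4) s3] BB_DH BB_const)
      moreover have "ext_quot E F g (\<gamma> (unBase q)) = h q"
        if q: "q \<in> {p \<in> XX 0. \<gamma>3 (unBase p) \<in> {s. absK (s - \<gamma>3 z0) < c}}" for q
      proof -
        have "absK (\<gamma>3 (unBase q) - \<gamma>3 z0) < c" using q by simp
        moreover from this have "\<gamma>3 (unBase q) \<noteq> 0" using \<rho>(2) by auto
        ultimately show ?thesis
          unfolding \<gamma> by (simp add: ext_quot_nonzero quot_def h_def lt_sub_def \<rho>(3))
      qed
      ultimately show ?thesis
        using o3 \<rho>(1) z0 by (intro exI[of _ "{p \<in> XX 0. \<gamma>3 (unBase p) \<in> {s. absK (s - \<gamma>3 z0) < c}}"] exI[of _ h]) auto
    next
      case True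
      \<comment> \<open>The bound is 2 |c| and not |c|, since clamped variables may take values of
        that size.\<close>
      obtain c where c: "c \<noteq> 0" "\<And>z \<tau>. (\<And>m. absK (z m - z0 m) \<le> 2 * absK c) \<Longrightarrow> absK \<tau> \<le> 2 * absK c \<Longrightarrow>
          step E (\<gamma>1 z) \<tau> (\<gamma>2 z) \<in> ?D"
      proof -
        let ?P = "prod_topology (lt_top ?K) (ktop absK)"
        have "Cont ?K ?Y UNIV 0 (\<lambda>p. \<gamma>1 (unBase p))" "Cont ?K ?Y UNIV 0 (\<lambda>p. \<gamma>2 (unBase p))"
          using DC_base[OF DC_Hol_Cont[OF KK Y(1) V zero_less_one s1[of 0]]]
            DC_base[OF DC_Hol_Cont[OF KK Y(1) V zero_less_one s2[of 0]]] .
        then have "continuous_map (lt_top ?K) (lt_top ?Y) \<gamma>1" "continuous_map (lt_top ?K) (lt_top ?Y) \<gamma>2"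
          unfolding Cont_0_iff[OF KK V] by (simp_all add: subtopology_UNIV)
        then have "continuous_map ?P (lt_top ?Y) (\<lambda>w. lt_add ?Y (\<gamma>1 (fst w)) (lt_smul ?Y (snd w) (\<gamma>2 (fst w))))"
          by (intro continuous_map_tvs_add[OF Y(1)] continuous_map_tvs_smul[OF Y(1)] continuous_map_snd
              continuous_map_compose[OF continuous_map_fst, unfolded o_def])
        from openin_continuous_map_preimage[OF this D]
        have "openin ?P {w \<in> topspace ?P. step E (\<gamma>1 (fst w)) (snd w) (\<gamma>2 (fst w)) \<in> ?D}"
          by (simp only: lt_add_iter_sp lt_smul_iter_sp)
        moreover have "(z0, 0) \<in> {w \<in> topspace ?P. step E (\<gamma>1 (fst w)) (snd w) (\<gamma>2 (fst w)) \<in> ?D}"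
          using d1[of z0] step_zero[OF E(1) c1 c2] by (simp add: topspace_product_topology)
        ultimately obtain A B where A: "openin (lt_top ?K) A" "z0 \<in> A" and B: "openin (ktop absK) B" "0 \<in> B"
          and AB: "A \<times> B \<subseteq> {w \<in> topspace ?P. step E (\<gamma>1 (fst w)) (snd w) (\<gamma>2 (fst w)) \<in> ?D}"
          unfolding openin_prod_topology_alt by meson
        obtain e where e: "0 < e" "\<And>z. (\<And>m. absK (z m - z0 m) < e) \<Longrightarrow> z \<in> A" by (rule Kn_ball[OF A]) blast
        obtain e' where e': "0 < e'" "\<And>y. absK (y - 0) < e' \<Longrightarrow> y \<in> B" using B unfolding openin_ktop by blast
        obtain c where c: "c \<noteq> 0" "absK c < min e e' / 2" using nontrivial[of "min e e' / 2"] e e' by auto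
        show thesis
        proof (rule that[OF c(1)])
          fix z \<tau> assume z: "\<And>m. absK (z m - z0 m) \<le> 2 * absK c" and \<tau>: "absK \<tau> \<le> 2 * absK c"
          have "absK (z m - z0 m) < e" for m using z[of m] c(2) by simp
          then have "z \<in> A" by (rule e(2))
          moreover have "\<tau> \<in> B" using e'(2)[of \<tau>] \<tau> c(2) by simp
          ultimately show "step E (\<gamma>1 z) \<tau> (\<gamma>2 z) \<in> ?D" using AB by auto
        qed
      qed
      let ?\<theta> = "cut \<eta> c"
      have \<theta>: "smooth_scalar TYPE('n) ?\<theta>" by (rule smooth_scalar_cut[OF b(2)])
      \<comment> \<open>The variables are clamped around z0 and the increment around 0. This makes
        \<Gamma> a map of the whole parameter space into the domain, unchanged near z0 and for small
        increments.\<close>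
      define \<Theta> where "\<Theta> = (\<lambda>(z :: 'n \<Rightarrow> 'k) m. z0 m + ?\<theta> (z m - z0 m))"
      define \<Gamma> where "\<Gamma> = (\<lambda>z. step E (\<gamma>1 (\<Theta> z)) (?\<theta> (z i)) (\<gamma>2 (\<Theta> z)))"
      have "DH ?K 1 n 0 (\<lambda>p m. z0 m + ?\<theta> (unBase p m - z0 m))" for n
        by (intro DH_vector BB_DH BB_add BB_const smooth_scalarD[OF \<theta>] BB_diff BB_coord)
      then have s\<Theta>: "DH (iter_sp absK ?K 0) 1 n 0 (\<lambda>p. Base (\<Theta> (unBase p)))" for n
        unfolding \<Theta>_def by (rule DC_Hol_lin_outer[OF KK KK tvs_iter_sp[OF KK] V lin_Base])
      have s\<Gamma>: "DH ?Y 1 n 0 (\<lambda>p. \<Gamma> (unBase p))" for n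
        unfolding \<Gamma>_def
      proof (rule st)
        fix n
        have "DH ?Y 1 n 0 (\<lambda>p. \<gamma>1 (unBase (Base (\<Theta> (unBase p)) :: ('n \<Rightarrow> 'k, 'k) pt)))"
          by (rule DC_Hol_compose[OF KK KK Y(1) V V zero_less_one s1 s\<Theta>]) simp
        then show "DH ?Y 1 n 0 (\<lambda>p. \<gamma>1 (\<Theta> (unBase p)))" by simp
        have "DH ?Y 1 n 0 (\<lambda>p. \<gamma>2 (unBase (Base (\<Theta> (unBase p)) :: ('n \<Rightarrow> 'k, 'k) pt)))"
          by (rule DC_Hol_compose[OF KK KK Y(1) V V zero_less_one s2 s\<Theta>]) simp
        then show "DH ?Y 1 n 0 (\<lambda>p. \<gamma>2 (\<Theta> (unBase p)))" by simp
        show "DH (Kt absK) 1 n 0 (\<lambda>p. ?\<theta> (unBase p i))"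
          by (intro BB_DH smooth_scalarD[OF \<theta>] BB_coord)
      qed
      have "DH F \<sigma> (Suc k) 0 (\<lambda>p. g (\<Gamma> (unBase p)))"
      proof (rule testedD[OF t E(1) s\<Gamma>])
        fix z show "\<Gamma> z \<in> ?D"
          unfolding \<Gamma>_def by (rule c(2)) (auto simp: \<Theta>_def cut_bound[OF b(1) c(1)])
      next
        show "depends_on I \<Gamma>"
          unfolding depends_on_def
        proof (intro allI impI)
          fix z z' :: "'n \<Rightarrow> 'k" assume e: "\<forall>m\<in>I. z m = z' m"
          have "\<gamma>1 (\<Theta> z) = \<gamma>1 (\<Theta> z')" "\<gamma>2 (\<Theta> z) = \<gamma>2 (\<Theta> z')"
            by (rule dep'; use e in \<open>simp add: \<Theta>_def\<close>)+
          then show "\<Gamma> z = \<Gamma> z'" using e i by (simp add: \<Gamma>_def)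
        qed
      qed
      then obtain G where G: "diff_rel ?K F UNIV 0 (\<lambda>p. g (\<Gamma> (unBase p))) G" "DH F \<sigma> k (Suc 0) G" by auto
      define e where "e = (\<lambda>m. if m = i then 1 else 0 :: 'k)"
      define \<pi> where "\<pi> = (\<lambda>(z :: 'n \<Rightarrow> 'k) m. if m = i then 0 else z m)"
      \<comment> \<open>Base point z with i-th coordinate reset to 0, direction \<open>e\<close>,
        increment \<gamma>3 z: there the quotient of g o \<Gamma> equals the quotient of g at
        \<gamma> z, so G o \<beta> is the required local model.\<close>
      define \<beta> where "\<beta> = (\<lambda>p :: ('n \<Rightarrow> 'k, 'k) pt. Triple (Base (\<pi> (unBase p))) (Base e) (\<gamma>3 (unBase p)) :: ('n \<Rightarrow> 'k, 'k) pt)"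
      have "continuous_map (lt_top ?K) (ktop absK) (\<lambda>z. if m = i then 0 else z m)" for m
        using continuous_map_product_projection[of m UNIV "\<lambda>_. ktop absK"] by (cases "m = i") auto
      then have "lin ?K ?K \<pi>"
        unfolding \<pi>_def by (auto simp: lin_def continuous_map_componentwise_UNIV fun_eq_iff)
      then have "lin (iter_sp absK ?K 0) (iter_sp absK ?K 0) (\<lambda>p. Base (\<pi> (unBase p)))"
        by (intro lin_compose[OF lin_unBase] lin_compose[OF _ lin_Base])
      then have "DH (iter_sp absK ?K (Suc 0)) 1 k 0 \<beta>"
        unfolding \<beta>_def
        by (rule DC_Hol_Triple[OF KK KK V zero_less_one DC_Hol_lin[OF KK tvs_iter_sp[OF KK] V]
            DC_Hol_const[OF KK tvs_iter_sp[OF KK] V] s3]) simp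
      then have GB: "DH F \<sigma> k 0 (\<lambda>p. G (\<beta> p))"
        by (rule DC_Hol_compose[OF KK KK E(2) V V \<sigma>(1) G(2)])
          (simp only: bgn_dom_Kn \<beta>_def Triple_in_carr Base_in_carr carr_Kpow, simp)
      have Gc: "G p \<in> carr F" if "p \<in> XX (Suc 0)" for p
        using hoelder_carr[OF DC_base[OF G(2)]] that by (simp only: bgn_dom_Kn)
      obtain N0 where N0: "openin (lt_top (iter_sp absK ?K 0)) N0" "Base z0 \<in> N0" "\<forall>q\<in>N0. ptd q (Base z0) < absK c"
        using ptd_nbhd[of "Base z0 :: ('n \<Rightarrow> 'k, 'k) pt" 0 "absK c"] c(1) by auto
      define N where "N = N0 \<inter> {p \<in> XX 0. \<gamma>3 (unBase p) \<in> {s. absK (s - 0) < absK c}}"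
      have "openin (lt_top (iter_sp absK ?K 0)) N" unfolding N_def by (intro openin_Int N0 o3)
      moreover have "p0 \<in> N" using N0 True c(1) by (simp add: N_def z0)
      moreover have "ext_quot E F g (\<gamma> (unBase q)) = G (\<beta> q)" if q: "q \<in> N" for q
      proof -
        have "q \<in> XX 0" using q by (simp add: N_def)
        then obtain z where z: "q = Base z" by (auto simp: carr_iter_sp_0)
        have near: "absK (z m - z0 m) \<le> absK c" for m
        proof -
          have "absK (z m - z0 m) \<le> ptd q (Base z0)" unfolding z ptd.simps by (rule Max_ge) auto
          moreover have "ptd q (Base z0) < absK c" using q N0(3) by (simp add: N_def)
          ultimately show ?thesis by linarith
        qed
        \<comment> \<open>\<gamma>1 and \<gamma>2 ignore the i-th coordinate, so it may be
          overwritten by s; the other coordinates and s lie where the clamp is the identity.\<close>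
        have \<Gamma>s: "\<Gamma> (\<lambda>m. \<pi> z m + s * e m) = step E (\<gamma>1 z) s (\<gamma>2 z)" if s: "absK s \<le> absK c" for s
        proof -
          have "\<gamma>1 (\<Theta> (\<lambda>m. \<pi> z m + s * e m)) = \<gamma>1 z" "\<gamma>2 (\<Theta> (\<lambda>m. \<pi> z m + s * e m)) = \<gamma>2 z"
            by (rule dep'; use near cut_eq[OF b(1) c(1)] in \<open>simp add: \<Theta>_def \<pi>_def e_def\<close>)+
          then show ?thesis using cut_eq[OF b(1) c(1) s] by (simp add: \<Gamma>_def \<pi>_def e_def)
        qed
        have rel: "g (step E (\<gamma>1 z) s (\<gamma>2 z)) = lt_add F (g (\<gamma>1 z)) (lt_smul F s (G (Triple (Base (\<pi> z)) (Base e) s)))"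
          if s: "absK s \<le> absK c" for s
        proof -
          have d: "Triple (Base (\<pi> z)) (Base e) s \<in> bgn_dom absK ?K UNIV (Suc 0)"
            unfolding bgn_dom_Kn by simp
          have "\<Gamma> (\<pi> z) = \<gamma>1 z" using \<Gamma>s[of 0] step_zero[OF E(1) c1 c2] by simp
          then show ?thesis using diff_relD[OF G(1) d] \<Gamma>s[OF s] by simp
        qed
        have quot: "quot E F g (\<gamma>1 z) (\<gamma>2 z) s = G (Triple (Base (\<pi> z)) (Base e) s)" if "s \<noteq> 0" "absK s < absK c" for s
          by (rule quot_eqI[where g=g and x="\<gamma>1 z", OF E(2) gc[OF d1]])
            (use rel[of s] that Gc[of "Triple (Base (\<pi> z)) (Base e) s"] in auto)
        have t: "absK (\<gamma>3 z) < absK c" using q by (simp add: N_def z)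
        show ?thesis
        proof (cases "\<gamma>3 z = 0")
          case False
          then show ?thesis using quot[OF False t] by (simp add: \<gamma> z \<beta>_def ext_quot_nonzero)
        next
          case t0: True
          \<comment> \<open>Here the increment s is varied freely with z fixed: the quotients of g
            are values of G, and continuity of G supplies the limit that defines
            \<open>ext_quot\<close>.\<close>
          have "lim0 F (quot E F g (\<gamma>1 z) (\<gamma>2 z)) (G (Triple (Base (\<pi> z)) (Base e) 0))"
          proof (rule lim0_cong[OF Cont_lim0[OF KK V]])
            show "Cont ?K F UNIV (Suc 0) G" by (rule DC_base[OF DC_Hol_Cont[OF KK E(2) V \<sigma>(1) G(2)]])
            show "Triple (Base (\<pi> z)) (Base e) 0 \<in> bgn_dom absK ?K UNIV (Suc 0)" unfolding bgn_dom_Kn by simp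
            show "0 < absK c" using c(1) by simp
          qed (use quot in auto)
          from ext_quot_zero[OF E(2) this] show ?thesis by (simp add: \<gamma> z \<beta>_def t0)
        qed
      qed
      ultimately show ?thesis using GB by blast
    qed
  qed
qed

text \<open>Each quotient uses up one variable of I, and k + 1 variables leave one for the curves at
  the last level. At every level a curve in any remaining variable tests Hoelder continuity, and
  \<open>ext_quot\<close> is the next member of the chain.\<close>

lemma DC_if_tested:
  fixes I :: "'n::finite set" and E :: "('e, 'k) lin_top"
  assumes b: "bump \<eta>" "smooth_scalar TYPE('n) \<eta>" and E: "tvs E" "tvs F" and U: "openin (lt_top E) U"
    and \<sigma>: "0 < \<sigma>" "\<sigma> \<le> 1" and cb: "countable_base_at_zero E"
  shows "tested E F U \<sigma> I j k g \<Longrightarrow> card I = Suc k \<Longrightarrow> DC E F U (Hol E F U \<sigma>) k j g"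
proof (induction k arbitrary: I j g)
  have Uc: "U \<subseteq> carr E" using openin_subset[OF U] .
  have hol: "Hol E F U \<sigma> j g" if t: "tested E F U \<sigma> I j k g" and I: "i0 \<in> I" for j k g i0 and I :: "'n set"
  proof (rule hoelder_if_curves[OF b tvs_iter_sp[OF E(1)] E(2) countable_base_iter_sp[OF E(1) cb] openin_bgn_dom[OF E(1) U] \<sigma>(1)
        tested_carr[OF t E(1) Uc]])
    fix \<gamma> :: "('n \<Rightarrow> 'k) \<Rightarrow> ('e, 'k) pt"
    assume \<gamma>: "bgn_Cinf absK Kn (iter_sp absK E j) UNIV \<gamma>" "range \<gamma> \<subseteq> bgn_dom absK E U j"
      "\<And>z z'. z i0 = z' i0 \<Longrightarrow> \<gamma> z = \<gamma> z'"
    have "depends_on I \<gamma>" unfolding depends_on_def using \<gamma>(3) I by blast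
    then have "DH F \<sigma> k 0 (\<lambda>p. g (\<gamma> (unBase p)))"
      using t \<gamma>(1,2) unfolding tested_def by blast
    then show "Hol Kn F UNIV \<sigma> 0 (\<lambda>p. g (\<gamma> (unBase p)))" by (rule DC_base)
  qed
  {
    case 0
    then obtain i0 where "i0 \<in> I" by fastforce
    then show ?case using hol[OF 0(1)] by simp
  next
    case (Suc k)
    then obtain i where i: "i \<in> I" by fastforce
    have "DC E F U (Hol E F U \<sigma>) k (Suc j) (ext_quot E F g)"
      by (rule Suc.IH[OF tested_step[OF b E U \<sigma> Suc.prems(1) i]]) (use Suc.prems(2) i in simp)
    note q = this
    have "ext_quot E F g p \<in> carr F" if "p \<in> bgn_dom absK E U (Suc j)" for p
      by (rule hoelder_carr[OF DC_base[OF q] that])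
    then have "diff_rel E F U j g (ext_quot E F g)"
      by (intro diff_rel_ext_quot[OF E Uc] tested_carr[OF Suc.prems(1) E(1) Uc])
    then show ?case using hol[OF Suc.prems(1) i] q by auto
  }
qed

text \<open>The chain rule for \<open>DC\<close>, after \<gamma> has been composed with
  \<open>Base\<close> to reach level 0 of the iterated spaces.\<close>

lemma bgn_Cks_compose:
  fixes \<gamma> :: "('n::finite \<Rightarrow> 'k) \<Rightarrow> 'e"
  assumes E: "tvs E" "tvs F" and U: "openin (lt_top E) U" and \<sigma>: "0 < \<sigma>" and f: "bgn_Cks absK E F U f l \<sigma>"
    and \<gamma>: "bgn_Cinf absK Kn E UNIV \<gamma>" "range \<gamma> \<subseteq> U"
  shows "bgn_Cks absK Kn F UNIV (f \<circ> \<gamma>) l \<sigma>"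
proof -
  note V = openin_Kn_UNIV[where 'n='n]
  have s: "DH E 1 l 0 (\<lambda>p. \<gamma> (unBase p))" using \<gamma>(1) unfolding bgn_Cinf_iff[OF E(1)] by blast
  have "DH F \<sigma> l 0 (\<lambda>p. f (unBase (Base (\<gamma> (unBase p)) :: ('e, 'k) pt)))"
    by (rule DC_Hol_compose[OF tvs_Kpow E V U \<sigma> f[unfolded bgn_Cks_iff[OF E U \<sigma>]]
          DC_Hol_lin_outer[OF tvs_Kpow E(1) tvs_iter_sp[OF E(1)] V lin_Base s]]) (use \<gamma>(2) in auto)
  then show ?thesis unfolding bgn_Cks_iff[OF tvs_Kpow E(2) V \<sigma>] by simp
qed

lemma bgn_Cks_if_tested:
  assumes b: "bump \<eta>" "smooth_scalar TYPE('n::finite) \<eta>" and E: "tvs E" "tvs F" and U: "openin (lt_top E) U"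
    and \<sigma>: "0 < \<sigma>" "\<sigma> \<le> 1" and cb: "countable_base_at_zero E" and l: "CARD('n) = Suc l"
    and f: "\<And>\<gamma> :: ('n \<Rightarrow> 'k) \<Rightarrow> 'e. bgn_Cinf absK Kn E UNIV \<gamma> \<Longrightarrow> range \<gamma> \<subseteq> U \<Longrightarrow> bgn_Cks absK Kn F UNIV (f \<circ> \<gamma>) l \<sigma>"
  shows "bgn_Cks absK E F U f l \<sigma>"
  unfolding bgn_Cks_iff[OF E U \<sigma>(1)]
proof (rule DC_if_tested[OF b E U \<sigma> cb])
  note V = openin_Kn_UNIV[where 'n='n]
  \<comment> \<open>At the start all variables are available, and level 0 differs from E only by
    \<open>Base\<close>.\<close>
  show "tested E F U \<sigma> (UNIV :: 'n set) 0 l (\<lambda>p. f (unBase p))"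
    unfolding tested_def
  proof (intro allI impI)
    fix \<gamma> :: "('n \<Rightarrow> 'k) \<Rightarrow> ('e, 'k) pt"
    assume \<gamma>: "bgn_Cinf absK Kn (iter_sp absK E 0) UNIV \<gamma>" "range \<gamma> \<subseteq> bgn_dom absK E U 0"
    have "bgn_Cinf absK Kn E UNIV (\<lambda>z. unBase (\<gamma> z))"
      using \<gamma>(1) DC_Hol_lin_outer[OF tvs_Kpow tvs_iter_sp[OF E(1)] E(1) V lin_unBase]
      unfolding bgn_Cinf_iff[OF E(1)] bgn_Cinf_iff[OF tvs_iter_sp[OF E(1)]] by blast
    then have "bgn_Cks absK Kn F UNIV (f \<circ> (\<lambda>z. unBase (\<gamma> z))) l \<sigma>"
      by (rule f) (use \<gamma>(2) in auto)
    then show "DH F \<sigma> l 0 (\<lambda>p. f (unBase (\<gamma> (unBase p))))"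
      unfolding bgn_Cks_iff[OF tvs_Kpow E(2) V \<sigma>(1)] by simp
  qed
qed (use l in simp)

end

theorem theorem4p1:
  fixes absK :: "'k::field \<Rightarrow> real"
    and E :: "('e, 'k) lin_top" and F :: "('f, 'k) lin_top"
    and U :: "'e set" and f :: "'e \<Rightarrow> 'f" and l :: nat and \<sigma> :: real
  assumes "is_real_field absK \<or> ultrametric_field absK"
    and "is_tvs absK E" and "is_tvs absK F"
    and "openin (lt_top E) U"
    and "0 < \<sigma>" and "\<sigma> \<le> 1"
    and "CARD('n::finite) = Suc l"
    and "metrizable_space (lt_top E)"
  shows "bgn_Cks absK E F U f l \<sigma> \<longleftrightarrow>
    (\<forall>\<gamma> :: ('n \<Rightarrow> 'k) \<Rightarrow> 'e. bgn_Cinf absK (Kpow absK) E UNIV \<gamma> \<and> \<gamma> ` UNIV \<subseteq> U \<longrightarrow>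
       bgn_Cks absK (Kpow absK) F UNIV (f \<circ> \<gamma>) l \<sigma>)"
proof -
  obtain \<eta> where \<eta>: "valued_field absK" "valued_field.bump absK \<eta>" "valued_field.smooth_scalar absK TYPE('n) \<eta>"
    by (rule bump_exists[OF assms(1)])
  interpret valued_field absK by (rule \<eta>(1))
  show ?thesis
    using bgn_Cks_compose[OF assms(2-5)]
      bgn_Cks_if_tested[OF \<eta>(2,3) assms(2-6) countable_base_if_metrizable[OF assms(2,8)] assms(7)] by blast
qed

end
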